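(* Let $Q$ be any acyclic conjunctive regular path query (CRPQ), and let $\mathsf{cw}=\mathsf{cw}(Q)$ be its contraction width. Then $Q$ can be evaluated over edge-labeled graphs $G=(V,E,\Sigma)$ in $$\mathcal{O}\big(|E| + |E|\cdot \mathsf{OUT}^{1/2}\cdot |V|^{\mathsf{cw}/2} + \mathsf{OUT}\cdot |V|^{\mathsf{cw}}\big)$$ data complexity, where $\mathsf{OUT}$ is the size (number of tuples) of the output of $Q$ over $G$. That is, for every fixed acyclic CRPQ $Q$ there is an algorithm that, given any edge-labeled graph $G=(V,E,\Sigma)$, computes the output of $Q$ over $G$ within this time bound, where the constant hidden in $\mathcal{O}(\cdot)$ may depend on $Q$ but not on $G$.
   Context: **Graphs.** An edge-labeled graph is $G=(V,E,\Sigma)$ with $V$ a finite set of vertices, $\Sigma$ a finite alphabet, and $E\subseteq V\times\Sigma\times V$ a set of directed labeled edges. Every vertex is assumed to have at least one incident edge. A path from $u$ to $v$ is a sequence of vertices $u=w_0,w_1,\ldots,w_k=v$ and symbols $\sigma_1,\ldots,\sigma_k$, $k\ge 0$, with $(w_{i-1},\sigma_i,w_i)\in E$ for all $i\in\{1,\ldots,k\}$; its label is the string $\sigma_1\cdots\sigma_k$. **Queries.** A regular path query (RPQ) over $\Sigma$ is a regular expression $r$ over $\Sigma$ with language $L(r)$. A CRPQ has the form $Q(\boldsymbol F)=r_1(X_1,Y_1)\wedge\cdots\wedge r_n(X_n,Y_n)$, where each $r_i$ is an RPQ, each $r_i(X_i,Y_i)$ is called an atom, $\mathrm{vars}(Q)=\{X_i,Y_i\mid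 i\in\{1,\ldots,n\}\}$, $\mathrm{free}(Q)=\boldsymbol F\subseteq \mathrm{vars}(Q)$ are the free variables, and $\mathrm{bound}(Q)=\mathrm{vars}(Q)\setminus\mathrm{free}(Q)$ are the bound variables. The conjunction of atoms is the body of $Q$. The output of $Q$ over $G$ is the set of all mappings $\mu:\mathrm{free}(Q)\to V$ that extend to a mapping $\mu':\mathrm{vars}(Q)\to V$ such that for every $i$, $G$ has a path from $\mu'(X_i)$ to $\mu'(Y_i)$ labeled by a string in $L(r_i)$. **Acyclicity.** The query graph $G_Q$ of $Q$ is the undirected multigraph with vertex set $\mathrm{vars}(Q)$ and one edge $\{X_i,Y_i\}$ per atom. $Q$ is acyclic if $G_Q$ is a forest (no cycles, self-loops or parallel edges). **Contracted query graph.** For a cycle-free undirected graph $H=(V_H,E_H)$, two elimination operations are defined. (i) A vertex $u$ of degree 2 with neighbors $v_1\neq v_2$: remove $u$ and the edges $\{u,v_1\},\{u,v_2\}$ and add the edge $\{v_1,v_2\}$. (ii) A vertex $u$ of degree 1 with neighbor $v$: remove $u$ and the edge $\{u,v\}$, and also remove $v$ if $v$ has no neighbor other than $u$. Let $\mathrm{eliminate}(H,u)$ be the resulting graph. An elimination order for an acyclic CRPQ $Q$ is a sequence $(X_1,\ldots,X_k)$ of bound variables for which there are graphs $G_0=G_Q$ and $G_i=\mathrm{eliminate}(G_{i-1},X_i)$ for $i\in\{1,\ldots,k\}$ such that all bound variables in $G_k$ have degree at least 3. The graph $G_k$ does not depend on the elimination order; it is called the contracted query graph of $Q$ and denoted $\mathsf{cg}(Q)$.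 **Contraction width.** A tree decomposition of $Q$ is a pair $\mathcal T=(T,\chi)$ with $T$ a tree and $\chi:V(T)\to 2^{\mathrm{vars}(Q)}$ such that for every atom $r(X,Y)$ there is $t$ with $X,Y\in\chi(t)$, and for every variable $X$ the set $\{t\mid X\in\chi(t)\}$ is a non-empty connected subtree of $T$. The sets $\chi(t)$ are the bags. $\mathcal T$ is free-connex if $T$ contains a connected subtree such that the union of the bags in it is exactly $\mathrm{free}(Q)$; $\mathsf{FTD}(Q)$ is the set of free-connex tree decompositions of $Q$. The CRPQ $Q_{\mathcal B}$ induced by a bag $\mathcal B$ has the same body as $Q$ and free variables $\mathrm{free}(Q)\cap\mathcal B$. Define $$\mathsf{cw}(Q)=\min_{\mathcal T\in\mathsf{FTD}(Q)}\mathsf{cw}(\mathcal T),\qquad \mathsf{cw}(\mathcal T)=\max_{\mathcal B\in\mathrm{bags}(\mathcal T)}|\mathrm{bound}(\mathsf{cg}(Q_{\mathcal B}))|,$$ where $\mathrm{bound}(\mathsf{cg}(Q_{\mathcal B}))$ is the set of bound variables of $Q_{\mathcal B}$ that occur as vertices in $\mathsf{cg}(Q_{\mathcal B})$. **Computational model.** Data complexity: the query is fixed and of constant size. The RAM model is used; each materialized relation over $V$ is assumed to be stored in a data structure that supports constant-time tuple lookup and constant-delay enumeration of its tuples. *)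

theory Defs
  imports Complex_Main "HOL-Library.FuncSet" "HOL-Library.Multiset"
begin

section \<open>Edge-labeled graphs\<close>

record ('v, 's) lgraph =
  lverts :: "'v set"
  ledges :: "('v \<times> 's \<times> 'v) set"
  labels :: "'s set"

definition wf_lgraph :: "('v, 's) lgraph \<Rightarrow> bool" where
  "wf_lgraph G \<longleftrightarrow>
     finite (lverts G) \<and> finite (labels G) \<and>
     ledges G \<subseteq> lverts G \<times> labels G \<times> lverts G \<and>
     (\<forall>v\<in>lverts G. \<exists>(a, s, b)\<in>ledges G. v = a \<or> v = b)"

inductive lpath :: "('v, 's) lgraph \<Rightarrow> 'v \<Rightarrow> 's list \<Rightarrow> 'v \<Rightarrow> bool" for G where
  empty: "u \<in> lverts G \<Longrightarrow> lpath G u [] u"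
| step: "(u, s, w) \<in> ledges G \<Longrightarrow> lpath G w ss v \<Longrightarrow> lpath G u (s # ss) v"


section \<open>Conjunctive regular path queries\<close>

datatype 's rexp =
    Zero
  | One
  | Sym 's
  | Plus "'s rexp" "'s rexp"
  | Times "'s rexp" "'s rexp"
  | Star "'s rexp"

fun lang :: "'s rexp \<Rightarrow> 's list set" where
  "lang Zero = {}"
| "lang One = {[]}"
| "lang (Sym s) = {[s]}"
| "lang (Plus r q) = lang r \<union> lang q"
| "lang (Times r q) = {v @ w | v w. v \<in> lang r \<and> w \<in> lang q}"
| "lang (Star r) = {concat ws | ws. set ws \<subseteq> lang r}"

record ('x, 's) crpq =
  atoms :: "('s rexp \<times> 'x \<times> 'x) list"
  free :: "'x set"

definition vars :: "('x, 's) crpq \<Rightarrow> 'x set" where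
  "vars Q = (\<Union>(r, x, y)\<in>set (atoms Q). {x, y})"

definition bound :: "('x, 's) crpq \<Rightarrow> 'x set" where
  "bound Q = vars Q - free Q"

definition wf_crpq :: "('x, 's) crpq \<Rightarrow> bool" where
  "wf_crpq Q \<longleftrightarrow> free Q \<subseteq> vars Q"

definition symbols :: "('x, 's) crpq \<Rightarrow> 's set" where
  "symbols Q = (\<Union>(r, x, y)\<in>set (atoms Q). set_rexp r)"

definition answers :: "('x, 's) crpq \<Rightarrow> ('v, 's) lgraph \<Rightarrow> ('x \<Rightarrow> 'v) set" where
  "answers Q G =
     {\<mu> \<in> free Q \<rightarrow>\<^sub>E lverts G.
        \<exists>\<mu>' \<in> vars Q \<rightarrow>\<^sub>E lverts G.
          (\<forall>x\<in>free Q. \<mu>' x = \<mu> x) \<and>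
          (\<forall>(r, x, y)\<in>set (atoms Q). \<exists>w\<in>lang r. lpath G (\<mu>' x) w (\<mu>' y))}"


section \<open>Undirected graphs and acyclic queries\<close>

text \<open>Edges of a simple undirected graph are two-element sets of vertices.\<close>

record 'a ugraph =
  uverts :: "'a set"
  uedges :: "'a set set"

definition neighbors :: "'a ugraph \<Rightarrow> 'a \<Rightarrow> 'a set" where
  "neighbors H u = {v. {u, v} \<in> uedges H}"

abbreviation degree :: "'a ugraph \<Rightarrow> 'a \<Rightarrow> nat" where
  "degree H u \<equiv> card (neighbors H u)"

definition cycle_free :: "'a ugraph \<Rightarrow> bool" where
  "cycle_free H \<longleftrightarrow>
     \<not> (\<exists>us. 3 \<le> length us \<and> distinct us \<and>
           (\<forall>i<length us. {us ! i, us ! (Suc i mod length us)} \<in> uedges H))"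

definition subtree :: "'a ugraph \<Rightarrow> 'a set \<Rightarrow> bool" where
  "subtree T S \<longleftrightarrow>
     S \<noteq> {} \<and> S \<subseteq> uverts T \<and>
     (\<forall>a\<in>S. \<forall>b\<in>S. (a, b) \<in> {(u, v). u \<in> S \<and> v \<in> S \<and> {u, v} \<in> uedges T}\<^sup>*)"

definition is_tree :: "'a ugraph \<Rightarrow> bool" where
  "is_tree T \<longleftrightarrow>
     finite (uverts T) \<and> (\<forall>e\<in>uedges T. e \<subseteq> uverts T \<and> card e = 2) \<and>
     subtree T (uverts T) \<and> cycle_free T"

text \<open>
  The edges of the query multigraph form a multiset with one entry per atom; a self-loop is a
  singleton. On acyclic queries, \<open>query_graph\<close> loses nothing by forgetting multiplicities.
\<close>

definition query_edges :: "('x, 's) crpq \<Rightarrow> 'x set multiset" where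
  "query_edges Q = image_mset (\<lambda>(r, x, y). {x, y}) (mset (atoms Q))"

definition query_graph :: "('x, 's) crpq \<Rightarrow> 'x ugraph" where
  "query_graph Q = \<lparr>uverts = vars Q, uedges = set_mset (query_edges Q)\<rparr>"

definition acyclic_crpq :: "('x, 's) crpq \<Rightarrow> bool" where
  "acyclic_crpq Q \<longleftrightarrow>
     (\<forall>e\<in>#query_edges Q. card e = 2) \<and>
     (\<forall>e. count (query_edges Q) e \<le> 1) \<and>
     cycle_free (query_graph Q)"


section \<open>Contracted query graphs\<close>

text \<open>
  \<open>eliminate H u\<close> is only used for \<open>u\<close> of degree 1 or 2. If the degree is 2, then
  \<open>neighbors H u\<close> is itself the edge to be added.
\<close>

definition eliminate :: "'a ugraph \<Rightarrow> 'a \<Rightarrow> 'a ugraph" where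
  "eliminate H u =
     (if degree H u = 2
      then \<lparr>uverts = uverts H - {u},
            uedges = insert (neighbors H u) {e \<in> uedges H. u \<notin> e}\<rparr>
      else \<lparr>uverts = uverts H - {u} - {v \<in> neighbors H u. neighbors H v = {u}},
            uedges = {e \<in> uedges H. u \<notin> e}\<rparr>)"

inductive eliminates :: "'a ugraph \<Rightarrow> 'a list \<Rightarrow> 'a ugraph \<Rightarrow> bool" where
  Nil: "eliminates H [] H"
| Cons: "u \<in> uverts H \<Longrightarrow> degree H u \<in> {1, 2} \<Longrightarrow> eliminates (eliminate H u) us K
          \<Longrightarrow> eliminates H (u # us) K"

definition contracts_to :: "('x, 's) crpq \<Rightarrow> 'x list \<Rightarrow> 'x ugraph \<Rightarrow> bool" where
  "contracts_to Q us K \<longleftrightarrow>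
     set us \<subseteq> bound Q \<and> eliminates (query_graph Q) us K \<and>
     (\<forall>x\<in>bound Q \<inter> uverts K. 3 \<le> degree K x)"

text \<open>For acyclic queries, the resulting graph does not depend on the elimination order.\<close>

definition cg :: "('x, 's) crpq \<Rightarrow> 'x ugraph" where
  "cg Q = (SOME K. \<exists>us. contracts_to Q us K)"


section \<open>Contraction width\<close>

text \<open>Tree nodes are natural numbers, which covers all finite trees up to isomorphism.\<close>

type_synonym 'x tree_dec = "nat ugraph \<times> (nat \<Rightarrow> 'x set)"

definition tree_decomposition :: "('x, 's) crpq \<Rightarrow> 'x tree_dec \<Rightarrow> bool" where
  "tree_decomposition Q = (\<lambda>(T, \<chi>).
     is_tree T \<and>
     (\<forall>t\<in>uverts T. \<chi> t \<subseteq> vars Q) \<and>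
     (\<forall>(r, x, y)\<in>set (atoms Q). \<exists>t\<in>uverts T. x \<in> \<chi> t \<and> y \<in> \<chi> t) \<and>
     (\<forall>x\<in>vars Q. subtree T {t \<in> uverts T. x \<in> \<chi> t}))"

definition free_connex :: "('x, 's) crpq \<Rightarrow> 'x tree_dec \<Rightarrow> bool" where
  "free_connex Q = (\<lambda>(T, \<chi>). \<exists>S. subtree T S \<and> (\<Union>t\<in>S. \<chi> t) = free Q)"

definition FTD :: "('x, 's) crpq \<Rightarrow> 'x tree_dec set" where
  "FTD Q = {D. tree_decomposition Q D \<and> free_connex Q D}"

definition bags :: "'x tree_dec \<Rightarrow> 'x set set" where
  "bags = (\<lambda>(T, \<chi>). \<chi> ` uverts T)"

definition induced :: "('x, 's) crpq \<Rightarrow> 'x set \<Rightarrow> ('x, 's) crpq" where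
  "induced Q B = Q\<lparr>free := free Q \<inter> B\<rparr>"

definition cw_dec :: "('x, 's) crpq \<Rightarrow> 'x tree_dec \<Rightarrow> nat" where
  "cw_dec Q D = Max ((\<lambda>B. card (bound (induced Q B) \<inter> uverts (cg (induced Q B)))) ` bags D)"

definition cw :: "('x, 's) crpq \<Rightarrow> nat" where
  "cw Q = Inf (cw_dec Q ` FTD Q)"


section \<open>Random access machines\<close>

text \<open>
  A program uses finitely many registers and an unbounded memory that is addressed through
  registers. Every instruction takes one unit of time. There is no multiplication, so
  the bit length of the largest word grows by at most one per step.
\<close>

datatype instr =
    Const nat nat
  | Copy nat nat
  | Add nat nat nat
  | Sub nat nat nat
  | Load nat nat
  | Store nat nat
  | Jump nat
  | JumpZero nat nat

record config =
  pc :: nat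
  regs :: "nat \<Rightarrow> nat"
  mem :: "nat \<Rightarrow> nat"

definition set_reg :: "nat \<Rightarrow> nat \<Rightarrow> config \<Rightarrow> config" where
  "set_reg r n s = s\<lparr>regs := (regs s)(r := n), pc := Suc (pc s)\<rparr>"

fun exec :: "instr \<Rightarrow> config \<Rightarrow> config" where
  "exec (Const r n) s = set_reg r n s"
| "exec (Copy r a) s = set_reg r (regs s a) s"
| "exec (Add r a b) s = set_reg r (regs s a + regs s b) s"
| "exec (Sub r a b) s = set_reg r (regs s a - regs s b) s"
| "exec (Load r a) s = set_reg r (mem s (regs s a)) s"
| "exec (Store a b) s = s\<lparr>mem := (mem s)(regs s a := regs s b), pc := Suc (pc s)\<rparr>"
| "exec (Jump l) s = s\<lparr>pc := l\<rparr>"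
| "exec (JumpZero a l) s = s\<lparr>pc := (if regs s a = 0 then l else Suc (pc s))\<rparr>"

type_synonym program = "instr list"

definition halted :: "program \<Rightarrow> config \<Rightarrow> bool" where
  "halted P s \<longleftrightarrow> length P \<le> pc s"

definition step :: "program \<Rightarrow> config \<Rightarrow> config" where
  "step P s = (if halted P s then s else exec (P ! pc s) s)"

text \<open>
  A graph is presented to the machine through a numbering \<open>\<nu>\<close> of its vertices, a numbering
  \<open>\<kappa>\<close> of the symbols, and a list \<open>es\<close> of its edges: registers 0 and 1 hold the numbers of
  vertices and edges, and the edges lie consecutively in memory, three words each.
  All other registers and cells are 0.
\<close>

definition input_config ::
  "('v \<Rightarrow> nat) \<Rightarrow> ('s \<Rightarrow> nat) \<Rightarrow> ('v, 's) lgraph \<Rightarrow> ('v \<times> 's \<times> 'v) list \<Rightarrow> config" where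
  "input_config \<nu> \<kappa> G es =
     (let ws = concat (map (\<lambda>(u, s, v). [\<nu> u, \<kappa> s, \<nu> v]) es) in
      \<lparr>pc = 0,
       regs = (\<lambda>r. if r = 0 then card (lverts G) else if r = 1 then length es else 0),
       mem = (\<lambda>a. if a < length ws then ws ! a else 0)\<rparr>)"

definition represents_input ::
  "('v, 's) lgraph \<Rightarrow> ('v \<Rightarrow> nat) \<Rightarrow> ('v \<times> 's \<times> 'v) list \<Rightarrow> bool" where
  "represents_input G \<nu> es \<longleftrightarrow>
     bij_betw \<nu> (lverts G) {..<card (lverts G)} \<and> distinct es \<and> set es = ledges G"

text \<open>
  The machine returns a set \<open>A\<close> of tuples of length \<open>k\<close> as a duplicate-free table: register 0
  holds the number of tuples, register 1 the address at which the table starts.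
\<close>

definition returns :: "nat \<Rightarrow> nat list set \<Rightarrow> config \<Rightarrow> bool" where
  "returns k A s \<longleftrightarrow>
     (\<exists>ts. distinct ts \<and> set ts = A \<and> regs s 0 = length ts \<and>
           map (mem s) [regs s 1..<regs s 1 + k * length ts] = concat ts)"

text \<open>The columns of the result are the free variables, in the order given by the list \<open>xs\<close>.\<close>

definition evaluates_within ::
  "program \<Rightarrow> ('x, 's) crpq \<Rightarrow> 'x list \<Rightarrow> ('s \<Rightarrow> nat) \<Rightarrow> (('v, 's) lgraph \<Rightarrow> real) \<Rightarrow> bool" where
  "evaluates_within P Q xs \<kappa> f \<longleftrightarrow>
     (\<forall>G \<nu> es. wf_lgraph G \<and> symbols Q \<subseteq> labels G \<and> represents_input G \<nu> es \<longrightarrow>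
        (\<exists>t s. real t \<le> f G \<and>
               (step P ^^ t) (input_config \<nu> \<kappa> G es) = s \<and> halted P s \<and>
               returns (length xs) ((\<lambda>\<mu>. map (\<lambda>x. \<nu> (\<mu> x)) xs) ` answers Q G) s))"

end

theory Submission
  imports Defs
begin

text \<open>
  Root the query forest, with free variables as roots where possible, and turn each atom into an
  automaton on the edge from parent to child, so that homomorphisms become solutions of a
  tree-shaped constraint problem whose arcs live in a product graph with \<open>O(|V| + |E|)\<close> nodes and
  arcs. A bottom-up pass removes all values without an extension to the subtree. Partial solutions
  are then extended variable by variable along a plan that stays within the free variables and the
  bound variables with two or more branches towards free ones, which are forgotten as soon as
  their component of bound variables is finished.

  One extension needs the reachable pairs \<open>R\<close> between two variables. Labels are propagated with a
  capacity \<open>d\<close> per node and label sources, doubling \<open>d\<close> until at most \<open>d\<close> sources are saturated;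
  those are searched individually. Each saturated source accounts for \<open>d\<close> pairs, hence
  \<open>d \<le> O(|R|\<^sup>1\<^sup>/\<^sup>2)\<close>, and the cost is \<open>O(|E| \<cdot> |R|\<^sup>1\<^sup>/\<^sup>2 + |R|)\<close>. Every pair extends to a partial
  solution, so \<open>|R| \<le> OUT \<cdot> |V|\<^sup>w\<close> if at most \<open>w\<close> bound variables are kept at a time.

  That \<open>w = cw Q\<close> suffices is seen in an optimal free-connex tree decomposition: by the Helly
  property of subtrees, some bag of free variables contains all free variables adjacent to a given
  component of bound variables. A branching variable of the component has three disjoint paths to
  this bag, and such a fan survives elimination, so the variable occurs in the contracted query
  graph of the bag.
\<close>

section \<open>A structured language for the machine\<close>

text \<open>The square root comes from balancing two searches. Propagation with capacity
  \<open>d\<close> costs \<open>d\<close> passes over the graph, searching \<open>h\<close>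
  saturated sources costs \<open>h\<close> passes, and \<open>h * d\<close> is at most the number of
  pairs; stopping once \<open>h <= d\<close> keeps both near the root of that number. Labels have to
  travel towards the sources, so that saturation is a property of a source, whereas a saturated
  source is searched forwards. Hence every arc of the product graph is stored twice, reversed in one
  copy and forward in the other. A second obstacle is memory: marks indexed by node and label have
  quadratically many cells and cannot be cleared within the bound. Old marks are therefore outdated
  by larger capacities, and the stages of the algorithm use fresh arrays instead of clearing old
  ones, which is possible because their number depends only on the query. Arcs into and out of a
  variable exist only for values that survive the bottom-up pass, so a pair found never leads to a
  dead end and can be charged to the next table. Vertices are charged to edges, as every vertex has
  an incident edge.\<close>

datatype expr = Lit nat | Var nat | Elem nat expr | Sum expr expr | Dif expr expr

datatype com =
    Skip
  | Assign nat expr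
  | Put nat expr expr
  | Seq com com  (infixr \<open>;;\<close> 60)
  | Cond expr com com
  | Loop expr com

text \<open>\<open>clk\<close> is a ghost component: no expression can read it, so time accounting
  cannot influence the computation. Arrays are total, like the machine memory they stand
  for.\<close>

record st =
  reg :: "nat => nat"
  arr :: "nat => nat => nat"
  clk :: nat

primrec val :: "expr => st => nat" where
  "val (Lit n) s = n"
| "val (Var r) s = reg s r"
| "val (Elem a e) s = arr s a (val e s)"
| "val (Sum e f) s = val e s + val f s"
| "val (Dif e f) s = val e s - val f s"

definition tick :: "st => st" where
  "tick s = s\<lparr>clk := Suc (clk s)\<rparr>"

definition assign :: "nat => nat => st => st" where
  "assign r n s = s\<lparr>reg := (reg s)(r := n), clk := Suc (clk s)\<rparr>"

definition put :: "nat => nat => nat => st => st" where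
  "put a i n s = s\<lparr>arr := (arr s)(a := (arr s a)(i := n)), clk := Suc (clk s)\<rparr>"

text \<open>An expression of any size is charged one unit, because its size is fixed by the program
  text; the true factor reappears as \<open>com_size\<close> in \<open>comp_correct\<close>.\<close>

inductive big :: "com => st => st => bool" where
  Skip: "big Skip s s"
| Assign: "big (Assign r e) s (assign r (val e s) s)"
| Put: "big (Put a e f) s (put a (val e s) (val f s) s)"
| Seq: "big c s s' ==> big d s' s'' ==> big (c ;; d) s s''"
| CondT: "val e s ~= 0 ==> big c (tick s) s' ==> big (Cond e c d) s s'"
| CondF: "val e s = 0 ==> big d (tick s) s' ==> big (Cond e c d) s s'"
| LoopT: "val e s ~= 0 ==> big c (tick s) s' ==> big (Loop e c) s' s'' ==> big (Loop e c) s s''"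
| LoopF: "val e s = 0 ==> big (Loop e c) s (tick s)"

text \<open>
  Element \<open>i\<close> of array \<open>a\<close> lives at address \<open>B + K * i + a\<close>, where \<open>K\<close> exceeds the index of every
  array in the program and register 1 of the machine holds \<open>B\<close>. Register \<open>r\<close> of the language is
  machine register \<open>2 * r\<close>; the odd machine registers from 3 on hold intermediate results.
\<close>

abbreviation tmp :: "nat => nat" where
  "tmp t \<equiv> Suc (2 * t)"

text \<open>The machine cannot multiply, so the factor \<open>K\<close>, a constant of the program,
  is unrolled into \<open>K\<close> additions.\<close>

definition address :: "nat => nat => nat => nat => instr list" where
  "address K a t d = [Const (tmp d) a, Add (tmp d) (tmp d) 1] @ replicate K (Add (tmp d) (tmp d) (tmp t))"

primrec comp_expr :: "nat => expr => nat => instr list" where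
  "comp_expr K (Lit n) t = [Const (tmp t) n]"
| "comp_expr K (Var r) t = [Copy (tmp t) (2 * r)]"
| "comp_expr K (Elem a e) t = comp_expr K e t @ address K a t (Suc t) @ [Load (tmp t) (tmp (Suc t))]"
| "comp_expr K (Sum e f) t = comp_expr K e t @ comp_expr K f (Suc t) @ [Add (tmp t) (tmp t) (tmp (Suc t))]"
| "comp_expr K (Dif e f) t = comp_expr K e t @ comp_expr K f (Suc t) @ [Sub (tmp t) (tmp t) (tmp (Suc t))]"

primrec comp :: "nat => com => nat => instr list" where
  "comp K Skip p = []"
| "comp K (Assign r e) p = comp_expr K e 1 @ [Copy (2 * r) (tmp 1)]"
| "comp K (Put a e f) p = comp_expr K e 1 @ comp_expr K f 2 @ address K a 1 3 @ [Store (tmp 3) (tmp 2)]"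
| "comp K (c ;; d) p = (let C = comp K c p in C @ comp K d (p + length C))"
| "comp K (Cond e c d) p =
     (let X = comp_expr K e 1;
          C = comp K c (p + length X + 1);
          q = p + length X + length C + 2;
          D = comp K d q
      in X @ [JumpZero (tmp 1) q] @ C @ [Jump (q + length D)] @ D)"
| "comp K (Loop e c) p =
     (let X = comp_expr K e 1;
          C = comp K c (p + length X + 1)
      in X @ [JumpZero (tmp 1) (p + length X + length C + 2)] @ C @ [Jump p])"

primrec expr_arrays :: "expr => nat set" where
  "expr_arrays (Lit n) = {}"
| "expr_arrays (Var r) = {}"
| "expr_arrays (Elem a e) = insert a (expr_arrays e)"
| "expr_arrays (Sum e f) = expr_arrays e \<union> expr_arrays f"
| "expr_arrays (Dif e f) = expr_arrays e \<union> expr_arrays f"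

primrec com_arrays :: "com => nat set" where
  "com_arrays Skip = {}"
| "com_arrays (Assign r e) = expr_arrays e"
| "com_arrays (Put a e f) = insert a (expr_arrays e \<union> expr_arrays f)"
| "com_arrays (c ;; d) = com_arrays c \<union> com_arrays d"
| "com_arrays (Cond e c d) = expr_arrays e \<union> com_arrays c \<union> com_arrays d"
| "com_arrays (Loop e c) = expr_arrays e \<union> com_arrays c"

lemma finite_com_arrays: "finite (com_arrays c)"
proof -
  have "finite (expr_arrays e)" for e by (induction e) auto
  then show ?thesis by (induction c) auto
qed

text \<open>Only arrays with index below \<open>K\<close> are represented. Nothing is said about odd
  registers other than 1: they are scratch space between any two commands.\<close>

definition sim :: "nat => nat => st => config => bool" where
  "sim K B h s \<longleftrightarrow> (\<forall>r. regs s (2 * r) = reg h r) & regs s 1 = B &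
     (\<forall>a<K. \<forall>i. mem s (B + K * i + a) = arr h a i)"

definition code_at :: "program => nat => instr list => bool" where
  "code_at P p is \<longleftrightarrow> (\<exists>xs ys. P = xs @ is @ ys & length xs = p)"

lemma code_at_append: "code_at P p (is @ js) \<longleftrightarrow> code_at P p is & code_at P (p + length is) js"
proof
  show "code_at P p (is @ js) ==> code_at P p is & code_at P (p + length is) js"
    unfolding code_at_def by (metis append.assoc length_append)
next
  assume "code_at P p is & code_at P (p + length is) js"
  then obtain xs ys us vs where 1: "P = xs @ is @ ys" "length xs = p"
    and 2: "P = us @ js @ vs" "length us = p + length is"
    unfolding code_at_def by blast
  have "us = xs @ is" using 1 2 by (metis append_assoc append_eq_append_conv length_append)
  then show "code_at P p (is @ js)" using 1 2 unfolding code_at_def by auto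
qed

lemma code_at_nth: "code_at P p (i # is) ==> P ! p = i & p < length P"
  unfolding code_at_def by (auto simp: nth_append)

lemma code_at_Cons: "code_at P p (i # is) \<longleftrightarrow> code_at P p [i] & code_at P (Suc p) is"
  using code_at_append[of P p "[i]" "is"] by simp

lemma step_code: "code_at P (pc s) [i] ==> step P s = exec i s"
  using code_at_nth[of P "pc s" i "[]"] by (simp add: step_def halted_def)

fun straight :: "instr => bool" where
  "straight (Jump l) = False"
| "straight (JumpZero a l) = False"
| "straight _ = True"

lemma pc_exec_straight: "straight i ==> pc (exec i s) = Suc (pc s)"
  by (cases i) (auto simp: set_reg_def)

lemma run_straight:
  assumes "code_at P (pc s) is" "list_all straight is"
  shows "(step P ^^ length is) s = fold exec is s & pc (fold exec is s) = pc s + length is"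
  using assms
proof (induction "is" arbitrary: s)
  case (Cons i "is")
  have i: "step P s = exec i s" and c: "code_at P (pc (exec i s)) is"
    using Cons.prems code_at_Cons[of P "pc s" i "is"] by (auto intro: step_code simp: pc_exec_straight)
  show ?case using Cons.IH[OF c] Cons.prems i by (simp add: funpow_Suc_right pc_exec_straight del: funpow.simps)
qed simp

lemma straight_address: "list_all straight (address K a t d)"
  by (auto simp: address_def list_all_iff)

lemma straight_expr: "list_all straight (comp_expr K e t)"
  by (induction e arbitrary: t) (simp_all add: straight_address)

lemma fold_replicate_Add:
  assumes "d ~= e"
  shows "fold exec (replicate k (Add d d e)) s =
    s\<lparr>regs := (regs s)(d := regs s d + k * regs s e), pc := pc s + k\<rparr>"
  using assms by (induction k arbitrary: s) (simp_all add: set_reg_def algebra_simps)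

lemma fold_address:
  assumes "t < d" "1 <= t"
  shows "fold exec (address K a t d) s =
    s\<lparr>regs := (regs s)(tmp d := regs s 1 + K * regs s (tmp t) + a), pc := pc s + K + 2\<rparr>"
  using assms by (simp add: address_def fold_replicate_Add set_reg_def ac_simps del: fold_replicate)

text \<open>A stack discipline: evaluation at depth \<open>t\<close> may clobber only the
  temporaries from \<open>tmp t\<close> upwards. As \<open>tmp 0\<close> is register 1, which holds
  the base address, all depths start at 1.\<close>

definition temp_eq :: "nat => config => config => bool" where
  "temp_eq t s s' \<longleftrightarrow> mem s' = mem s & (\<forall>r. even r \<or> r < tmp t --> regs s' r = regs s r)"

lemma temp_eq_trans: "temp_eq t s s' ==> temp_eq t' s' s'' ==> t <= t' ==> temp_eq t s s''"
  by (auto simp: temp_eq_def)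

lemma sim_temp_eq: "sim K B h s ==> temp_eq t s s' ==> 1 <= t ==> sim K B h s'"
  by (auto simp: sim_def temp_eq_def)

lemma comp_expr_correct:
  assumes "sim K B h s" "expr_arrays e \<subseteq> {..<K}" "1 <= t"
  shows "temp_eq t s (fold exec (comp_expr K e t) s) &
    regs (fold exec (comp_expr K e t) s) (tmp t) = val e h"
  using assms
proof (induction e arbitrary: t s)
  case (Lit n)
  then show ?case by (auto simp: temp_eq_def set_reg_def)
next
  case (Var r)
  then show ?case by (auto simp: temp_eq_def set_reg_def sim_def)
next
  case (Elem a e)
  define s1 where "s1 = fold exec (comp_expr K e t) s"
  have s1: "temp_eq t s s1" "regs s1 (tmp t) = val e h"
    using Elem unfolding s1_def by auto
  have "sim K B h s1" using Elem.prems s1 sim_temp_eq by blast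
  then show ?case using s1 Elem.prems
    by (auto simp: fold_address set_reg_def sim_def temp_eq_def s1_def[symmetric])
next
  case (Sum e f)
  define s1 where "s1 = fold exec (comp_expr K e t) s"
  define s2 where "s2 = fold exec (comp_expr K f (Suc t)) s1"
  have s1: "temp_eq t s s1" "regs s1 (tmp t) = val e h"
    using Sum unfolding s1_def by auto
  have "sim K B h s1" using Sum.prems s1 sim_temp_eq by blast
  then have s2: "temp_eq (Suc t) s1 s2" "regs s2 (tmp (Suc t)) = val f h"
    using Sum.IH(2)[of s1 "Suc t"] Sum.prems(2) unfolding s2_def by simp_all
  then show ?case using s1 s2
    by (auto simp: set_reg_def temp_eq_def s1_def[symmetric] s2_def[symmetric])
next
  case (Dif e f)
  define s1 where "s1 = fold exec (comp_expr K e t) s"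
  define s2 where "s2 = fold exec (comp_expr K f (Suc t)) s1"
  have s1: "temp_eq t s s1" "regs s1 (tmp t) = val e h"
    using Dif unfolding s1_def by auto
  have "sim K B h s1" using Dif.prems s1 sim_temp_eq by blast
  then have s2: "temp_eq (Suc t) s1 s2" "regs s2 (tmp (Suc t)) = val f h"
    using Dif.IH(2)[of s1 "Suc t"] Dif.prems(2) unfolding s2_def by simp_all
  then show ?case using s1 s2
    by (auto simp: set_reg_def temp_eq_def s1_def[symmetric] s2_def[symmetric])
qed

text \<open>Interleaving works like division with remainder: the remainder modulo \<open>K\<close>
  tells the array, the quotient the index. The same fact later separates product nodes and coded
  pairs.\<close>

lemma address_inj:
  fixes K a b i j :: nat
  assumes "a < K" "b < K"
  shows "B + K * i + a = B + K * j + b \<longleftrightarrow> i = j & a = b"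
  using assms
  by (metis add.assoc add_left_cancel div_mult_self4 div_less add.right_neutral gr_implies_not0
      mod_mult_self4 mod_less)

section \<open>Correctness of compilation\<close>

primrec com_size :: "nat => com => nat" where
  "com_size K Skip = 0"
| "com_size K (Assign r e) = length (comp_expr K e 1) + 1"
| "com_size K (Put a e f) = length (comp_expr K e 1) + length (comp_expr K f 2) + length (address K a 1 3) + 1"
| "com_size K (c ;; d) = com_size K c + com_size K d"
| "com_size K (Cond e c d) = length (comp_expr K e 1) + com_size K c + com_size K d + 2"
| "com_size K (Loop e c) = length (comp_expr K e 1) + com_size K c + 2"

text \<open>Jump targets are absolute positions, so the length of a fragment must be known
  independently of where it is placed.\<close>

lemma length_comp: "length (comp K c p) = com_size K c"
  by (induction c arbitrary: p) (simp_all add: Let_def)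

lemma run_expr:
  assumes "code_at P (pc s) (comp_expr K e t)" "sim K B h s" "expr_arrays e \<subseteq> {..<K}" "1 <= t"
  obtains s' where "(step P ^^ length (comp_expr K e t)) s = s'" "sim K B h s'" "temp_eq t s s'"
    "regs s' (tmp t) = val e h" "pc s' = pc s + length (comp_expr K e t)"
  using run_straight[OF assms(1) straight_expr] comp_expr_correct[OF assms(2-4)]
    sim_temp_eq[OF assms(2) _ assms(4)] by blast

lemma big_clk: "big c s s' ==> clk s <= clk s'"
  by (induction rule: big.induct) (auto simp: tick_def assign_def put_def)

lemma sim_tick: "sim K B (tick h) s = sim K B h s"
  by (simp add: sim_def tick_def)

lemma sim_pc: "sim K B h (s\<lparr>pc := p\<rparr>) = sim K B h s"
  by (simp add: sim_def)

lemma funpow_step_add: "(step P ^^ m) s = s' ==> (step P ^^ n) s' = s'' ==> (step P ^^ (m + n)) s = s''"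
  by (metis add.commute comp_apply funpow_add)

lemma funpow_step_Suc: "(step P ^^ m) s = s' ==> step P s' = s'' ==> (step P ^^ (Suc m)) s = s''"
  by simp

text \<open>One unit of \<open>clk\<close> pays for at most \<open>C\<close> machine steps. The
  inequality is additive rather than a difference, so that it telescopes along sequences and loop
  iterations in the natural numbers.\<close>

theorem comp_correct:
  assumes "big c h h'" "com_arrays c \<subseteq> {..<K}" "code_at P (pc s) (comp K c (pc s))"
    "sim K B h s" "com_size K c + 2 <= C"
  shows "\<exists>t s'. (step P ^^ t) s = s' & sim K B h' s' & pc s' = pc s + com_size K c &
    t + C * clk h <= C * clk h'"
  using assms
proof (induction arbitrary: s rule: big.induct)
  case (Skip h)
  then show ?case by (intro exI[of _ 0] exI[of _ s]) simp
next
  case (Assign r e h)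
  let ?X = "comp_expr K e 1"
  have cs: "code_at P (pc s) ?X" "code_at P (pc s + length ?X) [Copy (2 * r) (tmp 1)]"
    using Assign.prems(2) by (auto simp: code_at_append)
  obtain s1 where s1: "(step P ^^ length ?X) s = s1" "sim K B h s1" "temp_eq 1 s s1"
    "regs s1 (tmp 1) = val e h" "pc s1 = pc s + length ?X"
    using run_expr[OF cs(1) Assign.prems(3)] Assign.prems(1) by auto
  let ?s2 = "exec (Copy (2 * r) (tmp 1)) s1"
  have "(step P ^^ Suc (length ?X)) s = ?s2"
    using funpow_step_Suc[OF s1(1)] step_code cs(2) s1(5) by metis
  moreover have "sim K B (assign r (val e h) h) ?s2"
    using s1 by (auto simp: sim_def set_reg_def assign_def)
  ultimately show ?case using s1 Assign.prems(4)
    by (intro exI[of _ "Suc (length ?X)"] exI[of _ ?s2]) (auto simp: set_reg_def assign_def)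
next
  case (Put a e f h)
  let ?X = "comp_expr K e 1" and ?Y = "comp_expr K f 2" and ?Z = "address K a 1 3"
  have cs: "code_at P (pc s) ?X" "code_at P (pc s + length ?X) ?Y"
    "code_at P (pc s + length ?X + length ?Y) ?Z"
    "code_at P (pc s + length ?X + length ?Y + length ?Z) [Store (tmp 3) (tmp 2)]"
    using Put.prems(2) by (auto simp: code_at_append add.assoc)
  obtain s1 where s1: "(step P ^^ length ?X) s = s1" "sim K B h s1" "temp_eq 1 s s1"
    "regs s1 (tmp 1) = val e h" "pc s1 = pc s + length ?X"
    using run_expr[OF cs(1) Put.prems(3)] Put.prems(1) by auto
  obtain s2 where s2: "(step P ^^ length ?Y) s1 = s2" "sim K B h s2" "temp_eq 2 s1 s2"
    "regs s2 (tmp 2) = val f h" "pc s2 = pc s1 + length ?Y"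
    using run_expr[of P s1 K f 2 B h] cs(2) s1 Put.prems(1) by auto
  have t1: "regs s2 (tmp 1) = val e h" using s1 s2 by (auto simp: temp_eq_def)
  define s3 where "s3 = fold exec ?Z s2"
  have s3: "(step P ^^ length ?Z) s2 = s3" "pc s3 = pc s2 + length ?Z"
    using run_straight[of P s2 ?Z] cs(3) s1 s2 straight_address by (auto simp: s3_def)
  have s3': "s3 = s2\<lparr>regs := (regs s2)(tmp 3 := B + K * val e h + a), pc := pc s2 + K + 2\<rparr>"
    using t1 s2(2) unfolding s3_def by (subst fold_address) (auto simp: sim_def)
  let ?s4 = "exec (Store (tmp 3) (tmp 2)) s3"
  let ?t = "length ?X + length ?Y + length ?Z + 1"
  have "(step P ^^ (length ?X + (length ?Y + (length ?Z + 1)))) s = ?s4"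
    using step_code[of P s3] cs(4) s3(2) s2(5) s1(5)
    by (intro funpow_step_add[OF s1(1)] funpow_step_add[OF s2(1)] funpow_step_add[OF s3(1)]) auto
  then have r: "(step P ^^ ?t) s = ?s4" by (simp only: add.assoc)
  have a: "a < K" using Put.prems(1) by auto
  \<comment> \<open>\<open>tmp 3\<close> is machine register 7; being odd, it never belongs to a
    variable of the language.\<close>
  have odd: "2 * r ~= 7" for r :: nat by presburger
  have "sim K B (put a (val e h) (val f h) h) ?s4"
  proof -
    have 1: "regs ?s4 (2 * r) = reg h r" for r
      using s2(2) odd[of r] by (simp add: s3' sim_def)
    have 2: "regs ?s4 1 = B" using s2(2) by (simp add: s3' sim_def)
    have m: "mem ?s4 = (mem s2)(B + K * val e h + a := val f h)"
      using s2(4) by (simp add: s3')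
    have 3: "mem ?s4 (B + K * i + b) = arr (put a (val e h) (val f h) h) b i" if "b < K" for b i
    proof (cases "i = val e h & b = a")
      case True
      then show ?thesis unfolding m by (simp add: put_def)
    next
      case False
      then have "mem ?s4 (B + K * i + b) = mem s2 (B + K * i + b)"
        using address_inj[OF that a] unfolding m by (metis fun_upd_apply)
      also have "\<dots> = arr h b i" using s2(2) that by (simp add: sim_def)
      finally show ?thesis using False by (simp add: put_def)
    qed
    show ?thesis unfolding sim_def using 1 2 3 by (simp add: put_def)
  qed
  then show ?case using r s1(5) s2(5) s3(2) Put.prems(4)
    by (intro exI[of _ ?t] exI[of _ ?s4]) (auto simp: put_def)
next
  case (Seq c h h' d h'')
  let ?C = "comp K c (pc s)"
  have cs: "code_at P (pc s) ?C" "code_at P (pc s + com_size K c) (comp K d (pc s + com_size K c))"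
    using Seq.prems(2) by (auto simp: code_at_append Let_def length_comp)
  have l: "com_size K c + com_size K d + 2 <= C"
    using Seq.prems(4) by simp
  obtain t1 s1 where 1: "(step P ^^ t1) s = s1" "sim K B h' s1" "pc s1 = pc s + com_size K c"
    "t1 + C * clk h <= C * clk h'"
    using Seq.IH(1)[of s] Seq.prems cs l by auto
  obtain t2 s2 where 2: "(step P ^^ t2) s1 = s2" "sim K B h'' s2" "pc s2 = pc s1 + com_size K d"
    "t2 + C * clk h' <= C * clk h''"
    using Seq.IH(2)[of s1] Seq.prems 1 cs l by auto
  show ?case using funpow_step_add[OF 1(1) 2(1)] 1 2
    by (intro exI[of _ "t1 + t2"] exI[of _ s2]) (auto simp: Let_def)
next
  case (CondT e h c h' d)
  let ?X = "comp_expr K e 1"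
  let ?p = "pc s + length ?X + 1"
  let ?C = "comp K c ?p"
  let ?q = "pc s + length ?X + com_size K c + 2"
  let ?D = "comp K d ?q"
  have cs: "code_at P (pc s) ?X" "code_at P (pc s + length ?X) [JumpZero (tmp 1) ?q]"
    "code_at P ?p ?C" "code_at P (?p + com_size K c) [Jump (?q + com_size K d)]"
    using CondT.prems(2) by (auto simp: code_at_append Let_def length_comp code_at_Cons[of _ _ _ "_ @ _"] code_at_Cons[of _ _ _ "comp _ _ _"])
  have l: "length ?X + com_size K c + 2 + com_size K d + 2 <= C"
    using CondT.prems(4) by simp
  obtain s1 where s1: "(step P ^^ length ?X) s = s1" "sim K B h s1" "temp_eq 1 s s1"
    "regs s1 (tmp 1) = val e h" "pc s1 = pc s + length ?X"
    using run_expr[OF cs(1) CondT.prems(3)] CondT.prems(1) by auto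
  let ?s2 = "s1\<lparr>pc := ?p\<rparr>"
  have j: "step P s1 = ?s2"
    using step_code[of P s1] cs(2) s1 CondT.hyps by simp
  obtain t s3 where 3: "(step P ^^ t) ?s2 = s3" "sim K B h' s3" "pc s3 = ?p + com_size K c"
    "t + C * clk (tick h) <= C * clk h'"
    using CondT.IH[of ?s2] CondT.prems(1) cs(3) s1 l by (auto simp: sim_tick sim_pc)
  let ?s4 = "s3\<lparr>pc := ?q + com_size K d\<rparr>"
  have j2: "step P s3 = ?s4" using step_code[of P s3] cs(4) 3(3) by simp
  have "(step P ^^ Suc (Suc (length ?X) + t)) s = ?s4"
    using funpow_step_Suc[OF funpow_step_add[OF funpow_step_Suc[OF s1(1) j] 3(1)] j2] .
  then show ?case using 3 l
    by (intro exI[of _ "Suc (Suc (length ?X) + t)"] exI[of _ ?s4])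
      (auto simp: sim_pc Let_def tick_def)
next
  case (CondF e h d h' c)
  let ?X = "comp_expr K e 1"
  let ?p = "pc s + length ?X + 1"
  let ?C = "comp K c ?p"
  let ?q = "pc s + length ?X + com_size K c + 2"
  let ?D = "comp K d ?q"
  have cs: "code_at P (pc s) ?X" "code_at P (pc s + length ?X) [JumpZero (tmp 1) ?q]"
    "code_at P ?q ?D"
    using CondF.prems(2) by (auto simp: code_at_append Let_def length_comp code_at_Cons[of _ _ _ "_ @ _"] code_at_Cons[of _ _ _ "comp _ _ _"])
  have l: "length ?X + com_size K c + 2 + com_size K d + 2 <= C"
    using CondF.prems(4) by simp
  obtain s1 where s1: "(step P ^^ length ?X) s = s1" "sim K B h s1" "temp_eq 1 s s1"
    "regs s1 (tmp 1) = val e h" "pc s1 = pc s + length ?X"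
    using run_expr[OF cs(1) CondF.prems(3)] CondF.prems(1) by auto
  let ?s2 = "s1\<lparr>pc := ?q\<rparr>"
  have j: "step P s1 = ?s2"
    using step_code[of P s1] cs(2) s1 CondF.hyps by simp
  obtain t s3 where 3: "(step P ^^ t) ?s2 = s3" "sim K B h' s3" "pc s3 = ?q + com_size K d"
    "t + C * clk (tick h) <= C * clk h'"
    using CondF.IH[of ?s2] CondF.prems(1) cs(3) s1 l by (auto simp: sim_tick sim_pc)
  have "(step P ^^ (Suc (length ?X) + t)) s = s3"
    using funpow_step_add[OF funpow_step_Suc[OF s1(1) j] 3(1)] .
  then show ?case using 3 l
    by (intro exI[of _ "Suc (length ?X) + t"] exI[of _ s3]) (auto simp: Let_def tick_def)
next
  case (LoopT e h c h' h'')
  let ?X = "comp_expr K e 1"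
  let ?p = "pc s + length ?X + 1"
  let ?C = "comp K c ?p"
  let ?q = "pc s + length ?X + com_size K c + 2"
  have cs: "code_at P (pc s) ?X" "code_at P (pc s + length ?X) [JumpZero (tmp 1) ?q]"
    "code_at P ?p ?C" "code_at P (?p + com_size K c) [Jump (pc s)]"
    using LoopT.prems(2) by (auto simp: code_at_append Let_def length_comp code_at_Cons[of _ _ _ "_ @ _"] code_at_Cons[of _ _ _ "comp _ _ _"])
  have l: "length ?X + com_size K c + 2 + 2 <= C"
    using LoopT.prems(4) by simp
  obtain s1 where s1: "(step P ^^ length ?X) s = s1" "sim K B h s1" "temp_eq 1 s s1"
    "regs s1 (tmp 1) = val e h" "pc s1 = pc s + length ?X"
    using run_expr[OF cs(1) LoopT.prems(3)] LoopT.prems(1) by auto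
  let ?s2 = "s1\<lparr>pc := ?p\<rparr>"
  have j: "step P s1 = ?s2"
    using step_code[of P s1] cs(2) s1 LoopT.hyps by simp
  obtain t s3 where 3: "(step P ^^ t) ?s2 = s3" "sim K B h' s3" "pc s3 = ?p + com_size K c"
    "t + C * clk (tick h) <= C * clk h'"
    using LoopT.IH(1)[of ?s2] LoopT.prems(1) cs(3) s1 l by (auto simp: sim_tick sim_pc)
  let ?s4 = "s3\<lparr>pc := pc s\<rparr>"
  have j2: "step P s3 = ?s4" using step_code[of P s3] cs(4) 3(3) by simp
  obtain t' s5 where 5: "(step P ^^ t') ?s4 = s5" "sim K B h'' s5"
    "pc s5 = pc s + com_size K (Loop e c)" "t' + C * clk h' <= C * clk h''"
    using LoopT.IH(2)[of ?s4] LoopT.prems 3(2) by (auto simp: sim_pc)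
  have "(step P ^^ (Suc (Suc (length ?X) + t) + t')) s = s5"
    using funpow_step_add[OF funpow_step_Suc[OF funpow_step_add[OF funpow_step_Suc[OF s1(1) j] 3(1)] j2] 5(1)] .
  then show ?case using 3 5 l
    by (intro exI[of _ "Suc (Suc (length ?X) + t) + t'"] exI[of _ s5]) (auto simp: tick_def)
next
  case (LoopF e h c)
  let ?X = "comp_expr K e 1"
  let ?p = "pc s + length ?X + 1"
  let ?C = "comp K c ?p"
  let ?q = "pc s + length ?X + com_size K c + 2"
  have cs: "code_at P (pc s) ?X" "code_at P (pc s + length ?X) [JumpZero (tmp 1) ?q]"
    using LoopF.prems(2) by (auto simp: code_at_append Let_def length_comp code_at_Cons[of _ _ _ "_ @ _"] code_at_Cons[of _ _ _ "comp _ _ _"])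
  obtain s1 where s1: "(step P ^^ length ?X) s = s1" "sim K B h s1" "temp_eq 1 s s1"
    "regs s1 (tmp 1) = val e h" "pc s1 = pc s + length ?X"
    using run_expr[OF cs(1) LoopF.prems(3)] LoopF.prems(1) by auto
  let ?s2 = "s1\<lparr>pc := ?q\<rparr>"
  have "step P s1 = ?s2"
    using step_code[of P s1] cs(2) s1 LoopF.hyps by simp
  from funpow_step_Suc[OF s1(1) this] show ?case using s1 LoopF.prems(4)
    by (intro exI[of _ "Suc (length ?X)"] exI[of _ ?s2]) (auto simp: Let_def tick_def sim_tick sim_pc sim_def)
qed

section \<open>Weakest preconditions\<close>

lemma upd_simps [simp]:
  "reg (tick s) = reg s" "arr (tick s) = arr s" "clk (tick s) = Suc (clk s)"
  "reg (assign r n s) = (reg s)(r := n)" "arr (assign r n s) = arr s" "clk (assign r n s) = Suc (clk s)"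
  "reg (put a i n s) = reg s" "arr (put a i n s) = (arr s)(a := (arr s a)(i := n))"
  "clk (put a i n s) = Suc (clk s)"
  by (simp_all add: tick_def assign_def put_def)

text \<open>Total correctness: a terminating run must exist. Any witness run is enough, because
  \<open>comp_correct\<close> turns every derivation of \<open>big\<close> into a machine
  run.\<close>

definition wp :: "com => (st => bool) => st => bool" where
  "wp c Q s \<longleftrightarrow> (\<exists>s'. big c s s' & Q s')"

inductive_cases bigE [elim!]: "big Skip s t" "big (Assign r e) s t" "big (Put a e f) s t" "big (c ;; d) s t"
  "big (Cond e c d) s t"

lemma wp_simps [simp]:
  "wp Skip Q = Q"
  "wp (Assign r e) Q = (\<lambda>s. Q (assign r (val e s) s))"
  "wp (Put a e f) Q = (\<lambda>s. Q (put a (val e s) (val f s) s))"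
  "wp (c ;; d) Q = wp c (wp d Q)"
  "wp (Cond e c d) Q s \<longleftrightarrow> (if val e s ~= 0 then wp c Q (tick s) else wp d Q (tick s))"
  unfolding wp_def fun_eq_iff by (blast intro: big.intros)+ (auto intro: big.intros)

lemma wp_mono: "wp c P s ==> (\<And>s'. P s' ==> Q s') ==> wp c Q s"
  unfolding wp_def by blast

primrec warr :: "com => nat set" where
  "warr Skip = {}"
| "warr (Assign r e) = {}"
| "warr (Put a e f) = {a}"
| "warr (c ;; d) = warr c \<union> warr d"
| "warr (Cond e c d) = warr c \<union> warr d"
| "warr (Loop e c) = warr c"

primrec wreg :: "com => nat set" where
  "wreg Skip = {}"
| "wreg (Assign r e) = {r}"
| "wreg (Put a e f) = {}"
| "wreg (c ;; d) = wreg c \<union> wreg d"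
| "wreg (Cond e c d) = wreg c \<union> wreg d"
| "wreg (Loop e c) = wreg c"

definition mods :: "nat set => nat set => st => st => bool" where
  "mods X Y s s' \<longleftrightarrow> (\<forall>a. a \<notin> X --> arr s' a = arr s a) & (\<forall>r. r \<notin> Y --> reg s' r = reg s r)"

lemma mods_refl [simp]: "mods X Y s s"
  by (simp add: mods_def)

lemma mods_trans: "mods X Y s s' ==> mods X' Y' s' s'' ==> X \<subseteq> Z ==> X' \<subseteq> Z ==> Y \<subseteq> W ==> Y' \<subseteq> W ==> mods Z W s s''"
  unfolding mods_def by (metis (no_types, lifting) subsetD)

lemma mods_arr: "mods X Y s s' ==> a \<notin> X ==> arr s' a = arr s a"
  by (auto simp: mods_def)

lemma mods_reg: "mods X Y s s' ==> r \<notin> Y ==> reg s' r = reg s r"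
  by (auto simp: mods_def)

lemma mods_mono: "mods X Y s s' ==> X \<subseteq> X' ==> Y \<subseteq> Y' ==> mods X' Y' s s'"
  by (auto simp: mods_def)

lemma mods_tick [simp]: "mods X Y s (tick s') = mods X Y s s'" "mods X Y (tick s) s' = mods X Y s s'"
  by (simp_all add: mods_def)

lemma mods_assign: "r \<in> Y ==> mods X Y s (assign r n s') = mods X Y s s'"
  by (auto simp: mods_def)

lemma big_mods: "big c s s' ==> mods (warr c) (wreg c) s s'"
  by (induction rule: big.induct) (auto simp: mods_def)

text \<open>The written arrays and registers are read off the syntax, so invariants mention only
  what a loop changes; everything else is recovered from \<open>mods\<close>.\<close>

lemma wp_frame: "wp c P s ==> (\<And>s'. P s' ==> mods (warr c) (wreg c) s s' ==> Q s') ==> wp c Q s"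
  unfolding wp_def using big_mods by blast

lemma wp_Seq: "wp c P s ==> (\<And>s'. P s' ==> mods (warr c) (wreg c) s s' ==> wp d Q s') ==> wp (c ;; d) Q s"
  by (simp, erule wp_frame)

lemma wp_Loop:
  assumes "I s"
    and body: "\<And>s'. I s' ==> mods (warr c) (wreg c) s s' ==> val e s' ~= 0 ==> wp c (\<lambda>t. I t & f t < (f s' :: nat)) (tick s')"
    and exit: "\<And>s'. I s' ==> mods (warr c) (wreg c) s s' ==> val e s' = 0 ==> Q (tick s')"
  shows "wp (Loop e c) Q s"
proof -
  have "wp (Loop e c) Q s'" if "I s'" "mods (warr c) (wreg c) s s'" for s'
    using that
  proof (induction "f s'" arbitrary: s' rule: less_induct)
    case less
    show ?case
    proof (cases "val e s' = 0")
      case True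
      then show ?thesis using exit[OF less.prems] unfolding wp_def by (blast intro: LoopF)
    next
      case False
      then obtain t where t: "big c (tick s') t" "I t" "f t < f s'"
        using body[OF less.prems] unfolding wp_def by blast
      have "mods (warr c) (wreg c) s t"
        using mods_trans[OF less.prems(2)] big_mods[OF t(1)] by (metis mods_tick(2) subset_refl)
      then have "wp (Loop e c) Q t" using less.hyps t by blast
      then show ?thesis using t(1) False unfolding wp_def by (blast intro: LoopT)
    qed
  qed
  then show ?thesis using assms(1) by simp
qed

text \<open>The bound \<open>e\<close> is evaluated anew in each round; \<open>wp_For\<close>
  therefore asks that it keep the value \<open>N\<close>. The overhead is two units per round and
  two in total for start and exit.\<close>

definition For :: "nat => expr => com => com" where
  "For i e c = Assign i (Lit 0) ;; Loop (Dif e (Var i)) (c ;; Assign i (Sum (Var i) (Lit 1)))"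

lemma For_sets [simp]: "warr (For i e c) = warr c" "wreg (For i e c) = insert i (wreg c)"
  by (auto simp: For_def)

lemma wp_For:
  assumes "i \<notin> wreg c"
    and hi: "\<And>s'. mods (warr c) (insert i (wreg c)) s s' ==> val e s' = N"
    and init: "I 0 (assign i 0 s)"
    and body: "\<And>k s'. I k s' ==> mods (warr c) (insert i (wreg c)) s s' ==> reg s' i = k ==> k < N ==>
      wp c (\<lambda>t. I (Suc k) (assign i (Suc k) t)) (tick s')"
    and exit: "\<And>s'. I N s' ==> mods (warr c) (insert i (wreg c)) s s' ==> Q (tick s')"
  shows "wp (For i e c) Q s"
proof -
  let ?J = "\<lambda>s'. reg s' i <= N & I (reg s' i) s' & mods (warr c) (insert i (wreg c)) s s'"
  have "wp (Loop (Dif e (Var i)) (c ;; Assign i (Sum (Var i) (Lit 1)))) Q (assign i 0 s)"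
  proof (rule wp_Loop[where I = ?J and f = "\<lambda>s'. N - reg s' i"])
    show "?J (assign i 0 s)" using init by (simp add: mods_assign)
  next
    fix s' assume J: "?J s'" and v: "val (Dif e (Var i)) s' ~= 0"
    then have lt: "reg s' i < N" using hi by fastforce
    have "wp c (\<lambda>t. I (Suc (reg s' i)) (assign i (Suc (reg s' i)) t)) (tick s')"
      using body[of "reg s' i" s'] J lt by blast
    then show "wp (c ;; Assign i (Sum (Var i) (Lit 1))) (\<lambda>t. ?J t & N - reg t i < N - reg s' i) (tick s')"
      unfolding wp_simps
    proof (rule wp_frame)
      fix t assume t: "I (Suc (reg s' i)) (assign i (Suc (reg s' i)) t)"
        and m: "mods (warr c) (wreg c) (tick s') t"
      have r: "reg t i = reg s' i" using m assms(1) by (simp add: mods_def)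
      have "mods (warr c) (insert i (wreg c)) s t"
        using mods_trans[of "warr c" "insert i (wreg c)" s s' "warr c" "wreg c" t "warr c" "insert i (wreg c)"] J m by auto
      then show "?J (assign i (val (Sum (Var i) (Lit 1)) t) t) &
          N - reg (assign i (val (Sum (Var i) (Lit 1)) t) t) i < N - reg s' i"
        using r t lt by (simp add: mods_assign)
    qed
  next
    fix s' assume J: "?J s'" and v: "val (Dif e (Var i)) s' = 0"
    then have "reg s' i = N" using hi[of s'] by auto
    then show "Q (tick s')" using exit J by auto
  qed
  then show ?thesis by (simp add: For_def)
qed

section \<open>Linked lists of arcs\<close>

text \<open>Pointers are indices plus one, so that 0, the content of an untouched cell, is the empty
  list.\<close>

fun chain :: "(nat => nat) => nat => nat list => bool" where
  "chain nx p [] \<longleftrightarrow> p = 0"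
| "chain nx p (i # is) \<longleftrightarrow> p = Suc i & chain nx (nx i) is"

lemma chain_upd: "j \<notin> set is ==> chain (nx(j := x)) p is = chain nx p is"
  by (induction "is" arbitrary: p) auto

text \<open>New arcs are pushed to the front of their list, hence the reversal.\<close>

definition outs :: "(nat \<times> nat) list => nat => nat list" where
  "outs As w = rev (filter (\<lambda>i. fst (As ! i) = w) [0..<length As])"

definition targets :: "(nat \<times> nat) list => nat => nat list" where
  "targets As w = map (\<lambda>i. snd (As ! i)) (outs As w)"

lemma outs_Nil [simp]: "outs [] w = []"
  by (simp add: outs_def)

lemma set_outs: "set (outs As w) = {i. i < length As & fst (As ! i) = w}"
  by (auto simp: outs_def)

lemma distinct_outs: "distinct (outs As w)"
  by (simp add: outs_def)

lemma outs_snoc: "outs (As @ [(u, v)]) w = (if w = u then length As # outs As w else outs As w)"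
proof -
  have "filter (\<lambda>i. fst ((As @ [(u, v)]) ! i) = w) [0..<length As] = filter (\<lambda>i. fst (As ! i) = w) [0..<length As]"
    by (intro filter_cong) (auto simp: nth_append)
  then show ?thesis by (simp add: outs_def)
qed

lemma set_targets: "set (targets As w) = set As `` {w}"
proof -
  have "x \<in> set (targets As w) \<longleftrightarrow> (w, x) \<in> set As" for x
  proof
    assume "x \<in> set (targets As w)"
    then obtain i where "i < length As" "fst (As ! i) = w" "x = snd (As ! i)"
      by (auto simp: targets_def set_outs)
    then show "(w, x) \<in> set As" by (metis nth_mem prod.collapse)
  next
    assume "(w, x) \<in> set As"
    then obtain i where "i < length As" "As ! i = (w, x)" by (auto simp: in_set_conv_nth)
    then have "i \<in> set (outs As w)" "x = snd (As ! i)" by (auto simp: set_outs)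
    then show "x \<in> set (targets As w)" unfolding targets_def set_map by blast
  qed
  then show ?thesis by auto
qed

lemma sum_outs: "(\<Sum>w<N. length (outs As w)) <= length As"
proof (induction As rule: rev_induct)
  case (snoc a As)
  obtain u v where a: "a = (u, v)" by (cases a)
  have "(\<Sum>w<N. length (outs (As @ [a]) w)) = (\<Sum>w<N. length (outs As w) + (if w = u then 1 else 0))"
    by (intro sum.cong) (auto simp: a outs_snoc)
  also have "\<dots> <= (\<Sum>w<N. length (outs As w)) + 1"
    by (simp add: sum.distrib)
  finally show ?case using snoc by simp
qed simp

text \<open>Arrays \<open>g\<close>, \<open>g + 1\<close>, \<open>g + 2\<close> hold the list heads, the successor pointers and the targets.\<close>

definition links :: "nat => nat => st => (nat \<times> nat) list => bool" where
  "links g c s As \<longleftrightarrow> reg s c = length As & (\<forall>i<length As. arr s (g + 2) i = snd (As ! i)) &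
     (\<forall>w. chain (arr s (g + 1)) (arr s g w) (outs As w))"

definition add_link :: "nat => nat => nat => nat => com" where
  "add_link g c u v = Put (g + 1) (Var c) (Elem g (Var u)) ;; Put (g + 2) (Var c) (Var v) ;;
     Assign c (Sum (Var c) (Lit 1)) ;; Put g (Var u) (Var c)"

lemma add_link_sets [simp]: "warr (add_link g c u v) = {g, g + 1, g + 2}" "wreg (add_link g c u v) = {c}"
  by (auto simp: add_link_def)

lemma links_mods: "links g c s As ==> mods X Y s s' ==> g \<notin> X ==> g + 1 \<notin> X ==> g + 2 \<notin> X ==> c \<notin> Y ==> links g c s' As"
  by (simp add: links_def mods_def)

lemma links_tick [simp]: "links g c (tick s) As = links g c s As"
  by (simp add: links_def)

lemma wp_add_link:
  assumes "links g c s As" "u ~= c" "v ~= c"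
  shows "wp (add_link g c u v) (\<lambda>s'. links g c s' (As @ [(reg s u, reg s v)]) & clk s' = clk s + 4) s"
proof -
  have "length As \<notin> set (outs As w)" for w by (simp add: set_outs)
  then show ?thesis using assms
    by (auto simp: add_link_def links_def outs_snoc chain_upd nth_append less_Suc_eq)
qed

definition Each :: "nat => nat => nat => com => com" where
  "Each g p t c = Loop (Var p) (Assign t (Elem (g + 2) (Dif (Var p) (Lit 1))) ;; c ;;
     Assign p (Elem (g + 1) (Dif (Var p) (Lit 1))))"

lemma Each_sets [simp]: "warr (Each g p t c) = warr c" "wreg (Each g p t c) = {p, t} \<union> wreg c"
  by (auto simp: Each_def)

lemma wp_Each:
  assumes l: "links g d s As" and p: "reg s p = arr s g w"
    and fr: "g + 1 \<notin> warr c" "g + 2 \<notin> warr c" "p \<notin> wreg c" "p ~= t"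
    and init: "I 0 s"
    and body: "\<And>k s' x. I k s' ==> mods (warr c) ({p, t} \<union> wreg c) s s' ==> k < length (targets As w) ==>
      wp c (\<lambda>u. \<forall>x. I (Suc k) (assign p x u)) (assign t (targets As w ! k) (tick s'))"
    and exit: "\<And>s'. I (length (targets As w)) s' ==> mods (warr c) ({p, t} \<union> wreg c) s s' ==> Q (tick s')"
  shows "wp (Each g p t c) Q s"
proof -
  let ?is = "outs As w"
  let ?J = "\<lambda>s'. \<exists>k \<le> length ?is. I k s' & chain (arr s' (g + 1)) (reg s' p) (drop k ?is) &
    mods (warr c) ({p, t} \<union> wreg c) s s'"
  \<comment> \<open>The variant must be a function of the state: the number of remaining arcs is
    recovered from the pointer, which is unambiguous because a chain determines its length
    (\<open>ch_len\<close>).\<close>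
  let ?f = "\<lambda>s'. LEAST k. k <= length ?is & chain (arr s (g + 1)) (reg s' p) (drop (length ?is - k) ?is)"
  let ?b = "Assign t (Elem (g + 2) (Dif (Var p) (Lit 1))) ;; c ;; Assign p (Elem (g + 1) (Dif (Var p) (Lit 1)))"
  have ch_len: "chain nx q xs ==> chain nx q ys ==> length xs = length ys" for nx q xs ys
    by (induction nx q xs arbitrary: ys rule: chain.induct) (case_tac ys; auto)+
  have f: "?f s' = length ?is - k" if "k <= length ?is" "chain (arr s (g + 1)) (reg s' p) (drop k ?is)" for k s'
  proof (rule Least_equality)
    show "length ?is - k <= length ?is & chain (arr s (g + 1)) (reg s' p) (drop (length ?is - (length ?is - k)) ?is)"
      using that by simp
    fix y assume "y <= length ?is & chain (arr s (g + 1)) (reg s' p) (drop (length ?is - y) ?is)"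
    then show "length ?is - k <= y" using ch_len[OF that(2)] by force
  qed
  have "wp (Loop (Var p) ?b) Q s"
  proof (rule wp_Loop[where I = ?J and f = ?f])
    show "?J s" using init l p by (intro exI[of _ 0]) (simp add: links_def)
  next
    fix s' assume "?J s'" and v: "val (Var p) s' ~= 0"
    then obtain k where k: "k <= length ?is" "I k s'" "chain (arr s' (g + 1)) (reg s' p) (drop k ?is)"
      and m: "mods (warr c) ({p, t} \<union> wreg c) s s'" by blast
    have a: "arr s' (g + 1) = arr s (g + 1)" "arr s' (g + 2) = arr s (g + 2)"
      using m fr mods_arr by blast+
    have klt: "k < length ?is" using k v by (cases "k = length ?is") auto
    then have d: "drop k ?is = ?is ! k # drop (Suc k) ?is" by (simp add: Cons_nth_drop_Suc)
    then have ps: "reg s' p = Suc (?is ! k)" and nx: "chain (arr s' (g + 1)) (arr s' (g + 1) (?is ! k)) (drop (Suc k) ?is)"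
      using k(3) by auto
    have "?is ! k < length As" using klt nth_mem set_outs by blast
    then have tv: "arr s' (g + 2) (reg s' p - 1) = targets As w ! k"
      using l ps klt a by (simp add: links_def targets_def)
    have fs': "?f s' = length ?is - k" using f[OF k(1)] k(3) a by simp
    have "wp c (\<lambda>u. \<forall>x. I (Suc k) (assign p x u)) (assign t (targets As w ! k) (tick s'))"
      using body[OF k(2) m] klt by (simp add: targets_def)
    then have "wp c (\<lambda>u. ?J (assign p (arr u (g + 1) (reg u p - 1)) u) &
        ?f (assign p (arr u (g + 1) (reg u p - 1)) u) < ?f s') (assign t (targets As w ! k) (tick s'))"
    proof (rule wp_frame)
      fix u assume u: "\<forall>x. I (Suc k) (assign p x u)"
        and mu: "mods (warr c) (wreg c) (assign t (targets As w ! k) (tick s')) u"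
      have au: "arr u (g + 1) = arr s' (g + 1)" "reg u p = reg s' p"
        using mu fr by (simp_all add: mods_def)
      let ?u = "assign p (arr u (g + 1) (reg u p - 1)) u"
      have mu': "mods (warr c) ({p, t} \<union> wreg c) s ?u"
        using m mu by (auto simp: mods_def)
      have cu: "chain (arr ?u (g + 1)) (reg ?u p) (drop (Suc k) ?is)"
        using nx ps au by simp
      have "?f ?u = length ?is - Suc k"
        by (rule f) (use klt cu au a in auto)
      then show "?J ?u & ?f ?u < ?f s'"
        using u mu' cu klt fs' by (intro conjI exI[of _ "Suc k"]) auto
    qed
    then show "wp ?b (\<lambda>t. ?J t & ?f t < ?f s') (tick s')"
      using tv by simp
  next
    fix s' assume "?J s'" and v: "val (Var p) s' = 0"
    then obtain k where k: "k <= length ?is" "I k s'" "chain (arr s' (g + 1)) (reg s' p) (drop k ?is)"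
      and m: "mods (warr c) ({p, t} \<union> wreg c) s s'" by blast
    have "k = length ?is"
    proof (rule ccontr)
      assume "k ~= length ?is"
      then have "drop k ?is = ?is ! k # drop (Suc k) ?is" using k(1) by (simp add: Cons_nth_drop_Suc)
      then show False using k(3) v by simp
    qed
    then show "Q (tick s')" using exit[OF _ m] k(2) by (simp add: targets_def)
  qed
  then show ?thesis by (simp add: Each_def)
qed

section \<open>Label propagation with bounded capacity\<close>

definition cnt :: "(nat \<times> nat) list => nat => nat" where
  "cnt Qs w = count_list (map fst Qs) w"

definition enq :: "nat => nat => (nat \<times> nat) list => nat => (nat \<times> nat) list" where
  "enq cap l Qs w = (if (w, l) \<in> set Qs \<or> cap <= cnt Qs w then Qs else Qs @ [(w, l)])"

lemma cnt_Nil [simp]: "cnt [] w = 0"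
  by (simp add: cnt_def)

lemma cnt_append [simp]: "cnt (Qs @ Rs) w = cnt Qs w + cnt Rs w"
  by (simp add: cnt_def)

lemma cnt_Cons [simp]: "cnt ((v, l) # Qs) w = (if v = w then Suc (cnt Qs w) else cnt Qs w)"
  by (simp add: cnt_def)

lemma cnt_card: "distinct Qs ==> cnt Qs w = card {l. (w, l) \<in> set Qs}"
proof (induction Qs)
  case (Cons q Qs)
  obtain v l where q: "q = (v, l)" by (cases q)
  have fin: "finite {l. (w, l) \<in> set Qs}"
    by (rule finite_subset[of _ "snd ` set Qs"]) force+
  have "{l'. (w, l') \<in> set (q # Qs)} = (if v = w then insert l {l. (w, l) \<in> set Qs} else {l. (w, l) \<in> set Qs})"
    using q by auto
  then show ?case using Cons q fin by auto
qed simp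

text \<open>The first \<open>h\<close> entries of \<open>Qs\<close> have been processed. A label
  that should be at a node is there or the node is full; this is the only way in which labels get
  lost.\<close>

definition prop_inv :: "(nat \<times> nat) set => (nat \<times> nat) set => nat => (nat \<times> nat) list => nat => bool" where
  "prop_inv R I cap Qs h \<longleftrightarrow> distinct Qs & h <= length Qs & (\<forall>w. cnt Qs w <= cap) &
     (\<forall>(w, l)\<in>set Qs. \<exists>w0. (w0, l) \<in> I & (w0, w) \<in> R\<^sup>*) &
     (\<forall>(w, l)\<in>I. (w, l) \<in> set Qs \<or> cap <= cnt Qs w) &
     (\<forall>i<h. \<forall>w'. (fst (Qs ! i), w') \<in> R --> (w', snd (Qs ! i)) \<in> set Qs \<or> cap <= cnt Qs w')"

lemma prop_inv_Nil: "prop_inv R {} cap [] 0"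
  by (simp add: prop_inv_def)

lemma prop_inv_enq:
  assumes "prop_inv R I cap Qs h" "\<exists>w0. (w0, l) \<in> I & (w0, w) \<in> R\<^sup>*"
  shows "prop_inv R I cap (enq cap l Qs w) h"
  using assms by (fastforce simp: prop_inv_def enq_def nth_append)

lemma prop_inv_init:
  assumes "prop_inv R I cap Qs h"
  shows "prop_inv R (insert (w, l) I) cap (enq cap l Qs w) h"
proof -
  have 1: "distinct Qs" "h <= length Qs" "\<forall>w. cnt Qs w <= cap"
    and 2: "\<forall>(v, l)\<in>set Qs. \<exists>w0. (w0, l) \<in> I & (w0, v) \<in> R\<^sup>*"
    and 3: "\<forall>(v, l)\<in>I. (v, l) \<in> set Qs \<or> cap <= cnt Qs v"
    and 4: "\<forall>i<h. \<forall>w'. (fst (Qs ! i), w') \<in> R --> (w', snd (Qs ! i)) \<in> set Qs \<or> cap <= cnt Qs w'"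
    using assms by (auto simp: prop_inv_def)
  show ?thesis
  proof (cases "(w, l) \<in> set Qs \<or> cap <= cnt Qs w")
    case True
    then show ?thesis using 1 2 3 4 unfolding prop_inv_def enq_def by (auto; blast)
  next
    case False
    have 5: "\<exists>w0. (w0, l) \<in> insert (w, l) I & (w0, w) \<in> R\<^sup>*" by blast
    have 6: "\<forall>(v, l')\<in>set (Qs @ [(w, l)]). \<exists>w0. (w0, l') \<in> insert (w, l) I & (w0, v) \<in> R\<^sup>*"
      using 2 5 by fastforce
    have 7: "\<forall>(v, l')\<in>insert (w, l) I. (v, l') \<in> set (Qs @ [(w, l)]) \<or> cap <= cnt (Qs @ [(w, l)]) v"
      using 3 by (auto; fastforce)
    have 8: "\<forall>i<h. \<forall>w'. (fst ((Qs @ [(w, l)]) ! i), w') \<in> R -->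
        (w', snd ((Qs @ [(w, l)]) ! i)) \<in> set (Qs @ [(w, l)]) \<or> cap <= cnt (Qs @ [(w, l)]) w'"
      using 4 1(2) by (fastforce simp: nth_append)
    have 9: "distinct (Qs @ [(w, l)])" "h <= length (Qs @ [(w, l)])" "\<forall>v. cnt (Qs @ [(w, l)]) v <= cap"
      using 1 False by auto
    have "enq cap l Qs w = Qs @ [(w, l)]" using False by (simp add: enq_def)
    then show ?thesis using 6 7 8 9 unfolding prop_inv_def by simp
  qed
qed

lemma enq_mono: "(v, l') \<in> set Qs \<or> cap <= cnt Qs v ==> (v, l') \<in> set (enq cap l Qs w) \<or> cap <= cnt (enq cap l Qs w) v"
  by (auto simp: enq_def)

lemma length_enq: "length Qs <= length (enq cap l Qs w)"
  by (simp add: enq_def)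

lemma nth_enq: "i < length Qs ==> enq cap l Qs w ! i = Qs ! i"
  by (simp add: enq_def nth_append)

text \<open>Covers the scan of all successors of one queue entry. A node that has the label or is
  full stays so while the queue grows, which keeps earlier demands satisfied.\<close>

lemma prop_inv_foldl:
  assumes "prop_inv R I cap Qs h" "h < length Qs" "Qs ! h = (w, l)" "set ws \<subseteq> R `` {w}"
  shows "prop_inv R I cap (foldl (enq cap l) Qs ws) h & h < length (foldl (enq cap l) Qs ws) &
    foldl (enq cap l) Qs ws ! h = (w, l) &
    (\<forall>v l'. (v, l') \<in> set Qs \<or> cap <= cnt Qs v -->
       (v, l') \<in> set (foldl (enq cap l) Qs ws) \<or> cap <= cnt (foldl (enq cap l) Qs ws) v) &
    (\<forall>v\<in>set ws. (v, l) \<in> set (foldl (enq cap l) Qs ws) \<or> cap <= cnt (foldl (enq cap l) Qs ws) v)"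
  using assms
proof (induction ws arbitrary: Qs)
  case (Cons v ws)
  let ?Q = "enq cap l Qs v"
  have "(w, l) \<in> set Qs" using Cons.prems nth_mem by metis
  then have "\<exists>w0. (w0, l) \<in> I & (w0, w) \<in> R\<^sup>*" using Cons.prems(1) by (auto simp: prop_inv_def)
  then have "\<exists>w0. (w0, l) \<in> I & (w0, v) \<in> R\<^sup>*" using Cons.prems(4) by (auto intro: rtrancl.rtrancl_into_rtrancl)
  then have "prop_inv R I cap ?Q h" using prop_inv_enq Cons.prems(1) by blast
  moreover have "h < length ?Q" "?Q ! h = (w, l)"
    using Cons.prems length_enq[of Qs cap l v] by (auto simp: nth_enq)
  ultimately have IH: "prop_inv R I cap (foldl (enq cap l) ?Q ws) h & h < length (foldl (enq cap l) ?Q ws) &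
    foldl (enq cap l) ?Q ws ! h = (w, l) &
    (\<forall>v l'. (v, l') \<in> set ?Q \<or> cap <= cnt ?Q v -->
       (v, l') \<in> set (foldl (enq cap l) ?Q ws) \<or> cap <= cnt (foldl (enq cap l) ?Q ws) v) &
    (\<forall>v\<in>set ws. (v, l) \<in> set (foldl (enq cap l) ?Q ws) \<or> cap <= cnt (foldl (enq cap l) ?Q ws) v)"
    using Cons.IH[of ?Q] Cons.prems(4) by auto
  have "(v, l) \<in> set ?Q \<or> cap <= cnt ?Q v" by (simp add: enq_def)
  then have v: "(v, l) \<in> set (foldl (enq cap l) ?Q ws) \<or> cap <= cnt (foldl (enq cap l) ?Q ws) v"
    using IH by blast
  have "(x, l') \<in> set (foldl (enq cap l) ?Q ws) \<or> cap <= cnt (foldl (enq cap l) ?Q ws) x"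
    if "(x, l') \<in> set Qs \<or> cap <= cnt Qs x" for x l'
    using IH enq_mono[OF that] by blast
  then show ?case using IH v by simp
qed simp

lemma prop_inv_step:
  assumes "prop_inv R I cap Qs h" "h < length Qs" "Qs ! h = (w, l)" "set ws = R `` {w}"
  shows "prop_inv R I cap (foldl (enq cap l) Qs ws) (Suc h)"
  using prop_inv_foldl[OF assms(1-3)] assms(4) by (fastforce simp: prop_inv_def less_Suc_eq)

text \<open>Losses at full nodes do not affect the others: a node passes all its labels on to an
  unsaturated successor, so every predecessor of an unsaturated node holds at most as many labels
  and is unsaturated too. Going backwards along a path, nothing was refused.\<close>

theorem prop_inv_complete:
  assumes inv: "prop_inv R I cap Qs (length Qs)" and c: "cnt Qs w < cap"
  shows "(w, l) \<in> set Qs \<longleftrightarrow> (\<exists>w0. (w0, l) \<in> I & (w0, w) \<in> R\<^sup>*)"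
proof
  show "(w, l) \<in> set Qs ==> \<exists>w0. (w0, l) \<in> I & (w0, w) \<in> R\<^sup>*"
    using inv by (auto simp: prop_inv_def)
next
  have d: "distinct Qs" using inv by (simp add: prop_inv_def)
  have cl0: "\<forall>i<length Qs. \<forall>w'. (fst (Qs ! i), w') \<in> R --> (w', snd (Qs ! i)) \<in> set Qs \<or> cap <= cnt Qs w'"
    using inv unfolding prop_inv_def by blast
  have cl: "(w', l') \<in> set Qs" if vl: "(v, l') \<in> set Qs" and "(v, w') \<in> R" and "cnt Qs w' < cap" for v w' l'
  proof -
    obtain i where i: "i < length Qs" "Qs ! i = (v, l')" using vl by (auto simp: in_set_conv_nth)
    then have "(w', snd (Qs ! i)) \<in> set Qs \<or> cap <= cnt Qs w'"
      using cl0 that(2) by (metis fst_conv)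
    then show ?thesis using i that by auto
  qed
  have fin: "finite {l. (v, l) \<in> set Qs}" for v
    by (rule finite_subset[of _ "snd ` set Qs"]) force+
  assume "\<exists>w0. (w0, l) \<in> I & (w0, w) \<in> R\<^sup>*"
  then obtain w0 where w0: "(w0, l) \<in> I" "(w0, w) \<in> R\<^sup>*" by blast
  from w0(2) c show "(w, l) \<in> set Qs"
  proof (induction rule: rtrancl_induct)
    case base
    then show ?case using inv w0(1) by (auto simp: prop_inv_def)
  next
    case (step y z)
    have "{l. (y, l) \<in> set Qs} \<subseteq> {l. (z, l) \<in> set Qs}" using cl step by blast
    then have "cnt Qs y <= cnt Qs z" using fin card_mono d by (metis cnt_card)
    then show ?case using step cl by auto
  qed
qed

text \<open>A node enters the queue once per label, so work done per entry sums to at most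
  \<open>c\<close> passes over all nodes.\<close>

lemma sum_queue:
  fixes f :: "nat => nat"
  assumes "\<forall>w. cnt Qs w <= c" "fst ` set Qs \<subseteq> {..<N}"
  shows "(\<Sum>i<length Qs. f (fst (Qs ! i))) <= c * (\<Sum>w<N. f w)"
proof -
  have "(\<Sum>i<length Qs. f (fst (Qs ! i))) = (\<Sum>w<N. cnt Qs w * f w)"
    using assms(2)
  proof (induction Qs rule: rev_induct)
    case (snoc q Qs)
    obtain v l where q: "q = (v, l)" by (cases q)
    have "(\<Sum>w<N. cnt (Qs @ [q]) w * f w) = (\<Sum>w<N. cnt Qs w * f w + (if w = v then f w else 0))"
      by (intro sum.cong) (auto simp: q)
    also have "\<dots> = (\<Sum>w<N. cnt Qs w * f w) + f v"
      using snoc.prems q by (simp add: sum.distrib)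
    also have "(\<Sum>w<N. cnt Qs w * f w) = (\<Sum>i<length Qs. f (fst (Qs ! i)))"
      using snoc by simp
    also have "\<dots> = (\<Sum>i<length Qs. f (fst ((Qs @ [q]) ! i)))"
      by (intro sum.cong) (auto simp: nth_append)
    finally show ?case by (simp add: q)
  qed simp
  also have "\<dots> <= (\<Sum>w<N. c * f w)" using assms(1) by (intro sum_mono mult_right_mono) auto
  finally show ?thesis by (simp add: sum_distrib_left)
qed

text \<open>
  Array \<open>p\<close> marks the queued pairs; writing the capacity (register 14) as the mark
  makes the marks of earlier rounds with a smaller capacity invalid without clearing them.
  The queue with read position in register 17 and length in register 16 is in arrays \<open>p + 2\<close> and
  \<open>p + 3\<close>, array \<open>p + 1\<close> counts labels per node, and array 1 maps \<open>w\<close> to \<open>w * n\<close>.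
\<close>

definition queue :: "nat => nat => nat => st => (nat \<times> nat) list => bool" where
  "queue p n N s Qs \<longleftrightarrow> reg s 16 = length Qs &
     (\<forall>i<length Qs. arr s (p + 2) i = fst (Qs ! i) & arr s (p + 3) i = snd (Qs ! i)) &
     (\<forall>w<N. arr s (p + 1) w = cnt Qs w) &
     (\<forall>w<N. \<forall>l<n. arr s p (w * n + l) = reg s 14 \<longleftrightarrow> (w, l) \<in> set Qs) &
     (\<forall>i. arr s p i <= reg s 14) & set Qs \<subseteq> {..<N} \<times> {..<n} & (\<forall>w<N. arr s 1 w = w * n)"

lemma queue_upd [simp]:
  "queue p n N (tick s) Qs = queue p n N s Qs"
  "r ~= 14 ==> r ~= 16 ==> queue p n N (assign r x s) Qs = queue p n N s Qs"
  by (simp_all add: queue_def)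

text \<open>Marks never exceed the capacity in register 14, so a truncated difference of 0 means
  that the pair is already queued. The product in the cell index is looked up in array 1, as it
  cannot be computed in one step.\<close>

definition enqueue :: "nat => com" where
  "enqueue p = Assign 15 (Sum (Elem 1 (Var 12)) (Var 13)) ;;
     Cond (Dif (Var 14) (Elem (p + 1) (Var 12)))
       (Cond (Dif (Var 14) (Elem p (Var 15)))
         (Put p (Var 15) (Var 14) ;; Put (p + 1) (Var 12) (Sum (Elem (p + 1) (Var 12)) (Lit 1)) ;;
          Put (p + 2) (Var 16) (Var 12) ;; Put (p + 3) (Var 16) (Var 13) ;;
          Assign 16 (Sum (Var 16) (Lit 1))) Skip) Skip"

lemma enqueue_sets [simp]: "warr (enqueue p) = {p, p + 1, p + 2, p + 3}" "wreg (enqueue p) = {15, 16}"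
  by (auto simp: enqueue_def)

lemma pair_code_inj:
  fixes n :: nat
  assumes "l < n" "l' < n"
  shows "w * n + l = w' * n + l' \<longleftrightarrow> w = w' & l = l'"
  using address_inj[OF assms, of 0 w w'] by (simp add: mult.commute)

lemma wp_enqueue:
  assumes q: "queue p n N s Qs" and w: "reg s 12 < N" and l: "reg s 13 < n" and p: "1 < p"
  shows "wp (enqueue p) (\<lambda>t. queue p n N t (enq (reg s 14) (reg s 13) Qs (reg s 12)) & clk t <= clk s + 8) s"
proof -
  let ?w = "reg s 12" and ?l = "reg s 13"
  have ix: "arr s 1 ?w = ?w * n" using q w by (auto simp: queue_def)
  have c: "arr s (p + 1) ?w = cnt Qs ?w" using q w by (auto simp: queue_def)
  have m: "arr s p (?w * n + ?l) = reg s 14 \<longleftrightarrow> (?w, ?l) \<in> set Qs" "arr s p (?w * n + ?l) <= reg s 14"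
    using q w l by (auto simp: queue_def)
  show ?thesis
  proof (cases "(?w, ?l) \<in> set Qs \<or> reg s 14 <= cnt Qs ?w")
    case True
    then have "enq (reg s 14) ?l Qs ?w = Qs" by (simp add: enq_def)
    then show ?thesis using True q m c ix by (auto simp: enqueue_def queue_def)
  next
    case False
    have 1: "w * n + l = ?w * n + ?l \<longleftrightarrow> w = ?w & l = ?l" if "l < n" for w l
      using pair_code_inj[OF that l] .
    have lt: "arr s p (?w * n + ?l) < reg s 14" "cnt Qs ?w < reg s 14" using m False by auto
    have "enq (reg s 14) ?l Qs ?w = Qs @ [(?w, ?l)]" using False by (simp add: enq_def)
    moreover have "queue p n N s Qs" by fact
    ultimately show ?thesis using lt c ix w l p
      by (auto simp: enqueue_def queue_def nth_append less_Suc_eq 1)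
  qed
qed

definition propagate :: "nat => com" where
  "propagate p = Assign 17 (Lit 0) ;; Loop (Dif (Var 16) (Var 17))
     (Assign 18 (Elem (p + 2) (Var 17)) ;; Assign 13 (Elem (p + 3) (Var 17)) ;;
      Assign 19 (Elem 2 (Var 18)) ;; Each 2 19 12 (enqueue p) ;;
      Assign 17 (Sum (Var 17) (Lit 1)))"

lemma propagate_sets [simp]: "warr (propagate p) = {p, p + 1, p + 2, p + 3}"
    "wreg (propagate p) = {12, 13, 15, 16, 17, 18, 19}"
  by (auto simp: propagate_def)

lemma queue_cong: "queue p n N s Qs ==> arr t = arr s ==> reg t 14 = reg s 14 ==> reg t 16 = reg s 16 ==> queue p n N t Qs"
  by (simp add: queue_def)

theorem wp_propagate:
  assumes q: "queue p n N s Qs" and g: "links 2 2 s As" and p: "4 < p"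
    and As: "set As \<subseteq> {..<N} \<times> {..<N}" and inv: "prop_inv (set As) I (reg s 14) Qs 0"
  shows "wp (propagate p) (\<lambda>t. \<exists>Rs. queue p n N t Rs & prop_inv (set As) I (reg s 14) Rs (length Rs) &
    clk t <= clk s + 3 + (\<Sum>i<length Rs. 7 + 11 * length (outs As (fst (Rs ! i))))) s"
proof -
  let ?cost = "\<lambda>Rs h. \<Sum>i<h. 7 + 11 * length (outs As (fst (Rs ! i)))"
  let ?b = "Assign 18 (Elem (p + 2) (Var 17)) ;; Assign 13 (Elem (p + 3) (Var 17)) ;;
      Assign 19 (Elem 2 (Var 18)) ;; Each 2 19 12 (enqueue p) ;;
      Assign 17 (Sum (Var 17) (Lit 1))"
  let ?J = "\<lambda>t. \<exists>Rs. queue p n N t Rs & prop_inv (set As) I (reg s 14) Rs (reg t 17) &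
    clk t <= clk s + 1 + ?cost Rs (reg t 17)"
  let ?s = "assign 17 0 s"
  have "wp (Loop (Dif (Var 16) (Var 17)) ?b) (\<lambda>t. \<exists>Rs. queue p n N t Rs &
      prop_inv (set As) I (reg s 14) Rs (length Rs) & clk t <= clk s + 3 + ?cost Rs (length Rs)) ?s"
  proof (rule wp_Loop[where I = ?J and f = "\<lambda>t. N * n - reg t 17"])
    show "?J ?s" using q inv by (intro exI[of _ Qs]) (auto intro: queue_cong)
  next
    fix t assume "?J t" and m: "mods (warr ?b) (wreg ?b) ?s t" and v: "val (Dif (Var 16) (Var 17)) t ~= 0"
    then obtain Rs where Rs: "queue p n N t Rs" "prop_inv (set As) I (reg s 14) Rs (reg t 17)"
      "clk t <= clk s + 1 + ?cost Rs (reg t 17)" by blast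
    define h where "h = reg t 17"
    have h: "h < length Rs" using v Rs(1) by (simp add: queue_def h_def)
    obtain w l where wl: "Rs ! h = (w, l)" by (cases "Rs ! h")
    have wl': "arr t (p + 2) h = w" "arr t (p + 3) h = l" using Rs(1) h wl by (auto simp: queue_def)
    have cap: "reg t 14 = reg s 14" using m by (simp add: mods_def)
    have "(w, l) \<in> set Rs" using h wl nth_mem by metis
    then have wN: "w < N" "l < n" using Rs(1) by (auto simp: queue_def)
    define t1 where "t1 = assign 19 (arr t 2 w) (assign 13 l (assign 18 w (tick t)))"
    have lk: "links 2 2 t1 As" using g m p by (simp add: links_def mods_def t1_def)
    have inv_t1: "prop_inv (set As) I (reg s 14) Rs h" using Rs(2) by (simp add: h_def)
    let ?fold = "\<lambda>k. foldl (enq (reg s 14) l) Rs (take k (targets As w))"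
    let ?I = "\<lambda>k u. queue p n N u (?fold k) & clk u <= clk t1 + 11 * k"
    have each: "wp (Each 2 19 12 (enqueue p)) (\<lambda>u. queue p n N u (?fold (length (targets As w))) & clk u <= clk t1 + 1 + 11 * length (targets As w)) t1"
    proof (rule wp_Each[where I = ?I and d = 2 and As = As and w = w])
      show "?I 0 t1"
        using Rs(1) by (auto intro: queue_cong simp: t1_def)
    next
      fix k u
      assume "?I k u"
        and mu: "mods (warr (enqueue p)) ({19, 12} \<union> wreg (enqueue p)) t1 u"
        and k: "k < length (targets As w)"
      then have u: "queue p n N u (?fold k)" "clk u <= clk t1 + 11 * k" by auto
      let ?u = "assign 12 (targets As w ! k) (tick u)"
      have "targets As w ! k \<in> set (targets As w)" using k by simp
      then have tN: "targets As w ! k < N" using As set_targets[of As w] by auto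
      have r: "reg u 13 = l" "reg u 14 = reg s 14" using mu cap by (auto simp: mods_def t1_def)
      have "wp (enqueue p) (\<lambda>t. queue p n N t (enq (reg ?u 14) (reg ?u 13) (?fold k) (reg ?u 12)) &
          clk t <= clk ?u + 8) ?u"
        using u(1) tN r wN p by (intro wp_enqueue) (auto intro: queue_cong)
      then show "wp (enqueue p) (\<lambda>u. \<forall>x. ?I (Suc k) (assign 19 x u)) ?u"
        using k u(2) r by (elim wp_mono) (auto intro: queue_cong simp: take_Suc_conv_app_nth)
    next
      fix u assume "?I (length (targets As w)) u"
      then show "queue p n N (tick u) (?fold (length (targets As w))) & clk (tick u) <= clk t1 + 1 + 11 * length (targets As w)"
        by (auto intro: queue_cong)
    qed (use lk p in \<open>auto simp: t1_def\<close>)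
    show "wp ?b (\<lambda>u. ?J u & N * n - reg u 17 < N * n - reg t 17) (tick t)"
    proof -
      let ?R = "?fold (length (targets As w))"
      have fl: "prop_inv (set As) I (reg s 14) ?R (Suc h)"
        using prop_inv_step[OF inv_t1 h wl] set_targets by simp
      \<comment> \<open>The queue has no duplicates and its entries lie in a grid of
        \<open>N * n\<close> pairs; this bounds the read position and gives the loop its
        variant.\<close>
      have len: "h < N * n"
      proof -
        have "length Rs = card (set Rs)" using inv_t1 by (simp add: prop_inv_def distinct_card)
        also have "\<dots> <= card ({..<N} \<times> {..<n})"
          using Rs(1) by (intro card_mono) (auto simp: queue_def)
        finally show ?thesis using h by simp
      qed
      \<comment> \<open>Enqueuing only appends, so the cost charged to earlier entries is the same
        for the longer queue.\<close>
      have pre: "?R ! i = Rs ! i" if "i <= h" for i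
      proof -
        have "length Qs <= length (foldl (enq c l) Qs ws) & (\<forall>i<length Qs. foldl (enq c l) Qs ws ! i = Qs ! i)" for c Qs ws
        proof (induction ws arbitrary: Qs)
          case (Cons v ws)
          have "i < length (enq c l Qs v)" "enq c l Qs v ! i = Qs ! i" if "i < length Qs" for i
            using that length_enq[of Qs c l v] nth_enq by auto
          then show ?case using Cons[of "enq c l Qs v"] length_enq[of Qs c l v] by auto
        qed simp
        then show ?thesis using that h by simp
      qed
      have "?cost ?R (Suc h) = ?cost Rs h + 7 + 11 * length (targets As w)"
        using pre wl by (simp add: targets_def)
      then have c: "clk t1 + 2 + 11 * length (targets As w) <= clk s + 1 + ?cost ?R (Suc h)"
        using Rs(3) by (simp add: t1_def h_def)
      have "wp (Each 2 19 12 (enqueue p)) (\<lambda>u. ?J (assign 17 (val (Sum (Var 17) (Lit 1)) u) u) &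
          N * n - reg (assign 17 (val (Sum (Var 17) (Lit 1)) u) u) 17 < N * n - reg t 17) t1"
        using each
      proof (rule wp_frame)
        fix u assume u: "queue p n N u ?R & clk u <= clk t1 + 1 + 11 * length (targets As w)"
          and "mods (warr (Each 2 19 12 (enqueue p))) (wreg (Each 2 19 12 (enqueue p))) t1 u"
        then have r17: "reg u 17 = h" by (simp add: mods_def t1_def h_def)
        then show "?J (assign 17 (val (Sum (Var 17) (Lit 1)) u) u) &
          N * n - reg (assign 17 (val (Sum (Var 17) (Lit 1)) u) u) 17 < N * n - reg t 17"
          using u fl c len by (intro conjI exI[of _ ?R]) (auto intro: queue_cong simp: h_def)
      qed
      then show ?thesis using wl' by (simp add: t1_def h_def)
    qed
  next
    fix t assume "?J t" and m: "mods (warr ?b) (wreg ?b) ?s t" and v: "val (Dif (Var 16) (Var 17)) t = 0"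
    then obtain Rs where Rs: "queue p n N t Rs" "prop_inv (set As) I (reg s 14) Rs (reg t 17)"
      "clk t <= clk s + 1 + ?cost Rs (reg t 17)" by blast
    have "reg t 17 = length Rs" using Rs v by (auto simp: queue_def prop_inv_def)
    then show "\<exists>Rs. queue p n N (tick t) Rs & prop_inv (set As) I (reg s 14) Rs (length Rs) &
        clk (tick t) <= clk s + 3 + ?cost Rs (length Rs)"
      using Rs by (intro exI[of _ Rs]) (auto intro: queue_cong)
  qed
  then show ?thesis by (simp add: propagate_def)
qed

section \<open>Listing reachable pairs in output-sensitive time\<close>

primrec times :: "nat => expr => expr" where
  "times 0 e = Lit 0"
| "times (Suc k) e = Sum e (times k e)"

lemma val_times [simp]: "val (times k e) s = k * val e s"
  by (induction k) auto

text \<open>A node of the product graph is a vertex together with a state \<open>j\<close>. The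
  factor \<open>K\<close> depends on the query only, so the product is unrolled into sums.\<close>

definition node :: "nat => nat => expr => expr" where
  "node K j e = Sum (times K e) (Lit j)"

lemma val_node [simp]: "val (node K j e) s = K * val e s + j"
  by (simp add: node_def)

lemma node_less: "v < n ==> j < K ==> K * v + j < K * (n :: nat)"
proof -
  assume a: "v < n" "j < K"
  then have "K * v + j < K * v + K" by simp
  also have "\<dots> = K * Suc v" by simp
  also have "\<dots> <= K * n" using a by (intro mult_le_mono2) simp
  finally show ?thesis .
qed

lemma node_inj: "j < K ==> j' < K ==> K * v + j = K * v' + j' \<longleftrightarrow> v = v' & j = (j' :: nat)"
  using address_inj[of j K j' 0 v v'] by simp

text \<open>Every start node carries its own vertex as label, so a label arriving somewhere names
  the vertex it came from.\<close>

definition seeds :: "nat => nat => nat set => (nat \<times> nat) set" where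
  "seeds K j B = (\<lambda>b. (K * b + j, b)) ` B"

lemma seeds_insert: "seeds K j (insert b B) = insert (K * b + j, b) (seeds K j B)"
  by (simp add: seeds_def)

text \<open>Registers 0, 3 and 4 hold the number of vertices, of table rows and of nodes of the product graph.\<close>

definition reset :: "nat => com" where
  "reset p = Assign 16 (Lit 0) ;; For 20 (Var 4) (Put (p + 1) (Var 20) (Lit 0))"

lemma reset_sets [simp]: "warr (reset p) = {p + 1}" "wreg (reset p) = {16, 20}"
  by (auto simp: reset_def)

text \<open>Only the \<open>N\<close> counters are cleared. Clearing the marks, one per node and
  label, would exceed the time bound; instead all old marks are smaller than the new capacity and
  hence invalid.\<close>

lemma wp_reset:
  assumes "reg s 4 = N" "\<forall>i. arr s p i < reg s 14" "\<forall>w<N. arr s 1 w = w * n" "0 < p"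
  shows "wp (reset p) (\<lambda>t. queue p n N t [] & clk t <= clk s + 3 + 3 * N) s"
proof -
  let ?s = "assign 16 0 s"
  have "wp (For 20 (Var 4) (Put (p + 1) (Var 20) (Lit 0))) (\<lambda>t. queue p n N t [] & clk t <= clk s + 3 + 3 * N) ?s"
  proof (rule wp_For[where N = N and I = "\<lambda>k t. (\<forall>w<k. arr t (p + 1) w = 0) & clk t <= clk s + 2 + 3 * k"])
    fix t assume I: "(\<forall>w<N. arr t (p + 1) w = 0) & clk t <= clk s + 2 + 3 * N"
      and m: "mods (warr (Put (p + 1) (Var 20) (Lit 0))) (insert 20 (wreg (Put (p + 1) (Var 20) (Lit 0)))) ?s t"
    have a: "arr t p = arr s p" "arr t 1 = arr s 1" "reg t 14 = reg s 14" "reg t 16 = 0"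
      using m assms(4) by (simp_all add: mods_def)
    show "queue p n N (tick t) [] & clk (tick t) <= clk s + 3 + 3 * N"
    proof -
      have "arr s p i ~= reg s 14" "arr s p i <= reg s 14" for i
        using assms(2)[rule_format, of i] by auto
      then show ?thesis using I a assms(3) by (simp add: queue_def)
    qed
  qed (use assms in \<open>auto simp: mods_def less_Suc_eq\<close>)
  then show ?thesis by (simp add: reset_def)
qed

definition seed :: "nat => nat => nat => expr => com" where
  "seed p K j e = For 20 (Var 0) (Cond e (Assign 12 (node K j (Var 20)) ;; Assign 13 (Var 20) ;; enqueue p) Skip)"

lemma seed_sets [simp]: "warr (seed p K j e) = {p, p + 1, p + 2, p + 3}" "wreg (seed p K j e) = {12, 13, 15, 16, 20}"
  by (auto simp: seed_def)

lemma wp_seed: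
  assumes q: "queue p n (K * n) s Qs" and inv: "prop_inv R {} (reg s 14) Qs 0"
    and r: "reg s 0 = n" and j: "j < K" and p: "1 < p"
    and e: "\<And>t v. mods {p, p + 1, p + 2, p + 3} {12, 13, 15, 16, 20} s t ==> reg t 20 = v ==> v < n ==>
      val e t ~= 0 \<longleftrightarrow> v \<in> B"
    and B: "B \<subseteq> {..<n}"
  shows "wp (seed p K j e) (\<lambda>t. \<exists>Rs. queue p n (K * n) t Rs & prop_inv R (seeds K j B) (reg s 14) Rs 0 &
    clk t <= clk s + 2 + 13 * n) s"
proof -
  let ?c = "Cond e (Assign 12 (node K j (Var 20)) ;; Assign 13 (Var 20) ;; enqueue p) Skip"
  let ?I = "\<lambda>k t. \<exists>Rs. queue p n (K * n) t Rs & prop_inv R (seeds K j (B \<inter> {..<k})) (reg s 14) Rs 0 &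
    clk t <= clk s + 1 + 13 * k"
  have Bn: "B \<inter> {..<n} = B" using B by auto
  show ?thesis unfolding seed_def
  proof (rule wp_For[where N = n and I = ?I])
    show "?I 0 (assign 20 0 s)"
      using q inv by (intro exI[of _ Qs]) (auto intro: queue_cong simp: seeds_def)
  next
    fix k t assume "?I k t" and m: "mods (warr ?c) (insert 20 (wreg ?c)) s t" and k: "reg t 20 = k" "k < n"
    then obtain Rs where Rs: "queue p n (K * n) t Rs" "prop_inv R (seeds K j (B \<inter> {..<k})) (reg s 14) Rs 0"
      "clk t <= clk s + 1 + 13 * k" by blast
    have ev: "val e t ~= 0 \<longleftrightarrow> k \<in> B" using e[of t k] m k by (simp add: mods_def)
    have et: "val e (tick u) = val e u" for e u by (induction e) auto
    have c14: "reg t 14 = reg s 14" using m by (simp add: mods_def)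
    show "wp ?c (\<lambda>u. ?I (Suc k) (assign 20 (Suc k) u)) (tick t)"
    proof (cases "k \<in> B")
      case True
      let ?t = "assign 13 k (assign 12 (K * k + j) (tick (tick t)))"
      have lt: "K * k + j < K * n" using node_less k(2) j by blast
      have "wp (enqueue p) (\<lambda>u. queue p n (K * n) u (enq (reg ?t 14) (reg ?t 13) Rs (reg ?t 12)) & clk u <= clk ?t + 8) ?t"
        using Rs(1) lt k p by (intro wp_enqueue) (auto intro: queue_cong)
      then have "wp (enqueue p) (\<lambda>u. ?I (Suc k) (assign 20 (Suc k) u)) ?t"
      proof (rule wp_mono)
        fix u assume u: "queue p n (K * n) u (enq (reg ?t 14) (reg ?t 13) Rs (reg ?t 12)) & clk u <= clk ?t + 8"
        have "B \<inter> {..<Suc k} = insert k (B \<inter> {..<k})" using True by auto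
        then have "prop_inv R (seeds K j (B \<inter> {..<Suc k})) (reg s 14) (enq (reg ?t 14) (reg ?t 13) Rs (reg ?t 12)) 0"
          using prop_inv_init[OF Rs(2)] c14 by (simp add: seeds_insert)
        then show "?I (Suc k) (assign 20 (Suc k) u)"
          using u Rs(3) by (intro exI[of _ "enq (reg ?t 14) (reg ?t 13) Rs (reg ?t 12)"]) (auto intro: queue_cong)
      qed
      then show ?thesis using True ev k et by simp
    next
      case False
      then have "B \<inter> {..<Suc k} = B \<inter> {..<k}" by (auto simp: less_Suc_eq)
      then show ?thesis using False ev Rs et by (auto intro!: exI[of _ Rs] intro: queue_cong)
    qed
  next
    fix t assume "?I n t"
    then show "\<exists>Rs. queue p n (K * n) (tick t) Rs & prop_inv R (seeds K j B) (reg s 14) Rs 0 &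
        clk (tick t) <= clk s + 2 + 13 * n"
      unfolding Bn by auto
  qed (use r in \<open>auto simp: mods_def\<close>)
qed

definition spread :: "nat => nat => nat => expr => com" where
  "spread p K j e = reset p ;; seed p K j e ;; propagate p"

lemma spread_sets [simp]: "warr (spread p K j e) = {p, p + 1, p + 2, p + 3}"
    "wreg (spread p K j e) = {12, 13, 15, 16, 17, 18, 19, 20}"
  by (auto simp: spread_def)

lemma queue_cost:
  assumes q: "queue p n N s Rs" and c: "\<forall>w. cnt Rs w <= c"
  shows "(\<Sum>i<length Rs. 7 + 11 * length (outs As (fst (Rs ! i)))) <= c * (7 * N + 11 * length As)"
proof -
  have "fst ` set Rs \<subseteq> {..<N}" using q by (auto simp: queue_def)
  then have "(\<Sum>i<length Rs. 7 + 11 * length (outs As (fst (Rs ! i)))) <= c * (\<Sum>w<N. 7 + 11 * length (outs As w))"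
    using sum_queue[OF c, of N "\<lambda>w. 7 + 11 * length (outs As w)"] by blast
  also have "(\<Sum>w<N. 7 + 11 * length (outs As w)) = 7 * N + 11 * (\<Sum>w<N. length (outs As w))"
    by (simp add: sum.distrib sum_distrib_left)
  also have "c * \<dots> <= c * (7 * N + 11 * length As)"
    using sum_outs[of As N] by simp
  finally show ?thesis .
qed

theorem wp_spread:
  assumes g: "links 2 2 s As" "set As \<subseteq> {..<K * n} \<times> {..<K * n}"
    and r: "reg s 0 = n" "reg s 4 = K * n" "\<forall>w<K * n. arr s 1 w = w * n"
    and f: "\<forall>i. arr s p i < reg s 14" and j: "j < K" and p: "4 < p"
    and e: "\<And>t v. mods {p, p + 1, p + 2, p + 3} {12, 13, 15, 16, 20} s t ==> reg t 20 = v ==> v < n ==>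
      val e t ~= 0 \<longleftrightarrow> v \<in> B"
    and B: "B \<subseteq> {..<n}"
  shows "wp (spread p K j e) (\<lambda>t. \<exists>Rs. queue p n (K * n) t Rs &
    prop_inv (set As) (seeds K j B) (reg s 14) Rs (length Rs) &
    clk t <= clk s + 8 + 3 * (K * n) + 13 * n + (\<Sum>i<length Rs. 7 + 11 * length (outs As (fst (Rs ! i))))) s"
  unfolding spread_def
proof (rule wp_Seq[OF wp_reset])
  fix t assume t: "queue p n (K * n) t [] & clk t <= clk s + 3 + 3 * (K * n)"
    and m: "mods (warr (reset p)) (wreg (reset p)) s t"
  have r14: "reg t 14 = reg s 14" and r0: "reg t 0 = n" using m r by (auto simp: mods_def)
  show "wp (seed p K j e ;; propagate p) (\<lambda>t. \<exists>Rs. queue p n (K * n) t Rs &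
    prop_inv (set As) (seeds K j B) (reg s 14) Rs (length Rs) &
    clk t <= clk s + 8 + 3 * (K * n) + 13 * n + (\<Sum>i<length Rs. 7 + 11 * length (outs As (fst (Rs ! i))))) t"
  proof (rule wp_Seq[OF wp_seed[where Qs = "[]" and R = "set As"]])
    show "val e u ~= 0 \<longleftrightarrow> v \<in> B"
      if "mods {p, p + 1, p + 2, p + 3} {12, 13, 15, 16, 20} t u" "reg u 20 = v" "v < n" for u v
    proof (rule e[OF _ that(2,3)])
      show "mods {p, p + 1, p + 2, p + 3} {12, 13, 15, 16, 20} s u"
        using mods_trans[OF m that(1)] by simp
    qed
  next
    fix u assume "\<exists>Rs. queue p n (K * n) u Rs & prop_inv (set As) (seeds K j B) (reg t 14) Rs 0 &
        clk u <= clk t + 2 + 13 * n"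
      and mu: "mods (warr (seed p K j e)) (wreg (seed p K j e)) t u"
    then obtain Rs where Rs: "queue p n (K * n) u Rs" "prop_inv (set As) (seeds K j B) (reg t 14) Rs 0"
      "clk u <= clk t + 2 + 13 * n" by blast
    have lk: "links 2 2 u As"
    proof (rule links_mods[OF links_mods[OF g(1) m] mu])
    qed (use p in auto)
    have u14: "reg u 14 = reg t 14" using mu by (auto simp: mods_def)
    show "wp (propagate p) (\<lambda>t. \<exists>Rs. queue p n (K * n) t Rs &
      prop_inv (set As) (seeds K j B) (reg s 14) Rs (length Rs) &
      clk t <= clk s + 8 + 3 * (K * n) + 13 * n + (\<Sum>i<length Rs. 7 + 11 * length (outs As (fst (Rs ! i))))) u"
    proof (rule wp_mono[OF wp_propagate[OF Rs(1) lk p g(2)]])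
      show "prop_inv (set As) (seeds K j B) (reg u 14) Rs 0" using Rs(2) u14 by simp
    next
      fix v assume "\<exists>Rs. queue p n (K * n) v Rs & prop_inv (set As) (seeds K j B) (reg u 14) Rs (length Rs) &
        clk v <= clk u + 3 + (\<Sum>i<length Rs. 7 + 11 * length (outs As (fst (Rs ! i))))"
      then show "\<exists>Rs. queue p n (K * n) v Rs & prop_inv (set As) (seeds K j B) (reg s 14) Rs (length Rs) &
        clk v <= clk s + 8 + 3 * (K * n) + 13 * n + (\<Sum>i<length Rs. 7 + 11 * length (outs As (fst (Rs ! i))))"
        using t Rs(3) u14 r14 by (elim exE, intro exI) auto
    qed
  qed (use t r0 r14 j p B in \<open>auto simp: prop_inv_Nil\<close>)
qed (use r f p in auto)

definition graph_ok :: "(nat \<times> nat) list => nat => nat => st => bool" where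
  "graph_ok As K n s \<longleftrightarrow> links 2 2 s As & reg s 0 = n & reg s 4 = K * n & (\<forall>w<K * n. arr s 1 w = w * n)"

lemma graph_ok_mods: "graph_ok As K n s ==> mods X Y s t ==> X \<inter> {1, 2, 3, 4} = {} ==> Y \<inter> {0, 2, 4} = {} ==> graph_ok As K n t"
  unfolding graph_ok_def using links_mods[of 2 2 s As X Y t] by (auto simp: mods_def)

lemma graph_ok_upd [simp]:
  "graph_ok As K n (tick s) = graph_ok As K n s"
  "r ~= 0 ==> r ~= 2 ==> r ~= 4 ==> graph_ok As K n (assign r x s) = graph_ok As K n s"
  by (simp_all add: graph_ok_def links_def)

text \<open>Array \<open>d\<close> maps a node to one plus the vertex it stands for, and other nodes
  to 0. Register 23 always holds the first and 24 the second component of the new pair;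
  \<open>u\<close> selects which of them is the decoded vertex.\<close>

definition collect :: "nat => nat => nat => nat => nat => com" where
  "collect q d u v g = For 20 (Var 16) (Assign u (Elem d (Elem (q + 2) (Var 20))) ;;
     Cond (Var u) (Assign u (Dif (Var u) (Lit 1)) ;; Assign v (Elem (q + 3) (Var 20)) ;; add_link g 21 23 24) Skip)"

lemma collect_sets [simp]: "warr (collect q d u v g) = {g, g + 1, g + 2}" "wreg (collect q d u v g) = {20, 21, u, v}"
  by (auto simp: collect_def)

lemma wp_collect:
  assumes q: "queue q n N s Qs" and l: "links g 21 s Ps"
    and uv: "u = 23 & v = 24 \<or> u = 24 & v = 23"
    and g: "{d, q + 2, q + 3} \<inter> {g, g + 1, g + 2} = {}"
  shows "wp (collect q d u v g) (\<lambda>t. links g 21 t (Ps @ map (\<lambda>(w, l). if u = 23 then (arr s d w - 1, l) else (l, arr s d w - 1))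
      (filter (\<lambda>(w, l). arr s d w ~= 0) Qs)) & clk t <= clk s + 2 + 10 * length Qs) s"
proof -
  let ?F = "\<lambda>Qs. map (\<lambda>(w, l). if u = 23 then (arr s d w - 1, l) else (l, arr s d w - 1)) (filter (\<lambda>(w, l). arr s d w ~= 0) Qs)"
  let ?c = "Assign u (Elem d (Elem (q + 2) (Var 20))) ;;
     Cond (Var u) (Assign u (Dif (Var u) (Lit 1)) ;; Assign v (Elem (q + 3) (Var 20)) ;; add_link g 21 23 24) Skip"
  let ?I = "\<lambda>k t. links g 21 t (Ps @ ?F (take k Qs)) & clk t <= clk s + 1 + 10 * k"
  have up: "links g 21 (assign r x t) Ps = links g 21 t Ps" if "r ~= 21" for r x t Ps
    using that by (simp add: links_def)
  show ?thesis unfolding collect_def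
  proof (rule wp_For[where N = "length Qs" and I = ?I])
    show "?I 0 (assign 20 0 s)" using l up by simp
  next
    fix k t assume I: "?I k t" and m: "mods (warr ?c) (insert 20 (wreg ?c)) s t" and k: "reg t 20 = k" "k < length Qs"
    obtain w l where wl: "Qs ! k = (w, l)" by (cases "Qs ! k")
    have a: "arr t (q + 2) k = w" "arr t (q + 3) k = l" "arr t d = arr s d"
      using q m k wl g by (auto simp: mods_def queue_def)
    have tk: "take (Suc k) Qs = take k Qs @ [(w, l)]" using k wl by (simp add: take_Suc_conv_app_nth)
    let ?t = "assign v l (assign u (arr s d w - 1) (tick (assign u (arr s d w) (tick t))))"
    have u: "u ~= 20" "u ~= 21" "v ~= 21" "u ~= v" "v ~= 20" "(23::nat) ~= 21" "(24::nat) ~= 21" using uv by auto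
    have "wp (add_link g 21 23 24) (\<lambda>u'. links g 21 u' ((Ps @ ?F (take k Qs)) @ [(reg ?t 23, reg ?t 24)]) & clk u' = clk ?t + 4) ?t"
      using I u up by (intro wp_add_link) auto
    then have al: "wp (add_link g 21 23 24) (\<lambda>u'. links g 21 (assign 20 (Suc k) u') ((Ps @ ?F (take k Qs)) @ [(reg ?t 23, reg ?t 24)]) & clk u' = clk ?t + 4) ?t"
      by (elim wp_mono) (auto simp: up)
    show "wp ?c (\<lambda>x. ?I (Suc k) (assign 20 (Suc k) x)) (tick t)"
    proof (cases "arr s d w = 0")
      case True
      then show ?thesis using I a k u tk by (simp add: up)
    next
      case False
      have "wp (add_link g 21 23 24) (\<lambda>x. ?I (Suc k) (assign 20 (Suc k) x)) ?t"
        using al by (rule wp_mono) (use I False tk uv in auto)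
      then show ?thesis using False a k u by simp
    qed
  next
    show "val (Var 16) s' = length Qs" if "mods (warr ?c) (insert 20 (wreg ?c)) s s'" for s'
      using that q uv by (auto simp: mods_def queue_def)
  qed (use uv in auto)
qed

lemma decoded_iff:
  "(a, b) \<in> set (map (\<lambda>(w, l). (D w - 1, l)) (filter (\<lambda>(w, l). D w ~= 0) Qs)) \<longleftrightarrow> (\<exists>w. (w, b) \<in> set Qs & D w = Suc a)"
  for D :: "nat => nat"
proof
  assume "(a, b) \<in> set (map (\<lambda>(w, l). (D w - 1, l)) (filter (\<lambda>(w, l). D w ~= 0) Qs))"
  then obtain w where "(w, b) \<in> set Qs" "D w ~= 0" "a = D w - 1" by auto
  then show "\<exists>w. (w, b) \<in> set Qs & D w = Suc a" by auto
next
  assume "\<exists>w. (w, b) \<in> set Qs & D w = Suc a"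
  then obtain w where "(w, b) \<in> set (filter (\<lambda>(w, l). D w ~= 0) Qs)" "D w = Suc a" by auto
  then show "(a, b) \<in> set (map (\<lambda>(w, l). (D w - 1, l)) (filter (\<lambda>(w, l). D w ~= 0) Qs))"
    unfolding set_map by (intro image_eqI[of _ _ "(w, b)"]) auto
qed

lemma decoded_swap_iff:
  "(a, b) \<in> set (map (\<lambda>(w, l). (l, D w - 1)) (filter (\<lambda>(w, l). D w ~= 0) Qs)) \<longleftrightarrow> (\<exists>w. (w, a) \<in> set Qs & D w = Suc b)"
  for D :: "nat => nat"
proof
  assume "(a, b) \<in> set (map (\<lambda>(w, l). (l, D w - 1)) (filter (\<lambda>(w, l). D w ~= 0) Qs))"
  then obtain w where "(w, a) \<in> set Qs" "D w ~= 0" "b = D w - 1" by auto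
  then show "\<exists>w. (w, a) \<in> set Qs & D w = Suc b" by auto
next
  assume "\<exists>w. (w, a) \<in> set Qs & D w = Suc b"
  then obtain w where "(w, a) \<in> set (filter (\<lambda>(w, l). D w ~= 0) Qs)" "D w = Suc b" by auto
  then show "(a, b) \<in> set (map (\<lambda>(w, l). (l, D w - 1)) (filter (\<lambda>(w, l). D w ~= 0) Qs))"
    unfolding set_map by (intro image_eqI[of _ _ "(w, a)"]) auto
qed

text \<open>\<open>As\<close> holds a relation twice: \<open>js\<close> and \<open>jt\<close> are
  source and target in the copy with reversed arcs, \<open>fs\<close> and \<open>ft\<close> in the
  copy with forward arcs, and \<open>mirror\<close> ties the copies together. Labels travel
  backwards, so that the counter at a source node measures how many targets the source has; heavy
  sources are then searched forwards.\<close>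

locale two_way =
  fixes As :: "(nat \<times> nat) list" and K n js jt fs ft :: nat and A :: "nat set"
  assumes As: "set As \<subseteq> {..<K * n} \<times> {..<K * n}"
    and J: "js < K" "jt < K" "fs < K" "ft < K"
    and mirror: "\<And>a b. a < n ==> b < n ==> (K * b + jt, K * a + js) \<in> (set As)\<^sup>* \<longleftrightarrow> (K * a + fs, K * b + ft) \<in> (set As)\<^sup>*"
    and A: "A \<subseteq> {..<n}"
begin

definition Rel :: "(nat \<times> nat) set" where
  "Rel = {(a, b). a \<in> A & b < n & (K * b + jt, K * a + js) \<in> (set As)\<^sup>*}"

text \<open>The size of the graph up to constant factors; the summand 1 lets additive costs be
  absorbed even for an empty graph.\<close>

definition X :: nat where
  "X = K * n + n + length As + 1"

definition heavy :: "nat => (nat \<times> nat) list => nat set" where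
  "heavy cap Qs = {a \<in> A. cap <= cnt Qs (K * a + js)}"

lemma finite_Rel: "finite Rel"
  by (rule finite_subset[of _ "{..<n} \<times> {..<n}"]) (use A in \<open>auto simp: Rel_def\<close>)

text \<open>A saturated source has received \<open>cap\<close> distinct labels, and by soundness of
  propagation each of them is a pair of the relation.\<close>

lemma heavy_card:
  assumes "prop_inv (set As) (seeds K jt {..<n}) cap Qs (length Qs)"
  shows "card (heavy cap Qs) * cap <= card Rel"
proof -
  let ?L = "\<lambda>a. {l. (K * a + js, l) \<in> set Qs}"
  have d: "distinct Qs" using assms by (simp add: prop_inv_def)
  have fin: "finite (heavy cap Qs)" using A finite_subset[of A "{..<n}"] by (auto simp: heavy_def)
  have sub: "Sigma (heavy cap Qs) ?L \<subseteq> Rel"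
  proof clarify
    fix a l assume a: "a \<in> heavy cap Qs" and l: "(K * a + js, l) \<in> set Qs"
    obtain w0 where "(w0, l) \<in> seeds K jt {..<n}" "(w0, K * a + js) \<in> (set As)\<^sup>*"
      using assms l unfolding prop_inv_def by fast
    then show "(a, l) \<in> Rel" using a by (auto simp: seeds_def Rel_def heavy_def)
  qed
  have finL: "finite (?L a)" for a
    by (rule finite_subset[of _ "snd ` set Qs"]) force+
  have "card (heavy cap Qs) * cap = (\<Sum>a\<in>heavy cap Qs. cap)" by simp
  also have "\<dots> <= (\<Sum>a\<in>heavy cap Qs. card (?L a))"
    by (intro sum_mono) (auto simp: heavy_def cnt_card[OF d])
  also have "\<dots> = card (Sigma (heavy cap Qs) ?L)"
    using fin finL by (simp add: card_SigmaI)
  also have "\<dots> <= card Rel" using sub finite_Rel card_mono by blast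
  finally show ?thesis .
qed

definition round :: "nat => com" where
  "round p = spread p K jt (Lit 1) ;; Assign 22 (Lit 0) ;;
     For 20 (Var 0) (Cond (Elem (p + 8) (Var 20))
       (Cond (Dif (Var 14) (Elem (p + 1) (node K js (Var 20)))) Skip (Assign 22 (Sum (Var 22) (Lit 1)))) Skip)"

lemma round_sets [simp]: "warr (round p) = {p, p + 1, p + 2, p + 3}"
    "wreg (round p) = {12, 13, 15, 16, 17, 18, 19, 20, 22}"
  by (auto simp: round_def)

definition round_post :: "nat => nat => st => (nat \<times> nat) list => bool" where
  "round_post p cap t Qs \<longleftrightarrow> queue p n (K * n) t Qs & reg t 14 = cap &
    prop_inv (set As) (seeds K jt {..<n}) cap Qs (length Qs) & reg t 22 = card (heavy cap Qs)"

lemma spread_cost: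
  assumes "queue p n (K * n) s Rs" "\<forall>w. cnt Rs w <= c" "1 <= c"
  shows "8 + 3 * (K * n) + 13 * n + (\<Sum>i<length Rs. 7 + 11 * length (outs As (fst (Rs ! i)))) + 3 + 7 * n <= 40 * (X * c)"
proof -
  have "(\<Sum>i<length Rs. 7 + 11 * length (outs As (fst (Rs ! i)))) <= c * (7 * (K * n) + 11 * length As)"
    using queue_cost[OF assms(1,2)] .
  also have "\<dots> <= c * (11 * X)" by (intro mult_le_mono2) (simp add: X_def)
  finally have 1: "(\<Sum>i<length Rs. 7 + 11 * length (outs As (fst (Rs ! i)))) <= 11 * (X * c)" by (simp add: mult.commute mult.left_commute)
  have "8 + 3 * (K * n) + 13 * n + 3 + 7 * n <= 20 * X" by (simp add: X_def)
  also have "\<dots> <= 20 * (X * c)" using assms(3) by simp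
  finally show ?thesis using 1 by linarith
qed

lemma wp_round:
  assumes g: "graph_ok As K n s" and f: "\<forall>i. arr s p i < reg s 14" and p: "4 < p"
    and a: "\<And>a. a < n ==> arr s (p + 8) a ~= 0 \<longleftrightarrow> a \<in> A"
  shows "wp (round p) (\<lambda>t. (\<exists>Qs. round_post p (reg s 14) t Qs) & clk t <= clk s + 40 * (X * reg s 14)) s"
  unfolding round_def
proof (rule wp_Seq[OF wp_spread[where B = "{..<n}" and As = As]])
  fix t assume "\<exists>Rs. queue p n (K * n) t Rs & prop_inv (set As) (seeds K jt {..<n}) (reg s 14) Rs (length Rs) &
      clk t <= clk s + 8 + 3 * (K * n) + 13 * n + (\<Sum>i<length Rs. 7 + 11 * length (outs As (fst (Rs ! i))))"
    and m: "mods (warr (spread p K jt (Lit 1))) (wreg (spread p K jt (Lit 1))) s t"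
  then obtain Rs where Rs: "queue p n (K * n) t Rs" "prop_inv (set As) (seeds K jt {..<n}) (reg s 14) Rs (length Rs)"
    "clk t <= clk s + 8 + 3 * (K * n) + 13 * n + (\<Sum>i<length Rs. 7 + 11 * length (outs As (fst (Rs ! i))))"
    by blast
  have c14: "reg t 14 = reg s 14" and r0: "reg t 0 = n" and a8: "arr t (p + 8) = arr s (p + 8)"
    using m g p by (auto simp: mods_def graph_ok_def)
  have c1: "1 <= reg s 14" using f[rule_format, of 0] by simp
  have cc: "\<forall>w. cnt Rs w <= reg s 14" using Rs(2) by (simp add: prop_inv_def)
  have cost: "clk t + 3 + 7 * n <= clk s + 40 * (X * reg s 14)"
    using Rs(3) spread_cost[OF Rs(1) cc c1] by linarith
  let ?c = "Cond (Elem (p + 8) (Var 20))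
       (Cond (Dif (Var 14) (Elem (p + 1) (node K js (Var 20)))) Skip (Assign 22 (Sum (Var 22) (Lit 1)))) Skip"
  have "wp (For 20 (Var 0) ?c) (\<lambda>u. (\<exists>Qs. round_post p (reg s 14) u Qs) & clk u <= clk s + 40 * (X * reg s 14)) (assign 22 0 t)"
  proof (rule wp_For[where N = n and I = "\<lambda>k u. reg u 22 = card (heavy (reg s 14) Rs \<inter> {..<k}) & clk u <= clk t + 2 + 7 * k"])
    fix k u assume I: "reg u 22 = card (heavy (reg s 14) Rs \<inter> {..<k}) & clk u <= clk t + 2 + 7 * k"
      and mu: "mods (warr ?c) (insert 20 (wreg ?c)) (assign 22 0 t) u" and k: "reg u 20 = k" "k < n"
    have nl: "K * k + js < K * n" using node_less J(1) k by blast
    have au: "arr u (p + 8) k ~= 0 \<longleftrightarrow> k \<in> A" "arr u (p + 1) (K * k + js) = cnt Rs (K * k + js)" "reg u 14 = reg s 14"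
      using mu a8 a[of k] k Rs(1) nl c14 by (auto simp: mods_def queue_def)
    have hk: "k \<in> heavy (reg s 14) Rs \<longleftrightarrow> k \<in> A & reg s 14 <= cnt Rs (K * k + js)"
      by (auto simp: heavy_def)
    have "heavy (reg s 14) Rs \<inter> {..<Suc k} = (if k \<in> heavy (reg s 14) Rs then insert k (heavy (reg s 14) Rs \<inter> {..<k}) else heavy (reg s 14) Rs \<inter> {..<k})"
      by (auto simp: less_Suc_eq)
    then show "wp ?c (\<lambda>v. reg (assign 20 (Suc k) v) 22 = card (heavy (reg s 14) Rs \<inter> {..<Suc k}) &
        clk (assign 20 (Suc k) v) <= clk t + 2 + 7 * Suc k) (tick u)"
      using I au k hk by auto
  next
    fix u assume I: "reg u 22 = card (heavy (reg s 14) Rs \<inter> {..<n}) & clk u <= clk t + 2 + 7 * n"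
      and mu: "mods (warr ?c) (insert 20 (wreg ?c)) (assign 22 0 t) u"
    have "heavy (reg s 14) Rs \<inter> {..<n} = heavy (reg s 14) Rs" using A by (auto simp: heavy_def)
    moreover have "queue p n (K * n) (tick u) Rs"
      using Rs(1) mu by (auto simp: queue_def mods_def)
    moreover have "reg u 14 = reg s 14" using mu c14 by (auto simp: mods_def)
    ultimately show "(\<exists>Qs. round_post p (reg s 14) (tick u) Qs) & clk (tick u) <= clk s + 40 * (X * reg s 14)"
      using I Rs(2) cost by (auto simp: round_post_def)
  qed (use r0 in \<open>auto simp: mods_def\<close>)
  then show "wp (Assign 22 (Lit 0) ;; For 20 (Var 0) ?c)
      (\<lambda>u. (\<exists>Qs. round_post p (reg s 14) u Qs) & clk u <= clk s + 40 * (X * reg s 14)) t"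
    by simp
qed (use g f p As J in \<open>auto simp: graph_ok_def\<close>)

definition balance :: "nat => com" where
  "balance p = Assign 14 (Lit 1) ;; round p ;;
     Loop (Dif (Var 22) (Var 14)) (Assign 14 (Sum (Var 14) (Var 14)) ;; round p)"

lemma balance_sets [simp]: "warr (balance p) = {p, p + 1, p + 2, p + 3}"
    "wreg (balance p) = {12, 13, 14, 15, 16, 17, 18, 19, 20, 22}"
  by (auto simp: balance_def)

text \<open>A capacity above 1 is the double of some \<open>c\<close> that had more than
  \<open>c\<close> heavy sources. By \<open>heavy_card\<close> these account for
  \<open>c * c\<close> pairs, and doubling gives the factor 4.\<close>

definition cap_ok :: "nat => bool" where
  "cap_ok cap \<longleftrightarrow> 1 <= cap & (cap = 1 \<or> cap * cap <= 4 * card Rel)"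

lemma wp_balance:
  assumes g: "graph_ok As K n s" and f: "\<forall>i. arr s p i = 0" and p: "4 < p"
    and a: "\<And>a. a < n ==> arr s (p + 8) a ~= 0 \<longleftrightarrow> a \<in> A"
  shows "wp (balance p) (\<lambda>t. \<exists>cap Qs. cap_ok cap & round_post p cap t Qs & card (heavy cap Qs) <= cap &
    clk t <= clk s + 90 * (X * cap)) s"
proof -
  let ?s = "assign 14 1 s"
  let ?Q = "\<lambda>t. \<exists>cap Qs. cap_ok cap & round_post p cap t Qs & card (heavy cap Qs) <= cap &
    clk t <= clk s + 90 * (X * cap)"
  have X1: "1 <= X" by (simp add: X_def)
  have "wp (round p ;; Loop (Dif (Var 22) (Var 14)) (Assign 14 (Sum (Var 14) (Var 14)) ;; round p)) ?Q ?s"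
  proof (rule wp_Seq[OF wp_round])
    fix t assume t: "(\<exists>Qs. round_post p (reg ?s 14) t Qs) & clk t <= clk ?s + 40 * (X * reg ?s 14)"
      and m: "mods (warr (round p)) (wreg (round p)) ?s t"
    let ?c = "Assign 14 (Sum (Var 14) (Var 14)) ;; round p"
    \<comment> \<open>A round costs 40 times \<open>X * cap\<close> and the capacities double, so
      all rounds together stay near 80 times the last \<open>X * cap\<close>; 84 leaves room for the
      loop overhead.\<close>
    let ?I = "\<lambda>u. \<exists>cap Qs. cap_ok cap & round_post p cap u Qs & clk u <= clk s + 1 + 84 * (X * cap)"
    show "wp (Loop (Dif (Var 22) (Var 14)) ?c) ?Q t"
    proof (rule wp_Loop[where I = ?I and f = "\<lambda>u. card Rel + 1 - reg u 14"])
      obtain Qs where "round_post p 1 t Qs" using t by auto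
      then show "?I t" using t X1 by (intro exI[of _ 1] exI[of _ Qs]) (auto simp: cap_ok_def)
    next
      fix u assume "?I u" and mu: "mods (warr ?c) (wreg ?c) t u" and v: "val (Dif (Var 22) (Var 14)) u ~= 0"
      then obtain cap Qs where u: "cap_ok cap" "round_post p cap u Qs" "clk u <= clk s + 1 + 84 * (X * cap)" by blast
      have hv: "cap < card (heavy cap Qs)" using v u(2) by (simp add: round_post_def)
      have "cap * cap <= card (heavy cap Qs) * cap" using hv by (intro mult_le_mono1) simp
      also have "\<dots> <= card Rel" using heavy_card u(2) by (simp add: round_post_def)
      finally have cc: "cap * cap <= card Rel" .
      have c1: "1 <= cap" using u(1) by (simp add: cap_ok_def)
      then have cR: "cap <= card Rel" using cc le_trans[of cap "cap * cap"] by simp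
      let ?u = "assign 14 (cap + cap) (tick u)"
      have r14: "reg u 14 = cap" using u(2) by (simp add: round_post_def)
      have ms: "mods {p, p + 1, p + 2, p + 3} {12, 13, 14, 15, 16, 17, 18, 19, 20, 22} s ?u"
        using m mu by (auto simp: mods_def)
      have "wp (round p) (\<lambda>t. (\<exists>Qs. round_post p (reg ?u 14) t Qs) & clk t <= clk ?u + 40 * (X * reg ?u 14)) ?u"
      proof (rule wp_round)
        show "graph_ok As K n ?u" using graph_ok_mods[OF g ms] p by auto
        show "\<forall>i. arr ?u p i < reg ?u 14"
        proof
          fix i
          have "queue p n (K * n) u Qs" using u(2) by (simp add: round_post_def)
          then have "arr u p i <= reg u 14" unfolding queue_def by blast
          then show "arr ?u p i < reg ?u 14" using r14 c1 by simp
        qed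
        show "arr ?u (p + 8) a ~= 0 \<longleftrightarrow> a \<in> A" if "a < n" for a
          using a[OF that] mods_arr[OF ms, of "p + 8"] by simp
      qed (use p in auto)
      then have "wp (round p) (\<lambda>t. ?I t & card Rel + 1 - reg t 14 < card Rel + 1 - reg u 14) ?u"
      proof (rule wp_mono)
        fix x assume x: "(\<exists>Qs. round_post p (reg ?u 14) x Qs) & clk x <= clk ?u + 40 * (X * reg ?u 14)"
        then obtain Ws where Ws: "round_post p (cap + cap) x Ws" by auto
        have ok: "cap_ok (cap + cap)" using cc c1 by (simp add: cap_ok_def algebra_simps)
        have "1 <= X * cap" using mult_le_mono[OF X1 c1] by simp
        moreover have "X * (cap + cap) = X * cap + X * cap" by (simp add: distrib_left)
        moreover have "clk x <= clk u + 2 + 40 * (X * (cap + cap))" using x by simp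
        ultimately have "clk x <= clk s + 1 + 84 * (X * (cap + cap))"
          using u(3) by linarith
        moreover have "reg x 14 = cap + cap" using Ws by (simp add: round_post_def)
        ultimately show "?I x & card Rel + 1 - reg x 14 < card Rel + 1 - reg u 14"
          using ok Ws r14 c1 cR by (intro conjI exI[of _ "cap + cap"] exI[of _ Ws]) auto
      qed
      then show "wp ?c (\<lambda>t. ?I t & card Rel + 1 - reg t 14 < card Rel + 1 - reg u 14) (tick u)"
        using r14 by simp
    next
      fix u assume "?I u" and v: "val (Dif (Var 22) (Var 14)) u = 0"
      then obtain cap Qs where u: "cap_ok cap" "round_post p cap u Qs" "clk u <= clk s + 1 + 84 * (X * cap)" by blast
      have c1: "1 <= cap" using u(1) by (simp add: cap_ok_def)
      have "1 <= X * cap" using mult_le_mono[OF X1 c1] by simp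
      then have "clk (tick u) <= clk s + 90 * (X * cap)" using u(3) unfolding upd_simps by linarith
      moreover have "card (heavy cap Qs) <= cap" using v u(2) by (simp add: round_post_def)
      moreover have "round_post p cap (tick u) Qs" using u(2) by (simp add: round_post_def)
      ultimately show "?Q (tick u)" using u(1) by blast
    qed
  qed (use g f p a in auto)
  then show ?thesis by (simp add: balance_def)
qed

section \<open>Pairs of light and of heavy sources\<close>

definition classify :: "nat => com" where
  "classify p = For 20 (Var 0) (Cond (Elem (p + 8) (Var 20))
     (Cond (Dif (Var 14) (Elem (p + 1) (node K js (Var 20))))
       (Put (p + 9) (node K js (Var 20)) (Sum (Var 20) (Lit 1))) (Put (p + 10) (Var 20) (Lit 1))) Skip)"

lemma classify_sets [simp]: "warr (classify p) = {p + 9, p + 10}" "wreg (classify p) = {20}"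
  by (auto simp: classify_def)

lemma wp_classify:
  assumes q: "round_post p cap s Qs" and r: "reg s 0 = n" and z: "\<forall>i. arr s (p + 9) i = 0" "\<forall>i. arr s (p + 10) i = 0"
    and a: "\<And>a. a < n ==> arr s (p + 8) a ~= 0 \<longleftrightarrow> a \<in> A"
  shows "wp (classify p) (\<lambda>t. (\<forall>w x. arr t (p + 9) w = Suc x \<longleftrightarrow> x \<in> A - heavy cap Qs & w = K * x + js) &
    (\<forall>x. arr t (p + 10) x ~= 0 \<longleftrightarrow> x \<in> heavy cap Qs) & clk t <= clk s + 2 + 6 * n) s"
proof -
  let ?c = "Cond (Elem (p + 8) (Var 20))
     (Cond (Dif (Var 14) (Elem (p + 1) (node K js (Var 20))))
       (Put (p + 9) (node K js (Var 20)) (Sum (Var 20) (Lit 1))) (Put (p + 10) (Var 20) (Lit 1))) Skip"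
  let ?I = "\<lambda>k t. (\<forall>w x. arr t (p + 9) w = Suc x \<longleftrightarrow> x < k & x \<in> A - heavy cap Qs & w = K * x + js) &
    (\<forall>x. arr t (p + 10) x ~= 0 \<longleftrightarrow> x < k & x \<in> heavy cap Qs) & clk t <= clk s + 1 + 6 * k"
  have An: "x < n" if "x \<in> A" for x using A that by auto
  show ?thesis unfolding classify_def
  proof (rule wp_For[where N = n and I = ?I])
    show "?I 0 (assign 20 0 s)" using z by simp
  next
    fix k t assume I: "?I k t" and m: "mods (warr ?c) (insert 20 (wreg ?c)) s t" and k: "reg t 20 = k" "k < n"
    have nl: "K * k + js < K * n" using node_less J(1) k by blast
    have au: "arr t (p + 8) k ~= 0 \<longleftrightarrow> k \<in> A" "arr t (p + 1) (K * k + js) = cnt Qs (K * k + js)" "reg t 14 = cap"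
      using m a[of k] k q nl by (auto simp: mods_def queue_def round_post_def)
    have hk: "k \<in> heavy cap Qs \<longleftrightarrow> k \<in> A & cap <= cnt Qs (K * k + js)"
      by (auto simp: heavy_def)
    have inj: "K * k + js = K * x + js \<longleftrightarrow> x = k" for x using J(1) by auto
    consider "k \<in> A" "k \<in> heavy cap Qs" | "k \<in> A" "k \<notin> heavy cap Qs" | "k \<notin> A" "k \<notin> heavy cap Qs"
      using hk by blast
    then show "wp ?c (\<lambda>v. ?I (Suc k) (assign 20 (Suc k) v)) (tick t)"
    proof cases
      case 1
      then show ?thesis using I au k hk by (auto simp: less_Suc_eq)
    next
      case 2
      then have lt: "cnt Qs (K * k + js) < cap" using hk by auto
      have "wp ?c (\<lambda>v. ?I (Suc k) (assign 20 (Suc k) v)) (tick t) \<longleftrightarrow>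
        ?I (Suc k) (assign 20 (Suc k) (put (p + 9) (K * k + js) (Suc k) (tick (tick (tick t)))))"
        using 2 au k lt by simp
      moreover have "?I (Suc k) (assign 20 (Suc k) (put (p + 9) (K * k + js) (Suc k) (tick (tick (tick t)))))"
      proof (intro conjI allI)
        fix w x
        show "arr (assign 20 (Suc k) (put (p + 9) (K * k + js) (Suc k) (tick (tick (tick t))))) (p + 9) w = Suc x \<longleftrightarrow>
          x < Suc k & x \<in> A - heavy cap Qs & w = K * x + js"
        proof (cases "w = K * k + js")
          case True
          then show ?thesis using 2 inj by auto
        next
          case False
          then show ?thesis using I by (auto simp: less_Suc_eq)
        qed
      qed (use I 2 in \<open>auto simp: less_Suc_eq\<close>)
      ultimately show ?thesis by blast
    next
      case 3
      then show ?thesis using I au k by (auto simp: less_Suc_eq)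
    qed
  next
    fix t :: st assume I: "?I n t"
    have "x \<in> A - heavy cap Qs ==> x < n" "x \<in> heavy cap Qs ==> x < n" for x
      using An by (auto simp: heavy_def)
    then show "(\<forall>w x. arr (tick t) (p + 9) w = Suc x \<longleftrightarrow> x \<in> A - heavy cap Qs & w = K * x + js) &
      (\<forall>x. arr (tick t) (p + 10) x ~= 0 \<longleftrightarrow> x \<in> heavy cap Qs) & clk (tick t) <= clk s + 2 + 6 * n"
      using I by auto
  qed (use r in \<open>auto simp: mods_def\<close>)
qed

definition decode :: "nat => com" where
  "decode p = For 20 (Var 0) (Put (p + 14) (node K ft (Var 20)) (Sum (Var 20) (Lit 1)))"

lemma decode_sets [simp]: "warr (decode p) = {p + 14}" "wreg (decode p) = {20}"
  by (auto simp: decode_def)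

lemma wp_decode:
  assumes r: "reg s 0 = n" and z: "\<forall>i. arr s (p + 14) i = 0"
  shows "wp (decode p) (\<lambda>t. (\<forall>w x. arr t (p + 14) w = Suc x \<longleftrightarrow> x < n & w = K * x + ft) &
    clk t <= clk s + 2 + 3 * n) s"
proof -
  let ?I = "\<lambda>k t. (\<forall>w x. arr t (p + 14) w = Suc x \<longleftrightarrow> x < k & w = K * x + ft) & clk t <= clk s + 1 + 3 * k"
  have inj: "K * k + ft = K * x + ft \<longleftrightarrow> x = k" for x k using J(1) by auto
  show ?thesis unfolding decode_def
    by (rule wp_For[where N = n and I = ?I]) (use r z inj in \<open>auto simp: mods_def less_Suc_eq\<close>)
qed

text \<open>Arrays relative to \<open>p\<close>: 0 to 3 propagation, 4 to 7 search from heavy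
  sources, 8 the set \<open>A\<close> given by the caller, 9 decoder of light sources, 10 flags of
  heavy ones, 11 to 13 the resulting pairs as linked lists, 14 decoder of targets. The second search
  has capacity \<open>n + 1\<close>, which is never reached, so it is exact.\<close>

definition pairs :: "nat => com" where
  "pairs p = balance p ;; Assign 21 (Lit 0) ;; classify p ;; collect p (p + 9) 23 24 (p + 11) ;;
     Assign 14 (Sum (Var 0) (Lit 1)) ;; spread (p + 4) K fs (Elem (p + 10) (Var 20)) ;; decode p ;;
     collect (p + 4) (p + 14) 24 23 (p + 11)"

lemma pairs_sets [simp]: "warr (pairs p) = {p, p + 1, p + 2, p + 3, p + 4, p + 5, p + 6, p + 7, p + 9, p + 10, p + 11, p + 12, p + 13, p + 14}"
    "wreg (pairs p) = {12, 13, 14, 15, 16, 17, 18, 19, 20, 21, 22, 23, 24}"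
  by (auto simp: pairs_def)

lemma queue_length:
  assumes "queue p n (K * n) s Qs" "\<forall>w. cnt Qs w <= c"
  shows "length Qs <= X * c"
proof -
  have "fst ` set Qs \<subseteq> {..<K * n}" using assms(1) by (auto simp: queue_def)
  then have "length Qs <= c * (K * n)" using sum_queue[OF assms(2), of "K * n" "\<lambda>_. 1"] by simp
  also have "\<dots> <= c * X" by (intro mult_le_mono2) (simp add: X_def)
  finally show ?thesis by (simp add: mult.commute)
qed

text \<open>At the node of a light source nothing was refused, so the labels found there are exactly
  its targets.\<close>

lemma light_pairs:
  assumes inv: "prop_inv (set As) (seeds K jt {..<n}) cap Qs (length Qs)"
    and D: "\<forall>w x. D w = Suc x \<longleftrightarrow> x \<in> A - heavy cap Qs & w = K * x + js"
    and Ps: "Ps = map (\<lambda>(w, l). (D w - 1, l)) (filter (\<lambda>(w, l). D w ~= 0) Qs)"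
  shows "distinct Ps & set Ps = {(a, b) \<in> Rel. a \<notin> heavy cap Qs}"
proof
  have "inj_on (\<lambda>(w, l). (D w - 1, l)) (set (filter (\<lambda>(w, l). D w ~= 0) Qs))"
  proof (rule inj_onI, clarsimp)
    fix w l w' assume "0 < D w" "0 < D w'" "D w - Suc 0 = D w' - Suc 0"
    then have "D w = Suc (D w - 1)" "D w' = Suc (D w - 1)" by auto
    then show "w = w'" using D by metis
  qed
  then show "distinct Ps" using inv by (simp add: Ps prop_inv_def distinct_map)
  have "(a, b) \<in> set Ps \<longleftrightarrow> (\<exists>w. (w, b) \<in> set Qs & D w = Suc a)" for a b
    unfolding Ps by (rule decoded_iff)
  also have "(\<exists>w. (w, b) \<in> set Qs & D w = Suc a) \<longleftrightarrow> a \<in> A - heavy cap Qs & (K * a + js, b) \<in> set Qs" for a b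
    using D by auto
  also have "\<dots> a b \<longleftrightarrow> (a, b) \<in> Rel & a \<notin> heavy cap Qs" for a b
  proof (cases "a \<in> A - heavy cap Qs")
    case True
    then have "cnt Qs (K * a + js) < cap" by (auto simp: heavy_def)
    from prop_inv_complete[OF inv this] show ?thesis using True by (auto simp: seeds_def Rel_def)
  qed (auto simp: Rel_def)
  finally show "set Ps = {(a, b) \<in> Rel. a \<notin> heavy cap Qs}" by auto
qed

text \<open>Besides exactness, the bound on the counters matters for the running time: the search
  amounts to one pass over the graph per heavy source.\<close>

lemma heavy_pairs:
  assumes inv: "prop_inv (set As) (seeds K fs (heavy cap Qs)) (n + 1) Rs (length Rs)"
    and D: "\<forall>w x. D w = Suc x \<longleftrightarrow> x < n & w = K * x + ft"
    and Ps: "Ps = map (\<lambda>(w, l). (l, D w - 1)) (filter (\<lambda>(w, l). D w ~= 0) Rs)"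
  shows "distinct Ps & set Ps = {(a, b) \<in> Rel. a \<in> heavy cap Qs} & (\<forall>w. cnt Rs w <= card (heavy cap Qs))"
proof (intro conjI)
  have d: "distinct Rs" using inv by (simp add: prop_inv_def)
  have H: "heavy cap Qs \<subseteq> {..<n}" using A by (auto simp: heavy_def)
  have fin: "finite (heavy cap Qs)" using H finite_subset by blast
  have lab: "l \<in> heavy cap Qs" if "(w, l) \<in> set Rs" for w l
    using inv that unfolding prop_inv_def seeds_def by fast
  have c: "cnt Rs w <= card (heavy cap Qs)" for w
    unfolding cnt_card[OF d] using lab fin by (intro card_mono) auto
  then show "\<forall>w. cnt Rs w <= card (heavy cap Qs)" by blast
  \<comment> \<open>Labels are heavy sources, of which there are at most \<open>n\<close>; with
    capacity \<open>n + 1\<close> no node can saturate.\<close>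
  have "card (heavy cap Qs) <= n" using card_mono[OF _ H] by simp
  then have lt: "cnt Rs w < n + 1" for w using c[of w] by simp
  have "inj_on (\<lambda>(w, l). (l, D w - 1)) (set (filter (\<lambda>(w, l). D w ~= 0) Rs))"
  proof (rule inj_onI, clarsimp)
    fix w l w' assume "0 < D w" "0 < D w'" "D w - Suc 0 = D w' - Suc 0"
    then have "D w = Suc (D w - 1)" "D w' = Suc (D w - 1)" by auto
    then show "w = w'" using D by metis
  qed
  then show "distinct Ps" using d by (simp add: Ps distinct_map)
  have "(a, b) \<in> set Ps \<longleftrightarrow> (\<exists>w. (w, a) \<in> set Rs & D w = Suc b)" for a b
    unfolding Ps by (rule decoded_swap_iff)
  also have "(\<exists>w. (w, a) \<in> set Rs & D w = Suc b) \<longleftrightarrow> b < n & (K * b + ft, a) \<in> set Rs" for a b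
    using D by auto
  also have "\<dots> a b \<longleftrightarrow> (a, b) \<in> Rel & a \<in> heavy cap Qs" for a b
  proof (cases "a \<in> heavy cap Qs & b < n")
    case True
    then have a: "a \<in> A" "a < n" using H by (auto simp: heavy_def)
    have "(K * b + ft, a) \<in> set Rs \<longleftrightarrow> (K * a + fs, K * b + ft) \<in> (set As)\<^sup>*"
      using prop_inv_complete[OF inv lt] True by (auto simp: seeds_def)
    then show ?thesis using True a mirror[of a b] by (auto simp: Rel_def)
  next
    case False
    then show ?thesis using lab by (auto simp: Rel_def)
  qed
  finally show "set Ps = {(a, b) \<in> Rel. a \<in> heavy cap Qs}" by auto
qed

theorem wp_pairs:
  assumes g: "graph_ok As K n s" and f: "\<And>a. a \<in> {p..<p + 15} - {p + 8} ==> arr s a = (\<lambda>_. 0)" and p: "4 < p"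
    and a: "\<And>a. a < n ==> arr s (p + 8) a ~= 0 \<longleftrightarrow> a \<in> A"
  shows "wp (pairs p) (\<lambda>t. \<exists>cap Ps. cap_ok cap & links (p + 11) 21 t Ps & distinct Ps & set Ps = Rel &
    clk t <= clk s + 200 * (X * cap)) s"
  unfolding pairs_def
proof (rule wp_Seq[OF wp_balance[OF g]])
  let ?Q = "\<lambda>t. \<exists>cap Ps. cap_ok cap & links (p + 11) 21 t Ps & distinct Ps & set Ps = Rel &
    clk t <= clk s + 200 * (X * cap)"
  fix t assume "\<exists>cap Qs. cap_ok cap & round_post p cap t Qs & card (heavy cap Qs) <= cap & clk t <= clk s + 90 * (X * cap)"
    and m: "mods (warr (balance p)) (wreg (balance p)) s t"
  then obtain cap Qs where t: "cap_ok cap" "round_post p cap t Qs" "card (heavy cap Qs) <= cap" "clk t <= clk s + 90 * (X * cap)"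
    by blast
  have q: "queue p n (K * n) t Qs" and inv: "prop_inv (set As) (seeds K jt {..<n}) cap Qs (length Qs)"
    using t(2) by (auto simp: round_post_def)
  let ?t = "assign 21 0 t"
  have r0: "reg s 0 = n" using g by (simp add: graph_ok_def)
  have mt: "mods {p, p + 1, p + 2, p + 3} {12, 13, 14, 15, 16, 17, 18, 19, 20, 21, 22} s ?t"
    using m by (auto simp: mods_def)
  have "wp (classify p ;; collect p (p + 9) 23 24 (p + 11) ;;
     Assign 14 (Sum (Var 0) (Lit 1)) ;; spread (p + 4) K fs (Elem (p + 10) (Var 20)) ;; decode p ;;
     collect (p + 4) (p + 14) 24 23 (p + 11)) ?Q ?t"
  proof (rule wp_Seq[OF wp_classify[where cap = cap and Qs = Qs]])
    fix u assume u: "(\<forall>w x. arr u (p + 9) w = Suc x \<longleftrightarrow> x \<in> A - heavy cap Qs & w = K * x + js) &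
      (\<forall>x. arr u (p + 10) x ~= 0 \<longleftrightarrow> x \<in> heavy cap Qs) & clk u <= clk ?t + 2 + 6 * n"
      and m': "mods (warr (classify p)) (wreg (classify p)) ?t u"
    have mu: "mods {p, p + 1, p + 2, p + 3, p + 9, p + 10} {12, 13, 14, 15, 16, 17, 18, 19, 20, 21, 22} s u"
      using mods_trans[OF mt m'] by simp
    have qu: "queue p n (K * n) u Qs" using q m' p by (auto simp: queue_def mods_def)
    have "arr u (p + 11) = (\<lambda>_. 0)" "reg u 21 = 0" using mu m' f[of "p + 11"] by (auto simp: mods_def)
    then have lu: "links (p + 11) 21 u []" by (simp add: links_def)
    let ?Ps = "map (\<lambda>(w, l). (arr u (p + 9) w - 1, l)) (filter (\<lambda>(w, l). arr u (p + 9) w ~= 0) Qs)"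
    have Ps: "distinct ?Ps & set ?Ps = {(a, b) \<in> Rel. a \<notin> heavy cap Qs}"
      using light_pairs[OF inv _ refl, of "arr u (p + 9)"] u by blast
    have le1: "length Qs <= X * cap" using queue_length[OF qu] inv by (simp add: prop_inv_def)
    show "wp (collect p (p + 9) 23 24 (p + 11) ;;
     Assign 14 (Sum (Var 0) (Lit 1)) ;; spread (p + 4) K fs (Elem (p + 10) (Var 20)) ;; decode p ;;
     collect (p + 4) (p + 14) 24 23 (p + 11)) ?Q u"
    proof (rule wp_Seq[OF wp_collect[OF qu lu]])
      fix v assume v: "links (p + 11) 21 v ([] @ map (\<lambda>(w, l). if (23::nat) = 23 then (arr u (p + 9) w - 1, l) else (l, arr u (p + 9) w - 1))
          (filter (\<lambda>(w, l). arr u (p + 9) w ~= 0) Qs)) & clk v <= clk u + 2 + 10 * length Qs"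
        and m'': "mods (warr (collect p (p + 9) 23 24 (p + 11))) (wreg (collect p (p + 9) 23 24 (p + 11))) u v"
      then have lv: "links (p + 11) 21 v ?Ps" by simp
      have mv: "mods {p, p + 1, p + 2, p + 3, p + 9, p + 10, p + 11, p + 12, p + 13} {12, 13, 14, 15, 16, 17, 18, 19, 20, 21, 22, 23, 24} s v"
        using mods_trans[OF mu m''] by simp
      let ?v = "assign 14 (n + 1) v"
      have mv': "mods {p, p + 1, p + 2, p + 3, p + 9, p + 10, p + 11, p + 12, p + 13} {12, 13, 14, 15, 16, 17, 18, 19, 20, 21, 22, 23, 24} s ?v"
        using mv by (auto simp: mods_def)
      have gv: "graph_ok As K n ?v" using graph_ok_mods[OF g mv'] p by auto
      have v10: "arr v (p + 10) = arr u (p + 10)" using m'' by (auto simp: mods_def)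
      have v4: "arr ?v (p + 4) = (\<lambda>_. 0)" using mv' f[of "p + 4"] p by (auto simp: mods_def)
      have "wp (spread (p + 4) K fs (Elem (p + 10) (Var 20)) ;; decode p ;; collect (p + 4) (p + 14) 24 23 (p + 11)) ?Q ?v"
      proof (rule wp_Seq[OF wp_spread[where B = "heavy cap Qs" and As = As and n = n]])
        show "val (Elem (p + 10) (Var 20)) x ~= 0 \<longleftrightarrow> y \<in> heavy cap Qs"
          if "mods {p + 4, p + 4 + 1, p + 4 + 2, p + 4 + 3} {12, 13, 15, 16, 20} ?v x" "reg x 20 = y" "y < n" for x y
          using that u v10 by (auto simp: mods_def)
        show "heavy cap Qs \<subseteq> {..<n}" using A by (auto simp: heavy_def)
      next
        fix w assume "\<exists>Rs. queue (p + 4) n (K * n) w Rs &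
            prop_inv (set As) (seeds K fs (heavy cap Qs)) (reg ?v 14) Rs (length Rs) &
            clk w <= clk ?v + 8 + 3 * (K * n) + 13 * n + (\<Sum>i<length Rs. 7 + 11 * length (outs As (fst (Rs ! i))))"
          and mw: "mods (warr (spread (p + 4) K fs (Elem (p + 10) (Var 20)))) (wreg (spread (p + 4) K fs (Elem (p + 10) (Var 20)))) ?v w"
        then obtain Rs where Rs: "queue (p + 4) n (K * n) w Rs" "prop_inv (set As) (seeds K fs (heavy cap Qs)) (n + 1) Rs (length Rs)"
          "clk w <= clk ?v + 8 + 3 * (K * n) + 13 * n + (\<Sum>i<length Rs. 7 + 11 * length (outs As (fst (Rs ! i))))"
          by auto
        have rw: "reg w 0 = n" "arr w (p + 14) = (\<lambda>_. 0)" using mw mv' r0 f[of "p + 14"] by (auto simp: mods_def)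
        have mvw: "mods {p + 4, p + 5, p + 6, p + 7} {12, 13, 14, 15, 16, 17, 18, 19, 20} v w"
          using mw by (auto simp: mods_def)
        have lw: "links (p + 11) 21 w ?Ps" using links_mods[OF lv mvw] by simp
        show "wp (decode p ;; collect (p + 4) (p + 14) 24 23 (p + 11)) ?Q w"
        proof (rule wp_Seq[OF wp_decode])
          fix x assume x: "(\<forall>w y. arr x (p + 14) w = Suc y \<longleftrightarrow> y < n & w = K * y + ft) & clk x <= clk w + 2 + 3 * n"
            and mx: "mods (warr (decode p)) (wreg (decode p)) w x"
          have qx: "queue (p + 4) n (K * n) x Rs" using Rs(1) mx by (auto simp: queue_def mods_def)
          have lx: "links (p + 11) 21 x ?Ps" using links_mods[OF lw mx] by simp
          let ?Ws = "map (\<lambda>(w, l). (l, arr x (p + 14) w - 1)) (filter (\<lambda>(w, l). arr x (p + 14) w ~= 0) Rs)"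
          have Ws: "distinct ?Ws & set ?Ws = {(a, b) \<in> Rel. a \<in> heavy cap Qs} & (\<forall>w. cnt Rs w <= card (heavy cap Qs))"
            using heavy_pairs[OF Rs(2) _ refl, of "arr x (p + 14)"] x by blast
          then have c: "\<forall>w. cnt Rs w <= cap" using t(3) le_trans by blast
          have c1: "1 <= cap" using t(1) by (simp add: cap_ok_def)
          have le2: "length Rs <= X * cap" using queue_length[OF Rs(1) c] .
          have "clk w + 3 + 7 * n <= clk ?v + 40 * (X * cap)"
            using Rs(3) spread_cost[OF Rs(1) c c1] by linarith
          moreover have "20 + 6 * n <= 20 * (X * cap)"
          proof -
            have "20 + 6 * n <= 20 * X" by (simp add: X_def)
            also have "\<dots> <= 20 * (X * cap)" using c1 by simp
            finally show ?thesis .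
          qed
          ultimately have cost: "clk x + 2 + 10 * length Rs <= clk s + 200 * (X * cap)"
            using x v u t(4) le1 le2 by simp
          show "wp (collect (p + 4) (p + 14) 24 23 (p + 11)) ?Q x"
          proof (rule wp_mono[OF wp_collect[OF qx lx]])
            fix y assume "links (p + 11) 21 y (?Ps @ map (\<lambda>(w, l). if (24::nat) = 23 then (arr x (p + 14) w - 1, l) else (l, arr x (p + 14) w - 1))
                (filter (\<lambda>(w, l). arr x (p + 14) w ~= 0) Rs)) & clk y <= clk x + 2 + 10 * length Rs"
            then have y: "links (p + 11) 21 y (?Ps @ ?Ws)" "clk y <= clk x + 2 + 10 * length Rs" by auto
            have "distinct (?Ps @ ?Ws)" "set (?Ps @ ?Ws) = Rel"
              unfolding distinct_append set_append using Ps Ws by auto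
            then show "?Q y" using y cost t(1) by (intro exI[of _ cap] exI[of _ "?Ps @ ?Ws"]) auto
          qed auto
        qed (use rw in auto)
      qed (use gv p J As v4 in \<open>auto simp: graph_ok_def\<close>)
      then show "wp (Assign 14 (Sum (Var 0) (Lit 1)) ;; spread (p + 4) K fs (Elem (p + 10) (Var 20)) ;; decode p ;;
          collect (p + 4) (p + 14) 24 23 (p + 11)) ?Q v"
        using mv r0 by (simp add: mods_def)
    qed auto
  next
    show "round_post p cap ?t Qs" using t(2) by (simp add: round_post_def)
  qed (use mt f r0 a p in \<open>auto simp: mods_def\<close>)
  then show "wp (Assign 21 (Lit 0) ;; classify p ;; collect p (p + 9) 23 24 (p + 11) ;;
     Assign 14 (Sum (Var 0) (Lit 1)) ;; spread (p + 4) K fs (Elem (p + 10) (Var 20)) ;; decode p ;;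
     collect (p + 4) (p + 14) 24 23 (p + 11)) ?Q t" by simp
qed (use p f a in auto)

end

section \<open>Operations on tables\<close>

text \<open>Column \<open>i\<close> of a table with base \<open>cb\<close> is array \<open>cb + i\<close>.\<close>

definition tab :: "nat => nat set => nat => st => (nat => nat) list => bool" where
  "tab cb W r s rows \<longleftrightarrow> reg s r = length rows & (\<forall>k<length rows. \<forall>i\<in>W. arr s (cb + i) k = (rows ! k) i)"

text \<open>Rows are compared as functions; \<open>extensional\<close> makes rows that agree on the
  columns equal, so \<open>distinct\<close> really excludes duplicate tuples.\<close>

definition table :: "nat => nat set => st => (nat => nat) set => bool" where
  "table cb W s X \<longleftrightarrow> X \<subseteq> extensional W & (\<exists>rows. tab cb W 3 s rows & distinct rows & set rows = X)"

lemma tab_upd [simp]: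
  "tab cb W r (tick s) rows = tab cb W r s rows"
  "r' ~= r ==> tab cb W r (assign r' x s) rows = tab cb W r s rows"
  by (simp_all add: tab_def)

lemma tab_mods: "tab cb W r s rows ==> mods X Y s t ==> r \<notin> Y ==> (\<And>i. i \<in> W ==> cb + i \<notin> X) ==> tab cb W r t rows"
  by (simp add: tab_def mods_def)

lemma add_image_iff [simp]: "c + i \<in> (+) c ` S \<longleftrightarrow> i \<in> S" for c i :: nat
  by auto

primrec copyc :: "nat => nat => nat list => com" where
  "copyc cb cb' [] = Skip"
| "copyc cb cb' (i # W) = Put (cb' + i) (Var 25) (Elem (cb + i) (Var 20)) ;; copyc cb cb' W"

lemma copyc_sets [simp]: "warr (copyc cb cb' W) = (+) cb' ` set W" "wreg (copyc cb cb' W) = {}"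
  by (induction W) auto

lemma wp_copyc:
  assumes "\<And>i j. i \<in> set W ==> j \<in> set W ==> cb' + i ~= cb + j"
  shows "wp (copyc cb cb' W) (\<lambda>t. (\<forall>i\<in>set W. arr t (cb' + i) = (arr s (cb' + i))(reg s 25 := arr s (cb + i) (reg s 20))) &
    clk t = clk s + length W) s"
  using assms
proof (induction W arbitrary: s)
  case (Cons i W)
  let ?s = "put (cb' + i) (reg s 25) (arr s (cb + i) (reg s 20)) s"
  have ne: "cb + j ~= cb' + i" if "j \<in> set W" for j
    using Cons.prems[of i j] that by simp
  have "wp (copyc cb cb' W) (\<lambda>t. (\<forall>j\<in>set W. arr t (cb' + j) = (arr ?s (cb' + j))(reg ?s 25 := arr ?s (cb + j) (reg ?s 20))) &
    clk t = clk ?s + length W) ?s"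
    by (rule Cons.IH) (use Cons.prems in auto)
  then have "wp (copyc cb cb' W) (\<lambda>t. (\<forall>i\<in>set (i # W). arr t (cb' + i) = (arr s (cb' + i))(reg s 25 := arr s (cb + i) (reg s 20))) &
    clk t = clk s + length (i # W)) ?s"
  proof (rule wp_frame)
    fix t assume t: "(\<forall>j\<in>set W. arr t (cb' + j) = (arr ?s (cb' + j))(reg ?s 25 := arr ?s (cb + j) (reg ?s 20))) &
        clk t = clk ?s + length W"
      and m: "mods (warr (copyc cb cb' W)) (wreg (copyc cb cb' W)) ?s t"
    have 1: "arr t (cb' + j) = (arr s (cb' + j))(reg s 25 := arr s (cb + j) (reg s 20))" if "j \<in> set W" for j
      using t that ne[OF that] by auto
    have 2: "arr t (cb' + i) = (arr s (cb' + i))(reg s 25 := arr s (cb + i) (reg s 20))" if "i \<notin> set W"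
      using m that by (auto simp: mods_def)
    show "(\<forall>i\<in>set (i # W). arr t (cb' + i) = (arr s (cb' + i))(reg s 25 := arr s (cb + i) (reg s 20))) &
      clk t = clk s + length (i # W)"
      using 1 2 t by (cases "i \<in> set W") auto
  qed
  then show ?case by (simp del: fun_upd_apply)
qed simp

definition mark_column :: "nat => nat => com" where
  "mark_column a c = For 20 (Var 3) (Put a (Elem c (Var 20)) (Lit 1))"

lemma mark_column_sets [simp]: "warr (mark_column a c) = {a}" "wreg (mark_column a c) = {20}"
  by (auto simp: mark_column_def)

lemma wp_mark_column:
  assumes t: "tab cb W 3 s rows" and x: "x \<in> W" and z: "\<forall>i. arr s a i = 0" and a: "cb + x ~= a"
  shows "wp (mark_column a (cb + x)) (\<lambda>t. (\<forall>i. arr t a i ~= 0 \<longleftrightarrow> i \<in> (\<lambda>\<rho>. \<rho> x) ` set rows) &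
    clk t <= clk s + 2 + 3 * length rows) s"
proof -
  let ?I = "\<lambda>k t. (\<forall>i. arr t a i ~= 0 \<longleftrightarrow> i \<in> (\<lambda>\<rho>. \<rho> x) ` set (take k rows)) & clk t <= clk s + 1 + 3 * k"
  show ?thesis unfolding mark_column_def
    by (rule wp_For[where N = "length rows" and I = ?I])
      (use t x z a in \<open>auto simp: mods_def tab_def take_Suc_conv_app_nth\<close>)
qed

section \<open>Joining a table with a relation\<close>

definition joined :: "(nat \<times> nat) list => nat => nat => (nat => nat) list => (nat => nat) list" where
  "joined Ps x y rows = concat (map (\<lambda>\<rho>. map (\<lambda>b. \<rho>(y := b)) (targets Ps (\<rho> x))) rows)"

text \<open>Register 25 counts the rows of the new table while register 3 still holds the size of
  the old one.\<close>

definition join :: "nat list => nat => nat => nat => nat => nat => com" where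
  "join W cb cb' x y g = Assign 25 (Lit 0) ;;
     For 20 (Var 3) (Assign 19 (Elem g (Elem (cb + x) (Var 20))) ;;
       Each g 19 24 (copyc cb cb' W ;; Put (cb' + y) (Var 25) (Var 24) ;; Assign 25 (Sum (Var 25) (Lit 1)))) ;;
     Assign 3 (Var 25)"

lemma join_sets [simp]: "warr (join W cb cb' x y g) = (+) cb' ` set (y # W)"
    "wreg (join W cb cb' x y g) = {3, 19, 20, 24, 25}"
  by (auto simp: join_def)

lemma wp_join:
  assumes t: "tab cb (set W) 3 s rows" and l: "links g 21 s Ps"
    and x: "x \<in> set W" and y: "y \<notin> set W" and m: "\<And>i. i \<in> set (y # W) ==> i <= m"
    and lay: "cb + m < g" "g + 2 < cb'"
  shows "wp (join W cb cb' x y g) (\<lambda>t. tab cb' (set (y # W)) 3 t (joined Ps x y rows) &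
    clk t <= clk s + 4 + 4 * length rows + (length W + 6) * length (joined Ps x y rows)) s"
proof -
  let ?c = "copyc cb cb' W ;; Put (cb' + y) (Var 25) (Var 24) ;; Assign 25 (Sum (Var 25) (Lit 1))"
  let ?b = "Assign 19 (Elem g (Elem (cb + x) (Var 20))) ;; Each g 19 24 ?c"
  let ?s = "assign 25 0 s"
  let ?J = "\<lambda>k. joined Ps x y (take k rows)"
  let ?I = "\<lambda>k t. tab cb' (set (y # W)) 25 t (?J k) & clk t <= clk s + 2 + 4 * k + (length W + 6) * length (?J k)"
  have dis: "cb' + i ~= cb + j" if "i \<in> set (y # W)" "j \<in> set W" for i j
    using m[of j] that lay by auto
  have disg: "cb' + i ~= g" "cb' + i ~= g + 1" "cb' + i ~= g + 2" for i using lay by auto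
  have "wp (For 20 (Var 3) ?b) (\<lambda>t. tab cb' (set (y # W)) 25 t (joined Ps x y rows) &
      clk t <= clk s + 3 + 4 * length rows + (length W + 6) * length (joined Ps x y rows)) ?s"
  proof (rule wp_For[where N = "length rows" and I = ?I])
    fix k t assume I: "?I k t" and mt: "mods (warr ?b) (insert 20 (wreg ?b)) ?s t" and k: "reg t 20 = k" "k < length rows"
    define \<rho> where "\<rho> = rows ! k"
    have dis': "cb + j \<notin> warr ?b" if "j \<in> set W" for j
      using dis[of _ j] that by force
    have tt: "tab cb (set W) 3 t rows"
      by (rule tab_mods[OF _ mt]) (use t dis' in auto)
    then have xr: "arr t (cb + x) k = \<rho> x"
      using x k by (simp add: tab_def \<rho>_def)
    let ?t = "assign 19 (arr t g (\<rho> x)) (tick t)"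
    let ?ts = "targets Ps (\<rho> x)"
    have lt: "links g 21 ?t Ps"
    proof (rule links_mods[OF l])
      show "mods (warr ?b) (insert 25 (insert 20 (wreg ?b))) s ?t" using mt by (auto simp: mods_def)
    qed (use lay in auto)
    have Jk: "?J (Suc k) = ?J k @ map (\<lambda>b. \<rho>(y := b)) ?ts"
      using k by (simp add: joined_def take_Suc_conv_app_nth \<rho>_def)
    let ?P = "\<lambda>j. ?J k @ map (\<lambda>b. \<rho>(y := b)) (take j ?ts)"
    let ?E = "\<lambda>j u. tab cb' (set (y # W)) 25 u (?P j) & clk u <= clk t + 2 + (length W + 6) * j"
    have "wp (Each g 19 24 ?c) (\<lambda>u. tab cb' (set (y # W)) 25 u (?P (length ?ts)) &
        clk u <= clk t + 3 + (length W + 6) * length ?ts) ?t"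
    proof (rule wp_Each[where I = ?E, OF lt, where w = "\<rho> x"])
      fix j u z assume E: "?E j u" and mu: "mods (warr ?c) ({19, 24} \<union> wreg ?c) ?t u" and j: "j < length ?ts"
      let ?u = "assign 24 (?ts ! j) (tick u)"
      have u20: "reg u 20 = k" using mu k by (auto simp: mods_def)
      have u25: "reg u 25 = length (?P j)" using E by (simp add: tab_def)
      have "tab cb (set W) 3 u rows"
        by (rule tab_mods[OF _ mu]) (use tt dis' in auto)
      then have src: "arr u (cb + i) k = \<rho> i" if "i \<in> set W" for i
        using k that by (simp add: tab_def \<rho>_def)
      have "wp (copyc cb cb' W) (\<lambda>v. (\<forall>i\<in>set W. arr v (cb' + i) = (arr ?u (cb' + i))(reg ?u 25 := arr ?u (cb + i) (reg ?u 20))) &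
          clk v = clk ?u + length W) ?u"
        using dis by (intro wp_copyc) auto
      then have "wp (copyc cb cb' W) (\<lambda>v. \<forall>z. ?E (Suc j) (assign 19 z (assign 25 (reg v 25 + 1) (put (cb' + y) (reg v 25) (reg v 24) v)))) ?u"
      proof (rule wp_frame, intro allI)
        fix v z assume v: "(\<forall>i\<in>set W. arr v (cb' + i) = (arr ?u (cb' + i))(reg ?u 25 := arr ?u (cb + i) (reg ?u 20))) &
            clk v = clk ?u + length W"
          and mv: "mods (warr (copyc cb cb' W)) (wreg (copyc cb cb' W)) ?u v"
        have rv: "reg v 25 = length (?P j)" "reg v 24 = ?ts ! j" using mv u25 by (auto simp: mods_def)
        have yv: "arr v (cb' + y) = arr u (cb' + y)" using mv y by (auto simp: mods_def)
        have Pj: "?P (Suc j) = ?P j @ [\<rho>(y := ?ts ! j)]" using j by (simp add: take_Suc_conv_app_nth)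
        have "tab cb' (set (y # W)) 25 (assign 19 z (assign 25 (reg v 25 + 1) (put (cb' + y) (reg v 25) (reg v 24) v))) (?P (Suc j))"
          unfolding tab_def
        proof (intro conjI allI impI ballI)
          show "reg (assign 19 z (assign 25 (reg v 25 + 1) (put (cb' + y) (reg v 25) (reg v 24) v))) 25 = length (?P (Suc j))"
            using rv unfolding Pj by simp
          fix q i assume q: "q < length (?P (Suc j))" and i: "i \<in> set (y # W)"
          have old: "arr u (cb' + i) q = (?P j ! q) i" if "q < length (?P j)"
            using E i that unfolding tab_def by blast
          show "arr (assign 19 z (assign 25 (reg v 25 + 1) (put (cb' + y) (reg v 25) (reg v 24) v))) (cb' + i) q = (?P (Suc j) ! q) i"
          proof (cases "q < length (?P j)")
            case True
            then have "?P (Suc j) ! q = ?P j ! q" unfolding Pj by (rule nth_append_left)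
            then show ?thesis using True old v yv rv i u25 y by (cases "i = y") auto
          next
            case False
            then have qe: "q = length (?P j)" using q unfolding Pj by simp
            have "?P (Suc j) ! q = \<rho>(y := ?ts ! j)" unfolding Pj qe by (rule nth_append_length)
            then show ?thesis using qe v rv i u25 u20 y src by (cases "i = y") auto
          qed
        qed
        then show "?E (Suc j) (assign 19 z (assign 25 (reg v 25 + 1) (put (cb' + y) (reg v 25) (reg v 24) v)))"
          using E v by simp
      qed
      then show "wp ?c (\<lambda>u. \<forall>z. ?E (Suc j) (assign 19 z u)) ?u" by simp
    next
      fix u assume "?E (length ?ts) u"
      then show "tab cb' (set (y # W)) 25 (tick u) (?P (length ?ts)) & clk (tick u) <= clk t + 3 + (length W + 6) * length ?ts"
        by simp
    next
      show "?E 0 ?t" using I by simp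
    qed (use lay in auto)
    then have "wp (Each g 19 24 ?c) (\<lambda>u. ?I (Suc k) (assign 20 (Suc k) u)) ?t"
      by (rule wp_mono) (use I Jk in \<open>auto simp: algebra_simps\<close>)
    then show "wp ?b (\<lambda>u. ?I (Suc k) (assign 20 (Suc k) u)) (tick t)" using xr k by simp
  qed (use t in \<open>auto simp: tab_def joined_def mods_def\<close>)
  then have "wp (For 20 (Var 3) ?b) (\<lambda>t. tab cb' (set (y # W)) 3 (assign 3 (reg t 25) t) (joined Ps x y rows) &
      clk (assign 3 (reg t 25) t) <= clk s + 4 + 4 * length rows + (length W + 6) * length (joined Ps x y rows)) ?s"
    by (rule wp_mono) (auto simp: tab_def)
  then show ?thesis by (simp add: join_def)
qed

lemma joined_props:
  assumes "distinct rows" "set rows \<subseteq> extensional W" "distinct Ps" "y \<notin> W"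
  shows "distinct (joined Ps x y rows) & set (joined Ps x y rows) = {\<rho>(y := b) | \<rho> b. \<rho> \<in> set rows & (\<rho> x, b) \<in> set Ps} &
    set (joined Ps x y rows) \<subseteq> extensional (insert y W)"
proof (intro conjI)
  have dt: "distinct (targets Ps w)" for w
  proof -
    have "inj_on (\<lambda>i. snd (Ps ! i)) (set (outs Ps w))"
    proof (rule inj_onI)
      fix i j assume a: "i \<in> set (outs Ps w)" "j \<in> set (outs Ps w)" "snd (Ps ! i) = snd (Ps ! j)"
      then have "Ps ! i = Ps ! j" "i < length Ps" "j < length Ps" by (auto simp: set_outs prod_eq_iff)
      then show "i = j" using assms(3) nth_eq_iff_index_eq by blast
    qed
    then show ?thesis by (simp add: targets_def distinct_map distinct_outs)
  qed
  have un: "\<rho> y = undefined" if "\<rho> \<in> set rows" for \<rho>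
    using that assms(2,4) by (auto simp: extensional_def)
  show "distinct (joined Ps x y rows)" using assms(1) un unfolding joined_def
  proof (induction rows)
    case (Cons \<rho> rows)
    have "inj_on (\<lambda>b. \<rho>(y := b)) B" for B
      by (rule inj_onI) (metis fun_upd_same)
    then have "distinct (map (\<lambda>b. \<rho>(y := b)) (targets Ps (\<rho> x)))" by (simp add: distinct_map dt)
    moreover have "\<rho>(y := b) ~= \<rho>'(y := b')" if "\<rho>' \<in> set rows" for \<rho>' b b'
    proof
      assume "\<rho>(y := b) = \<rho>'(y := b')"
      \<comment> \<open>Old rows are undefined at \<open>y\<close>, so resetting \<open>y\<close>
        recovers the row that was extended.\<close>
      then have "(\<rho>(y := b))(y := undefined) = (\<rho>'(y := b'))(y := undefined)" by simp
      then have "\<rho> = \<rho>'" using Cons.prems that by (metis fun_upd_triv fun_upd_upd list.set_intros)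
      then show False using Cons.prems that by auto
    qed
    moreover have "distinct (concat (map (\<lambda>\<rho>. map (\<lambda>b. \<rho>(y := b)) (targets Ps (\<rho> x))) rows))"
      using Cons by (simp del: fun_upd_apply)
    ultimately show ?case by (auto simp del: fun_upd_apply)
  qed simp
  show "set (joined Ps x y rows) = {\<rho>(y := b) | \<rho> b. \<rho> \<in> set rows & (\<rho> x, b) \<in> set Ps}"
    by (auto simp: joined_def set_targets)
  show "set (joined Ps x y rows) \<subseteq> extensional (insert y W)"
    using assms(2) by (auto simp: joined_def extensional_def)
qed

text \<open>
  Rows get class numbers (multiples of \<open>n\<close>) column by column: class plus column value is the
  index at which the class for the longer prefix is looked up.
\<close>

definition refine :: "nat => nat => com" where
  "refine col p = Assign 22 (Lit 0) ;; For 20 (Var 3)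
     (Assign 23 (Sum (Elem p (Var 20)) (Elem col (Var 20))) ;;
      Cond (Elem (p + 1) (Var 23)) Skip (Assign 22 (Sum (Var 22) (Var 0)) ;; Put (p + 1) (Var 23) (Var 22)) ;;
      Put (p + 2) (Var 20) (Elem (p + 1) (Var 23)))"

lemma refine_sets [simp]: "warr (refine col p) = {p + 1, p + 2}" "wreg (refine col p) = {20, 22, 23}"
  by (auto simp: refine_def)

definition classes :: "nat => nat => nat set => (nat => nat) list => st => bool" where
  "classes p n Z rows s \<longleftrightarrow> (\<forall>k<length rows. n dvd arr s p k) &
     (\<forall>k<length rows. \<forall>k'<length rows. arr s p k = arr s p k' \<longleftrightarrow> (\<forall>i\<in>Z. (rows ! k) i = (rows ! k') i))"

text \<open>Class numbers are multiples of \<open>n\<close> and column values lie below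
  \<open>n\<close>, so their sum determines both; each new sum gets the next multiple. The numbers
  start at \<open>n\<close> because 0 marks a sum not seen before.\<close>

lemma wp_refine:
  assumes t: "tab cb W 3 s rows" and c: "classes p n Z rows s" and i: "i \<in> W" and r: "reg s 0 = n"
    and v: "\<And>\<rho>. \<rho> \<in> set rows ==> \<rho> i < n" and z: "\<forall>x. arr s (p + 1) x = 0" and p: "cb + i < p"
  shows "wp (refine (cb + i) p) (\<lambda>t. classes (p + 2) n (insert i Z) rows t & clk t <= clk s + 3 + 7 * length rows) s"
proof -
  let ?c = "Assign 23 (Sum (Elem p (Var 20)) (Elem (cb + i) (Var 20))) ;;
      Cond (Elem (p + 1) (Var 23)) Skip (Assign 22 (Sum (Var 22) (Var 0)) ;; Put (p + 1) (Var 23) (Var 22)) ;;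
      Put (p + 2) (Var 20) (Elem (p + 1) (Var 23))"
  define key where "key k = arr s p k + (rows ! k) i" for k
  let ?mp = "\<lambda>t. arr t (p + 1)"
  let ?I = "\<lambda>k t. (\<forall>j<k. arr t (p + 2) j = ?mp t (key j) & ?mp t (key j) ~= 0) &
     (\<forall>x y. ?mp t x ~= 0 --> ?mp t x = ?mp t y --> x = y) &
     (\<forall>x. n dvd ?mp t x & ?mp t x <= reg t 22) & n dvd reg t 22 & clk t <= clk s + 2 + 7 * k"
  let ?s = "assign 22 0 s"
  \<comment> \<open>A row supplies a value below \<open>n\<close>; without rows \<open>n\<close> may
    be 0, but then no class number is ever assigned.\<close>
  have n0: "0 < n" if "rows ~= []" using v[of "hd rows"] that by simp
  have "wp (For 20 (Var 3) ?c) (\<lambda>t. classes (p + 2) n (insert i Z) rows t & clk t <= clk s + 3 + 7 * length rows) ?s"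
  proof (rule wp_For[where N = "length rows" and I = ?I])
    show "?I 0 (assign 20 0 ?s)" using z by simp
  next
    fix k t assume I: "?I k t" and m: "mods (warr ?c) (insert 20 (wreg ?c)) ?s t" and k: "reg t 20 = k" "k < length rows"
    have key: "arr t p k + arr t (cb + i) k = key k"
      using m t i k p by (simp add: mods_def tab_def key_def)
    have r0: "reg t 0 = n" using m r by (simp add: mods_def)
    have npos: "0 < n" using k by (intro n0) auto
    show "wp ?c (\<lambda>u. ?I (Suc k) (assign 20 (Suc k) u)) (tick t)"
    proof (cases "?mp t (key k) = 0")
      case False
      then show ?thesis using I key k by (simp add: less_Suc_eq)
    next
      case True
      have ne: "key j ~= key k" if "j < k" for j using I True that by metis
      have lt: "?mp t x < reg t 22 + n" for x
      proof -
        have "?mp t x <= reg t 22" using I by blast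
        then show ?thesis using npos by linarith
      qed
      have le: "?mp t x <= reg t 22 + n" for x using lt[of x] by simp
      have ne2: "reg t 22 + n ~= ?mp t x" "?mp t x ~= reg t 22 + n" for x using lt[of x] by auto
      show ?thesis using I True key k r0 npos ne ne2 le
        by (auto simp: less_Suc_eq dvd_add)
    qed
  next
    fix t assume I: "?I (length rows) t" and m: "mods (warr ?c) (insert 20 (wreg ?c)) ?s t"
    have "classes (p + 2) n (insert i Z) rows (tick t)"
      unfolding classes_def
    proof (intro conjI allI impI)
      fix k assume "k < length rows"
      then show "n dvd arr (tick t) (p + 2) k" using I by simp
      fix k' assume k': "k' < length rows"
      have k: "k < length rows" by fact
      have "arr t (p + 2) k = arr t (p + 2) k' \<longleftrightarrow> key k = key k'" using I k k' by metis
      also have "\<dots> \<longleftrightarrow> arr s p k = arr s p k' & (rows ! k) i = (rows ! k') i"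
      proof -
        obtain q q' where q: "arr s p k = n * q" "arr s p k' = n * q'"
          using c k k' unfolding classes_def by (meson dvdE)
        have "(rows ! k) i < n" "(rows ! k') i < n" using v k k' by auto
        then show ?thesis using pair_code_inj[of "(rows ! k) i" n "(rows ! k') i" q q'] n0 k
          by (auto simp: key_def q mult.commute)
      qed
      also have "\<dots> \<longleftrightarrow> (\<forall>j\<in>insert i Z. (rows ! k) j = (rows ! k') j)"
        using c k k' unfolding classes_def by auto
      finally show "arr (tick t) (p + 2) k = arr (tick t) (p + 2) k' \<longleftrightarrow> (\<forall>j\<in>insert i Z. (rows ! k) j = (rows ! k') j)"
        by simp
    qed
    then show "classes (p + 2) n (insert i Z) rows (tick t) & clk (tick t) <= clk s + 3 + 7 * length rows"
      using I by simp
  next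
    show "val (Var 3) t = length rows" if "mods (warr ?c) (insert 20 (wreg ?c)) ?s t" for t
      using that t by (simp add: mods_def tab_def)
  qed auto
  then show ?thesis by (simp add: refine_def)
qed

text \<open>Every column gets its own lookup array and its own array of classes, so nothing has to
  be cleared in between.\<close>

primrec refines :: "nat => nat list => nat => com" where
  "refines cb [] p = Skip"
| "refines cb (i # W) p = refine (cb + i) p ;; refines cb W (p + 2)"

lemma refines_sets: "warr (refines cb W p) \<subseteq> {p<..p + 2 * length W}" "wreg (refines cb W p) \<subseteq> {20, 22, 23}"
  by (induction W arbitrary: p) fastforce+

lemma wp_refines:
  assumes "tab cb W 3 s rows" "classes p n Z rows s" "set V \<subseteq> W" "reg s 0 = n"
    and "\<And>\<rho> i. \<rho> \<in> set rows ==> i \<in> W ==> \<rho> i < n" "\<And>a. p < a ==> arr s a = (\<lambda>_. 0)" "\<And>i. i \<in> W ==> cb + i < p"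
  shows "wp (refines cb V p) (\<lambda>t. classes (p + 2 * length V) n (Z \<union> set V) rows t &
    clk t <= clk s + length V * (3 + 7 * length rows)) s"
  using assms
proof (induction V arbitrary: p Z s)
  case (Cons i V)
  have "wp (refine (cb + i) p ;; refines cb V (p + 2)) (\<lambda>t. classes (p + 2 * length (i # V)) n (Z \<union> set (i # V)) rows t &
    clk t <= clk s + length (i # V) * (3 + 7 * length rows)) s"
  proof (rule wp_Seq[OF wp_refine[OF Cons.prems(1,2)]])
    fix t assume t: "classes (p + 2) n (insert i Z) rows t & clk t <= clk s + 3 + 7 * length rows"
      and m: "mods (warr (refine (cb + i) p)) (wreg (refine (cb + i) p)) s t"
    have "tab cb W 3 t rows"
    proof (rule tab_mods[OF Cons.prems(1) m])
      show "cb + j \<notin> warr (refine (cb + i) p)" if "j \<in> W" for j using Cons.prems(7)[OF that] by simp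
    qed auto
    moreover have "reg t 0 = n" "\<And>a. p + 2 < a ==> arr t a = (\<lambda>_. 0)"
      using m Cons.prems(4,6) by (auto simp: mods_def)
    moreover have "cb + j < p + 2" if "j \<in> W" for j using Cons.prems(7)[OF that] by simp
    ultimately have "wp (refines cb V (p + 2)) (\<lambda>u. classes (p + 2 + 2 * length V) n (insert i Z \<union> set V) rows u &
        clk u <= clk t + length V * (3 + 7 * length rows)) t"
      using t Cons.prems(3,5) by (intro Cons.IH) auto
    then show "wp (refines cb V (p + 2)) (\<lambda>t. classes (p + 2 * length (i # V)) n (Z \<union> set (i # V)) rows t &
      clk t <= clk s + length (i # V) * (3 + 7 * length rows)) t"
      by (rule wp_mono) (use t in \<open>auto simp: algebra_simps\<close>)
  qed (use Cons.prems in auto)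
  then show ?case by simp
qed simp

definition select :: "nat list => nat => nat => nat => nat => com" where
  "select V cb cb' c sn = Assign 25 (Lit 0) ;;
     For 20 (Var 3) (Cond (Elem sn (Elem c (Var 20))) Skip
       (Put sn (Elem c (Var 20)) (Lit 1) ;; copyc cb cb' V ;; Assign 25 (Sum (Var 25) (Lit 1)))) ;;
     Assign 3 (Var 25)"

lemma select_sets [simp]: "warr (select V cb cb' c sn) = insert sn ((+) cb' ` set V)" "wreg (select V cb cb' c sn) = {3, 20, 25}"
  by (auto simp: select_def)

lemma wp_select:
  assumes t: "tab cb W 3 s rows" and V: "set V \<subseteq> W" and c: "classes c n (set V) rows s"
    and z: "\<forall>i. arr s sn i = 0" and lay: "\<And>i. i \<in> W ==> cb + i < c" "c < sn" "sn < cb'"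
  shows "wp (select V cb cb' c sn) (\<lambda>t. table cb' (set V) t ((\<lambda>\<rho>. restrict \<rho> (set V)) ` set rows) &
    clk t <= clk s + 4 + (length V + 6) * length rows) s"
proof -
  let ?c = "Cond (Elem sn (Elem c (Var 20))) Skip
       (Put sn (Elem c (Var 20)) (Lit 1) ;; copyc cb cb' V ;; Assign 25 (Sum (Var 25) (Lit 1)))"
  let ?s = "assign 25 0 s"
  let ?r = "\<lambda>\<rho>. restrict \<rho> (set V)"
  let ?I = "\<lambda>k t. (\<exists>out. tab cb' (set V) 25 t out & distinct out & set out = ?r ` set (take k rows)) &
    (\<forall>x. arr t sn x ~= 0 \<longleftrightarrow> x \<in> arr s c ` {..<k}) & clk t <= clk s + 2 + (length V + 6) * k"
  have dis: "cb' + i ~= cb + j" if "i \<in> set V" "j \<in> W" for i j using lay(1)[OF that(2)] lay(2,3) by auto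
  have dis': "cb + j \<notin> warr ?c" if "j \<in> W" for j using lay(1)[OF that] lay(2,3) by auto
  have req: "?r \<rho> = ?r \<rho>' \<longleftrightarrow> (\<forall>i\<in>set V. \<rho> i = \<rho>' i)" for \<rho> \<rho>' :: "nat => nat"
    by (auto simp: fun_eq_iff restrict_def)
  have "wp (For 20 (Var 3) ?c) (\<lambda>t. ((\<exists>out. tab cb' (set V) 25 t out & distinct out & set out = ?r ` set rows) & clk t <= clk s + 3 + (length V + 6) * length rows)) ?s"
  proof (rule wp_For[where N = "length rows" and I = ?I])
    show "?I 0 (assign 20 0 ?s)" using z by (auto simp: tab_def)
  next
    fix k t assume I: "?I k t" and m: "mods (warr ?c) (insert 20 (wreg ?c)) ?s t" and k: "reg t 20 = k" "k < length rows"
    obtain out where out: "tab cb' (set V) 25 t out" "distinct out" "set out = ?r ` set (take k rows)"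
      using I by blast
    have tt: "tab cb W 3 t rows" by (rule tab_mods[OF _ m]) (use t dis' in auto)
    have ct: "arr t c = arr s c" using m lay(2,3) by (auto simp: mods_def)
    have tk: "set (take (Suc k) rows) = insert (rows ! k) (set (take k rows))"
      using k by (simp add: take_Suc_conv_app_nth)
    have seen: "arr s c k \<in> arr s c ` {..<k} \<longleftrightarrow> ?r (rows ! k) \<in> ?r ` set (take k rows)"
    proof -
      have "arr s c k \<in> arr s c ` {..<k} \<longleftrightarrow> (\<exists>j<k. arr s c k = arr s c j)" by auto
      also have "\<dots> \<longleftrightarrow> (\<exists>j<k. ?r (rows ! k) = ?r (rows ! j))"
        using c k unfolding classes_def req by (meson order.strict_trans)
      also have "\<dots> \<longleftrightarrow> ?r (rows ! k) \<in> ?r ` set (take k rows)"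
      proof -
        have "set (take k rows) = (!) rows ` {0..<k}" using nth_image[of k rows] k by simp
        then show ?thesis by (simp only: image_image) (auto simp: image_iff)
      qed
      finally show ?thesis .
    qed
    have lt: "{..<Suc k} = insert k {..<k}" by auto
    show "wp ?c (\<lambda>u. ?I (Suc k) (assign 20 (Suc k) u)) (tick t)"
    proof (cases "arr s c k \<in> arr s c ` {..<k}")
      case True
      then have "arr t sn (arr s c k) ~= 0" using I by blast
      moreover have "?r ` set (take (Suc k) rows) = ?r ` set (take k rows)"
        unfolding tk using seen True by auto
      moreover have "arr s c ` {..<Suc k} = arr s c ` {..<k}" unfolding lt using True by auto
      ultimately show ?thesis using I out k ct by auto
    next
      case False
      then have z0: "arr t sn (arr s c k) = 0" using I by blast
      let ?t = "put sn (arr s c k) 1 (tick (tick t))"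
      let ?out = "out @ [?r (rows ! k)]"
      have "wp (copyc cb cb' V) (\<lambda>v. (\<forall>i\<in>set V. arr v (cb' + i) = (arr ?t (cb' + i))(reg ?t 25 := arr ?t (cb + i) (reg ?t 20))) &
          clk v = clk ?t + length V) ?t"
        using dis V by (intro wp_copyc) auto
      then have "wp (copyc cb cb' V) (\<lambda>u. ?I (Suc k) (assign 20 (Suc k) (assign 25 (reg u 25 + 1) u))) ?t"
      proof (rule wp_frame)
        fix v assume v: "(\<forall>i\<in>set V. arr v (cb' + i) = (arr ?t (cb' + i))(reg ?t 25 := arr ?t (cb + i) (reg ?t 20))) &
            clk v = clk ?t + length V"
          and mv: "mods (warr (copyc cb cb' V)) (wreg (copyc cb cb' V)) ?t v"
        let ?v = "assign 20 (Suc k) (assign 25 (reg v 25 + 1) v)"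
        have r25: "reg v 25 = length out" "reg t 25 = length out" using mv out(1) by (auto simp: mods_def tab_def)
        have src: "arr ?t (cb + i) (reg ?t 20) = (rows ! k) i" if "i \<in> set V" for i
          using tt k V that lay(1)[of i] lay(2,3) by (auto simp: tab_def)
        have col: "arr v (cb' + i) = (arr t (cb' + i))(length out := (rows ! k) i)" if "i \<in> set V" for i
          using v that src[OF that] r25 lay(3) by auto
        have "tab cb' (set V) 25 ?v ?out"
          using out(1) col r25 by (auto simp: tab_def nth_append less_Suc_eq)
        moreover have "distinct ?out" using out seen False by simp
        moreover have "set ?out = ?r ` set (take (Suc k) rows)" unfolding tk using out by simp
        moreover have "arr v sn = (arr t sn)(arr s c k := 1)"
        proof -
          have "sn \<notin> warr (copyc cb cb' V)" using lay(3) by auto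
          from mods_arr[OF mv this] show ?thesis by simp
        qed
        then have "arr ?v sn x ~= 0 \<longleftrightarrow> x \<in> arr s c ` {..<Suc k}" for x
          unfolding lt using I by auto
        moreover have "clk ?v <= clk s + 2 + (length V + 6) * Suc k" using v I by simp
        ultimately show "?I (Suc k) ?v" by blast
      qed
      then show ?thesis using z0 k ct by simp
    qed
  next
    fix t assume "?I (length rows) t"
    then show "((\<exists>out. tab cb' (set V) 25 (tick t) out & distinct out & set out = ?r ` set rows) & clk (tick t) <= clk s + 3 + (length V + 6) * length rows)"
      by auto
  next
    show "val (Var 3) t = length rows" if "mods (warr ?c) (insert 20 (wreg ?c)) ?s t" for t
      using that t by (simp add: mods_def tab_def)
  qed auto
  then have "wp (For 20 (Var 3) ?c) (\<lambda>t. table cb' (set V) (assign 3 (reg t 25) t) (?r ` set rows) &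
      clk (assign 3 (reg t 25) t) <= clk s + 4 + (length V + 6) * length rows) ?s"
  proof (rule wp_mono)
    fix t assume t: "(\<exists>out. tab cb' (set V) 25 t out & distinct out & set out = ?r ` set rows) & clk t <= clk s + 3 + (length V + 6) * length rows"
    then obtain out where "tab cb' (set V) 25 t out" "distinct out" "set out = ?r ` set rows" by blast
    then have "tab cb' (set V) 3 (assign 3 (reg t 25) t) out" by (simp add: tab_def)
    then show "table cb' (set V) (assign 3 (reg t 25) t) (?r ` set rows) &
      clk (assign 3 (reg t 25) t) <= clk s + 4 + (length V + 6) * length rows"
      using t \<open>distinct out\<close> \<open>set out = _\<close> unfolding table_def by auto
  qed
  then show ?thesis by (simp add: select_def)
qed

definition dedupe :: "nat list => nat => nat => com" where
  "dedupe V cb p = refines cb V p ;;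
     select V cb (p + 2 * length V + 2) (p + 2 * length V) (p + 2 * length V + 1)"

lemma dedupe_sets: "warr (dedupe V cb p) \<subseteq> {p<..p + 2 * length V + 1} \<union> (+) (p + 2 * length V + 2) ` set V" "wreg (dedupe V cb p) \<subseteq> {3, 20, 22, 23, 25}"
  using refines_sets[of cb V p] by (auto simp: dedupe_def)

text \<open>The time is linear in the number of rows, without sorting or hashing: rows that agree on
  \<open>V\<close> end up in the same class, and a class is a single number that can address a
  flag.\<close>

theorem wp_dedupe:
  assumes t: "table cb W s T" and V: "set V \<subseteq> W" and r: "reg s 0 = n"
    and v: "\<And>\<rho> i. \<rho> \<in> T ==> i \<in> W ==> \<rho> i < n" and z: "\<And>a. p <= a ==> arr s a = (\<lambda>_. 0)"
    and lay: "\<And>i. i \<in> W ==> cb + i < p"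
  shows "wp (dedupe V cb p) (\<lambda>t. table (p + 2 * length V + 2) (set V) t ((\<lambda>\<rho>. restrict \<rho> (set V)) ` T) &
    clk t <= clk s + (20 + 20 * length V) * (card T + 1)) s"
proof -
  obtain rows where rows: "tab cb W 3 s rows" "distinct rows" "set rows = T"
    using t by (auto simp: table_def)
  have len: "length rows = card T" using rows(2,3) distinct_card[of rows] by simp
  let ?L = "length V"
  have cl0: "classes p n {} rows s" using z[of p] by (simp add: classes_def)
  show ?thesis unfolding dedupe_def
  proof (rule wp_Seq[OF wp_refines[OF rows(1) cl0 V r]])
    fix u assume u: "classes (p + 2 * ?L) n ({} \<union> set V) rows u & clk u <= clk s + ?L * (3 + 7 * length rows)"
      and m: "mods (warr (refines cb V p)) (wreg (refines cb V p)) s u"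
    have m': "mods {p<..p + 2 * ?L} {20, 22, 23} s u" using mods_mono[OF m refines_sets] .
    have tu: "tab cb W 3 u rows"
    proof (rule tab_mods[OF rows(1) m'])
      show "cb + i \<notin> {p<..p + 2 * ?L}" if "i \<in> W" for i using lay[OF that] by simp
    qed auto
    have sn: "\<forall>i. arr u (p + 2 * ?L + 1) i = 0" using m' z[of "p + 2 * ?L + 1"] by (simp add: mods_def)
    show "wp (select V cb (p + 2 * ?L + 2) (p + 2 * ?L) (p + 2 * ?L + 1))
      (\<lambda>t. table (p + 2 * ?L + 2) (set V) t ((\<lambda>\<rho>. restrict \<rho> (set V)) ` T) &
      clk t <= clk s + (20 + 20 * ?L) * (card T + 1)) u"
    proof (rule wp_mono[OF wp_select[OF tu V _ sn]])
      show "cb + i < p + 2 * ?L" if "i \<in> W" for i using lay[OF that] by simp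
      fix v assume v: "table (p + 2 * ?L + 2) (set V) v ((\<lambda>\<rho>. restrict \<rho> (set V)) ` set rows) &
        clk v <= clk u + 4 + (?L + 6) * length rows"
      have "?L * (3 + 7 * length rows) + 4 + (?L + 6) * length rows <= (20 + 20 * ?L) * (length rows + 1)"
        by (simp add: algebra_simps)
      then show "table (p + 2 * ?L + 2) (set V) v ((\<lambda>\<rho>. restrict \<rho> (set V)) ` T) &
        clk v <= clk s + (20 + 20 * ?L) * (card T + 1)"
        using u v rows(3) len by auto
    qed (use u in auto)
  qed (use rows v z lay in auto)
qed

section \<open>One extension step on tables\<close>

context two_way
begin

text \<open>Only values that occur in column \<open>x\<close> act as sources, so every pair found
  extends at least one row.\<close>

definition extend :: "nat list => nat => nat => nat => nat => com" where
  "extend W cb p x y = mark_column (p + 8) (cb + x) ;; pairs p ;; join W cb (p + 15) x y (p + 11)"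

lemma extend_sets: "warr (extend W cb p x y) \<subseteq> {p..p + 14} \<union> (+) (p + 15) ` set (y # W)" "wreg (extend W cb p x y) \<subseteq> {3} \<union> {12..25}"
  by (auto simp: extend_def)

theorem wp_extend:
  assumes g: "graph_ok As K n s" and t: "table cb (set W) s T" and AT: "A = (\<lambda>\<rho>. \<rho> x) ` T"
    and x: "x \<in> set W" and y: "y \<notin> set W" and m: "\<And>i. i \<in> set (y # W) ==> i <= m"
    and lay: "cb + m < p" "4 < p" and z: "\<And>a. p <= a ==> arr s a = (\<lambda>_. 0)"
  shows "wp (extend W cb p x y) (\<lambda>u. \<exists>cap. cap_ok cap &
    table (p + 15) (set (y # W)) u {\<rho>(y := b) | \<rho> b. \<rho> \<in> T & (\<rho> x, b) \<in> Rel} &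
    clk u <= clk s + 200 * (X * cap) + (length W + 20) * (card T + card {\<rho>(y := b) | \<rho> b. \<rho> \<in> T & (\<rho> x, b) \<in> Rel} + 1)) s"
proof -
  let ?T = "{\<rho>(y := b) | \<rho> b. \<rho> \<in> T & (\<rho> x, b) \<in> Rel}"
  obtain rows where rows: "tab cb (set W) 3 s rows" "distinct rows" "set rows = T" "T \<subseteq> extensional (set W)"
    using t by (auto simp: table_def)
  have len: "length rows = card T" using rows(2,3) distinct_card[of rows] by simp
  let ?Q = "\<lambda>u. \<exists>cap. cap_ok cap & table (p + 15) (set (y # W)) u ?T &
    clk u <= clk s + 200 * (X * cap) + (length W + 20) * (card T + card ?T + 1)"
  show ?thesis unfolding extend_def
  proof (rule wp_Seq[OF wp_mark_column[OF rows(1) x]])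
    fix u assume u: "(\<forall>i. arr u (p + 8) i ~= 0 \<longleftrightarrow> i \<in> (\<lambda>\<rho>. \<rho> x) ` set rows) & clk u <= clk s + 2 + 3 * length rows"
      and mu: "mods (warr (mark_column (p + 8) (cb + x))) (wreg (mark_column (p + 8) (cb + x))) s u"
    have gu: "graph_ok As K n u" using graph_ok_mods[OF g mu] lay by auto
    have zu: "arr u a = (\<lambda>_. 0)" if "a \<in> {p..<p + 15} - {p + 8}" for a
      using mu z that by (auto simp: mods_def)
    have tu: "tab cb (set W) 3 u rows"
    proof (rule tab_mods[OF rows(1) mu])
      show "cb + i \<notin> warr (mark_column (p + 8) (cb + x))" if "i \<in> set W" for i
        using m[of i] that lay by auto
    qed auto
    show "wp (pairs p ;; join W cb (p + 15) x y (p + 11)) ?Q u"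
    proof (rule wp_Seq[OF wp_pairs[OF gu zu lay(2)]])
      fix v assume "\<exists>cap Ps. cap_ok cap & links (p + 11) 21 v Ps & distinct Ps & set Ps = Rel & clk v <= clk u + 200 * (X * cap)"
        and mv: "mods (warr (pairs p)) (wreg (pairs p)) u v"
      then obtain cap Ps where v: "cap_ok cap" "links (p + 11) 21 v Ps" "distinct Ps" "set Ps = Rel" "clk v <= clk u + 200 * (X * cap)"
        by blast
      have tv: "tab cb (set W) 3 v rows"
      proof (rule tab_mods[OF tu mv])
        show "cb + i \<notin> warr (pairs p)" if "i \<in> set W" for i
          using m[of i] that lay by auto
      qed auto
      note jp = joined_props[OF rows(2) _ v(3) y, of x]
      have jT: "set (joined Ps x y rows) = ?T" using jp rows(3,4) v(4) by auto
      have jl: "length (joined Ps x y rows) = card ?T" using jp rows(3,4) jT distinct_card by metis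
      show "wp (join W cb (p + 15) x y (p + 11)) ?Q v"
      proof (rule wp_mono[OF wp_join[OF tv v(2) x y m]])
        fix w assume w: "tab (p + 15) (set (y # W)) 3 w (joined Ps x y rows) &
          clk w <= clk v + 4 + 4 * length rows + (length W + 6) * length (joined Ps x y rows)"
        have "table (p + 15) (set (y # W)) w ?T"
          unfolding table_def using w jp jT rows(3,4) by (intro conjI exI[of _ "joined Ps x y rows"]) auto
        moreover have "2 + 3 * card T + 4 + 4 * card T + (length W + 6) * card ?T <= (length W + 20) * (card T + card ?T + 1)"
          by (simp add: algebra_simps)
        then have "clk w <= clk s + 200 * (X * cap) + (length W + 20) * (card T + card ?T + 1)"
          using w[THEN conjunct2] u[THEN conjunct2] v(5) unfolding len jl by linarith
        ultimately show "?Q w" using v(1) by blast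
      qed (use lay in auto)
    qed (use u rows(3) AT in auto)
  next
    show "cb + x ~= p + 8" using m[of x] x lay by auto
  qed (use z[of "p + 8"] in auto)
qed

end

section \<open>Tree-shaped constraint problems\<close>

text \<open>
  The variables are \<open>1, \<dots>, m\<close>; variable \<open>0\<close> is an artificial common root with the only value \<open>0\<close>,
  to which the roots of the query forest are attached by unrestricted constraints. The product
  graph has a state \<open>i\<close> for every variable and a block of states (above \<open>m\<close>, of level \<open>i\<close>) for the
  automaton of the constraint between \<open>par i\<close> and \<open>i\<close>; \<open>Ga\<close> holds the automaton transitions.
\<close>

locale csp =
  fixes m n :: nat and par off lev :: "nat => nat" and acc :: "nat => nat set"
    and Ga :: "((nat \<times> nat) \<times> (nat \<times> nat)) set"
  assumes par_less: "i \<in> {1..m} ==> par i < i"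
    and off: "i \<in> {1..m} ==> m < off i" "i \<in> {1..m} ==> lev (off i) = i"
    and acc: "i \<in> {1..m} ==> q \<in> acc i ==> m < q" "i \<in> {1..m} ==> q \<in> acc i ==> lev q = i"
    and Ga: "((j, a), (j', b)) \<in> Ga ==> m < j & m < j' & lev j' = lev j & lev j \<in> {1..m} & par (lev j) ~= 0 & a < n & b < n"
begin

definition Rl :: "nat => nat => nat => bool" where
  "Rl c a b \<longleftrightarrow> b < n & (if par c = 0 then a = 0 else \<exists>q\<in>acc c. ((off c, a), (q, b)) \<in> Ga\<^sup>*)"

text \<open>The values that survive the bottom-up pass: \<open>v\<close> at \<open>i\<close> extends
  to the whole subtree of \<open>i\<close>. As children have larger indices than parents, the
  recursion is well-founded and the least fixed point is the intended predicate.\<close>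

inductive D :: "nat => nat => bool" where
  "(i ~= 0 --> v < n) ==> (\<forall>c. c \<in> {1..m} & par c = i --> (\<exists>b. Rl c v b & D c b)) ==> D i v"

lemma D_iff: "D i v \<longleftrightarrow> (i ~= 0 --> v < n) & (\<forall>c. c \<in> {1..m} & par c = i --> (\<exists>b. Rl c v b & D c b))"
  by (subst D.simps) auto

lemma D_less: "D i v ==> i ~= 0 ==> v < n"
  by (erule D.cases) auto

definition ent :: "nat => ((nat \<times> nat) \<times> (nat \<times> nat)) set" where
  "ent i = {((q, a), (i, v)) | q a v. D i v & (if par i = 0 then q = off i & a = 0 else q \<in> acc i & a = v)}"

definition lv :: "nat => ((nat \<times> nat) \<times> (nat \<times> nat)) set" where
  "lv i = {((i, v), (off c, v)) | v c. D i v & (i = 0 --> v = 0) & c \<in> {1..m} & par c = i}"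

text \<open>The graph at the stage of the bottom-up pass where the variables from \<open>k\<close>
  on are finished; the automata are present from the start. Variable 0 is never entered, hence
  \<open>max 1 k\<close>.\<close>

definition Gam :: "nat => ((nat \<times> nat) \<times> (nat \<times> nat)) set" where
  "Gam k = Ga \<union> (\<Union>i\<in>{max 1 k..m}. ent i) \<union> (\<Union>i\<in>{k..m}. lv i)"

lemma Gam_cases:
  assumes "((j, a), (j', b)) \<in> Gam k"
  obtains (aut) "((j, a), (j', b)) \<in> Ga"
  | (ent) "j' \<in> {1..m}" "k <= j'" "m < j" "lev j = j'" "D j' b" "if par j' = 0 then j = off j' & a = 0 else j \<in> acc j' & a = b"
  | (lv) c where "c \<in> {1..m}" "par c = j" "j' = off c" "a = b" "D j a" "j = 0 --> a = 0" "j <= m"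
proof -
  consider "((j, a), (j', b)) \<in> Ga" | i where "i \<in> {max 1 k..m}" "((j, a), (j', b)) \<in> ent i"
    | i where "i \<in> {k..m}" "((j, a), (j', b)) \<in> lv i"
    using assms unfolding Gam_def by blast
  then show thesis
  proof cases
    case 1
    then show ?thesis by (rule aut)
  next
    case (2 i)
    then have "m < j & lev j = i" using off[of i] acc[of i] by (auto simp: ent_def split: if_splits)
    with 2 show ?thesis by (intro ent) (auto simp: ent_def)
  next
    case (3 i)
    then obtain c where "c \<in> {1..m}" "par c = j" "j' = off c" "a = b" "D j a" "j = 0 --> a = 0" "j <= m"
      by (auto simp: lv_def)
    then show ?thesis by (rule lv)
  qed
qed

text \<open>No arc leads to a smaller level, so a path from the gate of \<open>c\<close> to
  \<open>c\<close> cannot leave the block of \<open>c\<close> and return: it is an automaton run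
  followed by one entry arc.\<close>

theorem reach_child:
  assumes c: "c \<in> {1..m}" "k <= c"
  shows "((off c, a), (c, b)) \<in> (Gam k)\<^sup>* \<longleftrightarrow> Rl c a b & D c b"
proof
  define level where "level j = (if j <= m then j else lev j)" for j
  assume "((off c, a), (c, b)) \<in> (Gam k)\<^sup>*"
  then have "(m < fst (c, b) & lev (fst (c, b)) = c & ((off c, a), (c, b)) \<in> Ga\<^sup>*) \<or>
    (fst (c, b) = c & Rl c a (snd (c, b)) & D c (snd (c, b))) \<or> c < level (fst (c, b))"
  proof (induction rule: rtrancl_induct)
    case base
    then show ?case using off[OF c(1)] by simp
  next
    case (step x y)
    obtain j v j' w where xy: "x = (j, v)" "y = (j', w)" by (cases x, cases y)
    from step.hyps(2) have "((j, v), (j', w)) \<in> Gam k" by (simp add: xy)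
    then show ?case
    proof (cases rule: Gam_cases)
      case aut
      then show ?thesis using Ga[OF aut] step.IH c by (auto simp: xy level_def intro: rtrancl.rtrancl_into_rtrancl)
    next
      case ent
      show ?thesis
      proof (cases "c < level j")
        case True
        then show ?thesis using ent by (auto simp: xy level_def)
      next
        case False
        then have l: "lev j = c" "((off c, a), (j, v)) \<in> Ga\<^sup>*" using step.IH ent c by (auto simp: xy level_def)
        then have j': "j' = c" using ent by simp
        have "w < n" using D_less[OF ent(5)] ent(1) by simp
        \<comment> \<open>The block of a root has no transitions, so the entry arc starts at the
          gate itself, and it exists only for the value 0.\<close>
        moreover have "a = 0" if "par c = 0"
        proof -
          have "((off c, a), (j, v)) \<in> Ga\<^sup>*" by fact
          then have "(off c, a) = (j, v)"
          proof (cases rule: rtranclE)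
            case (step z)
            then show ?thesis using Ga[of "fst z" "snd z" j v] l that by auto
          qed
          then show ?thesis using ent that j' by auto
        qed
        ultimately have "Rl c a w" using ent j' l(2) by (auto simp: Rl_def split: if_splits)
        then show ?thesis using ent j' by (auto simp: xy)
      qed
    next
      case (lv c')
      have "j < c'" using lv par_less by blast
      then have "c < c'" using step.IH lv c by (auto simp: xy level_def)
      then show ?thesis using off[OF lv(1)] lv by (auto simp: xy level_def)
    qed
  qed
  then show "Rl c a b & D c b" using c by (auto simp: level_def)
next
  assume r: "Rl c a b & D c b"
  have e: "ent c \<subseteq> Gam k" using c by (auto simp: Gam_def)
  show "((off c, a), (c, b)) \<in> (Gam k)\<^sup>*"
  proof (cases "par c = 0")
    case True
    then have "((off c, a), (c, b)) \<in> ent c" using r by (auto simp: ent_def Rl_def)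
    then show ?thesis using e by blast
  next
    case False
    then obtain q where q: "q \<in> acc c" "((off c, a), (q, b)) \<in> Ga\<^sup>*" using r by (auto simp: Rl_def)
    then have "((q, b), (c, b)) \<in> Gam k" using r e False by (auto simp: ent_def)
    moreover have "((off c, a), (q, b)) \<in> (Gam k)\<^sup>*" using q(2) rtrancl_mono[of Ga "Gam k"] by (auto simp: Gam_def)
    ultimately show ?thesis by simp
  qed
qed

text \<open>Values along the tree path from \<open>x\<close> down to \<open>y\<close>, each
  consistent with its predecessor and extendable to its subtree. This is the relation that one
  extension step joins with.\<close>

inductive Chain :: "nat => nat => nat => nat => bool" for x a where
  refl: "Chain x a x a"
| step: "Chain x a z v ==> D z v ==> (z = 0 ==> v = 0) ==> c \<in> {1..m} ==> par c = z ==> Rl c v b ==> D c b ==> Chain x a c b"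

lemma Chain_le: "Chain x a y b ==> x <= m ==> x <= y & y <= m"
proof (induction rule: Chain.induct)
  case (step z v c b)
  then show ?case using par_less[of c] by auto
qed simp

theorem reach_chain:
  assumes x: "x <= m" and y: "y <= m"
  shows "((x, a), (y, b)) \<in> (Gam 0)\<^sup>* \<longleftrightarrow> Chain x a y b"
proof
  assume "((x, a), (y, b)) \<in> (Gam 0)\<^sup>*"
  then have "(fst (y, b) <= m --> Chain x a (fst (y, b)) (snd (y, b))) &
    (m < fst (y, b) --> lev (fst (y, b)) \<in> {1..m} &
      (\<exists>v. Chain x a (par (lev (fst (y, b)))) v & D (par (lev (fst (y, b)))) v & (par (lev (fst (y, b))) = 0 --> v = 0) &
        ((off (lev (fst (y, b))), v), (y, b)) \<in> Ga\<^sup>*))"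
  proof (induction rule: rtrancl_induct)
    case base
    then show ?case using x by (simp add: Chain.refl)
  next
    case (step s t)
    obtain j v j' w where st: "s = (j, v)" "t = (j', w)" by (cases s, cases t)
    from step.hyps(2) have "((j, v), (j', w)) \<in> Gam 0" by (simp add: st)
    then show ?case
    proof (cases rule: Gam_cases)
      case aut
      then show ?thesis using Ga[OF aut] step.IH by (auto simp: st intro: rtrancl.rtrancl_into_rtrancl)
    next
      case ent
      then obtain u where u: "Chain x a (par j') u" "D (par j') u" "par j' = 0 --> u = 0" "((off j', u), (j, v)) \<in> Ga\<^sup>*"
        using step.IH by (auto simp: st)
      have "w < n" using D_less[OF ent(5)] ent(1) by simp
      then have "Rl j' u w" using u ent by (auto simp: Rl_def split: if_splits)
      moreover have "par j' = 0 ==> u = 0" using u(3) by simp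
      ultimately have "Chain x a j' w" using Chain.step[OF u(1,2) _ ent(1) HOL.refl _ ent(5)] by simp
      then show ?thesis using ent(1) by (simp add: st)
    next
      case (lv c)
      then show ?thesis using step.IH off[OF lv(1)] by (auto simp: st)
    qed
  qed
  then show "Chain x a y b" using y by simp
next
  assume "Chain x a y b"
  then show "((x, a), (y, b)) \<in> (Gam 0)\<^sup>*"
  proof (induction rule: Chain.induct)
    case (step z v c b)
    have zc: "z < c" using par_less step.hyps by blast
    have "((z, v), (off c, v)) \<in> Gam 0" using step.hyps zc by (auto simp: Gam_def lv_def)
    moreover have "((off c, v), (c, b)) \<in> (Gam 0)\<^sup>*" using reach_child[of c 0] step.hyps by simp
    ultimately show ?case using step.IH by (meson rtrancl.rtrancl_into_rtrancl rtrancl_trans)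
  qed simp
qed

text \<open>The solutions. Nothing is required beyond index \<open>m\<close>; counting always
  happens after the restriction in \<open>proj\<close>.\<close>

definition H :: "(nat => nat) set" where
  "H = {\<mu>. \<mu> 0 = 0 & (\<forall>c\<in>{1..m}. Rl c (\<mu> (par c)) (\<mu> c))}"

lemma H_less: "\<mu> \<in> H ==> i \<in> {1..m} ==> \<mu> i < n"
  by (auto simp: H_def Rl_def)

lemma H_D: "\<mu> \<in> H ==> i <= m ==> D i (\<mu> i)"
proof (induction "m - i" arbitrary: i rule: less_induct)
  case less
  have "\<exists>b. Rl c (\<mu> i) b & D c b" if c: "c \<in> {1..m}" "par c = i" for c
  proof -
    have "D c (\<mu> c)" using less c par_less[OF c(1)] by auto
    then show ?thesis using less.prems c by (auto simp: H_def)
  qed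
  then show ?case using less.prems H_less by (subst D_iff) auto
qed

section \<open>Exchanging the values of a subtree\<close>

definition desc :: "nat => nat => bool" where
  "desc c j \<longleftrightarrow> (c, j) \<in> {(par i, i) | i. i \<in> {1..m}}\<^sup>*"

lemma desc_refl [simp]: "desc c c"
  by (simp add: desc_def)

lemma desc_step: "i \<in> {1..m} ==> desc c (par i) ==> desc c i"
  unfolding desc_def by (rule rtrancl.rtrancl_into_rtrancl) auto

lemma desc_cases: "desc c j ==> c ~= j ==> j \<in> {1..m} & desc c (par j)"
  unfolding desc_def by (erule rtranclE) auto

lemma desc_trans: "desc a b ==> desc b c ==> desc a c"
  unfolding desc_def by (rule rtrancl_trans)

lemma desc_le: "desc c j ==> c <= j"
proof (induction j rule: less_induct)
  case (less j)
  show ?case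
  proof (cases "c = j")
    case False
    then have j: "j \<in> {1..m}" "desc c (par j)" using desc_cases[OF less.prems] by blast+
    then have "c <= par j" using less.IH[OF par_less] by blast
    then show ?thesis using par_less[OF j(1)] by simp
  qed simp
qed

lemma desc_0: "j <= m ==> desc 0 j"
proof (induction j rule: less_induct)
  case (less j)
  then show ?case using par_less[of j] by (cases "j = 0") (auto intro: desc_step)
qed

text \<open>Changes a solution on the subtree of \<open>c\<close> only: the value at
  \<open>c\<close> becomes \<open>b\<close>, and deeper values are chosen anew on the way down,
  which \<open>D\<close> makes possible.\<close>

function glue :: "(nat => nat) => nat => nat => nat => nat" where
  "glue \<mu> c b j = (if j = c then b else if j \<in> {1..m} & desc c j
     then (SOME v. Rl j (glue \<mu> c b (par j)) v & D j v) else \<mu> j)"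
  by pat_completeness auto
termination by (relation "measure (\<lambda>(\<mu>, c, b, j). j)") (use par_less in auto)

declare glue.simps [simp del]

lemma glue_D:
  assumes "D c b"
  shows "desc c j ==> D j (glue \<mu> c b j) & (j ~= c --> Rl j (glue \<mu> c b (par j)) (glue \<mu> c b j))"
proof (induction j rule: less_induct)
  case (less j)
  show ?case
  proof (cases "j = c")
    case True
    then show ?thesis using assms by (simp add: glue.simps)
  next
    case False
    then have j: "j \<in> {1..m}" "desc c (par j)" using desc_cases less.prems by blast+
    then have "D (par j) (glue \<mu> c b (par j))" using less.IH par_less by blast
    then have "\<exists>v. Rl j (glue \<mu> c b (par j)) v & D j v" using j by (subst (asm) D_iff) blast
    from someI_ex[OF this] show ?thesis
      using False j less.prems by (subst (1 3) glue.simps) simp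
  qed
qed

lemma glue_H:
  assumes \<mu>: "\<mu> \<in> H" and c: "c \<in> {1..m}" and r: "Rl c (\<mu> (par c)) b" "D c b"
  shows "glue \<mu> c b \<in> H & glue \<mu> c b c = b & (\<forall>j. \<not> desc c j --> glue \<mu> c b j = \<mu> j)"
proof -
  have out: "glue \<mu> c b j = \<mu> j" if "\<not> desc c j" for j
    using that by (subst glue.simps) auto
  have "Rl j (glue \<mu> c b (par j)) (glue \<mu> c b j)" if j: "j \<in> {1..m}" for j
  proof (cases "desc c j")
    case True
    show ?thesis
    proof (cases "j = c")
      case True
      have "\<not> desc c (par c)" using desc_le par_less[OF c] by fastforce
      then show ?thesis using r out True by (simp add: glue.simps)
    next
      case False
      then show ?thesis using glue_D[OF r(2) True] by blast
    qed
  next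
    case False
    then have "\<not> desc c (par j)" using desc_step[OF j] by blast
    then show ?thesis using out False \<mu> j by (auto simp: H_def)
  qed
  moreover have "\<not> desc c 0" using desc_le c by fastforce
  then have "glue \<mu> c b 0 = 0" using out \<mu> by (simp add: H_def)
  ultimately show ?thesis using out by (auto simp: H_def glue.simps[of _ c _ c])
qed

lemma D_0_H: "D 0 0 ==> H ~= {}"
proof -
  assume d: "D 0 0"
  have "glue (\<lambda>_. 0) 0 0 \<in> H"
    using glue_D[OF d] desc_0 by (auto simp: H_def glue.simps[of _ 0 _ 0])
  then show ?thesis by blast
qed

definition proj :: "nat set => (nat => nat) set" where
  "proj W = (\<lambda>\<mu>. restrict \<mu> W) ` H"

lemma proj_0: "proj {0} = (if D 0 0 then {\<lambda>i\<in>{0}. 0} else {})"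
proof -
  have "D 0 0" if \<mu>: "\<mu> \<in> H" for \<mu>
  proof -
    have "\<mu> 0 = 0" using \<mu> by (simp add: H_def)
    then show ?thesis using H_D[OF \<mu>, of 0] by simp
  qed
  then have "H = {}" if "\<not> D 0 0" using that by blast
  moreover have "restrict \<mu> {0} = (\<lambda>i\<in>{0}. 0)" if "\<mu> \<in> H" for \<mu>
    using that by (auto simp: H_def restrict_def)
  then have "proj {0} = (\<lambda>_. \<lambda>i\<in>{0}. 0) ` H" unfolding proj_def by (intro image_cong) auto
  ultimately show ?thesis using D_0_H by auto
qed

lemma Chain_H:
  assumes "\<mu> \<in> H" "desc x y" "y <= m" "x <= m"
  shows "Chain x (\<mu> x) y (\<mu> y)"
  using assms
proof (induction y rule: less_induct)
  case (less y)
  show ?case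
  proof (cases "x = y")
    case False
    then have y: "y \<in> {1..m}" "desc x (par y)" using desc_cases less.prems by blast+
    have "Chain x (\<mu> x) (par y) (\<mu> (par y))" using less y par_less[OF y(1)] by auto
    moreover have "Rl y (\<mu> (par y)) (\<mu> y)" "D y (\<mu> y)" "D (par y) (\<mu> (par y))"
      using less.prems(1,3) y(1) par_less[OF y(1)] H_D by (auto simp: H_def)
    ultimately show ?thesis using Chain.step[OF _ _ _ y(1) HOL.refl] less.prems(1) by (auto simp: H_def)
  qed (simp add: Chain.refl)
qed

lemma Chain_desc: "Chain x a y b ==> desc x y"
  by (induction rule: Chain.induct) (auto intro: desc_step)

text \<open>The branch of \<open>x\<close> that contains \<open>y\<close> has no variable of
  \<open>W\<close>, so all of it may be chosen again without touching the columns already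
  present.\<close>

definition separates :: "nat => nat => nat set => bool" where
  "separates x y W \<longleftrightarrow> (\<forall>c. desc x c & c ~= x & desc c y --> (\<forall>w\<in>W. \<not> desc c w))"

lemma Chain_glue:
  assumes "Chain x a y b" "\<mu> \<in> H" "\<mu> x = a" "separates x y W" "x \<in> W"
  shows "\<exists>\<mu>'\<in>H. \<mu>' y = b & (\<forall>w\<in>W. \<mu>' w = \<mu> w)"
  using assms
proof (induction rule: Chain.induct)
  case (step z v c b)
  have zc: "desc z c" using step.hyps desc_step by auto
  have "separates x z W" using step.prems(3) zc desc_trans unfolding separates_def by blast
  then obtain \<mu>' where \<mu>': "\<mu>' \<in> H" "\<mu>' z = v" "\<forall>w\<in>W. \<mu>' w = \<mu> w" using step by blast
  have xc: "desc x c" using Chain_desc[OF step.hyps(1)] zc desc_trans by blast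
  moreover have "c ~= x" using desc_le[OF Chain_desc[OF step.hyps(1)]] par_less[of c] step.hyps by auto
  ultimately have xc: "desc x c" "c ~= x" by auto
  then have "\<forall>w\<in>W. \<not> desc c w" using step.prems(3) unfolding separates_def by auto
  then show ?case using glue_H[OF \<mu>'(1) step.hyps(4), of b] \<mu>' step.hyps by (intro bexI[of _ "glue \<mu>' c b"]) auto
qed auto

text \<open>Any chain from the present value of \<open>x\<close> can be glued into the solution
  behind a row. Joining with \<open>Chain\<close> thus produces a projection of full solutions,
  without dangling tuples.\<close>

theorem proj_extend:
  assumes x: "x \<in> W" "x <= m" and y: "y \<notin> W" "y <= m" "desc x y" and s: "separates x y W"
  shows "proj (insert y W) = {\<rho>(y := b) | \<rho> b. \<rho> \<in> proj W & Chain x (\<rho> x) y b}"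
proof (intro equalityI subsetI)
  fix \<sigma> assume "\<sigma> \<in> proj (insert y W)"
  then obtain \<mu> where \<mu>: "\<mu> \<in> H" "\<sigma> = restrict \<mu> (insert y W)" by (auto simp: proj_def)
  have "\<sigma> = (restrict \<mu> W)(y := \<mu> y)" using \<mu>(2) by (auto simp: restrict_def)
  moreover have "restrict \<mu> W \<in> proj W" using \<mu>(1) by (auto simp: proj_def)
  moreover have "Chain x (restrict \<mu> W x) y (\<mu> y)" using Chain_H[OF \<mu>(1) y(3,2) x(2)] x by simp
  ultimately show "\<sigma> \<in> {\<rho>(y := b) | \<rho> b. \<rho> \<in> proj W & Chain x (\<rho> x) y b}" by blast
next
  fix \<sigma> assume "\<sigma> \<in> {\<rho>(y := b) | \<rho> b. \<rho> \<in> proj W & Chain x (\<rho> x) y b}"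
  then obtain \<mu> b where \<mu>: "\<mu> \<in> H" "\<sigma> = (restrict \<mu> W)(y := b)" "Chain x (restrict \<mu> W x) y b" by (auto simp: proj_def)
  then obtain \<mu>' where \<mu>': "\<mu>' \<in> H" "\<mu>' y = b" "\<forall>w\<in>W. \<mu>' w = \<mu> w"
    using Chain_glue[OF \<mu>(3,1) _ s x(1)] x by auto
  have "\<sigma> = restrict \<mu>' (insert y W)" using \<mu> \<mu>' by (auto simp: restrict_def fun_eq_iff)
  then show "\<sigma> \<in> proj (insert y W)" using \<mu>' by (auto simp: proj_def)
qed

lemma proj_restrict: "V \<subseteq> W ==> (\<lambda>\<rho>. restrict \<rho> V) ` proj W = proj V"
  by (auto simp: proj_def image_image restrict_restrict Int_absorb1)

lemma finite_proj: "W \<subseteq> {..m} ==> finite (proj W)"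
proof (rule finite_subset)
  assume W: "W \<subseteq> {..m}"
  show "proj W \<subseteq> PiE W (\<lambda>_. {..n})"
  proof
    fix \<sigma> assume "\<sigma> \<in> proj W"
    then obtain \<mu> where \<mu>: "\<mu> \<in> H" "\<sigma> = restrict \<mu> W" by (auto simp: proj_def)
    have "\<mu> i <= n" if "i \<in> W" for i
      using H_less[OF \<mu>(1), of i] \<mu>(1) that W by (cases "i = 0") (auto simp: H_def less_imp_le)
    then show "\<sigma> \<in> PiE W (\<lambda>_. {..n})" using \<mu>(2) by auto
  qed
  show "finite (PiE W (\<lambda>_. {..n}))" using W finite_subset by (intro finite_PiE) auto
qed

text \<open>A tuple is determined by its part on \<open>F\<close> and its values at the remaining
  variables, since variable 0 is constant.\<close>

theorem card_proj:
  assumes W: "W \<subseteq> {..m}" and F: "F \<subseteq> {1..m}" and w: "card (W - insert 0 F) <= w" and n: "1 <= n"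
  shows "card (proj W) <= card (proj F) * n ^ w"
proof -
  let ?B = "W - insert 0 F"
  have fin: "finite ?B" using W finite_subset by blast
  let ?f = "\<lambda>\<sigma>. (restrict \<sigma> F, restrict \<sigma> ?B)"
  \<comment> \<open>\<open>W\<close> need not contain \<open>F\<close>, so tuples are counted over
    the union, from which \<open>proj W\<close> arises by restriction.\<close>
  define L where "L = proj (W \<union> F)"
  have fL: "finite L" unfolding L_def using W F by (intro finite_proj) auto
  have "proj W = (\<lambda>\<rho>. restrict \<rho> W) ` L" unfolding L_def by (rule proj_restrict[symmetric]) auto
  then have "card (proj W) <= card L" using card_image_le[OF fL] by metis
  also have "card L <= card (proj F \<times> PiE ?B (\<lambda>_. {..<n}))"
  proof (rule card_inj_on_le[of ?f])
    show "inj_on ?f L"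
    proof (rule inj_onI)
      fix \<sigma> \<tau> assume s: "\<sigma> \<in> L" "\<tau> \<in> L" and e: "?f \<sigma> = ?f \<tau>"
      obtain \<mu> \<nu> where \<mu>: "\<mu> \<in> H" "\<sigma> = restrict \<mu> (W \<union> F)" and \<nu>: "\<nu> \<in> H" "\<tau> = restrict \<nu> (W \<union> F)"
        using s by (auto simp: L_def proj_def)
      have "\<sigma> i = \<tau> i" for i
      proof -
        consider "i \<in> F" | "i \<in> ?B" | "i = 0" "i \<in> W" "i \<notin> F" | "i \<notin> W \<union> F" by blast
        then show ?thesis
        proof cases
          case 1
          then show ?thesis using e by (metis fst_conv restrict_apply')
        next
          case 2
          then show ?thesis using e by (metis snd_conv restrict_apply')
        next
          case 3
          then show ?thesis using \<mu> \<nu> by (auto simp: H_def)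
        next
          case 4
          then show ?thesis using \<mu> \<nu> by auto
        qed
      qed
      then show "\<sigma> = \<tau>" by blast
    qed
    show "?f ` L \<subseteq> proj F \<times> PiE ?B (\<lambda>_. {..<n})"
    proof clarify
      fix \<sigma> assume "\<sigma> \<in> L"
      then obtain \<mu> where \<mu>: "\<mu> \<in> H" "\<sigma> = restrict \<mu> (W \<union> F)" by (auto simp: L_def proj_def)
      have "restrict \<sigma> F = restrict \<mu> F" using \<mu>(2) by (auto simp: restrict_def)
      then have "restrict \<sigma> F \<in> proj F" using \<mu>(1) by (auto simp: proj_def)
      moreover have "restrict \<sigma> ?B \<in> PiE ?B (\<lambda>_. {..<n})"
      proof -
        have "i \<in> {1..m}" if "i \<in> ?B" for i using that W by (cases i) auto
        moreover have "restrict \<sigma> ?B = restrict \<mu> ?B" using \<mu>(2) by (auto simp: restrict_def)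
        ultimately show ?thesis using H_less[OF \<mu>(1)] by auto
      qed
      ultimately show "restrict \<sigma> F \<in> proj F & restrict \<sigma> ?B \<in> PiE ?B (\<lambda>_. {..<n})" ..
    qed
    show "finite (proj F \<times> PiE ?B (\<lambda>_. {..<n}))"
    proof -
      have "F \<subseteq> {..m}" using F by auto
      then show ?thesis using finite_proj fin by (intro finite_cartesian_product finite_PiE) auto
    qed
  qed
  also have "\<dots> = card (proj F) * n ^ card ?B" using fin by (simp add: card_cartesian_product card_PiE)
  also have "\<dots> <= card (proj F) * n ^ w" using w n by (intro mult_le_mono2 power_increasing) auto
  finally show ?thesis .
qed

end

section \<open>Building the product graph\<close>

primrec seqs :: "com list => com" where
  "seqs [] = Skip"
| "seqs (c # cs) = c ;; seqs cs"

lemma seqs_sets [simp]: "warr (seqs cs) = (\<Union>c\<in>set cs. warr c)" "wreg (seqs cs) = (\<Union>c\<in>set cs. wreg c)"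
  by (induction cs) auto

lemma wp_seqs:
  assumes "\<And>i s. i < length cs ==> I i s ==> wp (cs ! i) (I (Suc i)) s" "I 0 s"
  shows "wp (seqs cs) (I (length cs)) s"
  using assms
proof (induction cs arbitrary: I s)
  case (Cons c cs)
  have "wp c (I 1) s" using Cons.prems(1)[of 0 s] Cons.prems(2) by simp
  moreover have "wp (seqs cs) (I (length (c # cs))) t" if "I 1 t" for t
    using Cons.IH[of "\<lambda>i. I (Suc i)" t] Cons.prems(1)[of "Suc _"] that by simp
  ultimately show ?case by (auto elim: wp_mono)
qed simp

text \<open>The value does not depend on anything that \<open>add_arc\<close> writes, so the
  expression can be evaluated again after each insertion.\<close>

definition steady :: "expr => bool" where
  "steady e \<longleftrightarrow> (\<forall>s t. mods {2, 3, 4} {2, 10, 11} s t --> val e t = val e s)"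

lemma steady_simps [simp]: "steady (Lit x)" "r ~= 2 ==> r ~= 10 ==> r ~= 11 ==> steady (Var r)"
  by (auto simp: steady_def mods_def)

text \<open>The operations of a join plan: \<open>Ext x y\<close> adds column \<open>y\<close> by
  joining along the tree path from \<open>x\<close>, and \<open>Keep V\<close> projects to the
  columns \<open>V\<close>.\<close>

datatype op = Ext nat nat | Keep "nat list"

text \<open>What the program text may depend on: the query in numbers, but not the graph. A rule
  \<open>(j, c, j', d)\<close> moves from state \<open>j\<close> to \<open>j'\<close> along an edge
  with symbol \<open>c\<close>, in the direction of the edge iff \<open>d\<close> holds.\<close>

locale tree_prog =
  fixes m :: nat and par off lev :: "nat => nat" and acl :: "nat => nat list" and kst :: nat
    and rules :: "(nat \<times> nat \<times> nat \<times> bool) list"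
  assumes par_less': "i \<in> {1..m} ==> par i < i"
    and off': "i \<in> {1..m} ==> m < off i" "i \<in> {1..m} ==> off i < kst" "i \<in> {1..m} ==> lev (off i) = i"
    and acl': "i \<in> {1..m} ==> q \<in> set (acl i) ==> m < q & q < kst & lev q = i"
    and rules: "(j, c, j', d) \<in> set rules ==> m < j & j < kst & m < j' & j' < kst & lev j' = lev j & lev j \<in> {1..m} & par (lev j) ~= 0"
    and m_kst: "m < kst"
begin

text \<open>States below \<open>kst\<close> form the reversed copy, those from \<open>kst\<close> on
  the forward copy.\<close>

definition K :: nat where
  "K = 2 * kst"

section \<open>Two copies of the product graph\<close>

definition add_arc :: "(expr \<times> nat) \<times> (expr \<times> nat) => com" where
  "add_arc = (\<lambda>((e, j), (e', j')). Assign 10 (node K j' e') ;; Assign 11 (node K j e) ;; add_link 2 2 10 11 ;;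
     Assign 10 (node K (j + kst) e) ;; Assign 11 (node K (j' + kst) e') ;; add_link 2 2 10 11)"

lemma add_arc_sets [simp]: "warr (add_arc x) = {2, 3, 4}" "wreg (add_arc x) = {2, 10, 11}"
  by (auto simp: add_arc_def split: prod.splits)

definition arcs_of :: "((nat \<times> nat) \<times> (nat \<times> nat)) set => (nat \<times> nat) set" where
  "arcs_of \<Gamma> = (\<lambda>((j, a), (j', b)). (K * b + j', K * a + j)) ` \<Gamma> \<union>
     (\<lambda>((j, a), (j', b)). (K * a + (j + kst), K * b + (j' + kst))) ` \<Gamma>"

lemma arcs_of_insert: "arcs_of (insert ((j, a), (j', b)) \<Gamma>) =
    insert (K * b + j', K * a + j) (insert (K * a + (j + kst), K * b + (j' + kst)) (arcs_of \<Gamma>))"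
  by (auto simp: arcs_of_def)

lemma arcs_ofI:
  assumes "(x, y) \<in> \<Gamma>"
  shows "(K * snd y + fst y, K * snd x + fst x) \<in> arcs_of \<Gamma>"
    "(K * snd x + (fst x + kst), K * snd y + (fst y + kst)) \<in> arcs_of \<Gamma>"
  unfolding arcs_of_def
  by (rule UnI1, rule image_eqI[OF _ assms], simp add: case_prod_beta,
      rule UnI2, rule image_eqI[OF _ assms], simp add: case_prod_beta)

text \<open>No arc connects the copies, so a path that starts in the reversed copy stays there and
  can be decoded arc by arc.\<close>

lemma arcs_backward:
  assumes \<Gamma>: "\<Gamma> \<subseteq> ({..<kst} \<times> UNIV) \<times> ({..<kst} \<times> UNIV)" and j: "j < kst" "j' < kst"
  shows "(K * b + j', K * a + j) \<in> (arcs_of \<Gamma>)\<^sup>* \<longleftrightarrow> ((j, a), (j', b)) \<in> \<Gamma>\<^sup>*"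
proof
  assume "((j, a), (j', b)) \<in> \<Gamma>\<^sup>*"
  then have "(K * snd (j', b) + fst (j', b), K * a + j) \<in> (arcs_of \<Gamma>)\<^sup>*"
  proof (induction rule: rtrancl_induct)
    case (step y z)
    have "(K * snd z + fst z, K * snd y + fst y) \<in> arcs_of \<Gamma>"
      by (rule arcs_ofI[OF step.hyps(2)])
    then show ?case using step.IH by (rule converse_rtrancl_into_rtrancl)
  qed simp
  then show "(K * b + j', K * a + j) \<in> (arcs_of \<Gamma>)\<^sup>*" by simp
next
  have inj: "K * v + q = K * v' + q' \<longleftrightarrow> v = v' & q = q'" if "q < K" "q' < K" for v q v' q'
    using node_inj that .
  assume "(K * b + j', K * a + j) \<in> (arcs_of \<Gamma>)\<^sup>*"
  then have "\<exists>q v. K * a + j = K * v + q & q < kst & ((q, v), (j', b)) \<in> \<Gamma>\<^sup>*"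
  proof (induction rule: rtrancl_induct)
    case base
    then show ?case using j by blast
  next
    case (step y z)
    then obtain q v where q: "y = K * v + q" "q < kst" "((q, v), (j', b)) \<in> \<Gamma>\<^sup>*" by blast
    from step.hyps(2) consider i c i' d where "((i, c), (i', d)) \<in> \<Gamma>" "y = K * d + i'" "z = K * c + i"
      | i c i' d where "((i, c), (i', d)) \<in> \<Gamma>" "y = K * c + (i + kst)"
      by (auto simp: arcs_of_def)
    then show ?case
    proof cases
      case 1
      then have i: "i < kst" "i' < kst" using \<Gamma> by auto
      then have "d = v & i' = q" using inj[of i' q d v] q 1 by (simp add: K_def)
      then have "((i, c), (j', b)) \<in> \<Gamma>\<^sup>*" using 1(1) q(3) by (auto intro: converse_rtrancl_into_rtrancl)
      then show ?thesis using 1(3) i(1) by blast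
    next
      case 2
      then have "i < kst" using \<Gamma> by auto
      then show ?thesis using inj[of "i + kst" q c v] q 2 by (simp add: K_def)
    qed
  qed
  then show "((j, a), (j', b)) \<in> \<Gamma>\<^sup>*" using inj[of j] j by (auto simp: K_def)
qed

lemma arcs_forward:
  assumes \<Gamma>: "\<Gamma> \<subseteq> ({..<kst} \<times> UNIV) \<times> ({..<kst} \<times> UNIV)" and j: "j < kst" "j' < kst"
  shows "(K * a + (j + kst), K * b + (j' + kst)) \<in> (arcs_of \<Gamma>)\<^sup>* \<longleftrightarrow> ((j, a), (j', b)) \<in> \<Gamma>\<^sup>*"
proof
  assume "((j, a), (j', b)) \<in> \<Gamma>\<^sup>*"
  then have "(K * a + (j + kst), K * snd (j', b) + (fst (j', b) + kst)) \<in> (arcs_of \<Gamma>)\<^sup>*"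
  proof (induction rule: rtrancl_induct)
    case (step y z)
    have "(K * snd y + (fst y + kst), K * snd z + (fst z + kst)) \<in> arcs_of \<Gamma>"
      by (rule arcs_ofI[OF step.hyps(2)])
    then show ?case using step.IH by (rule rtrancl_into_rtrancl[rotated])
  qed simp
  then show "(K * a + (j + kst), K * b + (j' + kst)) \<in> (arcs_of \<Gamma>)\<^sup>*" by simp
next
  have inj: "K * v + q = K * v' + q' \<longleftrightarrow> v = v' & q = q'" if "q < K" "q' < K" for v q v' q'
    using node_inj that .
  assume "(K * a + (j + kst), K * b + (j' + kst)) \<in> (arcs_of \<Gamma>)\<^sup>*"
  then have "\<exists>q v. K * b + (j' + kst) = K * v + (q + kst) & q < kst & ((j, a), (q, v)) \<in> \<Gamma>\<^sup>*"
  proof (induction rule: rtrancl_induct)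
    case base
    then show ?case using j by blast
  next
    case (step y z)
    then obtain q v where q: "y = K * v + (q + kst)" "q < kst" "((j, a), (q, v)) \<in> \<Gamma>\<^sup>*" by blast
    from step.hyps(2) consider i c i' d where "((i, c), (i', d)) \<in> \<Gamma>" "y = K * d + i'"
      | i c i' d where "((i, c), (i', d)) \<in> \<Gamma>" "y = K * c + (i + kst)" "z = K * d + (i' + kst)"
      by (auto simp: arcs_of_def)
    then show ?case
    proof cases
      case 2
      then have i: "i < kst" "i' < kst" using \<Gamma> by auto
      then have "c = v & i = q" using inj[of "i + kst" "q + kst" c v] q 2 by (simp add: K_def)
      then have "((j, a), (i', d)) \<in> \<Gamma>\<^sup>*" using 2(1) q(3) by (auto intro: rtrancl_into_rtrancl)
      then show ?thesis using 2(3) i(2) by blast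
    next
      case 1
      then have "i' < kst" using \<Gamma> by auto
      then show ?thesis using inj[of i' "q + kst" d v] q 1 by (simp add: K_def)
    qed
  qed
  then show "((j, a), (j', b)) \<in> \<Gamma>\<^sup>*" using inj[of j'] j by (auto simp: K_def)
qed

text \<open>The list of arcs is hidden: from here on only the set of arcs and a bound on their
  number matter.\<close>

definition gst :: "nat => ((nat \<times> nat) \<times> (nat \<times> nat)) set => nat => st => bool" where
  "gst n \<Gamma> c s \<longleftrightarrow> (\<exists>As. graph_ok As K n s & set As = arcs_of \<Gamma> & length As <= c)"

lemma gst_upd [simp]: "gst n \<Gamma> c (tick s) = gst n \<Gamma> c s"
  "r ~= 0 ==> r ~= 2 ==> r ~= 4 ==> gst n \<Gamma> c (assign r x s) = gst n \<Gamma> c s"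
  by (simp_all add: gst_def)

lemma gst_mods: "gst n \<Gamma> c s ==> mods X Y s t ==> X \<inter> {1, 2, 3, 4} = {} ==> Y \<inter> {0, 2, 4} = {} ==> gst n \<Gamma> c t"
  unfolding gst_def using graph_ok_mods[of _ K n s X Y t] by blast

lemma gst_mono: "gst n \<Gamma> c s ==> c <= d ==> gst n \<Gamma> d s"
  unfolding gst_def using le_trans by blast

lemma wp_add_arc:
  assumes g: "gst n \<Gamma> c s" and st: "steady e" "steady e'"
  shows "wp (add_arc ((e, j), (e', j'))) (\<lambda>t. gst n (insert ((j, val e s), (j', val e' s)) \<Gamma>) (c + 2) t & clk t = clk s + 12) s"
proof -
  obtain As where As: "graph_ok As K n s" "set As = arcs_of \<Gamma>" "length As <= c" using g by (auto simp: gst_def)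
  define a b where "a = val e s" and "b = val e' s"
  have ve: "val e t = a" "val e' t = b" if "mods {2, 3, 4} {2, 10, 11} s t" for t
    using st that by (auto simp: steady_def a_def b_def)
  have lk: "links 2 2 (assign r x t) Bs = links 2 2 t Bs" if "r ~= 2" for r x t Bs
    using that by (simp add: links_def)
  let ?As = "As @ [(K * b + j', K * a + j)]"
  let ?s1 = "assign 11 (K * a + j) (assign 10 (K * b + j') s)"
  have m1: "mods {2, 3, 4} {2, 10, 11} s (assign 10 x s)" for x by (simp add: mods_assign)
  have "wp (add_link 2 2 10 11) (\<lambda>t. links 2 2 t ?As & clk t = clk s + 6) ?s1"
    by (rule wp_mono[OF wp_add_link[of 2 2 _ As]]) (use As(1) in \<open>auto simp: graph_ok_def lk\<close>)
  then have "wp (add_link 2 2 10 11) (\<lambda>t. wp (add_link 2 2 10 11)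
      (\<lambda>u. gst n (insert ((j, a), (j', b)) \<Gamma>) (c + 2) u & clk u = clk s + 12)
      (assign 11 (val (node K (j' + kst) e') (assign 10 (val (node K (j + kst) e) t) t)) (assign 10 (val (node K (j + kst) e) t) t))) ?s1"
  proof (rule wp_frame)
    fix t assume t: "links 2 2 t ?As & clk t = clk s + 6"
      and m: "mods (warr (add_link 2 2 10 11)) (wreg (add_link 2 2 10 11)) ?s1 t"
    have mt: "mods {2, 3, 4} {2, 10, 11} s t" using m by (auto simp: mods_def)
    have mt': "mods {2, 3, 4} {2, 10, 11} s (assign 10 x t)" for x using mt by (simp add: mods_assign)
    let ?t = "assign 11 (K * b + (j' + kst)) (assign 10 (K * a + (j + kst)) t)"
    have "wp (add_link 2 2 10 11) (\<lambda>u. gst n (insert ((j, a), (j', b)) \<Gamma>) (c + 2) u & clk u = clk s + 12) ?t"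
    proof (rule wp_frame[OF wp_add_link[of 2 2 _ ?As]])
      fix u assume u: "links 2 2 u (?As @ [(reg ?t 10, reg ?t 11)]) & clk u = clk ?t + 4"
        and mu: "mods (warr (add_link 2 2 10 11)) (wreg (add_link 2 2 10 11)) ?t u"
      have "graph_ok (?As @ [(reg ?t 10, reg ?t 11)]) K n u"
        using u mu mt As(1) by (auto simp: graph_ok_def mods_def)
      moreover have "set (?As @ [(reg ?t 10, reg ?t 11)]) = arcs_of (insert ((j, a), (j', b)) \<Gamma>)"
        using As(2) by (auto simp: arcs_of_insert)
      ultimately show "gst n (insert ((j, a), (j', b)) \<Gamma>) (c + 2) u & clk u = clk s + 12"
        unfolding gst_def using As(3) u t by (intro conjI exI[of _ "?As @ [(reg ?t 10, reg ?t 11)]"]) auto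
    qed (use t in \<open>auto simp: lk\<close>)
    then show "wp (add_link 2 2 10 11)
      (\<lambda>u. gst n (insert ((j, a), (j', b)) \<Gamma>) (c + 2) u & clk u = clk s + 12)
      (assign 11 (val (node K (j' + kst) e') (assign 10 (val (node K (j + kst) e) t) t)) (assign 10 (val (node K (j + kst) e) t) t))"
      using ve[OF mt] ve[OF mt'] by simp
  qed
  then show ?thesis using ve[OF m1] by (simp add: add_arc_def a_def[symmetric] b_def[symmetric])
qed

definition arc_val :: "st => (expr \<times> nat) \<times> (expr \<times> nat) => (nat \<times> nat) \<times> (nat \<times> nat)" where
  "arc_val s = (\<lambda>((e, j), (e', j')). ((j, val e s), (j', val e' s)))"

lemma wp_add_arcs:
  assumes "gst n \<Gamma> c s" "\<And>e j e' j'. ((e, j), (e', j')) \<in> set xs ==> steady e & steady e'"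
  shows "wp (seqs (map add_arc xs)) (\<lambda>t. gst n (arc_val s ` set xs \<union> \<Gamma>) (c + 2 * length xs) t & clk t = clk s + 12 * length xs) s"
  using assms
proof (induction xs arbitrary: \<Gamma> c s)
  case (Cons x xs)
  obtain e j e' j' where x: "x = ((e, j), (e', j'))" by (cases x) auto
  have st: "steady e" "steady e'" using Cons.prems(2) x by auto
  have "wp (add_arc x ;; seqs (map add_arc xs)) (\<lambda>t. gst n (arc_val s ` set (x # xs) \<union> \<Gamma>) (c + 2 * length (x # xs)) t &
      clk t = clk s + 12 * length (x # xs)) s"
  proof (rule wp_Seq)
    show "wp (add_arc x) (\<lambda>t. gst n (insert ((j, val e s), (j', val e' s)) \<Gamma>) (c + 2) t & clk t = clk s + 12) s"
      unfolding x by (rule wp_add_arc[OF Cons.prems(1) st])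
    fix t assume t: "gst n (insert ((j, val e s), (j', val e' s)) \<Gamma>) (c + 2) t & clk t = clk s + 12"
      and m: "mods (warr (add_arc x)) (wreg (add_arc x)) s t"
    have "arc_val t y = arc_val s y" if "y \<in> set xs" for y
    proof -
      obtain e j e' j' where y: "y = ((e, j), (e', j'))" by (cases y) auto
      then have "steady e" "steady e'" using Cons.prems(2)[of e j e' j'] that by auto
      then show ?thesis using m unfolding y by (simp add: arc_val_def steady_def)
    qed
    then have "arc_val t ` set xs = arc_val s ` set xs" by auto
    moreover have "arc_val s x = ((j, val e s), (j', val e' s))" by (simp add: x arc_val_def)
    moreover have "wp (seqs (map add_arc xs)) (\<lambda>u. gst n (arc_val t ` set xs \<union> insert ((j, val e s), (j', val e' s)) \<Gamma>)
        (c + 2 + 2 * length xs) u & clk u = clk t + 12 * length xs) t"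
      by (rule Cons.IH) (use t Cons.prems(2) in auto)
    ultimately show "wp (seqs (map add_arc xs)) (\<lambda>t. gst n (arc_val s ` set (x # xs) \<union> \<Gamma>) (c + 2 * length (x # xs)) t &
      clk t = clk s + 12 * length (x # xs)) t"
      using t by (elim wp_mono) (simp add: Un_commute)
  qed
  then show ?case by simp
qed simp

text \<open>The multiples of \<open>n\<close> in array 1 are obtained as a running sum in register
  5.\<close>

definition init :: com where
  "init = Assign 4 (times K (Var 0)) ;; Assign 2 (Lit 0) ;; Assign 5 (Lit 0) ;;
     For 20 (Var 4) (Put 1 (Var 20) (Var 5) ;; Assign 5 (Sum (Var 5) (Var 0)))"

lemma wp_init:
  assumes "reg s 0 = n" "\<And>a. a ~= 0 ==> arr s a = (\<lambda>_. 0)"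
  shows "wp init (\<lambda>t. gst n {} 0 t & reg t 1 = reg s 1 & arr t 0 = arr s 0 & (\<forall>a\<ge>5. arr t a = (\<lambda>_. 0)) &
    clk t <= clk s + 5 + 4 * (K * n)) s"
proof -
  let ?c = "Put 1 (Var 20) (Var 5) ;; Assign 5 (Sum (Var 5) (Var 0))"
  let ?s = "assign 5 0 (assign 2 0 (assign 4 (K * n) s))"
  have "wp (For 20 (Var 4) ?c) (\<lambda>t. gst n {} 0 t & reg t 1 = reg s 1 & arr t 0 = arr s 0 & (\<forall>a\<ge>5. arr t a = (\<lambda>_. 0)) &
    clk t <= clk s + 5 + 4 * (K * n)) ?s"
  proof (rule wp_For[where N = "K * n" and I = "\<lambda>k t. reg t 5 = k * n & (\<forall>w<k. arr t 1 w = w * n) & clk t <= clk s + 4 + 4 * k"])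
    fix t assume I: "reg t 5 = K * n * n & (\<forall>w<K * n. arr t 1 w = w * n) & clk t <= clk s + 4 + 4 * (K * n)"
      and m: "mods (warr ?c) (insert 20 (wreg ?c)) ?s t"
    have "graph_ok [] K n t" using m I assms by (auto simp: graph_ok_def links_def mods_def)
    then show "gst n {} 0 (tick t) & reg (tick t) 1 = reg s 1 & arr (tick t) 0 = arr s 0 & (\<forall>a\<ge>5. arr (tick t) a = (\<lambda>_. 0)) &
      clk (tick t) <= clk s + 5 + 4 * (K * n)"
      using m I assms by (auto simp: gst_def arcs_of_def mods_def)
  qed (use assms in \<open>auto simp: mods_def less_Suc_eq\<close>)
  then show ?thesis using assms by (simp add: init_def)
qed

definition rule_arc :: "nat \<times> nat \<times> nat \<times> bool => (expr \<times> nat) \<times> (expr \<times> nat)" where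
  "rule_arc = (\<lambda>(j, c, j', d). if d then ((Var 5, j), (Var 7, j')) else ((Var 7, j), (Var 5, j')))"

text \<open>Equality of symbols is tested by the sum of both truncated differences, which vanishes
  exactly if the numbers agree.\<close>

definition rule_com :: "nat \<times> nat \<times> nat \<times> bool => com" where
  "rule_com r = Cond (Sum (Dif (Var 6) (Lit (fst (snd r)))) (Dif (Lit (fst (snd r))) (Var 6))) Skip (add_arc (rule_arc r))"

definition build :: com where
  "build = For 20 (Var 1) (Assign 5 (Elem 0 (times 3 (Var 20))) ;; Assign 6 (Elem 0 (Sum (times 3 (Var 20)) (Lit 1))) ;;
     Assign 7 (Elem 0 (Sum (times 3 (Var 20)) (Lit 2))) ;; seqs (map rule_com rules))"

lemma rule_com_sets [simp]: "warr (rule_com r) = {2, 3, 4}" "wreg (rule_com r) = {2, 10, 11}"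
  by (auto simp: rule_com_def)

lemma build_sets: "warr build \<subseteq> {2, 3, 4}" "wreg build \<subseteq> {2, 5, 6, 7, 10, 11, 20}"
  by (auto simp: build_def)

definition aut :: "(nat \<times> nat \<times> nat) set => ((nat \<times> nat) \<times> (nat \<times> nat)) set" where
  "aut E = {((j, a), (j', b)) | j a j' b c. (j, c, j', True) \<in> set rules & (a, c, b) \<in> E} \<union>
     {((j, a), (j', b)) | j a j' b c. (j, c, j', False) \<in> set rules & (b, c, a) \<in> E}"

lemma aut_Un: "aut (E \<union> E') = aut E \<union> aut E'"
  unfolding aut_def by blast

lemma wp_build:
  assumes g: "gst n {} 0 s" and r1: "reg s 1 = length es"
    and a0: "\<And>i. i < length es ==> arr s 0 (3 * i) = fst (es ! i) & arr s 0 (3 * i + 1) = fst (snd (es ! i)) & arr s 0 (3 * i + 2) = snd (snd (es ! i))"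
  shows "wp build (\<lambda>t. gst n (aut (set es)) (2 * length rules * length es) t & clk t <= clk s + 2 + (5 + 13 * length rules) * length es) s"
proof -
  let ?c = "Assign 5 (Elem 0 (times 3 (Var 20))) ;; Assign 6 (Elem 0 (Sum (times 3 (Var 20)) (Lit 1))) ;;
     Assign 7 (Elem 0 (Sum (times 3 (Var 20)) (Lit 2))) ;; seqs (map rule_com rules)"
  let ?R = "length rules"
  let ?I = "\<lambda>k t. gst n (aut (set (take k es))) (2 * ?R * k) t & clk t <= clk s + 1 + (5 + 13 * ?R) * k"
  have ws: "warr ?c \<subseteq> {2, 3, 4}" "wreg ?c \<subseteq> {2, 5, 6, 7, 10, 11}" by auto
  show ?thesis unfolding build_def
  proof (rule wp_For[where N = "length es" and I = ?I])
    show "?I 0 (assign 20 0 s)" using g by (simp add: aut_def)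
  next
    fix k t assume I: "?I k t" and m: "mods (warr ?c) (insert 20 (wreg ?c)) s t" and k: "reg t 20 = k" "k < length es"
    obtain u x v where e: "es ! k = (u, x, v)" by (cases "es ! k") auto
    have "arr t 0 = arr s 0" using mods_arr[OF m, of 0] ws by auto
    then have a: "arr t 0 (3 * k) = u" "arr t 0 (3 * k + 1) = x" "arr t 0 (3 * k + 2) = v" using a0[OF k(2)] e by auto
    let ?t = "assign 7 v (assign 6 x (assign 5 u (tick t)))"
    let ?J = "\<lambda>i y. gst n (arc_val ?t ` rule_arc ` {r \<in> set (take i rules). fst (snd r) = x} \<union> aut (set (take k es))) (2 * ?R * k + 2 * i) y &
      clk y <= clk ?t + 13 * i & reg y 5 = u & reg y 6 = x & reg y 7 = v"
    have "wp (seqs (map rule_com rules)) (?J (length (map rule_com rules))) ?t"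
    proof (rule wp_seqs)
      show "?J 0 ?t" using I by simp
    next
      fix i y assume i: "i < length (map rule_com rules)" and J: "?J i y"
      obtain j c j' d where r: "rules ! i = (j, c, j', d)" by (cases "rules ! i") auto
      have tk: "set (take (Suc i) rules) = insert (j, c, j', d) (set (take i rules))"
        using i r by (simp add: take_Suc_conv_app_nth)
      have eq: "x - c + (c - x) = 0 \<longleftrightarrow> c = x" by auto
      show "wp (map rule_com rules ! i) (?J (Suc i)) y"
      proof (cases "c = x")
        case True
        obtain e1 j1 e2 j2 where ra: "rule_arc (j, c, j', d) = ((e1, j1), (e2, j2))"
          by (cases "rule_arc (j, c, j', d)") auto
        then have st: "steady e1" "steady e2" by (auto simp: rule_arc_def split: if_splits)
        have "val e1 y = val e1 ?t" "val e2 y = val e2 ?t" using ra J by (auto simp: rule_arc_def split: if_splits)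
        then have av: "arc_val ?t (rule_arc (j, c, j', d)) = ((j1, val e1 y), (j2, val e2 y))"
          unfolding ra by (simp add: arc_val_def)
        have set: "{r \<in> set (take (Suc i) rules). fst (snd r) = x} = insert (j, c, j', d) {r \<in> set (take i rules). fst (snd r) = x}"
          unfolding tk using True by auto
        have "wp (add_arc (rule_arc (j, c, j', d))) (?J (Suc i)) (tick y)"
          unfolding ra
        proof (rule wp_frame[OF wp_add_arc[OF _ st]])
          show "gst n (arc_val ?t ` rule_arc ` {r \<in> set (take i rules). fst (snd r) = x} \<union> aut (set (take k es))) (2 * ?R * k + 2 * i) (tick y)"
            using J by simp
          fix z assume z: "gst n (insert ((j1, val e1 (tick y)), (j2, val e2 (tick y)))
              (arc_val ?t ` rule_arc ` {r \<in> set (take i rules). fst (snd r) = x} \<union> aut (set (take k es)))) (2 * ?R * k + 2 * i + 2) z &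
              clk z = clk (tick y) + 12"
            and mz: "mods (warr (add_arc ((e1, j1), (e2, j2)))) (wreg (add_arc ((e1, j1), (e2, j2)))) (tick y) z"
          have vt: "val e (tick y) = val e y" for e by (induction e) auto
          have "arc_val ?t ` rule_arc ` {r \<in> set (take (Suc i) rules). fst (snd r) = x} \<union> aut (set (take k es)) =
            insert ((j1, val e1 (tick y)), (j2, val e2 (tick y)))
              (arc_val ?t ` rule_arc ` {r \<in> set (take i rules). fst (snd r) = x} \<union> aut (set (take k es)))"
            unfolding set image_insert av vt by simp
          moreover have "reg z 5 = u" "reg z 6 = x" "reg z 7 = v" using mz J by (auto simp: mods_def)
          moreover have "clk z <= clk ?t + 13 * Suc i" using z J by simp
          ultimately show "?J (Suc i) z" using z by simp
        qed
        then show ?thesis using i r True J by (simp add: rule_com_def)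
      next
        case False
        then have set: "{r \<in> set (take (Suc i) rules). fst (snd r) = x} = {r \<in> set (take i rules). fst (snd r) = x}"
          unfolding tk by auto
        have nz: "\<not> (x <= c & c <= x)" using False by auto
        show ?thesis using i r nz J gst_mono[of n _ "2 * ?R * k + 2 * i" "tick y" "2 * ?R * k + 2 * Suc i"] unfolding set
          by (auto simp: rule_com_def)
      qed
    qed
    then have "wp (seqs (map rule_com rules)) (\<lambda>y. ?I (Suc k) (assign 20 (Suc k) y)) ?t"
    proof (rule wp_mono)
      fix y assume J: "?J (length (map rule_com rules)) y"
      have "set (take (Suc k) es) = insert (u, x, v) (set (take k es))"
        using k e by (simp add: take_Suc_conv_app_nth)
      then have au: "aut (set (take (Suc k) es)) = aut {(u, x, v)} \<union> aut (set (take k es))"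
        using aut_Un[of "{(u, x, v)}" "set (take k es)"] by simp
      have "arc_val ?t ` rule_arc ` {r \<in> set rules. fst (snd r) = x} = aut {(u, x, v)}"
      proof (intro equalityI subsetI)
        fix z assume "z \<in> arc_val ?t ` rule_arc ` {r \<in> set rules. fst (snd r) = x}"
        then obtain j j' d where "(j, x, j', d) \<in> set rules" "z = arc_val ?t (rule_arc (j, x, j', d))" by auto
        then show "z \<in> aut {(u, x, v)}" by (cases d) (auto simp: aut_def arc_val_def rule_arc_def)
      next
        fix z assume "z \<in> aut {(u, x, v)}"
        then obtain j a j' b d where z: "z = ((j, a), (j', b))" "(j, x, j', d) \<in> set rules" "if d then a = u & b = v else b = u & a = v"
          unfolding aut_def by force
        then have "z = arc_val ?t (rule_arc (j, x, j', d))" by (cases d) (auto simp: arc_val_def rule_arc_def)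
        then show "z \<in> arc_val ?t ` rule_arc ` {r \<in> set rules. fst (snd r) = x}" using z(2) by force
      qed
      then show "?I (Suc k) (assign 20 (Suc k) y)" using J I au by (auto simp: algebra_simps)
    qed
    then show "wp ?c (\<lambda>y. ?I (Suc k) (assign 20 (Suc k) y)) (tick t)" using a k by simp
  next
    show "val (Var 1) t = length es" if "mods (warr ?c) (insert 20 (wreg ?c)) s t" for t
      using mods_reg[OF that, of 1] r1 ws by auto
  qed (use ws in auto)
qed

end

context tree_prog
begin

section \<open>The bottom-up pass\<close>

definition children :: "nat => nat list" where
  "children i = filter (\<lambda>c. par c = i) [1..<Suc m]"

lemma set_children: "set (children i) = {c \<in> {1..m}. par c = i}"
  by (auto simp: children_def)

text \<open>Arrays 0 to 4 hold the input edges, the multiples of \<open>n\<close> and the arcs;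
  after them each variable owns four arrays for its search.\<close>

definition pb :: "nat => nat" where
  "pb i = 5 + 4 * i"

text \<open>A positive counter at the gate of a child \<open>c\<close> means that the search for
  \<open>c\<close> arrived there, that is, \<open>c\<close> has a compatible surviving
  value.\<close>

definition check :: "nat => expr => com" where
  "check i e = Assign 8 (Lit 1) ;;
     seqs (map (\<lambda>c. Cond (Elem (pb c + 1) (node K (off c) e)) Skip (Assign 8 (Lit 0))) (children i))"

lemma check_sets [simp]: "warr (check i e) = {}" "wreg (check i e) = {8}"
  by (auto simp: check_def)

lemma wp_check:
  assumes e: "\<And>t. mods {} {8} s t ==> val e t = a"
  shows "wp (check i e) (\<lambda>t. (reg t 8 ~= 0 \<longleftrightarrow> (\<forall>c\<in>set (children i). arr s (pb c + 1) (K * a + off c) ~= 0)) &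
    clk t <= clk s + 1 + 2 * length (children i)) s"
proof -
  let ?f = "\<lambda>c. Cond (Elem (pb c + 1) (node K (off c) e)) Skip (Assign 8 (Lit 0))"
  let ?I = "\<lambda>j t. (reg t 8 ~= 0 \<longleftrightarrow> (\<forall>c\<in>set (take j (children i)). arr s (pb c + 1) (K * a + off c) ~= 0)) &
    clk t <= clk s + 1 + 2 * j & mods {} {8} s t"
  have "wp (seqs (map ?f (children i))) (?I (length (map ?f (children i)))) (assign 8 1 s)"
  proof (rule wp_seqs)
    fix j t assume j: "j < length (map ?f (children i))" and I: "?I j t"
    have "set (take (Suc j) (children i)) = insert (children i ! j) (set (take j (children i)))"
      using j by (simp add: take_Suc_conv_app_nth)
    moreover have "arr t = arr s" using I by (auto simp: mods_def)
    ultimately show "wp (map ?f (children i) ! j) (?I (Suc j)) t"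
      using j I e[of t] by (auto simp: mods_assign)
  qed (simp add: mods_assign)
  then show ?thesis by (simp add: check_def) (erule wp_mono, simp)
qed

definition entl :: "nat => ((expr \<times> nat) \<times> (expr \<times> nat)) list" where
  "entl i = (if par i = 0 then [((Lit 0, off i), (Var 20, i))] else map (\<lambda>q. ((Var 20, q), (Var 20, i))) (acl i))"

definition lvl :: "nat => expr => ((expr \<times> nat) \<times> (expr \<times> nat)) list" where
  "lvl i e = map (\<lambda>c. ((e, i), (e, off c))) (children i)"

definition attach :: "nat => com" where
  "attach i = For 20 (Var 0) (check i (Var 20) ;; Cond (Var 8) (seqs (map add_arc (entl i @ lvl i (Var 20)))) Skip)"

lemma attach_sets: "warr (attach i) \<subseteq> {2, 3, 4}" "wreg (attach i) \<subseteq> {2, 8, 10, 11, 20}"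
  by (auto simp: attach_def)

text \<open>Capacity 1 turns propagation into plain reachability against the arcs: afterwards the
  gate of \<open>i\<close> is marked at exactly those values that admit a surviving value of
  \<open>i\<close>.\<close>

definition step :: "nat => com" where
  "step i = attach i ;; Assign 14 (Lit 1) ;; spread (pb i) K i (Lit 1)"

lemma step_sets: "warr (step i) \<subseteq> {2, 3, 4} \<union> {pb i..pb i + 3}" "wreg (step i) \<subseteq> {2} \<union> {8..20}"
  using attach_sets[of i] by (auto simp: step_def)

text \<open>Register 3 becomes the size of the initial table over variable 0: one row if a solution
  exists, none otherwise. Without vertices there are no counters to read, so that case is decided
  directly.\<close>

definition root :: com where
  "root = (if children 0 = [] then Assign 3 (Lit 1) else
     Cond (Var 0) (check 0 (Lit 0) ;; Cond (Var 8) (seqs (map add_arc (lvl 0 (Lit 0))) ;; Assign 3 (Lit 1)) (Assign 3 (Lit 0)))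
       (Assign 3 (Lit 0)))"

lemma root_sets: "warr root \<subseteq> {2, 3, 4}" "wreg root \<subseteq> {2, 3, 8, 10, 11}"
  by (auto simp: root_def)

definition bottom_up :: com where
  "bottom_up = seqs (map step (rev [1..<Suc m])) ;; root"

definition le :: "nat => nat" where
  "le i = length (entl i) + length (children i)"

text \<open>Every arc is stored in both copies, hence the factors 2.\<close>

definition AC :: nat where
  "AC = 2 * length rules + 2 * (\<Sum>i\<in>{0..m}. le i)"

definition SC :: nat where
  "SC = 60 + 10 * K + 25 * AC"

lemma le_AC: "i <= m ==> le i <= AC"
proof -
  assume "i <= m"
  then have "le i <= (\<Sum>i\<in>{0..m}. le i)" by (intro member_le_sum) auto
  then show ?thesis by (simp add: AC_def)
qed

end

locale tree_run = tree_prog +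
  fixes n :: nat and es :: "(nat \<times> nat \<times> nat) list"
  assumes es: "(u, c, v) \<in> set es ==> u < n & v < n"
begin

sublocale csp m n par off lev "\<lambda>i. set (acl i)" "aut (set es)"
  by unfold_locales (use par_less' off' acl' in \<open>auto simp: aut_def dest: rules es\<close>)

lemma Gam_states: "Gam k \<subseteq> ({..<kst} \<times> UNIV) \<times> ({..<kst} \<times> UNIV)"
proof
  fix x assume xG: "x \<in> Gam k"
  obtain j a j' b where x: "x = ((j, a), (j', b))" by (cases x) auto
  from xG have "((j, a), (j', b)) \<in> Gam k" by (simp add: x)
  then have "j < kst & j' < kst"
  proof (cases rule: Gam_cases)
    case aut
    then show ?thesis using rules by (auto simp: aut_def)
  next
    case ent
    then have "j < kst" using off' acl' by (auto split: if_splits)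
    then show ?thesis using ent m_kst by auto
  next
    case (lv c)
    then show ?thesis using off' m_kst by auto
  qed
  then show "x \<in> ({..<kst} \<times> UNIV) \<times> ({..<kst} \<times> UNIV)" by (simp add: x)
qed

lemma Gam_less: "((j, a), (j', b)) \<in> Gam k ==> 0 < n ==> a < n & b < n"
  by (erule Gam_cases) (use Ga D_less in \<open>fastforce split: if_splits\<close>)+

text \<open>Variable 0 has the value 0 even if the graph has no vertex that 0 could number. In that
  case no root has a value, so no arc leaves variable 0 either.\<close>

lemma Gam_n0: "n = 0 ==> Gam 0 = {}"
proof -
  assume n: "n = 0"
  have 1: "False" if "D 0 0" "c \<in> {1..m}" "par c = 0" for c
    using that n D_less[of c] by (subst (asm) D_iff) fastforce
  have "False" if "((j, a), (j', b)) \<in> Gam 0" for j a j' b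
    using that
  proof (cases rule: Gam_cases)
    case (lv c)
    then have "j = 0" "a = 0" using D_less n by blast+
    then show ?thesis using lv 1 by blast
  qed (use n Ga D_less in fastforce)+
  then show ?thesis by auto
qed

lemma arcs_less:
  assumes "0 < n \<or> k = 0"
  shows "arcs_of (Gam k) \<subseteq> {..<K * n} \<times> {..<K * n}"
proof (cases "n = 0")
  case True
  then show ?thesis using assms Gam_n0 by (auto simp: arcs_of_def)
next
  case False
  show ?thesis
  proof
    fix x assume "x \<in> arcs_of (Gam k)"
    then obtain j a j' b where "((j, a), (j', b)) \<in> Gam k"
      and x: "x = (K * b + j', K * a + j) \<or> x = (K * a + (j + kst), K * b + (j' + kst))"
      by (auto simp: arcs_of_def)
    then have "a < n" "b < n" "j < kst" "j' < kst" using Gam_less Gam_states False by blast+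
    then show "x \<in> {..<K * n} \<times> {..<K * n}" using x node_less[of _ n _ K] by (auto simp: K_def)
  qed
qed

text \<open>The arcs at \<open>i\<close> for the values already visited by the loop of
  \<open>attach\<close>; both kinds of arcs carry the value in their second endpoint.\<close>

definition part :: "nat => (nat => bool) => ((nat \<times> nat) \<times> (nat \<times> nat)) set" where
  "part i P = {x \<in> ent i \<union> lv i. P (snd (snd x))}"

lemma arc_val_part:
  assumes i: "i \<in> {1..m}" and d: "D i k" and r: "reg t 20 = k"
  shows "arc_val t ` set (entl i @ lvl i (Var 20)) = part i (\<lambda>v. v = k)"
proof -
  have "arc_val t ` set (entl i) = {x \<in> ent i. snd (snd x) = k}"
    using d r by (auto simp: entl_def ent_def arc_val_def image_iff)
  moreover have "arc_val t ` set (lvl i (Var 20)) = {x \<in> lv i. snd (snd x) = k}"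
    using d r i by (auto simp: lvl_def lv_def arc_val_def set_children image_iff)
  ultimately show ?thesis by (auto simp: part_def)
qed

lemma part_empty: "i \<in> {1..m} ==> \<not> D i k ==> part i (\<lambda>v. v = k) = {}"
  by (auto simp: part_def ent_def lv_def)

lemma part_Suc: "part i (\<lambda>v. v < Suc k) = part i (\<lambda>v. v = k) \<union> part i (\<lambda>v. v < k)"
  by (auto simp: part_def less_Suc_eq)

lemma part_all: "i \<in> {1..m} ==> part i (\<lambda>v. v < n) = ent i \<union> lv i"
  using D_less[of i] by (auto simp: part_def ent_def lv_def)

lemma Gam_Suc: "i \<in> {1..m} ==> Gam i = ent i \<union> lv i \<union> Gam (Suc i)"
proof -
  assume i: "i \<in> {1..m}"
  then have "{max 1 i..m} = insert i {max 1 (Suc i)..m}" "{i..m} = insert i {Suc i..m}" by auto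
  then show ?thesis unfolding Gam_def by auto
qed

text \<open>The results of the searches for the variables from \<open>k\<close> on. Arrays not owned
  by them are still zero, as the next search requires.\<close>

definition known :: "nat => st => bool" where
  "known k s \<longleftrightarrow> (\<forall>i\<in>{k..m}. \<forall>v<n. arr s (pb i + 1) (K * v + off i) ~= 0 \<longleftrightarrow> (\<exists>b. Rl i v b & D i b)) &
     (\<forall>a\<ge>5. (\<forall>i\<in>{k..m}. a < pb i \<or> pb i + 3 < a) --> arr s a = (\<lambda>_. 0))"

lemma known_mods: "known k s ==> mods X Y s t ==> X \<subseteq> {..4} ==> known k t"
proof -
  assume k: "known k s" and m: "mods X Y s t" and X: "X \<subseteq> {..4}"
  have "arr t a = arr s a" if "5 <= a" for a using mods_arr[OF m, of a] X that by force
  then show ?thesis using k by (simp add: known_def pb_def)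
qed

lemma check_D:
  assumes kn: "known (Suc i) s" and v: "v < n"
  shows "(\<forall>c\<in>set (children i). arr s (pb c + 1) (K * v + off c) ~= 0) \<longleftrightarrow> D i v"
proof -
  have "arr s (pb c + 1) (K * v + off c) ~= 0 \<longleftrightarrow> (\<exists>b. Rl c v b & D c b)" if "c \<in> set (children i)" for c
    using kn that v par_less[of c] unfolding known_def set_children by auto
  then show ?thesis using v by (subst D_iff) (auto simp: set_children)
qed

lemma wp_attach:
  assumes i: "i \<in> {1..m}" and g: "gst n (Gam (Suc i)) c s" and kn: "known (Suc i) s"
  shows "wp (attach i) (\<lambda>t. gst n (Gam i) (c + 2 * le i * n) t & clk t <= clk s + 2 + (5 + 14 * le i) * n) s"
proof -
  let ?c = "check i (Var 20) ;; Cond (Var 8) (seqs (map add_arc (entl i @ lvl i (Var 20)))) Skip"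
  let ?I = "\<lambda>k t. gst n (part i (\<lambda>v. v < k) \<union> Gam (Suc i)) (c + 2 * le i * k) t & clk t <= clk s + 1 + (5 + 14 * le i) * k"
  have ws: "warr ?c \<subseteq> {2, 3, 4}" "wreg ?c \<subseteq> {2, 8, 10, 11}" by auto
  show ?thesis unfolding attach_def
  proof (rule wp_For[where N = n and I = ?I])
    show "?I 0 (assign 20 0 s)" using g by (simp add: part_def)
  next
    fix k t assume I: "?I k t" and m: "mods (warr ?c) (insert 20 (wreg ?c)) s t" and k: "reg t 20 = k" "k < n"
    have kt: "known (Suc i) (tick t)" using known_mods[OF kn m] ws by (auto simp: known_def)
    show "wp ?c (\<lambda>u. ?I (Suc k) (assign 20 (Suc k) u)) (tick t)"
    proof (rule wp_Seq[OF wp_check[where a = k]])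
      show "val (Var 20) u = k" if "mods {} {8} (tick t) u" for u using that k by (simp add: mods_def)
      fix u assume u: "(reg u 8 ~= 0 \<longleftrightarrow> (\<forall>c\<in>set (children i). arr (tick t) (pb c + 1) (K * k + off c) ~= 0)) &
          clk u <= clk (tick t) + 1 + 2 * length (children i)"
        and mu: "mods (warr (check i (Var 20))) (wreg (check i (Var 20))) (tick t) u"
      have r8: "reg u 8 ~= 0 \<longleftrightarrow> D i k" using u check_D[OF kt k(2)] by simp
      have gu: "gst n (part i (\<lambda>v. v < k) \<union> Gam (Suc i)) (c + 2 * le i * k) (tick u)"
        using I gst_mods[OF _ mu] by simp
      have cu: "clk u <= clk t + 2 + 2 * le i" using u by (simp add: le_def)
      show "wp (Cond (Var 8) (seqs (map add_arc (entl i @ lvl i (Var 20)))) Skip) (\<lambda>u. ?I (Suc k) (assign 20 (Suc k) u)) u"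
      proof (cases "D i k")
        case True
        have u20: "reg (tick u) 20 = k" using mu k by (simp add: mods_def)
        have len: "length (entl i @ lvl i (Var 20)) = le i" by (simp add: le_def lvl_def)
        have "wp (seqs (map add_arc (entl i @ lvl i (Var 20)))) (\<lambda>x. gst n (arc_val (tick u) ` set (entl i @ lvl i (Var 20)) \<union>
            (part i (\<lambda>v. v < k) \<union> Gam (Suc i))) (c + 2 * le i * k + 2 * length (entl i @ lvl i (Var 20))) x &
            clk x = clk (tick u) + 12 * length (entl i @ lvl i (Var 20))) (tick u)"
          by (rule wp_add_arcs[OF gu]) (auto simp: entl_def lvl_def split: if_splits)
        then have "wp (seqs (map add_arc (entl i @ lvl i (Var 20)))) (\<lambda>u. ?I (Suc k) (assign 20 (Suc k) u)) (tick u)"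
          unfolding arc_val_part[OF i True u20] len part_Suc
          by (rule wp_mono) (use I cu in \<open>auto simp: algebra_simps Un_assoc\<close>)
        then show ?thesis using True r8 by simp
      next
        case False
        have "?I (Suc k) (assign 20 (Suc k) (tick u))"
          unfolding part_Suc part_empty[OF i False]
          using gu I cu gst_mono[OF gu, of "c + 2 * le i * Suc k"] by auto
        then show ?thesis using False r8 by simp
      qed
    qed
  next
    fix t assume "?I n t"
    then show "gst n (Gam i) (c + 2 * le i * n) (tick t) & clk (tick t) <= clk s + 2 + (5 + 14 * le i) * n"
      using Gam_Suc[OF i] part_all[OF i] by simp
  next
    show "val (Var 0) t = n" if "mods (warr ?c) (insert 20 (wreg ?c)) s t" for t
      using mods_reg[OF that, of 0] ws g by (auto simp: gst_def graph_ok_def)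
  qed (use ws in auto)
qed

lemma Gam_pos_n0: "n = 0 ==> 1 <= k ==> Gam k = {}"
proof -
  assume "n = 0" "1 <= k"
  moreover have "Gam k \<subseteq> Gam 0" by (auto simp: Gam_def)
  ultimately show ?thesis using Gam_n0 by auto
qed

lemma wp_step:
  assumes i: "i \<in> {1..m}" and g: "gst n (Gam (Suc i)) c s" and kn: "known (Suc i) s"
  shows "wp (step i) (\<lambda>t. gst n (Gam i) (c + 2 * le i * n) t & known i t &
    clk t <= clk s + 12 + (18 + 14 * le i + 10 * K) * n + 11 * (c + 2 * le i * n)) s"
  unfolding step_def
proof (rule wp_Seq[OF wp_attach[OF i g kn]])
  let ?Q = "\<lambda>t. gst n (Gam i) (c + 2 * le i * n) t & known i t &
    clk t <= clk s + 12 + (18 + 14 * le i + 10 * K) * n + 11 * (c + 2 * le i * n)"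
  fix t assume t: "gst n (Gam i) (c + 2 * le i * n) t & clk t <= clk s + 2 + (5 + 14 * le i) * n"
    and m: "mods (warr (attach i)) (wreg (attach i)) s t"
  have "known (Suc i) t" using known_mods[OF kn m] attach_sets(1)[of i] by force
  then have kt: "known (Suc i) (assign 14 1 t)" by (simp add: known_def)
  let ?t = "assign 14 1 t"
  obtain As where As: "graph_ok As K n ?t" "set As = arcs_of (Gam i)" "length As <= c + 2 * le i * n"
    using t by (auto simp: gst_def)
  have ik: "i < K" "off i < K" using i m_kst off'(2)[OF i] by (auto simp: K_def)
  have less: "set As \<subseteq> {..<K * n} \<times> {..<K * n}"
    unfolding As(2) using arcs_less[of i] Gam_pos_n0 i by (cases "n = 0") (auto simp: arcs_of_def)
  have z: "\<forall>a. arr ?t (pb i) a = 0"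
  proof -
    have "pb i < pb i'" if "i' \<in> {Suc i..m}" for i' using that by (simp add: pb_def)
    then show ?thesis using kt unfolding known_def by (simp add: pb_def)
  qed
  have "wp (spread (pb i) K i (Lit 1)) ?Q ?t"
  proof (rule wp_frame[OF wp_spread[where B = "{..<n}" and As = As and n = n]])
    fix u assume "\<exists>Rs. queue (pb i) n (K * n) u Rs & prop_inv (set As) (seeds K i {..<n}) (reg ?t 14) Rs (length Rs) &
        clk u <= clk ?t + 8 + 3 * (K * n) + 13 * n + (\<Sum>j<length Rs. 7 + 11 * length (outs As (fst (Rs ! j))))"
      and mu: "mods (warr (spread (pb i) K i (Lit 1))) (wreg (spread (pb i) K i (Lit 1))) ?t u"
    then obtain Rs where Rs: "queue (pb i) n (K * n) u Rs" "prop_inv (set As) (seeds K i {..<n}) 1 Rs (length Rs)"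
        "clk u <= clk ?t + 8 + 3 * (K * n) + 13 * n + (\<Sum>j<length Rs. 7 + 11 * length (outs As (fst (Rs ! j))))"
      by auto
    have gu: "gst n (Gam i) (c + 2 * le i * n) u"
      using gst_mods[OF _ mu] t by (simp add: pb_def)
    have "\<forall>w. cnt Rs w <= 1" using Rs(2) unfolding prop_inv_def by blast
    then have "(\<Sum>j<length Rs. 7 + 11 * length (outs As (fst (Rs ! j)))) <= 1 * (7 * (K * n) + 11 * length As)"
      using queue_cost[OF Rs(1)] by blast
    then have "clk u <= clk s + 2 + (5 + 14 * le i) * n + 1 + 8 + 10 * (K * n) + 13 * n + 11 * (c + 2 * le i * n)"
      using Rs(3) t As(3) by simp
    then have cost: "clk u <= clk s + 12 + (18 + 14 * le i + 10 * K) * n + 11 * (c + 2 * le i * n)"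
      by (simp add: algebra_simps)
    have new: "arr u (pb i + 1) (K * v + off i) ~= 0 \<longleftrightarrow> (\<exists>b. Rl i v b & D i b)" if v: "v < n" for v
    proof -
      let ?w = "K * v + off i"
      have "?w < K * n" using node_less v ik by blast
      then have "arr u (pb i + 1) ?w ~= 0 \<longleftrightarrow> cnt Rs ?w ~= 0" using Rs(1) by (simp add: queue_def)
      also have "\<dots> \<longleftrightarrow> (\<exists>l. (?w, l) \<in> set Rs)" by (force simp: cnt_def count_list_0_iff)
      also have "\<dots> \<longleftrightarrow> (\<exists>b<n. (K * b + i, ?w) \<in> (set As)\<^sup>*)"
      proof
        assume "\<exists>l. (?w, l) \<in> set Rs"
        then obtain l w0 where "(w0, l) \<in> seeds K i {..<n}" "(w0, ?w) \<in> (set As)\<^sup>*"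
          using Rs(2) unfolding prop_inv_def by fast
        then show "\<exists>b<n. (K * b + i, ?w) \<in> (set As)\<^sup>*" by (auto simp: seeds_def)
      next
        assume "\<exists>b<n. (K * b + i, ?w) \<in> (set As)\<^sup>*"
        then obtain b where b: "b < n" "(K * b + i, ?w) \<in> (set As)\<^sup>*" by blast
        \<comment> \<open>With capacity 1 a node is either unsaturated, where propagation is
          complete, or it carries a label anyway.\<close>
        show "\<exists>l. (?w, l) \<in> set Rs"
        proof (cases "cnt Rs ?w < 1")
          case True
          have "(K * b + i, b) \<in> seeds K i {..<n}" unfolding seeds_def using b(1) by (intro image_eqI[of _ _ b]) auto
          then show ?thesis using prop_inv_complete[OF Rs(2) True] b by blast
        next
          case False
          then show ?thesis by (force simp: cnt_def count_list_0_iff)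
        qed
      qed
      also have "\<dots> \<longleftrightarrow> (\<exists>b<n. Rl i v b & D i b)"
      proof -
        have "(K * b + i, ?w) \<in> (set As)\<^sup>* \<longleftrightarrow> Rl i v b & D i b" for b
          unfolding As(2) using arcs_backward[OF Gam_states, of "off i" i b v i] reach_child[of i i v b] i m_kst off' by auto
        then show ?thesis by blast
      qed
      also have "\<dots> \<longleftrightarrow> (\<exists>b. Rl i v b & D i b)" using Rl_def by blast
      finally show ?thesis .
    qed
    have "known i u"
      unfolding known_def
    proof (intro conjI ballI allI impI)
      fix i' v assume i': "i' \<in> {i..m}" and v: "v < n"
      show "arr u (pb i' + 1) (K * v + off i') ~= 0 \<longleftrightarrow> (\<exists>b. Rl i' v b & D i' b)"
      proof (cases "i' = i")
        case True
        then show ?thesis using new v by simp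
      next
        case False
        then have "arr u (pb i' + 1) = arr ?t (pb i' + 1)" using mu i' by (auto simp: mods_def pb_def)
        then show ?thesis using kt i' False v unfolding known_def by auto
      qed
    next
      fix a assume a: "5 <= a" "\<forall>i'\<in>{i..m}. a < pb i' \<or> pb i' + 3 < a"
      have "i \<in> {i..m}" using i by simp
      then have "a < pb i \<or> pb i + 3 < a" using a by blast
      then have "arr u a = arr ?t a" using mu by (auto simp: mods_def)
      then show "arr u a = (\<lambda>_. 0)" using kt a unfolding known_def by auto
    qed
    then show "?Q u" using gu cost by simp
  qed (use As less z ik i in \<open>auto simp: graph_ok_def pb_def\<close>)
  then show "wp (Assign 14 (Lit 1) ;; spread (pb i) K i (Lit 1)) ?Q t" by simp
qed

lemma wp_root:
  assumes g: "gst n (Gam 1) c s" and kn: "known 1 s"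
  shows "wp root (\<lambda>t. gst n (Gam 0) (c + 2 * le 0) t & reg t 3 = (if D 0 0 then 1 else 0) & clk t <= clk s + 5 + 14 * le 0) s"
proof -
  have r0: "reg s 0 = n" using g by (auto simp: gst_def graph_ok_def)
  have G0: "Gam 0 = lv 0 \<union> Gam 1"
  proof -
    have "{max 1 0..m} = {max 1 1..m}" "{0..m} = insert 0 {1..m}" by auto
    then show ?thesis unfolding Gam_def by auto
  qed
  have D0: "D 0 0 \<longleftrightarrow> (\<forall>c\<in>set (children 0). \<exists>b. Rl c 0 b & D c b)"
    by (subst D_iff) (auto simp: set_children)
  have lv0: "lv 0 = {}" if "\<not> D 0 0 \<or> children 0 = []"
    using that set_children[of 0] by (auto simp: lv_def)
  show ?thesis
  proof (cases "children 0 = []")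
    case True
    then show ?thesis using g gst_mono[of n _ c "assign 3 1 s" "c + 2 * le 0"] D0 lv0 G0 by (simp add: root_def)
  next
    case ne: False
    show ?thesis
    proof (cases "n = 0")
      case True
      have "\<not> D 0 0" using ne True D0 Rl_def by (cases "children 0") auto
      then show ?thesis using ne True r0 g gst_mono[of n _ c "assign 3 0 (tick s)" "c + 2 * le 0"] lv0 G0 by (simp add: root_def)
    next
      case False
      have kt: "known (Suc 0) (tick s)" using kn by (simp add: known_def)
      let ?Q = "\<lambda>t. gst n (Gam 0) (c + 2 * le 0) t & reg t 3 = (if D 0 0 then 1 else 0) & clk t <= clk s + 5 + 14 * le 0"
      have "wp (check 0 (Lit 0) ;; Cond (Var 8) (seqs (map add_arc (lvl 0 (Lit 0))) ;; Assign 3 (Lit 1)) (Assign 3 (Lit 0))) ?Q (tick s)"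
      proof (rule wp_Seq[OF wp_check[where a = 0]])
        fix u assume u: "(reg u 8 ~= 0 \<longleftrightarrow> (\<forall>c\<in>set (children 0). arr (tick s) (pb c + 1) (K * 0 + off c) ~= 0)) &
            clk u <= clk (tick s) + 1 + 2 * length (children 0)"
          and mu: "mods (warr (check 0 (Lit 0))) (wreg (check 0 (Lit 0))) (tick s) u"
        have r8: "reg u 8 ~= 0 \<longleftrightarrow> D 0 0" using u check_D[OF kt, of 0] False by simp
        have gu: "gst n (Gam 1) c (tick u)" using gst_mods[OF _ mu] g by simp
        have len: "length (lvl 0 (Lit 0)) <= le 0" "length (children 0) <= le 0" by (simp_all add: le_def lvl_def)
        show "wp (Cond (Var 8) (seqs (map add_arc (lvl 0 (Lit 0))) ;; Assign 3 (Lit 1)) (Assign 3 (Lit 0))) ?Q u"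
        proof (cases "D 0 0")
          case True
          have av: "arc_val (tick u) ` set (lvl 0 (Lit 0)) = lv 0"
            using True by (auto simp: lvl_def lv_def arc_val_def set_children image_iff)
          have "wp (seqs (map add_arc (lvl 0 (Lit 0)))) (\<lambda>x. gst n (arc_val (tick u) ` set (lvl 0 (Lit 0)) \<union> Gam 1)
              (c + 2 * length (lvl 0 (Lit 0))) x & clk x = clk (tick u) + 12 * length (lvl 0 (Lit 0))) (tick u)"
            by (rule wp_add_arcs[OF gu]) (auto simp: lvl_def)
          then have "wp (seqs (map add_arc (lvl 0 (Lit 0)))) (\<lambda>x. ?Q (assign 3 1 x)) (tick u)"
            unfolding av
          proof (rule wp_mono)
            fix x assume x: "gst n (lv 0 \<union> Gam 1) (c + 2 * length (lvl 0 (Lit 0))) x & clk x = clk (tick u) + 12 * length (lvl 0 (Lit 0))"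
            then have "gst n (Gam 0) (c + 2 * le 0) x" using gst_mono[of n "Gam 0" _ x] len G0 by auto
            then show "?Q (assign 3 1 x)" using x u len True by simp
          qed
          then show ?thesis using True r8 by simp
        next
          case F: False
          then show ?thesis using r8 lv0 G0 gu gst_mono[OF gu, of "c + 2 * le 0"] u len by simp
        qed
      qed simp
      then show ?thesis using ne False r0 by (simp add: root_def)
    qed
  qed
qed

lemma wp_bottom_up:
  assumes g: "gst n (Gam (Suc m)) (2 * length rules * length es) s" and z: "\<forall>a\<ge>5. arr s a = (\<lambda>_. 0)"
  shows "wp bottom_up (\<lambda>t. gst n (Gam 0) (AC * (1 + n + length es)) t & table (pb (Suc m)) {0} t (proj {0}) &
    (\<forall>a\<ge>pb (Suc m). arr t a = (\<lambda>_. 0)) & clk t <= clk s + (m + 1) * (SC * (1 + n + length es))) s"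
proof -
  let ?Z = "1 + n + length es"
  \<comment> \<open>Bounds the number of arcs once the variables from \<open>k\<close> on are
    attached: the transitions of the automata, plus the arcs of each such variable per
    vertex.\<close>
  let ?c = "\<lambda>k. 2 * length rules * length es + 2 * n * (\<Sum>i\<in>{k..m}. le i)"
  have sub: "(\<Sum>i\<in>{k..m}. le i) <= (\<Sum>i\<in>{0..m}. le i)" for k by (intro sum_mono2) auto
  have cAC: "?c k + 2 * le 0 <= AC * ?Z" if "1 <= k" for k
  proof -
    have "2 * n * (\<Sum>i\<in>{k..m}. le i) <= 2 * n * (\<Sum>i\<in>{0..m}. le i)" using sub by simp
    moreover have "le 0 <= (\<Sum>i\<in>{0..m}. le i)" by (intro member_le_sum) auto
    moreover have "AC * ?Z = 2 * length rules * ?Z + 2 * (\<Sum>i\<in>{0..m}. le i) + 2 * n * (\<Sum>i\<in>{0..m}. le i) + 2 * length es * (\<Sum>i\<in>{0..m}. le i)"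
      by (simp add: AC_def algebra_simps)
    moreover have "2 * length rules * length es <= 2 * length rules * ?Z" by (intro mult_le_mono2) simp
    ultimately show ?thesis by linarith
  qed
  let ?I = "\<lambda>j t. gst n (Gam (Suc m - j)) (?c (Suc m - j)) t & known (Suc m - j) t & clk t <= clk s + j * (SC * ?Z)"
  let ?Q = "\<lambda>t. gst n (Gam 0) (AC * ?Z) t & table (pb (Suc m)) {0} t (proj {0}) &
    (\<forall>a\<ge>pb (Suc m). arr t a = (\<lambda>_. 0)) & clk t <= clk s + (m + 1) * (SC * ?Z)"
  have "wp (seqs (map step (rev [1..<Suc m]))) (?I (length (map step (rev [1..<Suc m])))) s"
  proof (rule wp_seqs)
    show "?I 0 s" using g z by (simp add: known_def)
  next
    fix j t assume j: "j < length (map step (rev [1..<Suc m]))" and I: "?I j t"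
    let ?i = "m - j"
    have jm: "j < m" using j by (simp del: upt_Suc)
    then have i: "?i \<in> {1..m}" and e: "Suc m - j = Suc ?i" "Suc m - Suc j = ?i" by auto
    have st: "map step (rev [1..<Suc m]) ! j = step ?i" using jm by (simp add: rev_nth Suc_diff_Suc del: upt_Suc)
    have ci: "?c (Suc ?i) + 2 * le ?i * n = ?c ?i"
    proof -
      have "{?i..m} = insert ?i {Suc ?i..m}" using i by auto
      then show ?thesis by (simp add: algebra_simps)
    qed
    show "wp (map step (rev [1..<Suc m]) ! j) (?I (Suc j)) t"
      unfolding st e(2)
    proof (rule wp_mono[OF wp_step[OF i]])
      show "gst n (Gam (Suc ?i)) (?c (Suc ?i)) t" "known (Suc ?i) t" using I by (simp_all only: e)
      fix u assume u: "gst n (Gam ?i) (?c (Suc ?i) + 2 * le ?i * n) u & known ?i u &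
        clk u <= clk t + 12 + (18 + 14 * le ?i + 10 * K) * n + 11 * (?c (Suc ?i) + 2 * le ?i * n)"
      have "?c ?i <= AC * ?Z" using cAC[of ?i] i by simp
      moreover have "(18 + 14 * le ?i + 10 * K) * n <= (18 + 14 * AC + 10 * K) * ?Z"
        using le_AC[of ?i] by (intro mult_le_mono) auto
      moreover have "SC * ?Z = 42 * ?Z + (18 + 14 * AC + 10 * K) * ?Z + 11 * (AC * ?Z)" by (simp add: SC_def algebra_simps)
      moreover have "12 + a + 11 * b <= w" if "b <= r" "a <= q" "w = 42 * z + q + 11 * r" "1 <= z" for a b q r w z :: nat
        using that by linarith
      ultimately have "12 + (18 + 14 * le ?i + 10 * K) * n + 11 * ?c ?i <= SC * ?Z" by simp
      then show "gst n (Gam ?i) (?c ?i) u & known ?i u & clk u <= clk s + Suc j * (SC * ?Z)"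
        using u I unfolding ci by simp
    qed
  qed
  then have "wp (seqs (map step (rev [1..<Suc m])) ;; root) ?Q s"
  proof (rule wp_Seq)
    fix t assume "?I (length (map step (rev [1..<Suc m]))) t"
    then have t: "gst n (Gam 1) (?c 1) t" "known 1 t" "clk t <= clk s + m * (SC * ?Z)" by (simp_all del: upt_Suc)
    show "wp root ?Q t"
    proof (rule wp_frame[OF wp_root[OF t(1,2)]])
      fix u assume u: "gst n (Gam 0) (?c 1 + 2 * le 0) u & reg u 3 = (if D 0 0 then 1 else 0) & clk u <= clk t + 5 + 14 * le 0"
        and m: "mods (warr root) (wreg root) t u"
      have "gst n (Gam 0) (AC * ?Z) u" using gst_mono u cAC[of 1] by blast
      moreover have z: "\<forall>a\<ge>pb (Suc m). arr u a = (\<lambda>_. 0)"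
      proof (intro allI impI)
        fix a assume a: "pb (Suc m) <= a"
        then have "arr u a = arr t a" using mods_arr[OF m, of a] root_sets by (force simp: pb_def)
        moreover have "5 <= a" "\<forall>i\<in>{1..m}. a < pb i \<or> pb i + 3 < a" using a by (auto simp: pb_def)
        ultimately show "arr u a = (\<lambda>_. 0)" using t(2) unfolding known_def by auto
      qed
      moreover have "table (pb (Suc m)) {0} u (proj {0})"
        unfolding table_def proj_0
      proof (intro conjI exI[of _ "if D 0 0 then [\<lambda>i\<in>{0}. 0] else []"])
        show "tab (pb (Suc m)) {0} 3 u (if D 0 0 then [\<lambda>i\<in>{0}. 0] else [])"
          using u z by (simp add: tab_def)
      qed auto
      moreover have "clk u <= clk s + (m + 1) * (SC * ?Z)"
      proof -
        have "5 + 14 * le 0 <= SC * 1" using le_AC[of 0] by (simp add: SC_def)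
        also have "SC * 1 <= SC * ?Z" by (intro mult_le_mono2) simp
        finally show ?thesis using u t(3) by simp
      qed
      ultimately show "?Q u" by blast
    qed
  qed
  then show ?thesis by (simp add: bottom_up_def)
qed

end

section \<open>Executing a join plan\<close>

text \<open>The column sets of all intermediate tables, including the first and the last; the sizes
  of these tables govern the cost.\<close>

fun states :: "nat list => op list => nat list list" where
  "states W [] = [W]"
| "states W (Ext x y # os) = W # states (y # W) os"
| "states W (Keep V # os) = W # states V os"

fun final :: "nat list => op list => nat list" where
  "final W [] = W"
| "final W (Ext x y # os) = final (y # W) os"
| "final W (Keep V # os) = final V os"

context tree_prog
begin

text \<open>Each operation works in arrays beyond all that were used before. As the plan is fixed,
  the number of arrays is a constant of the query, and freshness replaces initialization.\<close>

fun run :: "op list => nat list => nat => nat => com" where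
  "run [] W cb p = Skip"
| "run (Ext x y # os) W cb p = two_way.extend K x y (x + kst) (y + kst) W cb p x y ;; run os (y # W) (p + 15) (p + 16 + m)"
| "run (Keep V # os) W cb p = dedupe V cb p ;; run os V (p + 2 * length V + 2) (p + 2 * length V + 3 + m)"

fun base :: "op list => nat => nat => nat" where
  "base [] cb p = cb"
| "base (Ext x y # os) cb p = base os (p + 15) (p + 16 + m)"
| "base (Keep V # os) cb p = base os (p + 2 * length V + 2) (p + 2 * length V + 3 + m)"

fun free_array :: "op list => nat => nat" where
  "free_array [] p = p"
| "free_array (Ext x y # os) p = free_array os (p + 16 + m)"
| "free_array (Keep V # os) p = free_array os (p + 2 * length V + 3 + m)"

text \<open>Tables are stored by columns, whereas the result has to be delivered row by row.\<close>

definition flat :: "nat list => nat => nat => com" where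
  "flat cols cb a = Assign 9 (Lit 0) ;; For 20 (Var 3)
     (seqs (map (\<lambda>i. Put a (Var 9) (Elem (cb + i) (Var 20)) ;; Assign 9 (Sum (Var 9) (Lit 1))) cols))"

lemma wp_flat:
  assumes t: "tab cb W 3 s rows" and c: "set cols \<subseteq> W" and a: "\<And>i. i \<in> W ==> cb + i ~= a"
  shows "wp (flat cols cb a) (\<lambda>t. reg t 3 = length rows & reg t 9 = length cols * length rows &
    map (arr t a) [0..<length cols * length rows] = concat (map (\<lambda>\<rho>. map \<rho> cols) rows) &
    clk t <= clk s + 3 + (2 + 2 * length cols) * length rows) s"
proof -
  let ?f = "\<lambda>i. Put a (Var 9) (Elem (cb + i) (Var 20)) ;; Assign 9 (Sum (Var 9) (Lit 1))"
  let ?c = "seqs (map ?f cols)"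
  let ?out = "\<lambda>k. concat (map (\<lambda>\<rho>. map \<rho> cols) (take k rows))"
  let ?I = "\<lambda>k t. reg t 9 = length (?out k) & map (arr t a) [0..<reg t 9] = ?out k & clk t <= clk s + 2 + (2 + 2 * length cols) * k"
  have upd: "map (f(l := v)) [0..<l] = map f [0..<l]" for f :: "nat => nat" and l v by auto
  have lenc: "length (concat (map (\<lambda>\<rho>. map \<rho> cols) rs)) = length cols * length rs" for rs :: "(nat => nat) list"
    by (induction rs) auto
  let ?s = "assign 9 0 s"
  have ws: "warr ?c \<subseteq> {a}" "wreg ?c \<subseteq> {9}" by auto
  have "wp (For 20 (Var 3) ?c) (\<lambda>t. reg t 3 = length rows & reg t 9 = length cols * length rows &
    map (arr t a) [0..<length cols * length rows] = concat (map (\<lambda>\<rho>. map \<rho> cols) rows) &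
    clk t <= clk s + 3 + (2 + 2 * length cols) * length rows) ?s"
  proof (rule wp_For[where N = "length rows" and I = ?I])
    fix k t assume I: "?I k t" and m: "mods (warr ?c) (insert 20 (wreg ?c)) ?s t" and k: "reg t 20 = k" "k < length rows"
    let ?J = "\<lambda>j u. reg u 9 = length (?out k @ map (rows ! k) (take j cols)) &
      map (arr u a) [0..<reg u 9] = ?out k @ map (rows ! k) (take j cols) & clk u <= clk t + 1 + 2 * j & mods {a} {9} t u"
    have "wp ?c (?J (length (map ?f cols))) (tick t)"
    proof (rule wp_seqs)
      fix j u assume j: "j < length (map ?f cols)" and J: "?J j u"
      have jw: "cols ! j \<in> W" using c j by auto
      have "arr u (cb + cols ! j) = arr s (cb + cols ! j)"
        using a[OF jw] mods_arr[OF m, of "cb + cols ! j"] J ws by (auto simp: mods_def)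
      then have v: "arr u (cb + cols ! j) (reg u 20) = (rows ! k) (cols ! j)"
        using t k jw J by (simp add: tab_def mods_def)
      have mp: "map ((arr u a)(reg u 9 := x)) [0..<Suc (reg u 9)] = map (arr u a) [0..<reg u 9] @ [x]" for x
        by (simp add: upd fun_upd_same del: fun_upd_apply)
      let ?u = "assign 9 (Suc (reg u 9)) (put a (reg u 9) ((rows ! k) (cols ! j)) u)"
      have tk: "take (Suc j) cols = take j cols @ [cols ! j]" using j by (simp add: take_Suc_conv_app_nth)
      have e1: "map (arr ?u a) [0..<reg ?u 9] = map (arr u a) [0..<reg u 9] @ [(rows ! k) (cols ! j)]"
        using mp[of "(rows ! k) (cols ! j)"] by (simp del: upt_Suc fun_upd_apply add: fun_upd_same)
      have e2: "map (arr u a) [0..<reg u 9] = ?out k @ map (rows ! k) (take j cols)" using J by blast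
      have "map (arr ?u a) [0..<reg ?u 9] = ?out k @ map (rows ! k) (take (Suc j) cols)"
        unfolding e1 e2 tk by simp
      moreover have "reg ?u 9 = length (?out k @ map (rows ! k) (take (Suc j) cols))" using J unfolding tk by simp
      moreover have "mods {a} {9} t ?u" "clk ?u <= clk t + 1 + 2 * Suc j" using J by (auto simp: mods_def)
      ultimately have "?J (Suc j) ?u" by blast
      moreover have "wp (map ?f cols ! j) (?J (Suc j)) u = ?J (Suc j) ?u" using j v by simp
      ultimately show "wp (map ?f cols ! j) (?J (Suc j)) u" by blast
    qed (use I in auto)
    then show "wp ?c (\<lambda>u. ?I (Suc k) (assign 20 (Suc k) u)) (tick t)"
      by (rule wp_mono) (use I k in \<open>auto simp: take_Suc_conv_app_nth\<close>)
  next
    fix t assume I: "?I (length rows) t" and m: "mods (warr ?c) (insert 20 (wreg ?c)) ?s t"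
    have "reg t 3 = length rows" using mods_reg[OF m, of 3] ws assms(1) by (auto simp: tab_def)
    then show "reg (tick t) 3 = length rows & reg (tick t) 9 = length cols * length rows &
      map (arr (tick t) a) [0..<length cols * length rows] = concat (map (\<lambda>\<rho>. map \<rho> cols) rows) &
      clk (tick t) <= clk s + 3 + (2 + 2 * length cols) * length rows"
      using I lenc by auto
  next
    show "val (Var 3) t = length rows" if "mods (warr ?c) (insert 20 (wreg ?c)) ?s t" for t
      using mods_reg[OF that, of 3] ws assms(1) by (auto simp: tab_def)
  qed (use ws in auto)
  then show ?thesis by (simp add: flat_def)
qed

definition main :: "op list => nat list => com" where
  "main ops cols = init ;; build ;; bottom_up ;; run ops [0] (pb (Suc m)) (pb (Suc m) + Suc m) ;;
     flat cols (base ops (pb (Suc m)) (pb (Suc m) + Suc m)) (free_array ops (pb (Suc m) + Suc m))"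

definition OC :: nat where
  "OC = 500 * (K + m + 2)"

end

context tree_run
begin

fun plan_ok :: "nat list => op list => bool" where
  "plan_ok W [] \<longleftrightarrow> True"
| "plan_ok W (Ext x y # os) \<longleftrightarrow> x \<in> set W & y \<notin> set W & y <= m & desc x y & separates x y (set W) & plan_ok (y # W) os"
| "plan_ok W (Keep V # os) \<longleftrightarrow> set V \<subseteq> set W & distinct V & plan_ok V os"

lemma Chain_less: "Chain x a y b ==> x ~= y ==> b < n"
  by (erule Chain.cases) (auto dest: D_less)

text \<open>Every reachable pair occurs in some row of the new table. The capacity, which is of the
  order of the root of the number of pairs, can therefore be charged to the size of that
  table.\<close>

lemma wp_extend_proj:
  assumes g: "gst n (Gam 0) c s" and t: "table cb (set W) s (proj (set W))" and Wm: "set W \<subseteq> {..m}"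
    and lay: "cb + m < p" "4 < p" and z: "\<And>a. p <= a ==> arr s a = (\<lambda>_. 0)"
    and x: "x \<in> set W" and y: "y \<notin> set W" "y <= m" "desc x y" "separates x y (set W)" and n1: "H ~= {} ==> 1 <= n"
  shows "wp (two_way.extend K x y (x + kst) (y + kst) W cb p x y) (\<lambda>u. table (p + 15) (set (y # W)) u (proj (set (y # W))) &
    mods {p..p + 15 + m} ({3} \<union> {12..25}) s u & (\<exists>cap. (cap = 1 \<or> cap * cap <= 4 * card (proj (set (y # W)))) &
    clk u <= clk s + 200 * ((K + 2) * (1 + n + c) * cap) + (length W + 20) * (card (proj (set W)) + card (proj (set (y # W))) + 1))) s"
proof -
  obtain As where As: "graph_ok As K n s" "set As = arcs_of (Gam 0)" "length As <= c" using g by (auto simp: gst_def)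
  define A where "A = (\<lambda>\<rho>. \<rho> x) ` proj (set W)"
  have xm: "x <= m" using x Wm by auto
  have xy: "x ~= y" using x y by auto
  have A: "A \<subseteq> {..<n}"
  proof
    fix a assume "a \<in> A"
    then obtain \<mu> where \<mu>: "\<mu> \<in> H" "a = \<mu> x" using x by (auto simp: A_def proj_def)
    have "1 <= n" using n1 \<mu> by blast
    then show "a \<in> {..<n}" using \<mu> H_less[OF \<mu>(1), of x] xm by (cases "x = 0") (auto simp: H_def)
  qed
  interpret tw: two_way As K n x y "x + kst" "y + kst" A
  proof
    show "set As \<subseteq> {..<K * n} \<times> {..<K * n}" unfolding As(2) by (rule arcs_less) simp
    show "x < K" "y < K" "x + kst < K" "y + kst < K" using xm y m_kst by (simp_all add: K_def)
    show "((K * b + y, K * a + x) \<in> (set As)\<^sup>*) = ((K * a + (x + kst), K * b + (y + kst)) \<in> (set As)\<^sup>*)" for a b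
      unfolding As(2) using arcs_backward[OF Gam_states, of x y b a 0] arcs_forward[OF Gam_states, of x y a b 0] xm y m_kst
      by auto
    show "A \<subseteq> {..<n}" by (rule A)
  qed
  have Rel: "tw.Rel = {(a, b). a \<in> A & Chain x a y b}"
    unfolding tw.Rel_def As(2) using arcs_backward[OF Gam_states, of x y _ _ 0] xm y m_kst reach_chain[OF xm y(2)] Chain_less xy
    by auto
  have T: "{\<rho>(y := b) | \<rho> b. \<rho> \<in> proj (set W) & (\<rho> x, b) \<in> tw.Rel} = proj (set (y # W))"
  proof -
    have "\<rho> x \<in> A" if "\<rho> \<in> proj (set W)" for \<rho> using that by (simp add: A_def)
    then have "{\<rho>(y := b) | \<rho> b. \<rho> \<in> proj (set W) & (\<rho> x, b) \<in> tw.Rel} = {\<rho>(y := b) | \<rho> b. \<rho> \<in> proj (set W) & Chain x (\<rho> x) y b}"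
      unfolding Rel by blast
    then show ?thesis using proj_extend[OF x xm y] by simp
  qed
  have fin: "finite (proj (set (y # W)))" using Wm y by (intro finite_proj) auto
  have cR: "card tw.Rel <= card (proj (set (y # W)))"
  proof -
    have "tw.Rel \<subseteq> (\<lambda>\<sigma>. (\<sigma> x, \<sigma> y)) ` proj (set (y # W))"
    proof
      fix z assume "z \<in> tw.Rel"
      then obtain a b where ab: "z = (a, b)" "a \<in> A" "(a, b) \<in> tw.Rel" unfolding Rel by blast
      then obtain \<rho> where \<rho>: "\<rho> \<in> proj (set W)" "a = \<rho> x" unfolding A_def by blast
      have z: "z = (\<rho> x, b)" "\<rho> \<in> proj (set W)" "(\<rho> x, b) \<in> tw.Rel" using ab \<rho> by auto
      then have "\<rho>(y := b) \<in> proj (set (y # W))" unfolding T[symmetric] by blast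
      then show "z \<in> (\<lambda>\<sigma>. (\<sigma> x, \<sigma> y)) ` proj (set (y # W))"
        using z xy by (intro image_eqI[of _ _ "\<rho>(y := b)"]) auto
    qed
    then show ?thesis using fin by (meson card_image_le card_mono finite_imageI le_trans)
  qed
  have X: "tw.X <= (K + 2) * (1 + n + c)" using As(3) by (simp add: tw.X_def algebra_simps)
  show ?thesis
  proof (rule wp_frame[OF tw.wp_extend[OF As(1) t A_def x y(1) _ lay z]])
    show "i <= m" if "i \<in> set (y # W)" for i using that Wm y by auto
    fix u assume ex: "\<exists>cap. tw.cap_ok cap & table (p + 15) (set (y # W)) u {\<rho>(y := b) | \<rho> b. \<rho> \<in> proj (set W) & (\<rho> x, b) \<in> tw.Rel} &
      clk u <= clk s + 200 * (tw.X * cap) + (length W + 20) * (card (proj (set W)) + card {\<rho>(y := b) | \<rho> b. \<rho> \<in> proj (set W) & (\<rho> x, b) \<in> tw.Rel} + 1)"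
      and mu: "mods (warr (tw.extend W cb p x y)) (wreg (tw.extend W cb p x y)) s u"
    have "warr (tw.extend W cb p x y) \<subseteq> {p..p + 15 + m}" using tw.extend_sets(1)[of W cb p x y] Wm y by fastforce
    then have mods: "mods {p..p + 15 + m} ({3} \<union> {12..25}) s u" using mods_mono[OF mu _ tw.extend_sets(2)] by blast
    from ex obtain cap where cap: "tw.cap_ok cap" "table (p + 15) (set (y # W)) u (proj (set (y # W)))"
      "clk u <= clk s + 200 * (tw.X * cap) + (length W + 20) * (card (proj (set W)) + card (proj (set (y # W))) + 1)"
      unfolding T by blast
    have "tw.X * cap <= (K + 2) * (1 + n + c) * cap" using X by (rule mult_le_mono1)
    then have "clk u <= clk s + 200 * ((K + 2) * (1 + n + c) * cap) + (length W + 20) * (card (proj (set W)) + card (proj (set (y # W))) + 1)"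
      using cap(3) by linarith
    moreover have "cap = 1 \<or> cap * cap <= 4 * card (proj (set (y # W)))"
      using cap(1) cR unfolding tw.cap_ok_def by linarith
    ultimately show "table (p + 15) (set (y # W)) u (proj (set (y # W))) &
      mods {p..p + 15 + m} ({3} \<union> {12..25}) s u & (\<exists>cap. (cap = 1 \<or> cap * cap <= 4 * card (proj (set (y # W)))) &
      clk u <= clk s + 200 * ((K + 2) * (1 + n + c) * cap) + (length W + 20) * (card (proj (set W)) + card (proj (set (y # W))) + 1))"
      using cap(2) mods by blast
  qed auto
qed

text \<open>\<open>N\<close> bounds all intermediate tables. An extension costs the graph size times
  the root of \<open>N\<close>; copying, joining and projecting are linear in
  \<open>N\<close>.\<close>

theorem wp_run:
  assumes "plan_ok W ops" "gst n (Gam 0) c s" "table cb (set W) s (proj (set W))" "set W \<subseteq> {..m}" "distinct W"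
    and "cb + m < p" "4 < p" "\<And>a. p <= a ==> arr s a = (\<lambda>_. 0)"
    and "\<And>V. V \<in> set (states W ops) ==> card (proj (set V)) <= N" and n1: "ops ~= [] ==> H ~= {} ==> 1 <= n"
  shows "wp (run ops W cb p) (\<lambda>u. table (base ops cb p) (set (final W ops)) u (proj (set (final W ops))) &
    set (final W ops) \<subseteq> {..m} & base ops cb p + m < free_array ops p &
    real (clk u) <= real (clk s) + length ops * (OC * ((1 + n + c) * (1 + sqrt N) + N))) s"
  using assms
proof (induction ops arbitrary: W s cb p)
  case Nil
  then show ?case by simp
next
  case (Cons q os)
  define \<Phi> where "\<Phi> = (1 + real n + real c) * (1 + sqrt N) + N"
  have N1: "1 + real N <= \<Phi>"
  proof -
    have "1 * 1 <= (1 + real n + real c) * (1 + sqrt N)" by (intro mult_mono) auto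
    then show ?thesis by (simp add: \<Phi>_def)
  qed
  have \<Phi>0: "0 <= \<Phi>" using N1 by simp
  have lenW: "length W <= m + 1"
  proof -
    have "card (set W) <= card {..m}" using Cons.prems(4) by (intro card_mono) auto
    then show ?thesis using Cons.prems(5) by (simp add: distinct_card)
  qed
  have nxt: "wp (run os V cb' p') (\<lambda>u. table (base os cb' p') (set (final V os)) u (proj (set (final V os))) &
      set (final V os) \<subseteq> {..m} & base os cb' p' + m < free_array os p' &
      real (clk u) <= real (clk s) + length (q # os) * (OC * \<Phi>)) t"
    if "plan_ok V os" "gst n (Gam 0) c t" "table cb' (set V) t (proj (set V))" "set V \<subseteq> {..m}" "distinct V"
      "cb' + m < p'" "4 < p'" "\<And>a. p' <= a ==> arr t a = (\<lambda>_. 0)"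
      "\<And>V'. V' \<in> set (states V os) ==> card (proj (set V')) <= N"
      "real (clk t) <= real (clk s) + OC * \<Phi>" for V cb' p' t
    by (rule wp_mono[OF Cons.IH[OF that(1-9)]]) (use Cons.prems(10) that(10) in \<open>auto simp: \<Phi>_def algebra_simps\<close>)
  show ?case
  proof (cases q)
    case (Ext x y)
    have pk: "x \<in> set W" "y \<notin> set W" "y <= m" "desc x y" "separates x y (set W)" "plan_ok (y # W) os"
      using Cons.prems(1) by (auto simp: Ext)
    have st: "states W (q # os) = W # states (y # W) os" by (simp add: Ext)
    have hd: "V \<in> set (states V os)" for V by (cases os rule: states.cases[of "(V, os)" for os, simplified]) auto
    have cN: "card (proj (set W)) <= N" "card (proj (set (y # W))) <= N"
      using Cons.prems(9)[of W] Cons.prems(9)[of "y # W"] hd[of "y # W"] unfolding st by auto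
    have "wp (two_way.extend K x y (x + kst) (y + kst) W cb p x y ;; run os (y # W) (p + 15) (p + 16 + m))
      (\<lambda>u. table (base os (p + 15) (p + 16 + m)) (set (final (y # W) os)) u (proj (set (final (y # W) os))) &
        set (final (y # W) os) \<subseteq> {..m} & base os (p + 15) (p + 16 + m) + m < free_array os (p + 16 + m) &
        real (clk u) <= real (clk s) + length (q # os) * (OC * \<Phi>)) s"
    proof (rule wp_Seq[OF wp_extend_proj[OF Cons.prems(2-4,6-8) pk(1-5)]])
      fix u assume u: "table (p + 15) (set (y # W)) u (proj (set (y # W))) &
          mods {p..p + 15 + m} ({3} \<union> {12..25}) s u & (\<exists>cap. (cap = 1 \<or> cap * cap <= 4 * card (proj (set (y # W)))) &
          clk u <= clk s + 200 * ((K + 2) * (1 + n + c) * cap) + (length W + 20) * (card (proj (set W)) + card (proj (set (y # W))) + 1))"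
      then obtain cap where cap: "cap = 1 \<or> cap * cap <= 4 * card (proj (set (y # W)))"
        "clk u <= clk s + 200 * ((K + 2) * (1 + n + c) * cap) + (length W + 20) * (card (proj (set W)) + card (proj (set (y # W))) + 1)" by blast
      have mu: "mods {p..p + 15 + m} ({3} \<union> {12..25}) s u" using u by blast
      have "real cap <= 1 + 2 * sqrt N"
      proof (cases "cap = 1")
        case False
        then have "cap * cap <= 4 * N" using cap(1) cN(2) by linarith
        then have "real (cap * cap) <= real (4 * N)" by (simp only: of_nat_le_iff)
        then have "(real cap)\<^sup>2 <= 4 * real N" by (simp add: power2_eq_square)
        then have "real cap <= sqrt (4 * real N)" by (rule real_le_rsqrt)
        then show ?thesis by (simp add: real_sqrt_mult)
      qed simp
      then have "(K + 2) * (1 + real n + c) * cap <= (K + 2) * (1 + real n + c) * (2 * (1 + sqrt N))"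
        by (intro mult_left_mono) auto
      also have "\<dots> <= 2 * (K + 2) * \<Phi>" by (simp add: \<Phi>_def algebra_simps)
      finally have c1: "(K + 2) * (1 + real n + c) * cap <= 2 * (K + 2) * \<Phi>" .
      have "(length W + 20) * (card (proj (set W)) + card (proj (set (y # W))) + 1) <= (m + 21) * (2 * (N + 1))"
        using lenW cN by (intro mult_le_mono) auto
      then have "real ((length W + 20) * (card (proj (set W)) + card (proj (set (y # W))) + 1)) <= real ((m + 21) * (2 * (N + 1)))"
        by (simp only: of_nat_le_iff)
      also have "\<dots> = (2 * (real m + 21)) * (1 + real N)" by (simp add: algebra_simps)
      also have "\<dots> <= (2 * (real m + 21)) * \<Phi>" using N1 by (intro mult_left_mono) auto
      finally have c2: "real ((length W + 20) * (card (proj (set W)) + card (proj (set (y # W))) + 1)) <= (2 * (real m + 21)) * \<Phi>" .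
      have "real (clk u) <= real (clk s + 200 * ((K + 2) * (1 + n + c) * cap) + (length W + 20) * (card (proj (set W)) + card (proj (set (y # W))) + 1))"
        using cap(2) by (simp only: of_nat_le_iff)
      also have "\<dots> = real (clk s) + 200 * ((K + 2) * (1 + real n + c) * cap) + real ((length W + 20) * (card (proj (set W)) + card (proj (set (y # W))) + 1))"
        by (simp add: algebra_simps)
      also have "\<dots> <= real (clk s) + 200 * (2 * (K + 2) * \<Phi>) + (2 * (real m + 21)) * \<Phi>" using c1 c2 by linarith
      also have "\<dots> = real (clk s) + (400 * (K + 2) + 2 * (real m + 21)) * \<Phi>" by (simp add: algebra_simps)
      also have "\<dots> <= real (clk s) + OC * \<Phi>" using \<Phi>0 by (intro add_left_mono mult_right_mono) (auto simp: OC_def)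
      finally have cu: "real (clk u) <= real (clk s) + OC * \<Phi>" .
      show "wp (run os (y # W) (p + 15) (p + 16 + m)) (\<lambda>u. table (base os (p + 15) (p + 16 + m)) (set (final (y # W) os)) u (proj (set (final (y # W) os))) &
        set (final (y # W) os) \<subseteq> {..m} & base os (p + 15) (p + 16 + m) + m < free_array os (p + 16 + m) &
        real (clk u) <= real (clk s) + length (q # os) * (OC * \<Phi>)) u"
      proof (rule nxt[OF pk(6)])
        show "gst n (Gam 0) c u" by (rule gst_mods[OF Cons.prems(2) mu]) (use Cons.prems(7) in auto)
        show "arr u a = (\<lambda>_. 0)" if "p + 16 + m <= a" for a
          using mods_arr[OF mu, of a] Cons.prems(8)[of a] that by simp
        show "card (proj (set V')) <= N" if "V' \<in> set (states (y # W) os)" for V'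
          using Cons.prems(9)[of V'] that unfolding st by simp
      qed (use u cu Cons.prems(4,5) pk in auto)
    qed (use Cons.prems(10) in auto)
    then show ?thesis by (simp add: Ext \<Phi>_def add.assoc)
  next
    case (Keep V)
    have pk: "set V \<subseteq> set W" "distinct V" "plan_ok V os" using Cons.prems(1) by (auto simp: Keep)
    have st: "states W (q # os) = W # states V os" by (simp add: Keep)
    have cN: "card (proj (set W)) <= N" using Cons.prems(9)[of W] unfolding st by auto
    have lenV: "length V <= m + 1"
    proof -
      have "length V <= length W" using pk(1,2) Cons.prems(5) by (metis card_mono distinct_card List.finite_set)
      then show ?thesis using lenW by simp
    qed
    have r0: "reg s 0 = n" using Cons.prems(2) by (auto simp: gst_def graph_ok_def)
    let ?L = "length V"
    have "wp (dedupe V cb p ;; run os V (p + 2 * ?L + 2) (p + 2 * ?L + 3 + m))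
      (\<lambda>u. table (base os (p + 2 * ?L + 2) (p + 2 * ?L + 3 + m)) (set (final V os)) u (proj (set (final V os))) &
        set (final V os) \<subseteq> {..m} & base os (p + 2 * ?L + 2) (p + 2 * ?L + 3 + m) + m < free_array os (p + 2 * ?L + 3 + m) &
        real (clk u) <= real (clk s) + length (q # os) * (OC * \<Phi>)) s"
    proof (rule wp_Seq[OF wp_dedupe[OF Cons.prems(3) pk(1) r0]])
      show "\<rho> i < n" if \<rho>: "\<rho> \<in> proj (set W)" and "i \<in> set W" for \<rho> i
      proof -
        obtain \<mu> where \<mu>: "\<mu> \<in> H" "\<rho> = restrict \<mu> (set W)" using \<rho> by (auto simp: proj_def)
        have "1 <= n" using Cons.prems(10) \<mu> by blast
        then show ?thesis using \<mu> H_less[OF \<mu>(1), of i] that Cons.prems(4) by (cases "i = 0") (auto simp: H_def)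
      qed
      show "cb + i < p" if "i \<in> set W" for i using that Cons.prems(4,6) by fastforce
    next
      fix u assume u: "table (p + 2 * ?L + 2) (set V) u ((\<lambda>\<rho>. restrict \<rho> (set V)) ` proj (set W)) &
          clk u <= clk s + (20 + 20 * ?L) * (card (proj (set W)) + 1)"
        and mu: "mods (warr (dedupe V cb p)) (wreg (dedupe V cb p)) s u"
      have "(20 + 20 * ?L) * (card (proj (set W)) + 1) <= (40 + 20 * m) * (N + 1)" using lenV cN by (intro mult_le_mono) auto
      then have "clk u <= clk s + (40 + 20 * m) * (N + 1)" using u by linarith
      then have "real (clk u) <= real (clk s + (40 + 20 * m) * (N + 1))" by (simp only: of_nat_le_iff)
      also have "\<dots> = real (clk s) + (40 + 20 * real m) * (1 + real N)" by (simp add: algebra_simps)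
      also have "\<dots> <= real (clk s) + (40 + 20 * real m) * \<Phi>" using N1 by (intro add_left_mono mult_left_mono) auto
      also have "\<dots> <= real (clk s) + OC * \<Phi>" using \<Phi>0 by (intro add_left_mono mult_right_mono) (auto simp: OC_def)
      finally have cu: "real (clk u) <= real (clk s) + OC * \<Phi>" .
      have "warr (dedupe V cb p) \<subseteq> {p<..p + 2 * ?L + 2 + m}"
        using dedupe_sets(1)[of V cb p] pk(1) Cons.prems(4) by fastforce
      then have mu': "mods {p<..p + 2 * ?L + 2 + m} {3, 20, 22, 23, 25} s u" using mods_mono[OF mu _ dedupe_sets(2)] by blast
      show "wp (run os V (p + 2 * ?L + 2) (p + 2 * ?L + 3 + m))
        (\<lambda>u. table (base os (p + 2 * ?L + 2) (p + 2 * ?L + 3 + m)) (set (final V os)) u (proj (set (final V os))) &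
        set (final V os) \<subseteq> {..m} & base os (p + 2 * ?L + 2) (p + 2 * ?L + 3 + m) + m < free_array os (p + 2 * ?L + 3 + m) &
        real (clk u) <= real (clk s) + length (q # os) * (OC * \<Phi>)) u"
      proof (rule nxt[OF pk(3)])
        show "gst n (Gam 0) c u" by (rule gst_mods[OF Cons.prems(2) mu']) (use Cons.prems(7) in auto)
        show "table (p + 2 * ?L + 2) (set V) u (proj (set V))" using u proj_restrict[OF pk(1)] by simp
        show "arr u a = (\<lambda>_. 0)" if "p + 2 * ?L + 3 + m <= a" for a
          using mods_arr[OF mu', of a] Cons.prems(8)[of a] that by simp
        show "card (proj (set V')) <= N" if "V' \<in> set (states V os)" for V'
          using Cons.prems(9)[of V'] that unfolding st by simp
      qed (use cu Cons.prems(4,7) pk in auto)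
    qed (use Cons.prems(8) in auto)
    then show ?thesis by (simp add: Keep \<Phi>_def add.assoc)
  qed
qed

definition start_state :: "st => bool" where
  "start_state s \<longleftrightarrow> reg s 0 = n & reg s 1 = length es & clk s = 0 &
     (\<forall>i<length es. arr s 0 (3 * i) = fst (es ! i) & arr s 0 (3 * i + 1) = fst (snd (es ! i)) & arr s 0 (3 * i + 2) = snd (snd (es ! i))) &
     (\<forall>a. a ~= 0 --> arr s a = (\<lambda>_. 0))"

theorem wp_main:
  assumes s: "start_state s" and pok: "plan_ok [0] ops" and c: "set cols \<subseteq> set (final [0] ops)"
    and N: "\<And>V. V \<in> set (states [0] ops) ==> card (proj (set V)) <= N" and n1: "ops ~= [] ==> H ~= {} ==> 1 <= n"
  shows "wp (main ops cols) (\<lambda>u. \<exists>rows. distinct rows & set rows = proj (set (final [0] ops)) &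
      reg u 3 = length rows & reg u 9 = length cols * length rows &
      map (arr u (free_array ops (pb (Suc m) + Suc m))) [0..<length cols * length rows] = concat (map (\<lambda>\<rho>. map \<rho> cols) rows) &
      real (clk u) <= (100 + 4 * K + 13 * length rules + (m + 1) * SC + length ops * (OC * (1 + AC)) + 2 * length cols) *
        ((1 + n + length es) * (1 + sqrt N) + N)) s"
proof -
  let ?Z = "1 + n + length es"
  let ?p = "pb (Suc m)"
  let ?a = "free_array ops (?p + Suc m)"
  define \<Phi> where "\<Phi> = real ?Z * (1 + sqrt N) + N"
  have Z\<Phi>: "real ?Z <= \<Phi>"
  proof -
    have "real ?Z * 1 <= real ?Z * (1 + sqrt N)" by (intro mult_left_mono) auto
    then show ?thesis unfolding \<Phi>_def mult_1_right by (rule order_trans) simp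
  qed
  have N\<Phi>: "1 + real N <= \<Phi>"
  proof -
    have "1 * 1 <= real ?Z * (1 + sqrt N)" by (intro mult_mono) auto
    then show ?thesis by (simp add: \<Phi>_def)
  qed
  let ?Q = "\<lambda>u. \<exists>rows. distinct rows & set rows = proj (set (final [0] ops)) &
      reg u 3 = length rows & reg u 9 = length cols * length rows &
      map (arr u ?a) [0..<length cols * length rows] = concat (map (\<lambda>\<rho>. map \<rho> cols) rows) &
      real (clk u) <= (100 + 4 * K + 13 * length rules + (m + 1) * SC + length ops * (OC * (1 + AC)) + 2 * length cols) * \<Phi>"
  have aut_Gam: "Gam (Suc m) = aut (set es)" by (simp add: Gam_def)
  have "wp (main ops cols) ?Q s"
    unfolding main_def
  proof (rule wp_Seq[OF wp_init[of s n]])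
    fix s1 assume s1: "gst n {} 0 s1 & reg s1 1 = reg s 1 & arr s1 0 = arr s 0 & (\<forall>a\<ge>5. arr s1 a = (\<lambda>_. 0)) &
      clk s1 <= clk s + 5 + 4 * (K * n)"
    show "wp (build ;; bottom_up ;; run ops [0] ?p (?p + Suc m) ;; flat cols (base ops ?p (?p + Suc m)) ?a) ?Q s1"
    proof (rule wp_Seq[OF wp_build[of n s1 es]])
      fix s2 assume s2: "gst n (aut (set es)) (2 * length rules * length es) s2 & clk s2 <= clk s1 + 2 + (5 + 13 * length rules) * length es"
        and m2: "mods (warr build) (wreg build) s1 s2"
      have z2: "\<forall>a\<ge>5. arr s2 a = (\<lambda>_. 0)"
      proof (intro allI impI)
        fix a :: nat assume "5 <= a"
        then show "arr s2 a = (\<lambda>_. 0)" using mods_arr[OF m2, of a] build_sets(1) s1 by force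
      qed
      show "wp (bottom_up ;; run ops [0] ?p (?p + Suc m) ;; flat cols (base ops ?p (?p + Suc m)) ?a) ?Q s2"
      proof (rule wp_Seq[OF wp_bottom_up[OF _ z2]])
        fix s3 assume s3: "gst n (Gam 0) (AC * ?Z) s3 & table ?p {0} s3 (proj {0}) &
          (\<forall>a\<ge>?p. arr s3 a = (\<lambda>_. 0)) & clk s3 <= clk s2 + (m + 1) * (SC * ?Z)"
        show "wp (run ops [0] ?p (?p + Suc m) ;; flat cols (base ops ?p (?p + Suc m)) ?a) ?Q s3"
        proof (rule wp_Seq[OF wp_run[where W = "[0]" and c = "AC * ?Z" and N = N, OF pok]])
          fix s4 assume s4: "table (base ops ?p (?p + Suc m)) (set (final [0] ops)) s4 (proj (set (final [0] ops))) &
            set (final [0] ops) \<subseteq> {..m} & base ops ?p (?p + Suc m) + m < ?a &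
            real (clk s4) <= real (clk s3) + length ops * (OC * ((1 + n + (AC * ?Z)) * (1 + sqrt N) + N))"
          then obtain rows where rows: "tab (base ops ?p (?p + Suc m)) (set (final [0] ops)) 3 s4 rows" "distinct rows"
            "set rows = proj (set (final [0] ops))" by (auto simp: table_def)
          have len: "length rows <= N"
          proof -
            have "final W os' \<in> set (states W os')" for W os' by (induction W os' rule: states.induct) auto
            then show ?thesis using N rows distinct_card by metis
          qed
          show "wp (flat cols (base ops ?p (?p + Suc m)) ?a) ?Q s4"
          proof (rule wp_mono[OF wp_flat[OF rows(1) c]])
            show "base ops ?p (?p + Suc m) + i ~= ?a" if "i \<in> set (final [0] ops)" for i
              using s4 that by fastforce
            fix u assume u: "reg u 3 = length rows & reg u 9 = length cols * length rows &
              map (arr u ?a) [0..<length cols * length rows] = concat (map (\<lambda>\<rho>. map \<rho> cols) rows) &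
              clk u <= clk s4 + 3 + (2 + 2 * length cols) * length rows"
            have "3 + (2 + 2 * length cols) * length rows <= (5 + 2 * length cols) * (1 + N)"
            proof -
              have "(2 + 2 * length cols) * length rows <= (2 + 2 * length cols) * N" using len by (rule mult_le_mono2)
              then show ?thesis by (simp add: algebra_simps)
            qed
            then have "real (clk u) <= real (clk s4 + (5 + 2 * length cols) * (1 + N))"
              using u by (simp only: of_nat_le_iff) linarith
            also have "\<dots> = real (clk s4) + (5 + 2 * length cols) * (1 + real N)" by (simp add: algebra_simps)
            also have "(5 + 2 * length cols) * (1 + real N) <= (5 + 2 * length cols) * \<Phi>"
              using N\<Phi> by (intro mult_left_mono) auto
            finally have 5: "real (clk u) <= real (clk s4) + (5 + 2 * length cols) * \<Phi>" by simp
            have "(1 + n + (AC * ?Z)) * (1 + sqrt N) + N <= (1 + AC) * \<Phi>"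
            proof -
              have "1 + n + AC * ?Z <= (1 + AC) * ?Z" by simp
              then have "real (1 + n + AC * ?Z) <= real ((1 + AC) * ?Z)" by (simp only: of_nat_le_iff)
              then have "real (1 + n + AC * ?Z) * (1 + sqrt N) <= real ((1 + AC) * ?Z) * (1 + sqrt N)"
                by (intro mult_right_mono) auto
              moreover have "(1 + real AC) * \<Phi> = real ((1 + AC) * ?Z) * (1 + sqrt N) + N + AC * real N"
                by (simp add: \<Phi>_def algebra_simps)
              moreover have "0 <= AC * real N" by simp
              ultimately have "real (1 + n + AC * ?Z) * (1 + sqrt N) + N <= (1 + real AC) * \<Phi>" by linarith
              then show ?thesis by simp
            qed
            then have "length ops * (OC * ((1 + n + (AC * ?Z)) * (1 + sqrt N) + N)) <= length ops * (OC * ((1 + AC) * \<Phi>))"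
              by (intro mult_left_mono) auto
            then have 4: "real (clk s4) <= real (clk s3) + length ops * (OC * ((1 + AC) * \<Phi>))"
              using s4 by linarith
            have "clk s3 <= 7 + 4 * (K * n) + (5 + 13 * length rules) * length es + (m + 1) * (SC * ?Z)"
              using s s1 s2 s3 by (simp add: start_state_def)
            also have "\<dots> <= 7 * ?Z + 4 * (K * ?Z) + (5 + 13 * length rules) * ?Z + (m + 1) * (SC * ?Z)"
              by (intro add_mono mult_le_mono2) auto
            also have "\<dots> = (12 + 4 * K + 13 * length rules + (m + 1) * SC) * ?Z" by (simp add: algebra_simps)
            finally have "real (clk s3) <= real ((12 + 4 * K + 13 * length rules + (m + 1) * SC) * ?Z)"
              by (simp only: of_nat_le_iff)
            also have "\<dots> = real (12 + 4 * K + 13 * length rules + (m + 1) * SC) * real ?Z" by (rule of_nat_mult)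
            also have "\<dots> <= real (12 + 4 * K + 13 * length rules + (m + 1) * SC) * \<Phi>"
              using Z\<Phi> by (intro mult_left_mono) auto
            finally have "real (clk u) <= real (12 + 4 * K + 13 * length rules + (m + 1) * SC) * \<Phi> +
                length ops * (OC * ((1 + AC) * \<Phi>)) + (5 + 2 * length cols) * \<Phi>"
              using 4 5 by linarith
            also have "\<dots> = real (17 + 4 * K + 13 * length rules + (m + 1) * SC + length ops * (OC * (1 + AC)) + 2 * length cols) * \<Phi>"
              by (simp add: algebra_simps)
            also have "\<dots> <= real (100 + 4 * K + 13 * length rules + (m + 1) * SC + length ops * (OC * (1 + AC)) + 2 * length cols) * \<Phi>"
              using N\<Phi> by (intro mult_right_mono) auto
            finally show "?Q u" using u rows by (intro exI[of _ rows]) auto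
          qed
        qed (use s3 n1 N in \<open>auto simp: pb_def\<close>)
      qed (use s2 aut_Gam in auto)
    qed (use s s1 in \<open>auto simp: start_state_def\<close>)
  qed (use s in \<open>auto simp: start_state_def\<close>)
  then show ?thesis by (simp add: \<Phi>_def)
qed

end

section \<open>Complete programs\<close>

text \<open>The input lies in the first \<open>3 * E\<close> cells with stride 1, whereas array 0
  needs stride \<open>K\<close>; it is copied to the cells from \<open>3 * E\<close> on, so source
  and destination do not overlap. Register 2 keeps the number of edges, as variable 1 of the
  language, while register 1 becomes the base address.\<close>

definition prologue :: "nat => instr list" where
  "prologue K = [Copy 2 1, Add 1 1 2, Add 1 1 2, Copy 5 1, Const 7 1, Const 9 K,
     Sub 13 1 3, JumpZero 13 13, Load 11 3, Store 5 11, Add 5 5 9, Add 3 3 7, Jump 6]"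

text \<open>The table is moved to address 0; since array elements are at least \<open>K\<close> words apart, the copy never overtakes its source.\<close>

definition epilogue :: "nat => nat => nat => instr list" where
  "epilogue K a p = [Const 3 a, Add 3 3 1, Const 5 0, Const 7 1, Const 9 K,
     Sub 13 18 5, JumpZero 13 (p + 12), Load 11 3, Store 5 11, Add 3 3 9, Add 5 5 7, Jump (p + 5),
     Copy 0 6, Const 1 0]"

definition assemble :: "com => nat => program" where
  "assemble c a = (let K = Suc (Max (insert a (insert 0 (com_arrays c)))); C = comp K c 13 in
     prologue K @ C @ epilogue K a (13 + length C))"

lemma code_step: "code_at P p xs ==> k < length xs ==> pc s = p + k ==> Defs.step P s = exec (xs ! k) s"
  by (auto simp: code_at_def Defs.step_def halted_def nth_append)

lemma funpow_simps: "(f ^^ Suc k) x = (f ^^ k) (f x)"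
  by (simp add: funpow_swap1)

text \<open>The step count: six instructions of set-up, seven per word, two to leave the
  loop.\<close>

lemma prologue_correct:
  assumes P: "code_at P 0 (prologue K)" and K: "0 < K"
    and s: "pc s = 0" "regs s = (\<lambda>r. if r = 0 then n else if r = 1 then E else 0)" "\<And>a. 3 * E <= a ==> mem s a = 0"
    and h: "reg h = (\<lambda>r. if r = 0 then n else if r = 1 then E else 0)" "\<And>i. i < 3 * E ==> arr h 0 i = mem s i"
      "\<And>i. 3 * E <= i ==> arr h 0 i = 0" "\<And>a i. a ~= 0 ==> arr h a i = 0"
  shows "\<exists>s'. (Defs.step P ^^ (8 + 7 * (3 * E))) s = s' & pc s' = 13 & sim K (3 * E) h s'"
proof -
  let ?B = "3 * E"
  note st = code_step[OF P, unfolded prologue_def]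
  have steps: "pc t = 0 ==> Defs.step P t = exec (Copy 2 1) t"
    "pc t = 1 ==> Defs.step P t = exec (Add 1 1 2) t"
    "pc t = 2 ==> Defs.step P t = exec (Add 1 1 2) t"
    "pc t = 3 ==> Defs.step P t = exec (Copy 5 1) t"
    "pc t = 4 ==> Defs.step P t = exec (Const 7 1) t"
    "pc t = 5 ==> Defs.step P t = exec (Const 9 K) t"
    "pc t = 6 ==> Defs.step P t = exec (Sub 13 1 3) t"
    "pc t = 7 ==> Defs.step P t = exec (JumpZero 13 13) t"
    "pc t = 8 ==> Defs.step P t = exec (Load 11 3) t"
    "pc t = 9 ==> Defs.step P t = exec (Store 5 11) t"
    "pc t = 10 ==> Defs.step P t = exec (Add 5 5 9) t"
    "pc t = 11 ==> Defs.step P t = exec (Add 3 3 7) t"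
    "pc t = 12 ==> Defs.step P t = exec (Jump 6) t" for t
    using st[of 0 t] st[of 1 t] st[of 2 t] st[of 3 t] st[of 4 t] st[of 5 t] st[of 6 t] st[of 7 t] st[of 8 t]
      st[of 9 t] st[of 10 t] st[of 11 t] st[of 12 t] by simp_all
  define L where "L t k \<longleftrightarrow> pc t = 6 & regs t 0 = n & regs t 2 = E & regs t 1 = ?B & regs t 3 = k & regs t 5 = ?B + K * k & regs t 7 = 1 & regs t 9 = K &
    (\<forall>r. even r & r ~= 0 & r ~= 2 --> regs t r = 0) &
    (\<forall>a<?B. mem t a = mem s a) & (\<forall>j<k. mem t (?B + K * j) = mem s j) &
    (\<forall>a\<ge>?B. (\<forall>j<k. a ~= ?B + K * j) --> mem t a = 0)" for t :: config and k
  have init: "L ((Defs.step P ^^ 6) s) 0"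
  proof -
    let ?t = "exec (Const 9 K) (exec (Const 7 1) (exec (Copy 5 1) (exec (Add 1 1 2) (exec (Add 1 1 2) (exec (Copy 2 1) s)))))"
    have "(Defs.step P ^^ Suc (Suc (Suc (Suc (Suc (Suc 0)))))) s = ?t"
      unfolding funpow_simps using s(1) by (simp add: steps set_reg_def)
    then have e: "(Defs.step P ^^ 6) s = ?t" by (simp add: eval_nat_numeral)
    show ?thesis unfolding e using s by (auto simp: L_def set_reg_def)
  qed
  have loop: "L ((Defs.step P ^^ 7) t) (Suc k)" if L: "L t k" and k: "k < ?B" for t k
  proof -
    let ?t = "exec (Jump 6) (exec (Add 3 3 7) (exec (Add 5 5 9) (exec (Store 5 11) (exec (Load 11 3) (exec (JumpZero 13 13) (exec (Sub 13 1 3) t))))))"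
    have "(Defs.step P ^^ Suc (Suc (Suc (Suc (Suc (Suc (Suc 0))))))) t = ?t"
      unfolding funpow_simps using L k by (simp add: L_def steps set_reg_def)
    then have e: "(Defs.step P ^^ 7) t = ?t" by (simp add: eval_nat_numeral)
    have r: "pc ?t = 6" "regs ?t = (regs t)(13 := ?B - k, 11 := mem s k, 5 := ?B + K * Suc k, 3 := Suc k)"
      "mem ?t = (mem t)(?B + K * k := mem s k)"
      using L k by (auto simp: L_def set_reg_def)
    have inj: "?B + K * j = ?B + K * k \<longleftrightarrow> j = k" for j using K by simp
    show ?thesis unfolding e L_def r using L inj
      by (auto simp: L_def less_Suc_eq)
  qed
  have loops: "L ((Defs.step P ^^ (6 + 7 * k)) s) k" if "k <= ?B" for k
    using that
  proof (induction k)
    case (Suc k)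
    have "(Defs.step P ^^ (6 + 7 * Suc k)) s = (Defs.step P ^^ 7) ((Defs.step P ^^ (6 + 7 * k)) s)"
        unfolding comp_apply[of "Defs.step P ^^ 7", symmetric] funpow_add[symmetric] by (simp add: algebra_simps)
    then show ?case using loop Suc by simp
  qed (use init in simp)
  define t where "t = (Defs.step P ^^ (6 + 7 * ?B)) s"
  have t: "L t ?B" unfolding t_def by (rule loops) simp
  define u where "u = (Defs.step P ^^ 2) t"
  have "(Defs.step P ^^ Suc (Suc 0)) t = exec (JumpZero 13 13) (exec (Sub 13 1 3) t)"
    unfolding funpow_simps using t by (simp add: L_def steps set_reg_def)
  then have "u = exec (JumpZero 13 13) (exec (Sub 13 1 3) t)" by (simp add: u_def eval_nat_numeral)
  then have u: "pc u = 13" "mem u = mem t" "\<forall>r. r ~= 13 --> regs u r = regs t r"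
    using t by (auto simp: L_def set_reg_def)
  have "(Defs.step P ^^ (8 + 7 * ?B)) s = u"
    unfolding u_def t_def comp_apply[of "Defs.step P ^^ 2" "Defs.step P ^^ (6 + 7 * ?B)" s, symmetric] funpow_add[symmetric]
    by (rule arg_cong[of _ _ "\<lambda>i. (Defs.step P ^^ i) s"]) simp
  moreover have "sim K ?B h u"
    unfolding sim_def
  proof (intro conjI allI impI)
    fix r :: nat
    have "2 * r ~= 13" by presburger
    then have "regs u (2 * r) = regs t (2 * r)" using u by blast
    moreover have "regs t (2 * r) = reg h r"
      using t h(1) by (cases "r = 0"; cases "r = 1") (auto simp: L_def)
    ultimately show "regs u (2 * r) = reg h r" by simp
    show "regs u 1 = ?B" using u t by (simp add: L_def)
    fix a i assume a: "a < K"
    show "mem u (?B + K * i + a) = arr h a i"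
    proof (cases "a = 0 & i < ?B")
      case True
      then show ?thesis using t u h(2) by (simp add: L_def)
    next
      case False
      have "?B + K * i + a ~= ?B + K * j" if "j < ?B" for j
        using address_inj[OF a K, of ?B i j] False that by auto
      then have "mem t (?B + K * i + a) = 0" using t unfolding L_def by simp
      then show ?thesis using False u h(3,4) by (cases "a = 0") auto
    qed
  qed
  ultimately show ?thesis using u by blast
qed

lemma epilogue_correct:
  assumes P: "code_at P p (epilogue K a p)" and K: "a < K" and s: "pc s = p" and h: "sim K B h s"
  shows "\<exists>s'. (Defs.step P ^^ (9 + 7 * reg h 9)) s = s' & pc s' = p + 14 & regs s' 0 = reg h 3 & regs s' 1 = 0 &
    (\<forall>j<reg h 9. mem s' j = arr h a j)"
proof -
  let ?N = "reg h 9"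
  note st = code_step[OF P, unfolded epilogue_def]
  have steps: "pc t = p ==> Defs.step P t = exec (Const 3 a) t"
    "pc t = p + 1 ==> Defs.step P t = exec (Add 3 3 1) t"
    "pc t = p + 2 ==> Defs.step P t = exec (Const 5 0) t"
    "pc t = p + 3 ==> Defs.step P t = exec (Const 7 1) t"
    "pc t = p + 4 ==> Defs.step P t = exec (Const 9 K) t"
    "pc t = p + 5 ==> Defs.step P t = exec (Sub 13 18 5) t"
    "pc t = p + 6 ==> Defs.step P t = exec (JumpZero 13 (p + 12)) t"
    "pc t = p + 7 ==> Defs.step P t = exec (Load 11 3) t"
    "pc t = p + 8 ==> Defs.step P t = exec (Store 5 11) t"
    "pc t = p + 9 ==> Defs.step P t = exec (Add 3 3 9) t"
    "pc t = p + 10 ==> Defs.step P t = exec (Add 5 5 7) t"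
    "pc t = p + 11 ==> Defs.step P t = exec (Jump (p + 5)) t"
    "pc t = p + 12 ==> Defs.step P t = exec (Copy 0 6) t"
    "pc t = p + 13 ==> Defs.step P t = exec (Const 1 0) t" for t
    using st[of 0 t] st[of 1 t] st[of 2 t] st[of 3 t] st[of 4 t] st[of 5 t] st[of 6 t] st[of 7 t] st[of 8 t]
      st[of 9 t] st[of 10 t] st[of 11 t] st[of 12 t] st[of 13 t] by simp_all
  have hs: "regs s 18 = ?N" "regs s 6 = reg h 3" "regs s 1 = B" "\<And>i. mem s (B + K * i + a) = arr h a i"
  proof -
    have ev: "regs s (2 * r) = reg h r" for r using h by (simp add: sim_def)
    show "regs s 18 = ?N" using ev[of 9] by simp
    show "regs s 6 = reg h 3" using ev[of 3] by simp
    show "regs s 1 = B" "\<And>i. mem s (B + K * i + a) = arr h a i" using h K by (auto simp: sim_def)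
  qed
  define L where "L t k \<longleftrightarrow> pc t = p + 5 & regs t 18 = ?N & regs t 6 = reg h 3 & regs t 3 = B + K * k + a & regs t 5 = k &
    regs t 7 = 1 & regs t 9 = K & (\<forall>j<k. mem t j = arr h a j) & (\<forall>j\<ge>k. mem t j = mem s j)" for t :: config and k
  have init: "L ((Defs.step P ^^ 5) s) 0"
  proof -
    let ?t = "exec (Const 9 K) (exec (Const 7 1) (exec (Const 5 0) (exec (Add 3 3 1) (exec (Const 3 a) s))))"
    have "(Defs.step P ^^ Suc (Suc (Suc (Suc (Suc 0))))) s = ?t"
      unfolding funpow_simps using s by (simp add: steps set_reg_def)
    then have e: "(Defs.step P ^^ 5) s = ?t" by (simp add: eval_nat_numeral)
    show ?thesis unfolding e using s hs by (simp add: L_def set_reg_def)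
  qed
  have loop: "L ((Defs.step P ^^ 7) t) (Suc k)" if L: "L t k" and k: "k < ?N" for t k
  proof -
    let ?t = "exec (Jump (p + 5)) (exec (Add 5 5 7) (exec (Add 3 3 9) (exec (Store 5 11) (exec (Load 11 3) (exec (JumpZero 13 (p + 12)) (exec (Sub 13 18 5) t))))))"
    have "(Defs.step P ^^ Suc (Suc (Suc (Suc (Suc (Suc (Suc 0))))))) t = ?t"
      unfolding funpow_simps using L k by (simp add: L_def steps set_reg_def)
    then have e: "(Defs.step P ^^ 7) t = ?t" by (simp add: eval_nat_numeral)
    have "k <= K * k" using K by (cases K) auto
    then have "k <= B + K * k + a" by linarith
    then have "mem t (B + K * k + a) = mem s (B + K * k + a)" using L unfolding L_def by blast
    then have "mem t (B + K * k + a) = arr h a k" using hs(4) by simp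
    then have r: "pc ?t = p + 5" "regs ?t = (regs t)(13 := ?N - k, 11 := arr h a k, 3 := B + K * Suc k + a, 5 := Suc k)"
      "mem ?t = (mem t)(k := arr h a k)"
      using L k by (auto simp: L_def set_reg_def)
    show ?thesis unfolding e L_def r using L by (auto simp: L_def less_Suc_eq)
  qed
  have loops: "L ((Defs.step P ^^ (5 + 7 * k)) s) k" if "k <= ?N" for k
    using that
  proof (induction k)
    case (Suc k)
    have "(Defs.step P ^^ (5 + 7 * Suc k)) s = (Defs.step P ^^ 7) ((Defs.step P ^^ (5 + 7 * k)) s)"
      unfolding comp_apply[of "Defs.step P ^^ 7" "Defs.step P ^^ (5 + 7 * k)" s, symmetric] funpow_add[symmetric] by (rule arg_cong[of _ _ "\<lambda>i. (Defs.step P ^^ i) s"]) simp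
    then show ?case using loop Suc by simp
  qed (use init in simp)
  define t where "t = (Defs.step P ^^ (5 + 7 * ?N)) s"
  have t: "L t ?N" unfolding t_def by (rule loops) simp
  define u where "u = (Defs.step P ^^ 4) t"
  have "(Defs.step P ^^ Suc (Suc (Suc (Suc 0)))) t = exec (Const 1 0) (exec (Copy 0 6) (exec (JumpZero 13 (p + 12)) (exec (Sub 13 18 5) t)))"
    unfolding funpow_simps using t by (simp add: L_def steps set_reg_def)
  then have "u = exec (Const 1 0) (exec (Copy 0 6) (exec (JumpZero 13 (p + 12)) (exec (Sub 13 18 5) t)))"
    by (simp add: u_def eval_nat_numeral)
  then have u: "pc u = p + 14" "regs u 0 = reg h 3" "regs u 1 = 0" "\<forall>j<?N. mem u j = arr h a j"
    using t by (auto simp: L_def set_reg_def)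
  have "(Defs.step P ^^ (9 + 7 * ?N)) s = u"
    unfolding u_def t_def comp_apply[of "Defs.step P ^^ 4" "Defs.step P ^^ (5 + 7 * ?N)" s, symmetric] funpow_add[symmetric]
    by (rule arg_cong[of _ _ "\<lambda>i. (Defs.step P ^^ i) s"]) simp
  then show ?thesis using u by blast
qed

text \<open>\<open>C\<close> depends on the program alone and is fixed before the input. The
  summands \<open>E\<close> and \<open>reg h' 9\<close> pay for moving the input and the
  result.\<close>

theorem assemble_correct:
  fixes a :: nat and c :: com
  obtains C :: nat where "\<And>(s :: config) n E (h :: st) Q.
    pc s = 0 ==> regs s = (\<lambda>r. if r = 0 then n else if r = 1 then E else 0) ==> (\<And>a. 3 * E <= a ==> mem s a = 0) ==>
    h = \<lparr>reg = (\<lambda>r. if r = 0 then n else if r = 1 then E else 0), arr = (\<lambda>a i. if a = 0 & i < 3 * E then mem s i else 0), clk = 0\<rparr> ==>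
    wp c Q h ==>
    \<exists>t u h'. (Defs.step (assemble c a) ^^ t) s = u & Q h' & halted (assemble c a) u & regs u 0 = reg h' 3 & regs u 1 = 0 &
      (\<forall>j<reg h' 9. mem u j = arr h' a j) & t <= C * (1 + E + clk h' + reg h' 9)"
proof -
  define K where "K = Suc (Max (insert a (insert 0 (com_arrays c))))"
  define M where "M = comp K c 13"
  let ?P = "assemble c a"
  have P: "?P = prologue K @ M @ epilogue K a (13 + length M)" by (simp add: assemble_def K_def M_def Let_def)
  have fin: "finite (insert a (insert 0 (com_arrays c)))" using finite_com_arrays by simp
  have aK: "a < K" "0 < K" "com_arrays c \<subseteq> {..<K}"
    using Max_ge[OF fin] by (auto simp: K_def less_Suc_eq_le)
  have lp: "length (prologue K) = 13" by (simp add: prologue_def)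
  have c1: "code_at ?P 0 (prologue K)" unfolding code_at_def P by (rule exI[of _ "[]"]) auto
  have c2: "code_at ?P 13 M" unfolding code_at_def P by (rule exI[of _ "prologue K"]) (auto simp: lp)
  have c3: "code_at ?P (13 + length M) (epilogue K a (13 + length M))"
    unfolding code_at_def P by (rule exI[of _ "prologue K @ M"]) (auto simp: lp)
  have lenP: "length ?P = 13 + length M + 14" by (simp add: P lp epilogue_def)
  let ?C = "40 + com_size K c"
  show ?thesis
  proof (rule that[of ?C])
    fix s :: config and n E :: nat and h :: st and Q
    assume s: "pc s = 0" "regs s = (\<lambda>r. if r = 0 then n else if r = 1 then E else 0)" "\<And>a. 3 * E <= a ==> mem s a = 0"
      and h: "h = \<lparr>reg = (\<lambda>r. if r = 0 then n else if r = 1 then E else 0), arr = (\<lambda>a i. if a = 0 & i < 3 * E then mem s i else 0), clk = 0\<rparr>"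
      and w: "wp c Q h"
    obtain h' where h': "big c h h'" "Q h'" using w by (auto simp: wp_def)
    obtain s1 where s1: "(Defs.step ?P ^^ (8 + 7 * (3 * E))) s = s1" "pc s1 = 13" "sim K (3 * E) h s1"
      using prologue_correct[OF c1 aK(2) s, of h] by (auto simp: h)
    obtain t2 s2 where s2: "(Defs.step ?P ^^ t2) s1 = s2" "sim K (3 * E) h' s2" "pc s2 = 13 + length M"
      "t2 + (com_size K c + 2) * clk h <= (com_size K c + 2) * clk h'"
      using comp_correct[OF h'(1) aK(3), of ?P s1 "3 * E" "com_size K c + 2"] c2 s1(2,3) by (auto simp: M_def length_comp)
    obtain s3 where s3: "(Defs.step ?P ^^ (9 + 7 * reg h' 9)) s2 = s3" "pc s3 = 13 + length M + 14" "regs s3 0 = reg h' 3" "regs s3 1 = 0"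
      "\<forall>j<reg h' 9. mem s3 j = arr h' a j"
      using epilogue_correct[OF c3 aK(1) s2(3) s2(2)] by blast
    let ?t = "(8 + 7 * (3 * E)) + (t2 + (9 + 7 * reg h' 9))"
    have "(Defs.step ?P ^^ ?t) s = s3"
      by (intro funpow_step_add[OF s1(1)] funpow_step_add[OF s2(1)] s3(1))
    moreover have "halted ?P s3" using s3(2) lenP by (simp add: halted_def)
    moreover have "?t <= ?C * (1 + E + clk h' + reg h' 9)"
    proof -
      have "t2 <= (com_size K c + 2) * clk h'" using s2(4) by (simp add: h)
      then have "?t <= 17 + 21 * E + (com_size K c + 2) * clk h' + 7 * reg h' 9" by simp
      also have "\<dots> <= ?C * 1 + ?C * E + ?C * clk h' + ?C * reg h' 9"
      proof -
        have "17 <= ?C * 1" "21 * E <= ?C * E" "7 * reg h' 9 <= ?C * reg h' 9" by simp_all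
        moreover have "(com_size K c + 2) * clk h' <= ?C * clk h'" by (rule mult_le_mono1) simp
        ultimately show ?thesis by (intro add_mono)
      qed
      also have "\<dots> = ?C * (1 + E + clk h' + reg h' 9)" by (simp only: distrib_left)
      finally show ?thesis .
    qed
    ultimately show "\<exists>t u h'. (Defs.step ?P ^^ t) s = u & Q h' & halted ?P u & regs u 0 = reg h' 3 & regs u 1 = 0 &
      (\<forall>j<reg h' 9. mem u j = arr h' a j) & t <= ?C * (1 + E + clk h' + reg h' 9)"
      using h'(2) s3 by blast
  qed
qed

section \<open>Partial derivatives of regular expressions\<close>

primrec nullable :: "'s rexp => bool" where
  "nullable Zero = False"
| "nullable One = True"
| "nullable (Sym s) = False"
| "nullable (Plus r q) = (nullable r \<or> nullable q)"
| "nullable (Times r q) = (nullable r & nullable q)"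
| "nullable (Star r) = True"

text \<open>Antimirov's partial derivatives. Sets of expressions instead of single derivatives give
  finitely many states without simplification modulo identities.\<close>

primrec pd :: "'s => 's rexp => 's rexp set" where
  "pd s Zero = {}"
| "pd s One = {}"
| "pd s (Sym t) = (if s = t then {One} else {})"
| "pd s (Plus r q) = pd s r \<union> pd s q"
| "pd s (Times r q) = (\<lambda>p. Times p q) ` pd s r \<union> (if nullable r then pd s q else {})"
| "pd s (Star r) = (\<lambda>p. Times p (Star r)) ` pd s r"

text \<open>A finite set containing all expressions that arise from \<open>r\<close> by iterated derivation.\<close>

primrec derivs :: "'s rexp => 's rexp set" where
  "derivs Zero = {}"
| "derivs One = {}"
| "derivs (Sym t) = {One}"
| "derivs (Plus r q) = derivs r \<union> derivs q"
| "derivs (Times r q) = (\<lambda>p. Times p q) ` derivs r \<union> derivs q"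
| "derivs (Star r) = (\<lambda>p. Times p (Star r)) ` derivs r"

lemma finite_derivs: "finite (derivs r)"
  by (induction r) auto

lemma pd_derivs: "pd s r \<subseteq> derivs r"
  by (induction r) auto

lemma pd_closed: "p \<in> derivs r ==> pd s p \<subseteq> derivs r"
proof (induction r arbitrary: p)
  case (Times r q)
  then show ?case using pd_derivs[of s q] by (auto split: if_splits) blast+
next
  case (Star r)
  then show ?case using pd_derivs[of s r] by (auto split: if_splits) blast+
qed auto

lemma pd_symbols: "p \<in> pd s r ==> s \<in> set_rexp r"
  by (induction r arbitrary: p) (auto split: if_splits)

lemma nullable_lang: "nullable r \<longleftrightarrow> [] \<in> lang r"
proof (induction r)
  case (Star r)
  have "[] = concat [] & set [] \<subseteq> lang r" by simp
  then show ?case by (simp only: nullable.simps lang.simps) blast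
qed auto

lemma Star_Cons: "s # w \<in> lang (Star r) \<longleftrightarrow> (\<exists>v u. w = v @ u & s # v \<in> lang r & u \<in> lang (Star r))"
proof
  assume "s # w \<in> lang (Star r)"
  then obtain ws where "s # w = concat ws" "set ws \<subseteq> lang r" by auto
  then show "\<exists>v u. w = v @ u & s # v \<in> lang r & u \<in> lang (Star r)"
  proof (induction ws)
    case (Cons x ws)
    then show ?case by (cases x) auto
  qed simp
next
  assume "\<exists>v u. w = v @ u & s # v \<in> lang r & u \<in> lang (Star r)"
  then obtain v ws where "w = v @ concat ws" "s # v \<in> lang r" "set ws \<subseteq> lang r" by auto
  then have "s # w = concat ((s # v) # ws) & set ((s # v) # ws) \<subseteq> lang r" by simp
  then show "s # w \<in> lang (Star r)" by (simp only: lang.simps) blast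
qed

lemma pd_lang: "s # w \<in> lang r \<longleftrightarrow> (\<exists>p\<in>pd s r. w \<in> lang p)"
proof (induction r arbitrary: w)
  case (Times r q)
  have "s # w \<in> lang (Times r q) \<longleftrightarrow> (\<exists>v u. w = v @ u & s # v \<in> lang r & u \<in> lang q) \<or> ([] \<in> lang r & s # w \<in> lang q)"
    by (auto simp: Cons_eq_append_conv)
  also have "\<dots> \<longleftrightarrow> (\<exists>p\<in>pd s r. w \<in> lang (Times p q)) \<or> (nullable r & (\<exists>p\<in>pd s q. w \<in> lang p))"
    unfolding Times.IH nullable_lang[symmetric] by (simp only: lang.simps) blast
  also have "\<dots> \<longleftrightarrow> (\<exists>p\<in>pd s (Times r q). w \<in> lang p)"
    by (simp only: pd.simps bex_Un bex_simps) simp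
  finally show ?case .
next
  case (Star r)
  then show ?case unfolding Star_Cons by auto
qed auto

text \<open>The product of the graph with the automaton whose states are the partial
  derivatives.\<close>

definition rpq_step :: "('v, 's) lgraph => (('s rexp \<times> 'v) \<times> ('s rexp \<times> 'v)) set" where
  "rpq_step G = {((p, u), (p', v)) | p u p' v s. p' \<in> pd s p & (u, s, v) \<in> ledges G}"

theorem rpq_reach:
  assumes "wf_lgraph G" "u \<in> lverts G"
  shows "(\<exists>w\<in>lang r. lpath G u w v) \<longleftrightarrow> (\<exists>p. nullable p & ((r, u), (p, v)) \<in> (rpq_step G)\<^sup>*)"
proof
  assume "\<exists>w\<in>lang r. lpath G u w v"
  then obtain w where "lpath G u w v" "w \<in> lang r" by blast
  then show "\<exists>p. nullable p & ((r, u), (p, v)) \<in> (rpq_step G)\<^sup>*"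
  proof (induction arbitrary: r rule: lpath.induct)
    case (empty u)
    then show ?case using nullable_lang by blast
  next
    case (step u s w ss v)
    then have "s # ss \<in> lang r" by simp
    then obtain p where p: "p \<in> pd s r" "ss \<in> lang p" unfolding pd_lang by blast
    then have e: "((r, u), (p, w)) \<in> rpq_step G" using step.hyps(1) by (auto simp: rpq_step_def)
    obtain p' where p': "nullable p'" "((p, w), (p', v)) \<in> (rpq_step G)\<^sup>*" using step.IH[OF p(2)] by blast
    then show ?case using converse_rtrancl_into_rtrancl[OF e p'(2)] by blast
  qed
next
  assume "\<exists>p. nullable p & ((r, u), (p, v)) \<in> (rpq_step G)\<^sup>*"
  then obtain p where p: "nullable p" "((r, u), (p, v)) \<in> (rpq_step G)\<^sup>*" by blast
  from p(2) assms(2) have "\<exists>w\<in>lang (fst (r, u)). lpath G (snd (r, u)) w v"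
  proof (induction "(r, u)" arbitrary: r u rule: converse_rtrancl_induct)
    case base
    moreover have "[] \<in> lang p" using p(1) nullable_lang by blast
    ultimately show ?case unfolding fst_conv snd_conv using lpath.empty by fast
  next
    case (step z)
    obtain q x where z: "z = (q, x)" by (cases z)
    then obtain s where s: "q \<in> pd s r" "(u, s, x) \<in> ledges G" using step.hyps(1) by (auto simp: rpq_step_def)
    then have "x \<in> lverts G" using assms(1) by (auto simp: wf_lgraph_def)
    then obtain w where w: "w \<in> lang q" "lpath G x w v" using step.hyps(3)[OF z] unfolding fst_conv snd_conv by blast
    have "s # w \<in> lang r" unfolding pd_lang using s(1) w(1) by (intro bexI[of _ q])
    then show ?case unfolding fst_conv snd_conv using lpath.step[OF s(2) w(2)] by blast
  qed
  then show "\<exists>w\<in>lang r. lpath G u w v" by simp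
qed

text \<open>An atom may point from child to parent although its automaton always starts at the
  parent; then the reversed expression is run on the reversed graph.\<close>

primrec rev_rexp :: "'s rexp => 's rexp" where
  "rev_rexp Zero = Zero"
| "rev_rexp One = One"
| "rev_rexp (Sym s) = Sym s"
| "rev_rexp (Plus r q) = Plus (rev_rexp r) (rev_rexp q)"
| "rev_rexp (Times r q) = Times (rev_rexp q) (rev_rexp r)"
| "rev_rexp (Star r) = Star (rev_rexp r)"

lemma rev_rexp_lang: "w \<in> lang (rev_rexp r) \<longleftrightarrow> rev w \<in> lang r"
proof (induction r arbitrary: w)
  case (Times r q)
  have "w \<in> lang (rev_rexp (Times r q)) \<longleftrightarrow> (\<exists>x y. w = x @ y & rev x \<in> lang q & rev y \<in> lang r)"
    using Times by auto
  also have "\<dots> \<longleftrightarrow> (\<exists>x y. rev w = x @ y & x \<in> lang r & y \<in> lang q)"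
    by (metis rev_append rev_rev_ident)
  finally show ?case by auto
next
  case (Star r)
  have "w \<in> lang (rev_rexp (Star r)) \<longleftrightarrow> (\<exists>ws. w = concat ws & (\<forall>x\<in>set ws. rev x \<in> lang r))"
    using Star by auto
  also have "\<dots> \<longleftrightarrow> (\<exists>ws. rev w = concat ws & (\<forall>x\<in>set ws. x \<in> lang r))"
  proof
    assume "\<exists>ws. w = concat ws & (\<forall>x\<in>set ws. rev x \<in> lang r)"
    then obtain ws where "w = concat ws" "\<forall>x\<in>set ws. rev x \<in> lang r" by blast
    then show "\<exists>ws. rev w = concat ws & (\<forall>x\<in>set ws. x \<in> lang r)"
      by (intro exI[of _ "rev (map rev ws)"]) (auto simp: rev_concat rev_map)
  next
    assume "\<exists>ws. rev w = concat ws & (\<forall>x\<in>set ws. x \<in> lang r)"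
    then obtain ws where "rev w = concat ws" "\<forall>x\<in>set ws. x \<in> lang r" by blast
    then have "w = concat (rev (map rev ws))" "\<forall>x\<in>set (rev (map rev ws)). rev x \<in> lang r"
      by (metis rev_concat rev_map rev_rev_ident) (auto simp: \<open>\<forall>x\<in>set ws. x \<in> lang r\<close>)
    then show "\<exists>ws. w = concat ws & (\<forall>x\<in>set ws. rev x \<in> lang r)" by blast
  qed
  finally show ?case by auto
qed auto

definition rev_graph :: "('v, 's) lgraph => ('v, 's) lgraph" where
  "rev_graph G = G\<lparr>ledges := {(v, s, u) | u s v. (u, s, v) \<in> ledges G}\<rparr>"

lemma wf_rev_graph: "wf_lgraph G ==> wf_lgraph (rev_graph G)"
  unfolding wf_lgraph_def rev_graph_def by fastforce

lemma rev_graph_rev: "rev_graph (rev_graph G) = G"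
proof -
  have "{(v, s, u) | u s v. (v, s, u) \<in> ledges G} = ledges G" by auto
  then show ?thesis by (simp add: rev_graph_def)
qed

lemma lpath_snoc: "lpath G u w x ==> (x, s, v) \<in> ledges G ==> v \<in> lverts G ==> lpath G u (w @ [s]) v"
  by (induction rule: lpath.induct) (auto intro: lpath.intros)

lemma lpath_rev:
  assumes "wf_lgraph G" "lpath G u w v"
  shows "lpath (rev_graph G) v (rev w) u"
  using assms(2)
proof (induction rule: lpath.induct)
  case (empty u)
  then show ?case by (auto simp: rev_graph_def intro: lpath.empty)
next
  case (step u s w ss v)
  have "(w, s, u) \<in> ledges (rev_graph G)" "u \<in> lverts (rev_graph G)"
    using step.hyps(1) assms(1) by (auto simp: rev_graph_def wf_lgraph_def)
  then show ?case using lpath_snoc[OF step.IH] by simp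
qed

lemma rev_rpq:
  assumes "wf_lgraph G"
  shows "(\<exists>w\<in>lang (rev_rexp r). lpath (rev_graph G) v w u) \<longleftrightarrow> (\<exists>w\<in>lang r. lpath G u w v)"
  using lpath_rev[OF assms] lpath_rev[OF wf_rev_graph[OF assms]] rev_graph_rev[of G] rev_rexp_lang
  by (metis rev_rev_ident)

text \<open>Moves reachability through an encoding \<open>f\<close> that commutes with single steps;
  used to pass from derivatives and vertices to their numbers.\<close>

lemma rtrancl_image:
  assumes "\<And>x y'. x \<in> S ==> (f x, y') \<in> R \<longleftrightarrow> (\<exists>y\<in>S. y' = f y & (x, y) \<in> T)" and x: "x \<in> S"
    and T: "\<And>x y. x \<in> S ==> (x, y) \<in> T ==> y \<in> S"
  shows "(f x, y') \<in> R\<^sup>* \<longleftrightarrow> (\<exists>y\<in>S. y' = f y & (x, y) \<in> T\<^sup>*)"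
proof
  assume "(f x, y') \<in> R\<^sup>*"
  then show "\<exists>y\<in>S. y' = f y & (x, y) \<in> T\<^sup>*"
  proof (induction rule: rtrancl_induct)
    case base
    then show ?case using x by blast
  next
    case (step y z)
    then show ?case using assms(1) by (metis rtrancl.rtrancl_into_rtrancl)
  qed
next
  assume "\<exists>y\<in>S. y' = f y & (x, y) \<in> T\<^sup>*"
  then obtain y where y: "y' = f y" "(x, y) \<in> T\<^sup>*" by blast
  from y(2) have "y \<in> S & (f x, f y) \<in> R\<^sup>*"
  proof (induction rule: rtrancl_induct)
    case (step y z)
    then have "z \<in> S" "(f y, f z) \<in> R" using assms(1) T by blast+
    then show ?case using step.IH by (meson rtrancl.rtrancl_into_rtrancl)
  qed (use x in simp)
  then show "(f x, y') \<in> R\<^sup>*" using y(1) by simp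
qed

section \<open>Rooted orders of forests\<close>

definition adj :: "'a ugraph => 'a => 'a => bool" where
  "adj H a b \<longleftrightarrow> {a, b} \<in> uedges H"

definition conn :: "'a ugraph => 'a set => ('a \<times> 'a) set" where
  "conn H S = {(u, v). u \<in> S & v \<in> S & {u, v} \<in> uedges H}"

lemma adj_sym: "adj H a b = adj H b a"
  by (simp add: adj_def insert_commute)

lemma conn_sym: "(a, b) \<in> (conn H S)\<^sup>* ==> (b, a) \<in> (conn H S)\<^sup>*"
proof -
  have "(conn H S)\<inverse> = conn H S" by (auto simp: conn_def insert_commute)
  then show "(a, b) \<in> (conn H S)\<^sup>* ==> (b, a) \<in> (conn H S)\<^sup>*" by (metis rtrancl_converseI)
qed

lemma conn_mono: "S \<subseteq> S' ==> (a, b) \<in> (conn H S)\<^sup>* ==> (a, b) \<in> (conn H S')\<^sup>*"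
  by (rule subsetD[OF rtrancl_mono]) (auto simp: conn_def)

lemma conn_path:
  assumes "(a, b) \<in> (conn H S)\<^sup>*" "a \<in> S"
  shows "\<exists>us. us ~= [] & hd us = a & last us = b & distinct us & set us \<subseteq> S & successively (adj H) us"
  using assms
proof (induction rule: converse_rtrancl_induct)
  case base
  then show ?case by (intro exI[of _ "[b]"]) simp
next
  case (step a c)
  then obtain us where us: "us ~= []" "hd us = c" "last us = b" "distinct us" "set us \<subseteq> S" "successively (adj H) us"
    by (auto simp: conn_def)
  have ac: "adj H a c" using step.hyps by (auto simp: conn_def adj_def)
  show ?case
  proof (cases "a \<in> set us")
    case True
    then obtain xs ys where "us = xs @ a # ys" by (meson split_list)
    then show ?thesis using us by (intro exI[of _ "a # ys"]) (auto simp: successively_append_iff)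
  next
    case False
    then show ?thesis using us ac step.prems by (intro exI[of _ "a # us"]) (auto simp: successively_Cons)
  qed
qed

text \<open>Otherwise the path inside \<open>S\<close> between the two neighbours of
  \<open>v\<close> would close a cycle through \<open>v\<close>.\<close>

lemma cycle_free_unique:
  assumes cf: "cycle_free H" and c: "(a, b) \<in> (conn H S)\<^sup>*" and ab: "a \<in> S" "v \<notin> S" "adj H v a" "adj H v b"
  shows "a = b"
proof (rule ccontr)
  assume "a ~= b"
  obtain us where us: "us ~= []" "hd us = a" "last us = b" "distinct us" "set us \<subseteq> S" "successively (adj H) us"
    using conn_path[OF c ab(1)] by blast
  let ?cs = "v # us"
  have s: "successively (adj H) ?cs" using us ab by (auto simp: successively_Cons)
  have "2 <= length us" using us \<open>a ~= b\<close> by (cases us; cases "tl us") auto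
  then have len: "3 <= length ?cs" by simp
  have dist: "distinct ?cs" using us ab by auto
  have "{?cs ! i, ?cs ! (Suc i mod length ?cs)} \<in> uedges H" if i: "i < length ?cs" for i
  proof (cases "Suc i = length ?cs")
    case True
    then have "?cs ! i = b" using us by (simp add: last_conv_nth nth_Cons')
    moreover have "?cs ! (Suc i mod length ?cs) = v" by (simp only: True mod_self nth_Cons_0)
    ultimately show ?thesis using ab(4) by (simp add: adj_def insert_commute)
  next
    case False
    then have "Suc i < length ?cs" using i by simp
    then show ?thesis using s unfolding successively_conv_nth adj_def by simp
  qed
  then show False using cf len dist unfolding cycle_free_def by blast
qed

definition wf_ugraph :: "'a ugraph => bool" where
  "wf_ugraph H \<longleftrightarrow> finite (uverts H) & (\<forall>e\<in>uedges H. e \<subseteq> uverts H & card e = 2)"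

text \<open>Vertices are numbered from 1; parent 0 marks the roots. Roots are taken from \<open>F\<close> as long as possible.\<close>

definition rooted_on :: "'a ugraph => 'a set => 'a list => (nat => nat) => bool" where
  "rooted_on H F vs par \<longleftrightarrow> distinct vs & (\<forall>i\<in>{1..length vs}. par i < i) &
     {e \<in> uedges H. e \<subseteq> set vs} = {{vs ! (i - 1), vs ! (par i - 1)} | i. i \<in> {1..length vs} & par i ~= 0} &
     (\<forall>i\<in>{1..length vs}. par i = 0 --> vs ! (i - 1) \<in> F \<or> F \<subseteq> set (take (i - 1) vs))"

text \<open>The invariant \<open>op\<close> says that at most one tree is unfinished: numbered
  vertices with unnumbered neighbours are connected to each other. Hence a vertex attached to the
  numbered ones has exactly one numbered neighbour, its parent, and a new root is opened only when
  no tree is unfinished.\<close>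

lemma rooted_extend:
  assumes H: "wf_ugraph H" "cycle_free H" and r: "rooted_on H F vs par" and vs: "set vs \<subseteq> uverts H" "set vs ~= uverts H"
    and op: "\<And>a b. a \<in> set vs ==> b \<in> set vs ==> \<exists>x. x \<notin> set vs & adj H a x ==> \<exists>x. x \<notin> set vs & adj H b x ==> (a, b) \<in> (conn H (set vs))\<^sup>*"
    and F: "F \<subseteq> uverts H"
  shows "\<exists>v par'. v \<in> uverts H - set vs & rooted_on H F (vs @ [v]) par' &
    (\<forall>a\<in>set (vs @ [v]). \<forall>b\<in>set (vs @ [v]). (\<exists>x. x \<notin> set (vs @ [v]) & adj H a x) --> (\<exists>x. x \<notin> set (vs @ [v]) & adj H b x) -->
       (a, b) \<in> (conn H (set (vs @ [v])))\<^sup>*)"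
proof -
  let ?k = "Suc (length vs)"
  have nth: "(vs @ [v]) ! (i - 1) = vs ! (i - 1)" if "i \<in> {1..length vs}" for i v
    using that by (simp add: nth_append less_eq_Suc_le) 
  have tk: "take (i - 1) (vs @ [v]) = take (i - 1) vs" if "i \<in> {1..length vs}" for i v
    using that by auto
  have pl: "par i < i" if "i \<in> {1..length vs}" for i using r that by (simp add: rooted_on_def)
  have eq: "{e \<in> uedges H. e \<subseteq> set vs} = {{vs ! (i - 1), vs ! (par i - 1)} | i. i \<in> {1..length vs} & par i ~= 0}"
    using r by (simp add: rooted_on_def)
  have new: "rooted_on H F (vs @ [v]) (par(?k := q))"
    if v: "v \<in> uverts H - set vs" and q: "q <= length vs"
      and e: "{e \<in> uedges H. e \<subseteq> insert v (set vs) & v \<in> e} = (if q = 0 then {} else {{v, vs ! (q - 1)}})"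
      and f: "q = 0 --> v \<in> F \<or> F \<subseteq> set vs" for v q
  proof -
    let ?p = "par(?k := q)"
    have I: "{1..length (vs @ [v])} = insert ?k {1..length vs}" by auto
    have U: "{f i | i. i \<in> A & P i} \<union> {f i | i. i = k & P i} = {f i | i. i \<in> insert k A & P i}" for f :: "nat => 'a set" and A P k
      by blast
    have "{e \<in> uedges H. e \<subseteq> set (vs @ [v])} = {e \<in> uedges H. e \<subseteq> set vs} \<union> {e \<in> uedges H. e \<subseteq> insert v (set vs) & v \<in> e}"
      by auto
    also have "{e \<in> uedges H. e \<subseteq> set vs} = {{(vs @ [v]) ! (i - 1), (vs @ [v]) ! (?p i - 1)} | i. i \<in> {1..length vs} & ?p i ~= 0}"
    proof -
      have key: "{(vs @ [v]) ! (i - 1), (vs @ [v]) ! (?p i - 1)} = {vs ! (i - 1), vs ! (par i - 1)} & ?p i = par i" if i: "i \<in> {1..length vs}" for i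
      proof -
        have "par i - 1 < length vs" using pl[OF i] i by auto
        then show ?thesis using i nth[OF i] by (auto simp: nth_append)
      qed
      then have "(e = {vs ! (i - 1), vs ! (par i - 1)} & i \<in> {1..length vs} & par i ~= 0) \<longleftrightarrow>
          (e = {(vs @ [v]) ! (i - 1), (vs @ [v]) ! (?p i - 1)} & i \<in> {1..length vs} & ?p i ~= 0)" for e i
      proof (cases "i \<in> {1..length vs}")
        case True
        from key[OF True] have a: "{(vs @ [v]) ! (i - 1), (vs @ [v]) ! (?p i - 1)} = {vs ! (i - 1), vs ! (par i - 1)}" and b: "?p i = par i"
          by blast+
        show ?thesis by (simp only: a) (simp only: b)
      qed blast
      then show ?thesis unfolding eq by (intro Collect_cong ex_cong1)
    qed
    also have "{e \<in> uedges H. e \<subseteq> insert v (set vs) & v \<in> e} = {{(vs @ [v]) ! (i - 1), (vs @ [v]) ! (?p i - 1)} | i. i = ?k & ?p i ~= 0}"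
      unfolding e using q by (auto simp: nth_append)
    finally have E: "{e \<in> uedges H. e \<subseteq> set (vs @ [v])} = {{(vs @ [v]) ! (i - 1), (vs @ [v]) ! (?p i - 1)} | i. i \<in> {1..length (vs @ [v])} & ?p i ~= 0}"
      unfolding I by (simp only: U)
    have R: "\<forall>i\<in>{1..length (vs @ [v])}. ?p i = 0 --> (vs @ [v]) ! (i - 1) \<in> F \<or> F \<subseteq> set (take (i - 1) (vs @ [v]))"
    proof
      fix i assume "i \<in> {1..length (vs @ [v])}"
      then consider "i = ?k" | "i \<in> {1..length vs}" unfolding I by blast
      then show "?p i = 0 --> (vs @ [v]) ! (i - 1) \<in> F \<or> F \<subseteq> set (take (i - 1) (vs @ [v]))"
      proof cases
        case 1
        then show ?thesis using f by simp
      next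
        case 2
        then show ?thesis using r nth[OF 2] tk[OF 2] by (auto simp: rooted_on_def)
      qed
    qed
    show ?thesis unfolding rooted_on_def using E R v r q by (auto simp: rooted_on_def less_Suc_eq_le)
  qed
  have e2: "\<exists>b. e = {v, b} & b ~= v & adj H v b" if "e \<in> uedges H" "v \<in> e" for e v
  proof -
    have "card e = 2" using H(1) that by (simp add: wf_ugraph_def)
    then obtain x y where "e = {x, y}" "x ~= y" by (meson card_2_iff)
    then show ?thesis using that by (cases "v = x") (auto simp: adj_def insert_commute)
  qed
  show ?thesis
  proof (cases "\<exists>u\<in>set vs. \<exists>v. v \<notin> set vs & adj H u v")
    case True
    then obtain u v where uv: "u \<in> set vs" "v \<notin> set vs" "adj H u v" by blast
    then have vH: "v \<in> uverts H - set vs" using H(1) by (auto simp: wf_ugraph_def adj_def)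
    obtain q where q: "q < length vs" "vs ! q = u" using uv(1) by (auto simp: in_set_conv_nth)
    have uniq: "b = u" if "b \<in> set vs" "adj H v b" for b
    proof -
      have "(u, b) \<in> (conn H (set vs))\<^sup>*" using op[OF uv(1) that(1)] uv that adj_sym by metis
      then show ?thesis using cycle_free_unique[OF H(2) _ uv(1,2)] uv(3) that(2) adj_sym by metis
    qed
    have "{e \<in> uedges H. e \<subseteq> insert v (set vs) & v \<in> e} = {{v, u}}"
    proof
      show "{e \<in> uedges H. e \<subseteq> insert v (set vs) & v \<in> e} \<subseteq> {{v, u}}" using e2 uniq by blast
      show "{{v, u}} \<subseteq> {e \<in> uedges H. e \<subseteq> insert v (set vs) & v \<in> e}" using uv by (auto simp: adj_def insert_commute)
    qed
    then have 1: "rooted_on H F (vs @ [v]) (par(?k := Suc q))" using q by (intro new[OF vH]) auto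
    have vu: "(v, u) \<in> (conn H (set (vs @ [v])))\<^sup>*" using uv by (intro r_into_rtrancl) (auto simp: conn_def adj_def insert_commute)
    have cu: "(a, u) \<in> (conn H (set (vs @ [v])))\<^sup>*" if "a \<in> set (vs @ [v])" "\<exists>x. x \<notin> set (vs @ [v]) & adj H a x" for a
    proof (cases "a = v")
      case False
      then have "(a, u) \<in> (conn H (set vs))\<^sup>*" using op[of a u] that uv by auto
      then show ?thesis by (rule conn_mono[rotated]) auto
    qed (use vu in simp)
    have all: "(a, b) \<in> (conn H (set (vs @ [v])))\<^sup>*" if "a \<in> set (vs @ [v])" "b \<in> set (vs @ [v])"
      "\<exists>x. x \<notin> set (vs @ [v]) & adj H a x" "\<exists>x. x \<notin> set (vs @ [v]) & adj H b x" for a b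
      by (rule rtrancl_trans[OF cu[OF that(1,3)] conn_sym[OF cu[OF that(2,4)]]])
    show ?thesis
      by (rule exI[of _ v], rule exI[of _ "par(?k := Suc q)"], intro conjI ballI impI, rule vH, rule 1, rule all, assumption+)
  next
    case False
    \<comment> \<open>A vertex of \<open>F\<close> is preferred as the new root; if none is left,
      all of \<open>F\<close> is already numbered.\<close>
    obtain v where v: "v \<in> uverts H - set vs" "v \<in> F \<or> F \<subseteq> set vs"
      using vs F by blast
    have none: "{e \<in> uedges H. e \<subseteq> insert v (set vs) & v \<in> e} = {}"
    proof -
      have "False" if e: "e \<in> uedges H" "e \<subseteq> insert v (set vs)" "v \<in> e" for e
      proof -
        obtain b where "e = {v, b}" "b ~= v" "adj H v b" using e2[OF e(1,3)] by blast
        then have "b \<in> set vs" "adj H b v" using e(2) adj_sym[of H v b] by auto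
        then show False using False v(1) by blast
      qed
      then show ?thesis by blast
    qed
    have 1: "rooted_on H F (vs @ [v]) (par(?k := 0))" using none v by (intro new) auto
    have "a = v" if "a \<in> set (vs @ [v])" "\<exists>x. x \<notin> set (vs @ [v]) & adj H a x" for a
      using that False by auto
    then show ?thesis using v(1) 1 by (intro exI[of _ v] exI[of _ "par(?k := 0)"]) blast
  qed
qed

theorem rooted_order:
  assumes H: "wf_ugraph H" "cycle_free H" and F: "F \<subseteq> uverts H"
  shows "\<exists>vs par. set vs = uverts H & rooted_on H F vs par"
proof -
  let ?I = "\<lambda>vs par. set vs \<subseteq> uverts H & rooted_on H F vs par &
    (\<forall>a\<in>set vs. \<forall>b\<in>set vs. (\<exists>x. x \<notin> set vs & adj H a x) --> (\<exists>x. x \<notin> set vs & adj H b x) --> (a, b) \<in> (conn H (set vs))\<^sup>*)"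
  have fin: "finite (uverts H)" using H by (simp add: wf_ugraph_def)
  have "\<exists>vs' par'. set vs' = uverts H & rooted_on H F vs' par'" if "?I vs par" for vs par
    using that
  proof (induction "card (uverts H - set vs)" arbitrary: vs par rule: less_induct)
    case less
    show ?case
    proof (cases "set vs = uverts H")
      case True
      then show ?thesis using less.prems by blast
    next
      case False
      obtain v par' where v: "v \<in> uverts H - set vs" "rooted_on H F (vs @ [v]) par'"
        "\<forall>a\<in>set (vs @ [v]). \<forall>b\<in>set (vs @ [v]). (\<exists>x. x \<notin> set (vs @ [v]) & adj H a x) --> (\<exists>x. x \<notin> set (vs @ [v]) & adj H b x) -->
           (a, b) \<in> (conn H (set (vs @ [v])))\<^sup>*"
        using rooted_extend[OF H _ _ False _ F, of par] less.prems by blast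
      have "uverts H - set (vs @ [v]) \<subset> uverts H - set vs" using v(1) by auto
      then have "card (uverts H - set (vs @ [v])) < card (uverts H - set vs)" using fin by (intro psubset_card_mono) auto
      then show ?thesis using less.hyps[of "vs @ [v]" par'] v less.prems by auto
    qed
  qed
  moreover have "rooted_on H F [] (\<lambda>_. 0)"
    using H by (auto simp: rooted_on_def wf_ugraph_def)
  then have "?I [] (\<lambda>_. 0)" by simp
  ultimately show ?thesis by blast
qed

section \<open>The Helly property of subtrees\<close>

locale rooted =
  fixes m :: nat and par :: "nat => nat"
  assumes par_less: "i \<in> {1..m} ==> par i < i"
begin

definition below :: "nat => nat => bool" where
  "below c j \<longleftrightarrow> (c, j) \<in> {(par i, i) | i. i \<in> {1..m}}\<^sup>*"

lemma below_refl [simp]: "below c c"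
  by (simp add: below_def)

lemma below_step: "i \<in> {1..m} ==> below c (par i) ==> below c i"
  unfolding below_def by (rule rtrancl.rtrancl_into_rtrancl) auto

lemma below_par: "i \<in> {1..m} ==> below (par i) i"
  by (rule below_step) auto

lemma below_cases: "below c j ==> c ~= j ==> j \<in> {1..m} & below c (par j)"
  unfolding below_def by (erule rtranclE) auto

lemma below_trans: "below a b ==> below b c ==> below a c"
  unfolding below_def by (rule rtrancl_trans)

lemma below_le: "below c j ==> c <= j"
proof (induction j rule: less_induct)
  case (less j)
  show ?case
  proof (cases "c = j")
    case False
    then have j: "j \<in> {1..m}" "below c (par j)" using below_cases[OF less.prems] by blast+
    then have "c <= par j" using less.IH[OF par_less] by blast
    then show ?thesis using par_less[OF j(1)] by simp
  qed simp
qed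

lemma below_child: "below c j ==> c ~= j ==> \<exists>d\<in>{1..m}. par d = c & below d j"
proof (induction j rule: less_induct)
  case (less j)
  have j: "j \<in> {1..m}" "below c (par j)" using below_cases less.prems by blast+
  show ?case
  proof (cases "c = par j")
    case True
    then show ?thesis using j by (intro bexI[of _ j]) auto
  next
    case False
    then obtain d where "d \<in> {1..m}" "par d = c" "below d (par j)" using less.IH[OF par_less[OF j(1)] j(2)] by blast
    then show ?thesis using below_step[OF j(1)] by blast
  qed
qed

lemma below_linear: "below a j ==> below b j ==> a <= b ==> below a b"
proof (induction j rule: less_induct)
  case (less j)
  show ?case
  proof (cases "b = j")
    case True
    then show ?thesis using less.prems by simp
  next
    case False
    then have j: "j \<in> {1..m}" "below b (par j)" using below_cases less.prems by blast+
    have "a ~= j" using less.prems below_le[OF j(2)] par_less[OF j(1)] by auto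
    then have "below a (par j)" using below_cases less.prems by blast
    then show ?thesis using less.IH[OF par_less[OF j(1)]] j less.prems by blast
  qed
qed

lemma siblings_disjoint: "par d = par e ==> d ~= e ==> d \<in> {1..m} ==> e \<in> {1..m} ==> below d j ==> \<not> below e j"
proof
  assume a: "par d = par e" "d ~= e" "d \<in> {1..m}" "e \<in> {1..m}" "below d j" "below e j"
  have "below d e \<or> below e d" using below_linear a by (meson nle_le)
  then show False
  proof
    assume "below d e"
    then have "below d (par d)" using below_cases a by metis
    then show False using below_le par_less a by fastforce
  next
    assume "below e d"
    then have "below e (par e)" using below_cases a by metis
    then show False using below_le par_less a by fastforce
  qed
qed

text \<open>If the parent of \<open>s\<close> were missing, a walk from \<open>s\<close> inside
  \<open>N\<close> could never leave the subtree of \<open>s\<close>, where all indices are at least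
  \<open>s\<close>; but the minimum is smaller.\<close>

lemma connected_top:
  assumes N: "N \<subseteq> {1..m}" and c: "\<And>a b. a \<in> N ==> b \<in> N ==> (a, b) \<in> {(a, b). a \<in> N & b \<in> N & (par a = b \<or> par b = a)}\<^sup>*"
    and s: "s \<in> N" "s ~= Min N"
  shows "par s \<in> N"
proof (rule ccontr)
  assume p: "par s \<notin> N"
  have fin: "finite N" using N finite_subset by blast
  have mN: "Min N \<in> N" using fin s by (intro Min_in) auto
  from c[OF s(1) mN] have "below s (Min N)"
  proof (induction rule: rtrancl_induct)
    case (step a b)
    then have ab: "a \<in> N" "b \<in> N" "par a = b \<or> par b = a" by auto
    show ?case
    proof (cases "par b = a")
      case True
      then show ?thesis using step.IH below_step[of b s] ab N by auto
    next
      case False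
      then have "par a = b" using ab by blast
      then have "a ~= s" using p ab by auto
      then show ?thesis using below_cases[OF step.IH] \<open>par a = b\<close> by auto
    qed
  qed simp
  then have "s <= Min N" by (rule below_le)
  then show False using s Min_le[OF fin s(1)] by simp
qed

text \<open>Take the member whose smallest index \<open>t\<close> is largest. From a point common to
  it and any other member, moving to parents stays in both sets until \<open>t\<close> is
  reached.\<close>

lemma helly_index:
  assumes fam: "finite \<N>" "\<N> ~= {}" "\<And>N. N \<in> \<N> ==> N \<subseteq> {1..m} & N ~= {}"
    and c: "\<And>N a b. N \<in> \<N> ==> a \<in> N ==> b \<in> N ==> (a, b) \<in> {(a, b). a \<in> N & b \<in> N & (par a = b \<or> par b = a)}\<^sup>*"
    and i: "\<And>N M. N \<in> \<N> ==> M \<in> \<N> ==> N \<inter> M ~= {}"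
  shows "\<Inter>\<N> ~= {}"
proof -
  have fin: "finite N" if "N \<in> \<N>" for N using fam(3)[OF that] finite_subset by blast
  define t where "t = Max (Min ` \<N>)"
  have "t \<in> Min ` \<N>" unfolding t_def using fam by (intro Max_in) auto
  then obtain N where N: "N \<in> \<N>" "Min N = t" by auto
  have "t \<in> M" if M: "M \<in> \<N>" for M
  proof -
    have tM: "Min M <= t" unfolding t_def using fam M by (intro Max_ge) auto
    obtain s where s: "s \<in> N \<inter> M" using i[OF N(1) M] by blast
    have "x \<in> N \<inter> M ==> t \<in> M" for x
    proof (induction x rule: less_induct)
      case (less x)
      show ?case
      proof (cases "x = t")
        case False
        have "t < x" using False N less.prems Min_le[OF fin[OF N(1)]] by force
        then have "x ~= Min M" "x ~= Min N" using tM N by auto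
        then have "par x \<in> N \<inter> M"
          using connected_top[OF conjunct1[OF fam(3)[OF N(1)]] c[OF N(1)]] connected_top[OF conjunct1[OF fam(3)[OF M]] c[OF M]] less.prems by blast
        moreover have "x \<in> {1..m}" using fam(3)[OF M] less.prems by blast
        ultimately show ?thesis using less.IH[of "par x"] par_less by blast
      qed (use less.prems in blast)
    qed
    then show ?thesis using s by blast
  qed
  then show ?thesis by blast
qed

end

theorem helly:
  assumes T: "is_tree T" and fam: "finite \<F>" "\<F> ~= {}" "\<And>N. N \<in> \<F> ==> subtree T N"
    and i: "\<And>N M. N \<in> \<F> ==> M \<in> \<F> ==> N \<inter> M ~= {}"
  shows "\<Inter>\<F> ~= {}"
proof -
  have "wf_ugraph T" "cycle_free T" using T by (auto simp: is_tree_def wf_ugraph_def)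
  then obtain vs par where vs: "set vs = uverts T" "rooted_on T {} vs par" using rooted_order[of T "{}"] by blast
  let ?m = "length vs"
  interpret rooted ?m par using vs(2) by unfold_locales (auto simp: rooted_on_def)
  have E: "uedges T = {{vs ! (i - 1), vs ! (par i - 1)} | i. i \<in> {1..?m} & par i ~= 0}"
  proof -
    have "{e \<in> uedges T. e \<subseteq> set vs} = uedges T" using T vs(1) by (auto simp: is_tree_def)
    then show ?thesis using vs(2) by (simp add: rooted_on_def)
  qed
  have inj: "vs ! (i - 1) = vs ! (j - 1) \<longleftrightarrow> i = j" if "i \<in> {1..?m}" "j \<in> {1..?m}" for i j
  proof -
    have "i - 1 < ?m" "j - 1 < ?m" "distinct vs" using that vs(2) by (auto simp: rooted_on_def)
    then have "vs ! (i - 1) = vs ! (j - 1) \<longleftrightarrow> i - 1 = j - 1" by (simp only: nth_eq_iff_index_eq)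
    then show ?thesis using that by auto
  qed
  define ix where "ix N = {i \<in> {1..?m}. vs ! (i - 1) \<in> N}" for N
  have ex: "\<exists>i\<in>{1..?m}. vs ! (i - 1) = x" if x: "x \<in> uverts T" for x
  proof -
    obtain k where "k < ?m" "vs ! k = x" using in_set_conv_nth[of x vs] x vs(1) by auto
    then show ?thesis by (intro bexI[of _ "Suc k"]) auto
  qed
  have edge: "par a = b \<or> par b = a" if ab: "a \<in> {1..?m}" "b \<in> {1..?m}" "{vs ! (a - 1), vs ! (b - 1)} \<in> uedges T" for a b
  proof -
    from ab(3)[unfolded E mem_Collect_eq] obtain i where e: "{vs ! (a - 1), vs ! (b - 1)} = {vs ! (i - 1), vs ! (par i - 1)}"
      and i1: "i \<in> {1..?m}" and i2: "par i ~= 0" by (elim exE conjE)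
    note ii = i1 i2 e
    have pin: "par i \<in> {1..?m}" using ii par_less[OF ii(1)] by auto
    from ii(3) consider "vs ! (a - 1) = vs ! (i - 1)" "vs ! (b - 1) = vs ! (par i - 1)"
      | "vs ! (a - 1) = vs ! (par i - 1)" "vs ! (b - 1) = vs ! (i - 1)"
      unfolding doubleton_eq_iff by blast
    then show ?thesis
    proof cases
      case 1
      then have "a = i" "b = par i" using inj[OF ab(1) ii(1)] inj[OF ab(2) pin] by blast+
      then show ?thesis by blast
    next
      case 2
      then have "b = i" "a = par i" using inj[OF ab(2) ii(1)] inj[OF ab(1) pin] by blast+
      then show ?thesis by blast
    qed
  qed
  have "\<Inter>(ix ` \<F>) ~= {}"
  proof (rule helly_index)
    show "finite (ix ` \<F>)" "ix ` \<F> ~= {}" using fam by auto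
    fix N' assume "N' \<in> ix ` \<F>"
    then obtain N where N: "N \<in> \<F>" "N' = ix N" by auto
    have st: "N ~= {}" "N \<subseteq> uverts T" "\<And>a b. a \<in> N ==> b \<in> N ==> (a, b) \<in> (conn T N)\<^sup>*"
      using fam(3)[OF N(1)] by (auto simp: subtree_def conn_def)
    obtain x where x: "x \<in> N" "x \<in> uverts T" using st by blast
    then obtain i where "i \<in> {1..?m}" "vs ! (i - 1) = x" using ex by blast
    then have "i \<in> N'" using x by (simp add: N(2) ix_def)
    then show "N' \<subseteq> {1..?m} & N' ~= {}" by (auto simp: N(2) ix_def)
    fix a b assume ab: "a \<in> N'" "b \<in> N'"
    have "(vs ! (a - 1), vs ! (b - 1)) \<in> (conn T N)\<^sup>*" using ab st by (auto simp: N(2) ix_def)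
    then have "\<forall>b\<in>N'. y = vs ! (b - 1) --> (a, b) \<in> {(a, b). a \<in> N' & b \<in> N' & (par a = b \<or> par b = a)}\<^sup>*"
      if "y = vs ! (b - 1)" for y
      unfolding that
    proof (induction rule: rtrancl_induct)
      case base
      then show ?case using inj ab by (auto simp: N(2) ix_def)
    next
      case (step y z)
      then have yz: "y \<in> N" "z \<in> N" "{y, z} \<in> uedges T" by (auto simp: conn_def)
      then obtain k where k: "k \<in> {1..?m}" "vs ! (k - 1) = y" using ex st by blast
      then have kN: "k \<in> N'" using yz by (simp add: N(2) ix_def)
      show ?case
      proof (intro ballI impI)
        fix b assume b: "b \<in> N'" "z = vs ! (b - 1)"
        then have "par k = b \<or> par b = k" using edge[of k b] k yz by (auto simp: N(2) ix_def)
        moreover have "(a, k) \<in> {(a, b). a \<in> N' & b \<in> N' & (par a = b \<or> par b = a)}\<^sup>*" using step.IH kN k by blast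
        ultimately show "(a, b) \<in> {(a, b). a \<in> N' & b \<in> N' & (par a = b \<or> par b = a)}\<^sup>*"
          using kN b by (auto intro: rtrancl.rtrancl_into_rtrancl)
      qed
    qed
    then show "(a, b) \<in> {(a, b). a \<in> N' & b \<in> N' & (par a = b \<or> par b = a)}\<^sup>*" using ab by blast
  next
    fix N' M' assume "N' \<in> ix ` \<F>" "M' \<in> ix ` \<F>"
    then obtain N M where NM: "N \<in> \<F>" "N' = ix N" "M \<in> \<F>" "M' = ix M" by auto
    obtain x where x: "x \<in> N" "x \<in> M" using i NM by blast
    then have "x \<in> uverts T" using fam(3)[OF NM(1)] by (auto simp: subtree_def)
    then obtain k where "k \<in> {1..?m}" "vs ! (k - 1) = x" using ex by blast
    then have "k \<in> N' \<inter> M'" using x by (simp add: NM ix_def)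
    then show "N' \<inter> M' ~= {}" by blast
  qed
  then obtain i where "\<forall>N\<in>\<F>. i \<in> ix N" by auto
  then show ?thesis by (auto simp: ix_def)
qed

lemma subtree_Un:
  assumes "subtree T A" "subtree T B" "A \<inter> B ~= {}"
  shows "subtree T (A \<union> B)"
proof -
  obtain x where x: "x \<in> A" "x \<in> B" using assms by blast
  have c: "\<And>a b. a \<in> A ==> b \<in> A ==> (a, b) \<in> (conn T A)\<^sup>*" "\<And>a b. a \<in> B ==> b \<in> B ==> (a, b) \<in> (conn T B)\<^sup>*"
    using assms by (auto simp: subtree_def conn_def)
  have "(a, x) \<in> (conn T (A \<union> B))\<^sup>*" if "a \<in> A \<union> B" for a
    using that c x conn_mono[of A "A \<union> B"] conn_mono[of B "A \<union> B"] by blast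
  then have "(a, b) \<in> (conn T (A \<union> B))\<^sup>*" if "a \<in> A \<union> B" "b \<in> A \<union> B" for a b
    using that conn_sym rtrancl_trans by metis
  then show ?thesis using assms unfolding subtree_def conn_def by auto
qed

section \<open>Vertices that survive contraction\<close>

text \<open>Without isolated vertices a degree below 3 means degree 1 or 2, so an elimination
  applies. Elimination preserves this, because a neighbour left alone is removed as well.\<close>

definition simple :: "'a ugraph => bool" where
  "simple H \<longleftrightarrow> wf_ugraph H & (\<forall>x\<in>uverts H. neighbors H x ~= {})"

lemma neighborsD:
  assumes "wf_ugraph H" "v \<in> neighbors H u"
  shows "v \<in> uverts H" "u \<in> uverts H" "v ~= u" "u \<in> neighbors H v"
proof -
  have e: "{u, v} \<in> uedges H" using assms by (simp add: neighbors_def)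
  then have "{u, v} \<subseteq> uverts H" "card {u, v} = 2" using assms by (auto simp: wf_ugraph_def)
  then show "v \<in> uverts H" "u \<in> uverts H" "v ~= u" by auto
  show "u \<in> neighbors H v" using e by (simp add: neighbors_def insert_commute)
qed

lemma finite_neighbors: "wf_ugraph H ==> finite (neighbors H u)"
  by (rule finite_subset[of _ "uverts H"]) (auto simp: wf_ugraph_def neighbors_def)

lemma eliminate_uedges: "{e \<in> uedges H. u \<notin> e} \<subseteq> uedges (eliminate H u)"
  by (auto simp: eliminate_def)

lemma simple_eliminate:
  assumes H: "simple H" and u: "degree H u \<in> {1, 2}"
  shows "simple (eliminate H u)"
proof -
  have wf: "wf_ugraph H" using H by (simp add: simple_def)
  note nd = neighborsD[OF wf]
  have fin: "finite (uverts H)" using wf by (simp add: wf_ugraph_def)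
  have eH: "e \<subseteq> uverts H" "card e = 2" if "e \<in> uedges H" for e using wf that by (auto simp: wf_ugraph_def)
  let ?H = "eliminate H u"
  have keep: "neighbors ?H x ~= {}" if "y \<in> neighbors H x" "x ~= u" "y ~= u" for x y
    using that eliminate_uedges[of H u] by (auto simp: neighbors_def)
  show ?thesis
  proof (cases "degree H u = 2")
    case True
    then obtain a b where ab: "neighbors H u = {a, b}" "a ~= b" by (meson card_2_iff)
    have abn: "a \<in> uverts H" "b \<in> uverts H" "a ~= u" "b ~= u" using nd[of a u] nd[of b u] ab by auto
    have V: "uverts ?H = uverts H - {u}" and E: "uedges ?H = insert {a, b} {e \<in> uedges H. u \<notin> e}"
      using True ab by (auto simp: eliminate_def)
    have "wf_ugraph ?H" unfolding wf_ugraph_def V E using fin eH abn ab by auto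
    moreover have "neighbors ?H x ~= {}" if x: "x \<in> uverts ?H" for x
    proof -
      have x': "x \<in> uverts H" "x ~= u" using x V by auto
      obtain y where y: "y \<in> neighbors H x" using H x' by (auto simp: simple_def)
      show ?thesis
      proof (cases "y = u")
        case True
        then have "x \<in> {a, b}" using nd(4)[OF y] ab by simp
        then show ?thesis unfolding neighbors_def E by (auto simp: insert_commute)
      qed (use keep[OF y] x' in blast)
    qed
    ultimately show ?thesis by (simp add: simple_def)
  next
    case False
    then have "degree H u = 1" using u by simp
    then obtain v where v: "neighbors H u = {v}" by (meson card_1_singletonE)
    have V: "uverts ?H = uverts H - {u} - {x \<in> neighbors H u. neighbors H x = {u}}" and E: "uedges ?H = {e \<in> uedges H. u \<notin> e}"
      using False by (auto simp: eliminate_def)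
    have "e \<subseteq> uverts ?H" if e: "e \<in> uedges H" "u \<notin> e" for e
    proof
      fix x assume x: "x \<in> e"
      obtain a b where "e = {a, b}" using eH(2)[OF e(1)] by (meson card_2_iff)
      then obtain y where y: "e = {x, y}" using x by (metis insert_commute insertE singletonD)
      then have "y \<in> neighbors H x" "y ~= u" using e by (auto simp: neighbors_def)
      then show "x \<in> uverts ?H" using V x e eH(1)[OF e(1)] by auto
    qed
    then have "wf_ugraph ?H" unfolding wf_ugraph_def using fin eH by (auto simp: V E)
    moreover have "neighbors ?H x ~= {}" if x: "x \<in> uverts ?H" for x
    proof -
      have x': "x \<in> uverts H" "x ~= u" "x \<in> neighbors H u ==> neighbors H x ~= {u}" using x V by auto
      have ne: "neighbors H x ~= {}" using H x' by (auto simp: simple_def)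
      obtain y where y: "y \<in> neighbors H x" "y ~= u"
      proof (cases "neighbors H x \<subseteq> {u}")
        case True
        then have e: "neighbors H x = {u}" using ne by blast
        then show ?thesis using x'(3) nd(4)[of u x] by blast
      qed (use that in blast)
      then show ?thesis using keep x' by blast
    qed
    ultimately show ?thesis by (simp add: simple_def)
  qed
qed

text \<open>Makes the choice in \<open>cg\<close> meaningful. Each elimination removes a vertex, so
  the process ends.\<close>

lemma contraction_exists:
  "simple H ==> \<exists>us K. set us \<subseteq> A & eliminates H us K & (\<forall>x\<in>A \<inter> uverts K. 3 <= degree K x)"
proof (induction "card (uverts H)" arbitrary: H rule: less_induct)
  case less
  have wf: "wf_ugraph H" using less.prems by (simp add: simple_def)
  show ?case
  proof (cases "\<exists>u\<in>A \<inter> uverts H. degree H u < 3")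
    case True
    then obtain u where u: "u \<in> A" "u \<in> uverts H" "degree H u < 3" by auto
    have "degree H u ~= 0" using less.prems u finite_neighbors[OF wf, of u] by (auto simp: simple_def)
    then have d: "degree H u \<in> {1, 2}" using u by auto
    have "uverts (eliminate H u) \<subseteq> uverts H - {u}" by (auto simp: eliminate_def)
    then have "card (uverts (eliminate H u)) < card (uverts H)"
      using u wf by (intro psubset_card_mono) (auto simp: wf_ugraph_def)
    then obtain us K where "set us \<subseteq> A" "eliminates (eliminate H u) us K" "\<forall>x\<in>A \<inter> uverts K. 3 <= degree K x"
      using less.hyps simple_eliminate[OF less.prems d] by blast
    then show ?thesis using u d by (intro exI[of _ "u # us"] exI[of _ K]) (auto intro: eliminates.Cons)
  next
    case False
    then show ?thesis by (intro exI[of _ "[]"] exI[of _ H]) (auto intro: eliminates.Nil simp: not_less)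
  qed
qed

definition arm :: "'a ugraph => 'a set => 'a => 'a list => bool" where
  "arm H B z p \<longleftrightarrow> p ~= [] & distinct (z # p) & successively (adj H) (z # p) & last p \<in> B"

text \<open>Three paths to \<open>B\<close> that share only their start \<open>z\<close>: the
  obstruction to eliminating \<open>z\<close> as long as \<open>B\<close> is left alone.\<close>

definition fan :: "'a ugraph => 'a set => 'a => bool" where
  "fan H B z \<longleftrightarrow> (\<exists>p q r. arm H B z p & arm H B z q & arm H B z r &
     set p \<inter> set q = {} & set p \<inter> set r = {} & set q \<inter> set r = {})"

lemma arm_hd: "arm H B z p ==> hd p \<in> neighbors H z & hd p \<in> set p"
  by (cases p) (auto simp: arm_def adj_def neighbors_def)

lemma fan_degree:
  assumes "wf_ugraph H" "fan H B z"
  shows "3 <= degree H z"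
proof -
  obtain p q r where a: "arm H B z p" "arm H B z q" "arm H B z r"
    "set p \<inter> set q = {}" "set p \<inter> set r = {}" "set q \<inter> set r = {}" using assms by (auto simp: fan_def)
  then have "{hd p, hd q, hd r} \<subseteq> neighbors H z" "card {hd p, hd q, hd r} = 3"
    using arm_hd[OF a(1)] arm_hd[OF a(2)] arm_hd[OF a(3)] by (auto simp: card_insert_if)
  then show ?thesis using card_mono[OF finite_neighbors[OF assms(1)]] by metis
qed

lemma successively_eliminate:
  assumes "successively (adj H) xs" "u \<notin> set xs"
  shows "successively (adj (eliminate H u)) xs"
proof -
  have "adj (eliminate H u) a b" if "a \<in> set xs" "b \<in> set xs" "adj H a b" for a b
    using that assms(2) eliminate_uedges[of H u] by (auto simp: adj_def)
  then show ?thesis using successively_mono[OF assms(1)] by blast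
qed

text \<open>An eliminated vertex on the arm is interior, being neither \<open>z\<close> nor in
  \<open>B\<close>. Its two neighbours on the arm are then all its neighbours, and the new edge
  bridges the gap.\<close>

lemma arm_eliminate:
  assumes wf: "wf_ugraph H" and p: "arm H B z p" and u: "u ~= z" "u \<notin> B" "degree H u \<in> {1, 2}"
  shows "arm (eliminate H u) B z (removeAll u p)"
proof (cases "u \<in> set p")
  case False
  then show ?thesis using p u successively_eliminate[of H "z # p" u] by (auto simp: arm_def)
next
  case True
  then obtain xs ys where e: "p = xs @ u # ys" by (meson split_list)
  have ys: "ys ~= []" "last ys \<in> B" using p u by (auto simp: arm_def e split: if_splits)
  have dist: "distinct (z # xs)" "distinct ys" "u \<notin> set xs" "u \<notin> set ys" "set (z # xs) \<inter> set ys = {}"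
    using p by (auto simp: arm_def e)
  have succ: "successively (adj H) ((z # xs) @ u # ys)" using p by (simp add: arm_def e)
  let ?a = "last (z # xs)" and ?b = "hd ys"
  have s: "successively (adj H) (z # xs)" "successively (adj H) ys" "adj H ?a u" "adj H u ?b"
    using succ ys unfolding successively_append_iff by (auto simp: successively_Cons)
  have ab: "?a \<in> neighbors H u" "?b \<in> neighbors H u" using s by (auto simp: adj_def neighbors_def insert_commute)
  have "?a \<in> set (z # xs)" by (rule last_in_set) simp
  moreover have "?b \<in> set ys" using ys by simp
  ultimately have ne: "?a ~= ?b" using dist(5) by (metis disjoint_iff)
  have "card {?a, ?b} <= degree H u" using ab by (intro card_mono finite_neighbors[OF wf]) auto
  then have d: "degree H u = 2" using u ne by auto
  have "neighbors H u = {?a, ?b}"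
    using card_subset_eq[OF finite_neighbors[OF wf], of "{?a, ?b}" u] ab d ne by auto
  then have "{?a, ?b} \<in> uedges (eliminate H u)" using d by (simp add: eliminate_def)
  then have "adj (eliminate H u) ?a ?b" by (simp add: adj_def)
  then have "successively (adj (eliminate H u)) ((z # xs) @ ys)"
    unfolding successively_append_iff using successively_eliminate[OF s(1)] successively_eliminate[OF s(2)] dist u by auto
  moreover have "removeAll u p = xs @ ys" using dist by (simp add: e)
  ultimately show ?thesis using ys dist by (auto simp: arm_def)
qed

text \<open>The centre of a fan has degree at least 3 and is itself never eliminated.\<close>

lemma fan_eliminate:
  assumes "wf_ugraph H" "fan H B z" "u \<notin> B" "degree H u \<in> {1, 2}"
  shows "fan (eliminate H u) B z"
proof -
  have "u ~= z" using fan_degree[OF assms(1,2)] assms(4) by auto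
  note ae = arm_eliminate[OF assms(1) _ this assms(3,4)]
  obtain p q r where a: "arm H B z p" "arm H B z q" "arm H B z r"
    "set p \<inter> set q = {}" "set p \<inter> set r = {}" "set q \<inter> set r = {}" using assms by (auto simp: fan_def)
  then show ?thesis unfolding fan_def using ae[OF a(1)] ae[OF a(2)] ae[OF a(3)]
    by (intro exI[of _ "removeAll u p"] exI[of _ "removeAll u q"] exI[of _ "removeAll u r"]) auto
qed

lemma fan_survives: "eliminates H us K ==> simple H ==> fan H B z ==> set us \<inter> B = {} ==> z \<in> uverts K"
proof (induction rule: eliminates.induct)
  case (Nil H)
  then obtain p where "arm H B z p" "wf_ugraph H" by (auto simp: fan_def simple_def)
  then show ?case using arm_hd neighborsD(2) by metis
next
  case (Cons u H us K)
  then show ?case using simple_eliminate[of H u] fan_eliminate[of H B z u] by (auto simp: simple_def)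
qed

lemma simple_query_graph: "acyclic_crpq Q ==> simple (query_graph Q)"
  unfolding simple_def
proof
  assume Q: "acyclic_crpq Q"
  have e: "uedges (query_graph Q) = (\<lambda>(r, x, y). {x, y}) ` set (atoms Q)"
    by (simp add: query_graph_def query_edges_def)
  have v: "uverts (query_graph Q) = (\<Union>(r, x, y)\<in>set (atoms Q). {x, y})" by (simp add: query_graph_def vars_def)
  have "card e = 2" if "e \<in> uedges (query_graph Q)" for e
    using that Q by (simp add: acyclic_crpq_def query_graph_def)
  then show "wf_ugraph (query_graph Q)" unfolding wf_ugraph_def v by (auto simp: e)
  show "\<forall>x\<in>uverts (query_graph Q). neighbors (query_graph Q) x ~= {}"
  proof
    fix x assume "x \<in> uverts (query_graph Q)"
    then obtain r a b where ab: "(r, a, b) \<in> set (atoms Q)" "x = a \<or> x = b" unfolding v by auto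
    then have "{a, b} \<in> uedges (query_graph Q)" unfolding e by force
    then show "neighbors (query_graph Q) x ~= {}" using ab by (auto simp: neighbors_def insert_commute)
  qed
qed

text \<open>The argument applies to every elimination order, hence also to the graph that
  \<open>SOME\<close> picks in \<open>cg\<close>.\<close>

theorem fan_in_cg:
  assumes Q: "acyclic_crpq Q" and f: "fan (query_graph Q) (free Q \<inter> B) z"
  shows "z \<in> uverts (cg (induced Q B))"
proof -
  have g: "query_graph (induced Q B) = query_graph Q"
    by (simp add: query_graph_def query_edges_def vars_def induced_def)
  have "\<exists>K us. contracts_to (induced Q B) us K"
    unfolding contracts_to_def g using contraction_exists[OF simple_query_graph[OF Q]] by metis
  then have "\<exists>us. contracts_to (induced Q B) us (cg (induced Q B))" unfolding cg_def by (rule someI_ex)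
  then obtain us where us: "contracts_to (induced Q B) us (cg (induced Q B))" by blast
  have "set us \<inter> (free Q \<inter> B) = {}" using us by (auto simp: contracts_to_def bound_def induced_def)
  moreover have "eliminates (query_graph Q) us (cg (induced Q B))" using us by (simp add: contracts_to_def g)
  ultimately show ?thesis using fan_survives simple_query_graph[OF Q] f by metis
qed

text \<open>Two adjacent bags suffice, the free variables and all variables. With this, the infimum
  in \<open>cw\<close> is attained.\<close>

lemma FTD_nonempty:
  assumes "wf_crpq Q"
  shows "FTD Q ~= {}"
proof -
  let ?T = "\<lparr>uverts = {0, 1 :: nat}, uedges = {{0, 1}}\<rparr>" and ?c = "\<lambda>t :: nat. if t = 0 then free Q else vars Q"
  have F: "free Q \<subseteq> vars Q" using assms by (simp add: wf_crpq_def)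
  have st: "subtree ?T S" if S: "S ~= {}" "S \<subseteq> {0, 1}" for S
  proof -
    have "(a, b) \<in> {(u, v). u \<in> S & v \<in> S & {u, v} \<in> uedges ?T}\<^sup>*" if ab: "a \<in> S" "b \<in> S" for a b
    proof (cases "a = b")
      case False
      then have "{a, b} = {0, 1}" using ab S by auto
      then show ?thesis using ab by (intro r_into_rtrancl) simp
    qed simp
    then show ?thesis using S unfolding subtree_def by simp
  qed
  have "cycle_free ?T"
  proof -
    have False if us: "3 <= length us" "distinct us" "\<forall>i<length us. {us ! i, us ! (Suc i mod length us)} \<in> {{0, 1 :: nat}}" for us
    proof -
      have u: "us ! i = 0 \<or> us ! i = 1" if "i < length us" for i using us(3) that by (auto simp: doubleton_eq_iff)
      have "0 < length us" using us(1) by linarith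
      then have "us ! 0 ~= us ! 1" "us ! 0 ~= us ! 2" "us ! 1 ~= us ! 2" 
        using us(1) \<open>0 < length us\<close> nth_eq_iff_index_eq[OF us(2), of 0 1] nth_eq_iff_index_eq[OF us(2), of 0 2] nth_eq_iff_index_eq[OF us(2), of 1 2] by auto
      then show False using u[of 0] u[of 1] u[of 2] us(1) by linarith
    qed
    then show ?thesis unfolding cycle_free_def ugraph.select_convs by blast
  qed
  then have T: "is_tree ?T" using st[of "{0, 1}"] by (simp add: is_tree_def)
  have "subtree ?T {t \<in> uverts ?T. x \<in> ?c t}" if "x \<in> vars Q" for x
    using that by (intro st) auto
  moreover have "\<forall>(r, x, y)\<in>set (atoms Q). x \<in> vars Q & y \<in> vars Q" by (force simp: vars_def)
  ultimately have "tree_decomposition Q (?T, ?c)" using T F by (auto simp: tree_decomposition_def)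
  moreover have "free_connex Q (?T, ?c)" using st[of "{0}"] by (auto simp: free_connex_def intro!: exI[of _ "{0}"])
  ultimately show ?thesis by (auto simp: FTD_def)
qed

lemma cw_bag:
  assumes "wf_crpq Q"
  obtains T \<chi> S where "tree_decomposition Q (T, \<chi>)" "subtree T S" "(\<Union>t\<in>S. \<chi> t) = free Q"
    "\<And>t. t \<in> uverts T ==> card (bound (induced Q (\<chi> t)) \<inter> uverts (cg (induced Q (\<chi> t)))) <= cw Q"
proof -
  have "cw Q \<in> cw_dec Q ` FTD Q" unfolding cw_def using FTD_nonempty[OF assms] by (intro Inf_nat_def1) auto
  then obtain T \<chi> where D: "(T, \<chi>) \<in> FTD Q" "cw Q = cw_dec Q (T, \<chi>)" by auto
  have td: "tree_decomposition Q (T, \<chi>)" using D by (simp add: FTD_def)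
  then have "finite (uverts T)" by (auto simp: tree_decomposition_def is_tree_def)
  then have le: "card (bound (induced Q (\<chi> t)) \<inter> uverts (cg (induced Q (\<chi> t)))) <= cw Q" if "t \<in> uverts T" for t
    using that unfolding D(2) cw_dec_def bags_def by (intro Max_ge) auto
  obtain S where "subtree T S" "(\<Union>t\<in>S. \<chi> t) = free Q" using D by (auto simp: FTD_def free_connex_def)
  with that[OF td _ _ le] show thesis by blast
qed

section \<open>A join plan of small width\<close>

text \<open>The assumption \<open>root\<close> is the effect of preferring free variables as roots:
  a bound root has no free variable in its tree.\<close>

locale marked = rooted m par for m par +
  fixes fr :: "nat => bool"
  assumes fr_range: "fr i ==> i \<in> {1..m}"
    and root: "i \<in> {1..m} ==> par i = 0 ==> \<not> fr i ==> below i j ==> \<not> fr j"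
begin

definition live :: "nat => bool" where
  "live i \<longleftrightarrow> (\<exists>j. below i j & fr j)"

text \<open>For a bound variable this is the top of its component of bound variables. A free
  variable with a bound parent is assigned to the component of the parent; every other free variable
  stands for itself.\<close>

function tp :: "nat => nat" where
  "tp i = (if i \<in> {1..m} & par i ~= 0 & \<not> fr (par i) then tp (par i) else i)"
  by pat_completeness auto
termination by (relation "measure id") (use par_less in auto)

definition kept :: "nat => bool" where
  "kept i \<longleftrightarrow> fr i \<or> (\<exists>d\<in>{1..m}. \<exists>e\<in>{1..m}. i \<in> {1..m} & d ~= e & par d = i & par e = i & live d & live e)"

text \<open>The nearest kept proper ancestor, or 0: the column from which \<open>i\<close> will be
  reached.\<close>

function kp :: "nat => nat" where
  "kp i = (if i \<in> {1..m} & par i ~= 0 & \<not> kept (par i) then kp (par i) else par i)"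
  by pat_completeness auto
termination by (relation "measure id") (use par_less in auto)

declare tp.simps [simp del] kp.simps [simp del]

lemma tp_top: "\<not> (i \<in> {1..m} & par i ~= 0 & \<not> fr (par i)) ==> tp i = i"
  by (subst tp.simps) (simp only: if_False)

lemma tp_par: "i \<in> {1..m} ==> par i ~= 0 ==> \<not> fr (par i) ==> tp i = tp (par i)"
  by (subst tp.simps) simp

lemma kp_top: "i \<in> {1..m} ==> par i = 0 \<or> kept (par i) ==> kp i = par i"
  by (subst kp.simps) auto

lemma kp_par: "i \<in> {1..m} ==> par i ~= 0 ==> \<not> kept (par i) ==> kp i = kp (par i)"
  by (subst kp.simps) simp

lemma par_range: "i \<in> {1..m} ==> par i ~= 0 ==> par i \<in> {1..m}"
  using par_less[of i] by auto

lemma fr_kept: "fr i ==> kept i"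
  by (simp add: kept_def)

lemma kept_range: "kept i ==> i \<in> {1..m}"
  using fr_range by (auto simp: kept_def)

lemma live_up: "below i j ==> live j ==> live i"
  unfolding live_def using below_trans by blast

lemma kept_live: "kept i ==> live i"
proof -
  assume "kept i"
  then consider "fr i" | d where "d \<in> {1..m}" "par d = i" "live d" unfolding kept_def by blast
  then show "live i"
  proof cases
    case 1
    then show ?thesis unfolding live_def using below_refl by blast
  next
    case 2
    then show ?thesis using live_up[of i d] below_par[of d] by simp
  qed
qed

lemma tp_props:
  "i \<in> {1..m} ==> tp i \<in> {1..m} & below (tp i) i & (par (tp i) = 0 \<or> fr (par (tp i))) & (tp i ~= i --> \<not> fr (tp i) & \<not> fr (par i) & par i \<in> {1..m} & tp (par i) = tp i)"
proof (induction i rule: less_induct)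
  case (less i)
  show ?case
  proof (cases "par i ~= 0 & \<not> fr (par i)")
    case True
    then have t: "tp i = tp (par i)" and p: "par i \<in> {1..m}" using tp_par par_range less.prems by auto
    have IH: "tp (par i) \<in> {1..m} & below (tp (par i)) (par i) & (par (tp (par i)) = 0 \<or> fr (par (tp (par i)))) & (tp (par i) ~= par i --> \<not> fr (tp (par i)))"
      using less.IH[OF par_less[OF less.prems] p] by blast
    have "below (tp (par i)) i" using below_step[OF less.prems] IH by blast
    moreover have "\<not> fr (tp (par i))" using IH True by (cases "tp (par i) = par i") auto
    ultimately show ?thesis unfolding t using IH True p by blast
  next
    case False
    then have "tp i = i" using tp_top by blast
    then show ?thesis using False less.prems by auto
  qed
qed

lemma tp_le: "i \<in> {1..m} ==> tp i <= i"
  using tp_props below_le by blast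

lemma tp_mono: "below a b ==> a \<in> {1..m} ==> tp a <= tp b"
proof (induction b rule: less_induct)
  case (less b)
  show ?case
  proof (cases "a = b")
    case False
    then have b: "b \<in> {1..m}" "below a (par b)" using below_cases less.prems by blast+
    have p: "par b ~= 0" using below_le[OF b(2)] less.prems by auto
    show ?thesis
    proof (cases "fr (par b)")
      case True
      then have "tp b = b" using tp_top by blast
      then show ?thesis using tp_le[OF less.prems(2)] below_le[OF less.prems(1)] by simp
    next
      case False
      then have "tp b = tp (par b)" using tp_par b p by blast
      then show ?thesis using less.IH[OF par_less[OF b(1)] b(2) less.prems(2)] by simp
    qed
  qed simp
qed

text \<open>The last clause makes the plan executable: the column needed for \<open>i\<close> is
  variable 0, a free variable of an earlier group, or a member of the same group with a smaller
  index.\<close>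

lemma kp_props:
  "i \<in> {1..m} ==> below (kp i) i & kp i < i & (kp i = 0 \<or> kept (kp i) & (fr (kp i) & tp (kp i) < tp i \<or> tp (kp i) = tp i))"
proof (induction i rule: less_induct)
  case (less i)
  note i = less.prems
  show ?case
  proof (cases "par i = 0 \<or> kept (par i)")
    case True
    then have k: "kp i = par i" using kp_top i by blast
    have "fr (par i) & tp (par i) < tp i \<or> tp (par i) = tp i" if "par i ~= 0"
    proof (cases "fr (par i)")
      case True
      then have "tp i = i" using tp_top by blast
      then show ?thesis using tp_le[OF par_range[OF i that]] par_less[OF i] True by simp
    next
      case False
      then show ?thesis using tp_par[OF i that] by simp
    qed
    then show ?thesis unfolding k using True below_par[OF i] par_less[OF i] by blast
  next
    case False
    then have k: "kp i = kp (par i)" and p: "par i \<in> {1..m}" using kp_par i par_range by blast+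
    have "tp i = tp (par i)" using False tp_par i fr_kept by blast
    then show ?thesis using less.IH[OF par_less[OF i] p] par_less[OF i] below_step[OF i] unfolding k by auto
  qed
qed

lemma kp_between: "i \<in> {1..m} ==> below (kp i) c ==> c ~= kp i ==> below c i ==> c ~= i ==> \<not> kept c"
proof (induction i rule: less_induct)
  case (less i)
  note i = less.prems(1)
  have c: "below c (par i)" using below_cases less.prems by blast
  show ?case
  proof (cases "par i = 0 \<or> kept (par i)")
    case True
    then have "kp i = par i" using kp_top i by blast
    then show ?thesis using less.prems c below_le by (metis le_antisym)
  next
    case False
    then have k: "kp i = kp (par i)" and p: "par i \<in> {1..m}" using kp_par i par_range by blast+
    show ?thesis using less.IH[OF par_less[OF i] p] less.prems c False by (cases "c = par i") (auto simp: k)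
  qed
qed

text \<open>A bound vertex that is not kept has at most one live child. With no kept vertex on the
  way, every path from \<open>c\<close> to something kept is therefore forced through
  \<open>i\<close>.\<close>

lemma follow:
  assumes "\<And>c'. below c c' ==> below c' i ==> c' ~= i ==> \<not> kept c'" "below c i" "below c w" "kept w" "kept i" "c \<in> {1..m}"
  shows "below i w"
  using assms
proof (induction "i - c" arbitrary: c rule: less_induct)
  case less
  show ?case
  proof (cases "c = i")
    case False
    have nk: "\<not> kept c" using less.prems(1)[of c] less.prems(2) False by simp
    obtain d where d: "d \<in> {1..m}" "par d = c" "below d i" using below_child[OF less.prems(2) False] by blast
    have "c ~= w" using nk less.prems by blast
    then obtain e where e: "e \<in> {1..m}" "par e = c" "below e w" using below_child[OF less.prems(3)] by blast
    have l: "live d" "live e" using live_up d e kept_live less.prems by blast+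
    have cd: "below c d" using below_par d by blast
    have "c < d" using par_less d by blast
    have "d = e" using nk l d e less.prems(6) unfolding kept_def by blast
    moreover have "i - d < i - c" using \<open>c < d\<close> below_le[OF d(3)] by simp
    ultimately show ?thesis using less.hyps[of d] less.prems below_trans[OF cd] d e by blast
  qed (use less.prems in simp)
qed


definition sep :: "nat => nat => nat set => bool" where
  "sep x y W \<longleftrightarrow> (\<forall>c. below x c & c ~= x & below c y --> (\<forall>w\<in>W. \<not> below c w))"

fun ok :: "nat list => op list => bool" where
  "ok W [] \<longleftrightarrow> True"
| "ok W (Ext x y # os) \<longleftrightarrow> x \<in> set W & y \<notin> set W & y <= m & below x y & sep x y (set W) & ok (y # W) os"
| "ok W (Keep V # os) \<longleftrightarrow> set V \<subseteq> set W & distinct V & ok V os"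

text \<open>The columns that remain when all groups before \<open>c\<close> are finished.\<close>

definition base :: "nat => nat set" where
  "base c = insert 0 {i. fr i & tp i < c}"

text \<open>The branching variables of the component with top \<open>c\<close>, together with the
  free variables at its lower boundary. A free \<open>c\<close> forms a group by itself.\<close>

definition group :: "nat => nat set" where
  "group c = {i. kept i & tp i = c}"

definition small :: "nat list => bool" where
  "small W \<longleftrightarrow> (\<exists>c. set W \<subseteq> insert 0 (Collect fr) \<union> group c)"

definition good :: "nat list => op list => nat set => bool" where
  "good W os Z \<longleftrightarrow> ok W os & (\<forall>V\<in>set (states W os). small V) & set (final W os) = Z"

text \<open>Anything kept in the branch towards \<open>i\<close> lies below \<open>i\<close> by
  \<open>follow\<close>. It thus has an index of at least \<open>i\<close> and belongs to no earlier
  group, so it is not yet a column.\<close>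

lemma kp_sep:
  assumes W: "set W \<subseteq> base (tp i) \<union> {j \<in> group (tp i). j < i}" and i: "kept i"
  shows "sep (kp i) i (set W)"
  unfolding sep_def
proof (intro allI impI ballI notI)
  fix c w assume c: "below (kp i) c & c ~= kp i & below c i" and w: "w \<in> set W" "below c w"
  have im: "i \<in> {1..m}" using kept_range i by blast
  have "kp i < c" using c below_le by (metis le_neq_implies_less)
  then have c1: "c \<in> {1..m}" using below_le[of c i] c im by auto
  have "w ~= 0" using below_le[OF w(2)] c1 by auto
  then have wk: "kept w" and w': "fr w & tp w < tp i \<or> w < i" using W w fr_kept by (auto simp: base_def group_def)
  have "below i w"
  proof (rule follow[of c])
    show "\<not> kept c'" if "below c c'" "below c' i" "c' ~= i" for c'
    proof (rule kp_between[OF im _ _ that(2,3)])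
      show "below (kp i) c'" using below_trans c that by blast
      show "c' ~= kp i" using below_le[OF that(1)] \<open>kp i < c\<close> by auto
    qed
  qed (use c w wk i c1 in auto)
  then show False using tp_mono[OF _ im] below_le w' by fastforce
qed

lemma good_Keep: "set V \<subseteq> set W ==> distinct V ==> small W ==> good V os Z ==> good W (Keep V # os) Z"
  by (simp add: good_def)

lemma group_range: "group c \<subseteq> {1..m}"
  using kept_range by (auto simp: group_def)

lemma group_set: "set (filter (\<lambda>i. kept i & tp i = c) [1..<Suc m]) = group c"
  using group_range[of c] by (auto simp: group_def simp del: upt_Suc)

text \<open>The members are added in increasing order, so ancestors come first and the column
  \<open>kp i\<close> is present when \<open>i\<close> needs it.\<close>

lemma good_group:
  assumes rest: "\<And>W. set W = base c \<union> group c ==> small W ==> good W os Z"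
  shows "filter (\<lambda>i. kept i & tp i = c) [1..<Suc m] = ys @ zs ==> set W = base c \<union> set ys ==>
    good W (map (\<lambda>i. Ext (kp i) i) zs @ os) Z"
proof (induction zs arbitrary: ys W)
  case Nil
  have "set ys = group c" using group_set[of c] unfolding Nil(1) by simp
  moreover have "small W" unfolding small_def Nil(2) calculation by (intro exI[of _ c]) (auto simp: base_def)
  ultimately show ?case using rest[of W] Nil by simp
next
  case (Cons i zs)
  have S: "set (ys @ i # zs) = group c" using group_set[of c] unfolding Cons.prems(1) .
  then have i: "kept i" "tp i = c" and im: "i \<in> {1..m}" using kept_range by (auto simp: group_def)
  have "sorted_wrt (<) (ys @ i # zs)" unfolding Cons.prems(1)[symmetric] by (intro sorted_wrt_filter sorted_wrt_upt)
  then have ys: "\<forall>j\<in>set ys. j < i" and zs: "\<forall>j\<in>set zs. i < j" by (auto simp: sorted_wrt_append)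
  have W: "set W \<subseteq> base c \<union> {j \<in> group c. j < i}" using Cons.prems(2) S ys by auto
  have "kp i \<in> set W"
  proof -
    have "kp i = 0 \<or> kept (kp i) & (fr (kp i) & tp (kp i) < c \<or> tp (kp i) = c)" and l: "kp i < i" using kp_props[OF im] i by blast+
    moreover have "kp i \<in> set ys" if "kept (kp i)" "tp (kp i) = c"
    proof -
      have "kp i \<in> set (ys @ i # zs)" using that S by (simp add: group_def)
      then show ?thesis using zs l by auto
    qed
    ultimately show ?thesis unfolding Cons.prems(2) base_def by blast
  qed
  moreover have "i \<notin> set W" using W i im by (auto simp: base_def)
  moreover have "sep (kp i) i (set W)" using kp_sep[of W i] W i by simp
  moreover have "small W" unfolding small_def using W by (intro exI[of _ c]) (auto simp: base_def)
  moreover have "good (i # W) (map (\<lambda>i. Ext (kp i) i) zs @ os) Z" using Cons.IH[of "ys @ [i]" "i # W"] Cons.prems by auto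
  ultimately show ?case using kp_props[OF im] im by (simp add: good_def)
qed

text \<open>An index \<open>c\<close> that is no top has an empty group and contributes only a
  projection.\<close>

definition plan :: "nat => nat => op list" where
  "plan a b = concat (map (\<lambda>c. map (\<lambda>i. Ext (kp i) i) (filter (\<lambda>i. kept i & tp i = c) [1..<Suc m]) @
     [Keep (0 # filter (\<lambda>i. fr i & tp i <= c) [1..<Suc m])]) [a..<b])"

lemma good_plan: "1 <= a ==> a <= Suc m ==> set W = base a ==> good W (plan a (Suc m)) (insert 0 (Collect fr))"
proof (induction "Suc m - a" arbitrary: a W)
  case 0
  then have a: "a = Suc m" by simp
  have "tp i < Suc m" if "fr i" for i using tp_le[OF fr_range[OF that]] fr_range[OF that] by simp
  then have "base a = insert 0 (Collect fr)" unfolding a base_def by blast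
  then show ?case using 0 by (auto simp: plan_def a good_def small_def)
next
  case (Suc k)
  then have am: "a < Suc m" by simp
  let ?V = "0 # filter (\<lambda>i. fr i & tp i <= a) [1..<Suc m]"
  have V: "set ?V = base (Suc a)" using fr_range by (force simp: base_def)
  have "plan a (Suc m) = map (\<lambda>i. Ext (kp i) i) (filter (\<lambda>i. kept i & tp i = a) [1..<Suc m]) @ Keep ?V # plan (Suc a) (Suc m)"
    unfolding plan_def upt_conv_Cons[OF am] by simp
  moreover have "good U (Keep ?V # plan (Suc a) (Suc m)) (insert 0 (Collect fr))" if U: "set U = base a \<union> group a" "small U" for U
  proof (rule good_Keep[OF _ _ U(2)])
    show "set ?V \<subseteq> set U" unfolding V U base_def group_def using fr_kept by auto
    show "distinct ?V" by (auto simp del: upt_Suc)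
    show "good ?V (plan (Suc a) (Suc m)) (insert 0 (Collect fr))" using Suc.hyps(1)[of "Suc a" ?V] Suc.hyps(2) Suc.prems V am by simp
  qed
  ultimately show ?case using good_group[of a "Keep ?V # plan (Suc a) (Suc m)" _ "[]"] Suc.prems by simp
qed

theorem plan_exists:
  "ok [0] (plan 1 (Suc m)) & set (final [0] (plan 1 (Suc m))) = insert 0 (Collect fr) &
   (\<forall>V\<in>set (states [0] (plan 1 (Suc m))). set V \<subseteq> {..m} & (\<exists>c. set V - insert 0 (Collect fr) \<subseteq> group c))"
proof -
  have "base 1 = {0}" using tp_props fr_range by (fastforce simp: base_def)
  then have "good [0] (plan 1 (Suc m)) (insert 0 (Collect fr))" by (intro good_plan) auto
  moreover have "set V \<subseteq> {..m} & (\<exists>c. set V - insert 0 (Collect fr) \<subseteq> group c)" if "small V" for V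
  proof -
    obtain c where c: "set V \<subseteq> insert 0 (Collect fr) \<union> group c" using \<open>small V\<close> by (auto simp: small_def)
    then have "set V \<subseteq> {..m}" using fr_range group_range[of c] by fastforce
    then show ?thesis using c by blast
  qed
  ultimately show ?thesis unfolding good_def by blast
qed

text \<open>The path stops at the first free variable it meets, so it ends at the boundary of the
  component it starts in.\<close>

lemma down:
  "d \<in> {1..m} ==> live d ==> \<exists>p. p ~= [] & hd p = d & successively (\<lambda>a b. b \<in> {1..m} & par b = a) p & distinct p &
     (\<forall>x\<in>set p. below d x) & fr (last p) & (\<not> fr (par d) --> par d ~= 0 --> tp (last p) = tp (par d))"
proof (induction "m - d" arbitrary: d rule: less_induct)
  case less
  note d = less.prems
  show ?case
  proof (cases "fr d")
    case True
    then show ?thesis using tp_par[OF d(1)] by (intro exI[of _ "[d]"]) auto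
  next
    case False
    obtain j where "below d j" "fr j" using d(2) by (auto simp: live_def)
    then obtain e where e: "e \<in> {1..m}" "par e = d" "below e j" using below_child[of d j] False by blast
    have "live e" using e \<open>fr j\<close> by (auto simp: live_def)
    moreover have de: "d < e" using par_less e by blast
    moreover have "m - e < m - d" using de e(1) by auto
    ultimately obtain p where p: "p ~= []" "hd p = e" "successively (\<lambda>a b. b \<in> {1..m} & par b = a) p" "distinct p"
      "\<forall>x\<in>set p. below e x" "fr (last p)" "\<not> fr (par e) --> par e ~= 0 --> tp (last p) = tp (par e)"
      using less.hyps[of e] e(1) by blast
    have "tp (last p) = tp d" using p(7) e False d by auto
    moreover have "d \<notin> set p" using p(5) below_le de by fastforce
    moreover have "\<forall>x\<in>set p. below d x" using p(5) e below_par below_trans by blast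
    ultimately show ?thesis using p e tp_par[OF d(1)] by (intro exI[of _ "d # p"]) (auto simp: successively_Cons)
  qed
qed

lemma up:
  "i \<in> {1..m} ==> fr (par (tp i)) ==> \<exists>p. p ~= [] & successively (\<lambda>a b. a \<in> {1..m} & par a = b) (i # p) & distinct p &
     (\<forall>x\<in>set p. x \<in> {1..m} & x < i) & last p = par (tp i)"
proof (induction i rule: less_induct)
  case (less i)
  note i = less.prems(1)
  show ?case
  proof (cases "tp i = i")
    case True
    then show ?thesis using i less.prems(2) fr_range par_less[OF i] by (intro exI[of _ "[par i]"]) auto
  next
    case False
    then have p: "par i \<in> {1..m}" "tp (par i) = tp i" using tp_props[OF i] by auto
    then obtain q where "q ~= []" "successively (\<lambda>a b. a \<in> {1..m} & par a = b) (par i # q)" "distinct q"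
      "\<forall>x\<in>set q. x \<in> {1..m} & x < par i" "last q = par (tp i)" using less.IH[OF par_less[OF i] p(1)] less.prems(2) by auto
    then show ?thesis using p i par_less[OF i] by (intro exI[of _ "par i # q"]) auto
  qed
qed

end

section \<open>Kept variables and the contracted query graph\<close>

locale query_order =
  fixes Q :: "('x, 's) crpq" and vs :: "'x list" and par :: "nat => nat" and m :: nat
  assumes Q: "wf_crpq Q" "acyclic_crpq Q" and m: "m = length vs" and vs: "set vs = vars Q"
    and ord: "rooted_on (query_graph Q) (free Q) vs par"
begin

definition v :: "nat => 'x" where
  "v i = vs ! (i - 1)"

definition fr :: "nat => bool" where
  "fr i \<longleftrightarrow> i \<in> {1..m} & v i \<in> free Q"

lemma v_inj: "i \<in> {1..m} ==> j \<in> {1..m} ==> v i = v j \<longleftrightarrow> i = j"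
proof -
  assume "i \<in> {1..m}" "j \<in> {1..m}"
  then have l: "i - 1 < length vs" "j - 1 < length vs" "i = j \<longleftrightarrow> i - 1 = j - 1" using m by auto
  have "distinct vs" using ord by (simp add: rooted_on_def)
  then show ?thesis unfolding v_def using nth_eq_iff_index_eq[OF _ l(1,2)] l(3) by simp
qed

lemma v_vars: "i \<in> {1..m} ==> v i \<in> vars Q"
  using m by (auto simp: v_def vs[symmetric])

lemma v_surj: "x \<in> vars Q ==> \<exists>i\<in>{1..m}. v i = x"
proof -
  assume "x \<in> vars Q"
  then obtain k where "k < length vs" "vs ! k = x" using in_set_conv_nth[of x vs] vs by auto
  then show ?thesis using m by (intro bexI[of _ "Suc k"]) (auto simp: v_def)
qed

lemma v_image: "v ` {1..m} = vars Q"
  using v_vars v_surj by blast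

lemma edges: "uedges (query_graph Q) = {{v i, v (par i)} | i. i \<in> {1..m} & par i ~= 0}"
proof -
  have "\<forall>e\<in>uedges (query_graph Q). e \<subseteq> set vs"
    using simple_query_graph[OF Q(2)] vs by (auto simp: simple_def wf_ugraph_def query_graph_def)
  then have "{e \<in> uedges (query_graph Q). e \<subseteq> set vs} = uedges (query_graph Q)" by blast
  then show ?thesis using ord unfolding rooted_on_def v_def m by simp
qed

lemma free_vars: "free Q \<subseteq> vars Q"
  using Q by (simp add: wf_crpq_def)

sublocale rooted m par
  using ord by unfold_locales (auto simp: rooted_on_def m)

text \<open>Descendants have larger indices, but when a bound root was opened, all free variables
  had already been numbered.\<close>

lemma root_free:
  assumes i: "i \<in> {1..m}" "par i = 0" "\<not> fr i" "below i j"
  shows "\<not> fr j"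
proof
  assume j: "fr j"
  have "v i \<notin> free Q" using i by (simp add: fr_def)
  then have "free Q \<subseteq> set (take (i - 1) vs)" using ord i m unfolding rooted_on_def v_def by blast
  then have "v j \<in> set (take (i - 1) vs)" using j by (auto simp: fr_def)
  then obtain k where k: "k < i - 1" "vs ! k = v j" by (auto simp: in_set_conv_nth)
  then have "v (Suc k) = v j" "Suc k \<in> {1..m}" using i m by (auto simp: v_def)
  then have "Suc k = j" using v_inj j by (simp add: fr_def)
  then show False using k below_le[OF i(4)] by simp
qed

sublocale marked m par fr
  using root_free by unfold_locales (auto simp: fr_def)

lemma adj_v: "i \<in> {1..m} ==> par i ~= 0 ==> adj (query_graph Q) (v i) (v (par i)) & adj (query_graph Q) (v (par i)) (v i)"
  unfolding adj_def edges by (auto simp: insert_commute)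

text \<open>Two arms descend through different live children, the third climbs to the free variable
  above the component. Disjoint sibling subtrees separate the first two; their indices exceed
  \<open>i\<close>, while those of the third are smaller.\<close>

lemma group_fan:
  assumes i: "i \<in> group c" "\<not> fr i" and B: "v (par c) \<in> B" "\<And>j. fr j ==> tp j = c ==> v j \<in> B" and c: "fr (par c)"
  shows "fan (query_graph Q) B (v i)"
proof -
  have im: "i \<in> {1..m}" and t: "tp i = c" using i kept_range[of i] by (simp_all add: group_def)
  obtain d e where de: "d \<in> {1..m}" "e \<in> {1..m}" "d ~= e" "par d = i" "par e = i" "live d" "live e"
    using i unfolding group_def kept_def by blast
  have arm_down: "\<exists>p. arm (query_graph Q) B (v i) (map v p) & (\<forall>x\<in>set p. x \<in> {1..m} & i < x & below d x)"
    if d: "d \<in> {1..m}" "par d = i" "live d" for d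
  proof -
    obtain p where p: "p ~= []" "hd p = d" "successively (\<lambda>a b. b \<in> {1..m} & par b = a) p" "distinct p"
      "\<forall>x\<in>set p. below d x" "fr (last p)" "\<not> fr (par d) --> par d ~= 0 --> tp (last p) = tp (par d)" using down[OF d(1,3)] by blast
    have id: "i < d" using par_less d by blast
    have px: "x \<in> {1..m} & i < x & below d x" if "x \<in> set p" for x
    proof -
      have "below d x" using p that by blast
      then show ?thesis using id below_le[of d x] below_cases[of d x] d(1) by (cases "d = x") auto
    qed
    have "successively (\<lambda>a b. b \<in> {1..m} & par b = a & a ~= 0) (i # p)"
    proof -
      have "successively (\<lambda>a b. b \<in> {1..m} & par b = a & a ~= 0) p"
        using px by (intro successively_mono[OF p(3)]) fastforce
      then show ?thesis using p(1,2) d im by (auto simp: successively_Cons)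
    qed
    then have "successively (adj (query_graph Q)) (map v (i # p))"
      unfolding successively_map by (rule successively_mono) (use adj_v in blast)
    moreover have "distinct (map v (i # p))"
    proof -
      have "distinct (i # p)" using p px by auto
      moreover have "inj_on v (set (i # p))" using v_inj px im by (intro inj_onI) auto
      ultimately show ?thesis by (simp only: distinct_map)
    qed
    moreover have "last (map v p) \<in> B" using p B(2)[of "last p"] d i im t by (auto simp: last_map)
    ultimately show ?thesis using p px by (intro exI[of _ p]) (auto simp: arm_def)
  qed
  obtain p where p: "arm (query_graph Q) B (v i) (map v p)" "\<forall>x\<in>set p. x \<in> {1..m} & i < x & below d x"
    using arm_down[of d] de by blast
  obtain q where q: "arm (query_graph Q) B (v i) (map v q)" "\<forall>x\<in>set q. x \<in> {1..m} & i < x & below e x"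
    using arm_down[of e] de by blast
  obtain r where r: "r ~= []" "successively (\<lambda>a b. a \<in> {1..m} & par a = b) (i # r)" "distinct r"
    "\<forall>x\<in>set r. x \<in> {1..m} & x < i" "last r = par c" using up[OF im] c t by auto
  have "arm (query_graph Q) B (v i) (map v r)"
  proof -
    have "successively (\<lambda>a b. a \<in> {1..m} & par a = b & b ~= 0) (i # r)"
    proof (cases r)
      case (Cons a r')
      have "successively (\<lambda>a b. a \<in> {1..m} & par a = b & b ~= 0) r"
      proof (rule successively_mono)
        show "successively (\<lambda>a b. a \<in> {1..m} & par a = b) r" using r(2) Cons by simp
        show "a \<in> {1..m} & par a = b & b ~= 0" if "b \<in> set r" "a \<in> {1..m} & par a = b" for a b
          using that r(4) by fastforce
      qed
      then show ?thesis using r(2,4) Cons by auto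
    qed (use r in simp)
    then have "successively (adj (query_graph Q)) (map v (i # r))"
      unfolding successively_map by (rule successively_mono) (use adj_v in blast)
    moreover have "distinct (map v (i # r))"
    proof -
      have "distinct (i # r)" using r by auto
      moreover have "inj_on v (set (i # r))" using v_inj r(4) im by (intro inj_onI) auto
      ultimately show ?thesis by (simp only: distinct_map)
    qed
    ultimately show ?thesis using r B(1) by (auto simp: arm_def last_map)
  qed
  moreover have "set (map v p) \<inter> set (map v q) = {} & set (map v p) \<inter> set (map v r) = {} & set (map v q) \<inter> set (map v r) = {}"
  proof -
    have img: "set (map v xs) \<inter> set (map v ys) = {}"
      if "\<forall>x\<in>set xs. x \<in> {1..m}" "\<forall>y\<in>set ys. y \<in> {1..m}" "\<And>x. x \<in> set xs ==> x \<notin> set ys" for xs ys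
    proof -
      have "v x ~= v y" if "x \<in> set xs" "y \<in> set ys" for x y using v_inj[of x y] that \<open>\<forall>x\<in>set xs. x \<in> {1..m}\<close> \<open>\<forall>y\<in>set ys. y \<in> {1..m}\<close> \<open>\<And>x. x \<in> set xs ==> x \<notin> set ys\<close> by metis
      then show ?thesis by auto
    qed
    have 1: "x \<notin> set q" if x: "x \<in> set p" for x
    proof
      assume "x \<in> set q"
      then have "below e x" using q(2) by blast
      moreover have "below d x" using p(2) x by blast
      ultimately show False using siblings_disjoint[of d e x] de by simp
    qed
    have 2: "x \<notin> set r" if "x \<in> set p \<or> x \<in> set q" for x
    proof
      assume "x \<in> set r"
      then have "x < i" using r(4) by blast
      moreover have "i < x" using that p(2) q(2) by (elim disjE) simp_all
      ultimately show False by simp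
    qed
    have 3: "\<forall>x\<in>set p. x \<in> {1..m}" "\<forall>x\<in>set q. x \<in> {1..m}" "\<forall>x\<in>set r. x \<in> {1..m}" using p(2) q(2) r(4) by blast+
    have 4: "x \<in> set p ==> x \<notin> set r" "x \<in> set q ==> x \<notin> set r" for x using 2[of x] by simp_all
    show ?thesis using img[OF 3(1,2) 1] img[OF 3(1,3) 4(1)] img[OF 3(2,3) 4(2)] by simp
  qed
  ultimately show ?thesis unfolding fan_def using p(1) q(1) by metis
qed

theorem card_group:
  assumes W: "W \<subseteq> group c" "\<And>i. i \<in> W ==> \<not> fr i"
  shows "card W <= cw Q"
proof (cases "W = {}")
  case False
  then obtain i0 where i0: "i0 \<in> W" by blast
  then have i0m: "i0 \<in> {1..m}" and t0: "tp i0 = c" "kept i0" "\<not> fr i0" using W kept_range[of i0] by (auto simp: group_def)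
  have "c \<in> {1..m} & below c i0 & (par c = 0 \<or> fr (par c)) & \<not> fr c"
    using tp_props[OF i0m] t0 by metis
  then have cm: "c \<in> {1..m}" and ci: "below c i0" and cpar: "par c = 0 \<or> fr (par c)" and cb: "\<not> fr c" by blast+
  \<comment> \<open>Otherwise the top is a bound root, whose tree contains no free variable and
    hence nothing kept.\<close>
  have cf: "fr (par c)"
  proof (rule ccontr)
    assume "\<not> fr (par c)"
    then have "par c = 0" using cpar by blast
    moreover obtain j where "below i0 j" "fr j" using kept_live[OF t0(2)] by (auto simp: live_def)
    ultimately show False using root_free[OF cm _ cb, of j] below_trans[OF ci] by blast
  qed
  then have pc: "par c \<in> {1..m}" using fr_range by blast
  obtain T \<chi> S where td: "tree_decomposition Q (T, \<chi>)" and S: "subtree T S" "(\<Union>t\<in>S. \<chi> t) = free Q"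
    and le: "\<And>t. t \<in> uverts T ==> card (bound (induced Q (\<chi> t)) \<inter> uverts (cg (induced Q (\<chi> t)))) <= cw Q"
    using cw_bag[OF Q(1)] by blast
  define N where "N x = {t \<in> uverts T. x \<in> \<chi> t}" for x
  have T: "is_tree T" using td by (simp add: tree_decomposition_def)
  have sN: "subtree T (N (v i))" if "i \<in> {1..m}" for i using td v_vars[OF that] by (simp add: tree_decomposition_def N_def)
  have meet: "N (v i) \<inter> N (v (par i)) ~= {}" if i: "i \<in> {1..m}" "par i ~= 0" for i
  proof -
    have "{v i, v (par i)} \<in> uedges (query_graph Q)" using edges i by blast
    then obtain r x y where a: "(r, x, y) \<in> set (atoms Q)" "{v i, v (par i)} = {x, y}" by (auto simp: query_graph_def query_edges_def)
    then obtain t where "t \<in> uverts T" "x \<in> \<chi> t" "y \<in> \<chi> t" using td by (auto simp: tree_decomposition_def)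
    then have "t \<in> N (v i) \<inter> N (v (par i))" using a(2) by (auto simp: N_def doubleton_eq_iff)
    then show ?thesis by blast
  qed
  define X where "X = {i \<in> {1..m}. \<not> fr i & tp i = c}"
  have cX: "c \<in> X" using cm cb cpar tp_top[of c] by (auto simp: X_def)
  have X: "c <= i" "i ~= c ==> par i \<in> X & par i ~= 0 & i \<in> {1..m}" if "i \<in> X" for i
    using that tp_props[of i] below_le[of c i] by (auto simp: X_def)
  \<comment> \<open>The component is added in increasing order: the parent of the new vertex is
    already there, and the atom between them forces their subtrees to meet.\<close>
  have conn: "subtree T (\<Union>i\<in>X \<inter> {..c + k}. N (v i))" for k
  proof (induction k)
    case 0
    have "X \<inter> {..c + 0} = {c}" using cX X(1) by force
    then show ?case using sN[OF cm] by simp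
  next
    case (Suc k)
    let ?i = "c + Suc k"
    show ?case
    proof (cases "?i \<in> X")
      case False
      then have "X \<inter> {..c + Suc k} = X \<inter> {..c + k}" by (auto simp: le_Suc_eq)
      then show ?thesis using Suc by simp
    next
      case True
      then have e: "X \<inter> {..c + Suc k} = insert ?i (X \<inter> {..c + k})" by (auto simp: le_Suc_eq)
      have i: "par ?i \<in> X" "par ?i ~= 0" "?i \<in> {1..m}" using X(2)[OF True] by auto
      have "par ?i \<in> X \<inter> {..c + k}" using i(1) par_less[OF i(3)] by simp
      then have "N (v ?i) \<inter> (\<Union>i\<in>X \<inter> {..c + k}. N (v i)) ~= {}" using meet[OF i(3,2)] by blast
      then show ?thesis unfolding e UN_insert using subtree_Un[OF sN[OF i(3)] Suc] by blast
    qed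
  qed
  define U where "U = (\<Union>i\<in>X. N (v i))"
  have "X \<inter> {..c + m} = X" by (auto simp: X_def)
  then have sU: "subtree T U" using conn[of m] by (simp add: U_def)
  define F where "F = insert (par c) {j. fr j & tp j = c}"
  have Fm: "j \<in> {1..m} & fr j" if "j \<in> F" for j using that fr_range cf by (auto simp: F_def)
  have sNU: "subtree T (N (v j) \<union> U)" if "j \<in> F" for j
  proof -
    have "N (v j) \<inter> U ~= {}"
    proof (cases "j = par c")
      case True
      have "par c ~= 0" using pc by auto
      then show ?thesis using meet[OF cm] cX unfolding True U_def by blast
    next
      case False
      then have j: "fr j" "tp j = c" using that by (auto simp: F_def)
      then have "par j \<in> X & par j ~= 0 & j \<in> {1..m}" using tp_props[of j] fr_range[of j] cb by (auto simp: X_def)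
      then show ?thesis using meet[of j] unfolding U_def by blast
    qed
    then show ?thesis using subtree_Un[OF sN sU] Fm[OF that] by blast
  qed
  \<comment> \<open>Each \<open>N (v j)\<close> is enlarged by \<open>U\<close>, so that these sets
    meet pairwise; \<open>S\<close> meets each of them because \<open>v j\<close> is free.\<close>
  have "\<Inter>(insert S ((\<lambda>j. N (v j) \<union> U) ` F)) ~= {}"
  proof (rule helly[OF T])
    have "F \<subseteq> {1..m}" using Fm by blast
    then show "finite (insert S ((\<lambda>j. N (v j) \<union> U) ` F))" using finite_subset by blast
    show "subtree T M" if "M \<in> insert S ((\<lambda>j. N (v j) \<union> U) ` F)" for M using that S(1) sNU by auto
    have U0: "U ~= {}" using sU by (simp add: subtree_def)
    have S0: "S ~= {}" "S \<subseteq> uverts T" using S(1) by (auto simp: subtree_def)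
    have SN: "S \<inter> N (v j) ~= {}" if "j \<in> F" for j
    proof -
      have "v j \<in> (\<Union>t\<in>S. \<chi> t)" using Fm[OF that] S(2) by (simp add: fr_def)
      then obtain t where "t \<in> S" "v j \<in> \<chi> t" by blast
      then have "t \<in> S \<inter> N (v j)" using S0 by (auto simp: N_def)
      then show ?thesis by blast
    qed
    have cases: "M = S \<or> (\<exists>j\<in>F. M = N (v j) \<union> U)" if "M \<in> insert S ((\<lambda>j. N (v j) \<union> U) ` F)" for M using that by blast
    have SU: "S \<inter> (N (v j) \<union> U) ~= {}" "(N (v j) \<union> U) \<inter> S ~= {}" "(N (v j) \<union> U) \<inter> (N (v k) \<union> U) ~= {}" if "j \<in> F" for j k
      using SN[OF that] U0 by blast+
    show "M \<inter> M' ~= {}" if "M \<in> insert S ((\<lambda>j. N (v j) \<union> U) ` F)" "M' \<in> insert S ((\<lambda>j. N (v j) \<union> U) ` F)" for M M'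
      using cases[OF that(1)] cases[OF that(2)] SU S0(1) by (elim disjE bexE) (simp_all only: Int_absorb not_False_eq_True)
  qed simp
  then obtain t where t: "t \<in> S" "\<forall>j\<in>F. t \<in> N (v j) \<union> U" by auto
  have tT: "t \<in> uverts T" using t(1) S(1) by (auto simp: subtree_def)
  \<comment> \<open>Bags in \<open>S\<close> contain only free variables, so the common node lies
    outside \<open>U\<close> and hence in every \<open>N (v j)\<close>.\<close>
  have "\<chi> t \<subseteq> free Q" using t(1) S(2) by blast
  then have "t \<notin> U" by (auto simp: U_def N_def X_def fr_def)
  then have Fb: "v j \<in> free Q \<inter> \<chi> t" if "j \<in> F" for j using t(2) that Fm[OF that] by (auto simp: N_def fr_def)
  have "v i \<in> bound (induced Q (\<chi> t)) \<inter> uverts (cg (induced Q (\<chi> t)))" if i: "i \<in> W" for i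
  proof
    have ig: "i \<in> group c" "\<not> fr i" "i \<in> {1..m}" using W i group_range by blast+
    have "fan (query_graph Q) (free Q \<inter> \<chi> t) (v i)"
    proof (rule group_fan[OF ig(1,2) _ _ cf])
      show "v (par c) \<in> free Q \<inter> \<chi> t" by (rule Fb) (simp add: F_def)
      show "v j \<in> free Q \<inter> \<chi> t" if "fr j" "tp j = c" for j by (rule Fb) (use that in \<open>simp add: F_def\<close>)
    qed
    then show "v i \<in> uverts (cg (induced Q (\<chi> t)))" by (rule fan_in_cg[OF Q(2)])
    show "v i \<in> bound (induced Q (\<chi> t))" using ig v_vars[OF ig(3)] by (auto simp: bound_def induced_def vars_def fr_def)
  qed
  then have sub: "v ` W \<subseteq> bound (induced Q (\<chi> t)) \<inter> uverts (cg (induced Q (\<chi> t)))" by blast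
  have "bound (induced Q (\<chi> t)) \<subseteq> set vs" unfolding vs by (auto simp: bound_def induced_def vars_def)
  then have fin: "finite (bound (induced Q (\<chi> t)) \<inter> uverts (cg (induced Q (\<chi> t))))" using finite_subset by blast
  have "inj_on v W" using v_inj W(1) group_range by (intro inj_onI) blast
  then have "card W = card (v ` W)" by (rule card_image[symmetric])
  also have "\<dots> <= card (bound (induced Q (\<chi> t)) \<inter> uverts (cg (induced Q (\<chi> t))))" by (rule card_mono[OF fin sub])
  also have "\<dots> <= cw Q" by (rule le[OF tT])
  finally show ?thesis .
qed simp

end

section \<open>Evaluating a query\<close>

lemma finite_set_rexp: "finite (set_rexp r)"
  by (induction r) auto

locale query_run = query_order Q vs par m for Q :: "('x, 's) crpq" and vs par m +
  fixes \<kappa> :: "'s => nat"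
  assumes \<kappa>: "inj \<kappa>"
begin

text \<open>A root has no atom and the choice is arbitrary there; the code of the resulting
  expression then serves as the gate \<open>off i\<close>.\<close>

definition atm :: "nat => 's rexp \<times> 'x \<times> 'x" where
  "atm i = (SOME a. a \<in> set (atoms Q) & (case a of (r, x, y) => {x, y} = {v i, v (par i)}))"

definition fwd :: "nat => bool" where
  "fwd i \<longleftrightarrow> fst (snd (atm i)) = v (par i)"

definition rx :: "nat => 's rexp" where
  "rx i = (if fwd i then fst (atm i) else rev_rexp (fst (atm i)))"

definition st :: "nat => 's rexp set" where
  "st i = insert (rx i) (derivs (rx i))"

definition ST :: "'s rexp set" where
  "ST = (\<Union>i\<in>{1..m}. st i)"

definition ix :: "'s rexp => nat" where
  "ix = (SOME f. inj_on f ST)"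

definition B :: nat where
  "B = Suc (Max (insert 0 (ix ` ST)))"

text \<open>Variable \<open>i\<close> owns a block of \<open>B\<close> consecutive state numbers, so
  \<open>lev\<close> recovers \<open>i\<close> by division.\<close>

definition cd :: "nat => 's rexp => nat" where
  "cd i p = Suc m + (i * B + ix p)"

definition off :: "nat => nat" where
  "off i = cd i (rx i)"

definition lev :: "nat => nat" where
  "lev j = (j - Suc m) div B"

definition kst :: nat where
  "kst = Suc m + Suc m * B"

definition acl :: "nat => nat list" where
  "acl i = (SOME qs. set qs = cd i ` {p \<in> st i. nullable p})"

definition rules :: "(nat \<times> nat \<times> nat \<times> bool) list" where
  "rules = (SOME rs. set rs = {(cd i p, \<kappa> s, cd i p', fwd i) | i p s p'. i \<in> {1..m} & par i ~= 0 & p \<in> st i & p' \<in> pd s p})"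

lemma finite_st: "finite (st i)"
  by (simp add: st_def finite_derivs)

lemma finite_ST: "finite ST"
  by (simp add: ST_def finite_st)

lemma st_ST: "i \<in> {1..m} ==> p \<in> st i ==> p \<in> ST"
  unfolding ST_def by blast

lemma pd_st: "p \<in> st i ==> pd s p \<subseteq> st i"
  using pd_derivs pd_closed by (fastforce simp: st_def)

lemma ix_inj: "inj_on ix ST"
proof -
  have "\<exists>f :: 's rexp => nat. inj_on f ST" using finite_imp_inj_to_nat_seg[OF finite_ST] by blast
  then show ?thesis unfolding ix_def by (rule someI_ex)
qed

lemma ix_less: "p \<in> ST ==> ix p < B"
  unfolding B_def less_Suc_eq_le using finite_ST by (intro Max_ge) auto

lemma cd_props:
  assumes "i \<in> {1..m}" "p \<in> st i"
  shows "m < cd i p" "cd i p < kst" "lev (cd i p) = i"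
proof -
  have x: "ix p < B" by (rule ix_less[OF st_ST[OF assms]])
  show "m < cd i p" by (simp add: cd_def)
  show "lev (cd i p) = i" using x by (simp add: lev_def cd_def)
  have "i * B <= m * B" using assms by simp
  then show "cd i p < kst" unfolding cd_def kst_def mult_Suc using x by linarith
qed

lemma cd_inj: "i \<in> {1..m} ==> j \<in> {1..m} ==> p \<in> st i ==> q \<in> st j ==> cd i p = cd j q \<longleftrightarrow> i = j & p = q"
proof
  assume a: "i \<in> {1..m}" "j \<in> {1..m}" "p \<in> st i" "q \<in> st j" and e: "cd i p = cd j q"
  have ij: "i = j" using cd_props(3)[OF a(1,3)] cd_props(3)[OF a(2,4)] e by simp
  then have "ix p = ix q" using e by (simp add: cd_def)
  moreover have "p \<in> ST" "q \<in> ST" using a st_ST by blast+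
  ultimately show "i = j & p = q" using ij ix_inj by (auto dest: inj_onD)
qed simp

lemma set_acl: "set (acl i) = cd i ` {p \<in> st i. nullable p}"
proof -
  have "finite (cd i ` {p \<in> st i. nullable p})" using finite_st by simp
  then have "\<exists>qs. set qs = cd i ` {p \<in> st i. nullable p}" by (rule finite_list)
  then show ?thesis unfolding acl_def by (rule someI_ex)
qed

lemma set_rules: "set rules = {(cd i p, \<kappa> s, cd i p', fwd i) | i p s p'. i \<in> {1..m} & par i ~= 0 & p \<in> st i & p' \<in> pd s p}"
proof -
  let ?R = "{(cd i p, \<kappa> s, cd i p', fwd i) | i p s p'. i \<in> {1..m} & par i ~= 0 & p \<in> st i & p' \<in> pd s p}"
  have "?R \<subseteq> (\<lambda>(i, p, s, p'). (cd i p, \<kappa> s, cd i p', fwd i)) ` ({1..m} \<times> ST \<times> (\<Union>p\<in>ST. set_rexp p) \<times> ST)"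
  proof
    fix x assume "x \<in> ?R"
    then obtain i p s p' where x: "x = (cd i p, \<kappa> s, cd i p', fwd i)" "i \<in> {1..m}" "p \<in> st i" "p' \<in> pd s p" by blast
    have "p \<in> ST" "p' \<in> ST" using x(3,4) pd_st[OF x(3)] st_ST[OF x(2)] by blast+
    moreover have "s \<in> set_rexp p" by (rule pd_symbols[OF x(4)])
    ultimately show "x \<in> (\<lambda>(i, p, s, p'). (cd i p, \<kappa> s, cd i p', fwd i)) ` ({1..m} \<times> ST \<times> (\<Union>p\<in>ST. set_rexp p) \<times> ST)"
      using x by (intro image_eqI[of _ _ "(i, p, s, p')"]) auto
  qed
  moreover have "finite ({1..m} \<times> ST \<times> (\<Union>p\<in>ST. set_rexp p) \<times> ST)" using finite_ST finite_set_rexp by blast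
  ultimately have "finite ?R" using finite_surj by blast
  then have "\<exists>rs. set rs = ?R" by (rule finite_list)
  then show ?thesis unfolding rules_def by (rule someI_ex)
qed

sublocale P: tree_prog m par off lev acl kst rules
proof unfold_locales
  fix i assume i: "i \<in> {1..m}"
  show "par i < i" using par_less i by blast
  have "rx i \<in> st i" by (simp add: st_def)
  then show "m < off i" "off i < kst" "lev (off i) = i" using cd_props[OF i] by (simp_all add: off_def)
  show "m < q & q < kst & lev q = i" if "q \<in> set (acl i)" for q using that cd_props[OF i] by (auto simp: set_acl)
next
  fix j c j' d assume "(j, c, j', d) \<in> set rules"
  then obtain i p s p' where x: "j = cd i p" "j' = cd i p'" "i \<in> {1..m}" "par i ~= 0" "p \<in> st i" "p' \<in> pd s p"
    unfolding set_rules by blast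
  then have "p' \<in> st i" using pd_st by blast
  then show "m < j & j < kst & m < j' & j' < kst & lev j' = lev j & lev j \<in> {1..m} & par (lev j) ~= 0"
    using cd_props[OF x(3,5)] cd_props[OF x(3), of p'] x by simp
next
  show "m < kst" by (simp add: kst_def)
qed

text \<open>Acyclicity bounds the multiplicity of every edge by 1, and two different atoms on the
  same pair of variables would count twice.\<close>

lemma atom_unique:
  assumes "(r, x, y) \<in> set (atoms Q)" "(r', x', y') \<in> set (atoms Q)" "{x, y} = {x', y'}"
  shows "(r, x, y) = (r', x', y')"
proof (rule ccontr)
  assume ne: "(r, x, y) ~= (r', x', y')"
  let ?f = "\<lambda>(r :: 's rexp, x, y). {x, y}"
  let ?D = "?f -` {{x, y}} \<inter> set (atoms Q)"
  have "(\<Sum>a\<in>{(r, x, y), (r', x', y')}. count (mset (atoms Q)) a) <= (\<Sum>a\<in>?D. count (mset (atoms Q)) a)"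
    using assms by (intro sum_mono2) auto
  then have "count (mset (atoms Q)) (r, x, y) + count (mset (atoms Q)) (r', x', y') <= (\<Sum>a\<in>?D. count (mset (atoms Q)) a)"
    using ne by simp
  moreover have "(\<Sum>a\<in>?D. count (mset (atoms Q)) a) = count (query_edges Q) {x, y}"
    by (simp add: query_edges_def count_image_mset)
  moreover have "count (query_edges Q) {x, y} <= 1" using Q(2) by (simp add: acyclic_crpq_def)
  moreover have "1 <= count (mset (atoms Q)) (r, x, y)" "1 <= count (mset (atoms Q)) (r', x', y')"
    using assms by (simp_all add: Suc_le_eq)
  ultimately show False by linarith
qed

lemma at_props:
  assumes "i \<in> {1..m}" "par i ~= 0"
  shows "\<exists>r x y. atm i = (r, x, y) & (r, x, y) \<in> set (atoms Q) & {x, y} = {v i, v (par i)}"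
proof -
  have "{v i, v (par i)} \<in> uedges (query_graph Q)" using edges assms by blast
  then have "\<exists>a. a \<in> set (atoms Q) & (case a of (r, x, y) => {x, y} = {v i, v (par i)})"
    by (auto simp: query_graph_def query_edges_def)
  then have "atm i \<in> set (atoms Q) & (case atm i of (r, x, y) => {x, y} = {v i, v (par i)})" unfolding atm_def by (rule someI_ex)
  then show ?thesis by (cases "atm i") auto
qed

text \<open>Edges of the query graph belong to the variables that are not roots, and by
  \<open>atom_unique\<close> each edge carries a single atom.\<close>

lemma atoms_all:
  "(\<forall>(r, x, y)\<in>set (atoms Q). \<Phi> r x y) \<longleftrightarrow> (\<forall>i\<in>{1..m}. par i ~= 0 --> (case atm i of (r, x, y) => \<Phi> r x y))"
proof
  assume "\<forall>(r, x, y)\<in>set (atoms Q). \<Phi> r x y"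
  then show "\<forall>i\<in>{1..m}. par i ~= 0 --> (case atm i of (r, x, y) => \<Phi> r x y)" using at_props by fastforce
next
  assume a: "\<forall>i\<in>{1..m}. par i ~= 0 --> (case atm i of (r, x, y) => \<Phi> r x y)"
  have "\<Phi> r x y" if xy: "(r, x, y) \<in> set (atoms Q)" for r x y
  proof -
    have "{x, y} \<in> uedges (query_graph Q)" using xy by (force simp: query_graph_def query_edges_def)
    then obtain i where i: "i \<in> {1..m}" "par i ~= 0" "{x, y} = {v i, v (par i)}" unfolding edges by blast
    obtain r' x' y' where at': "atm i = (r', x', y')" "(r', x', y') \<in> set (atoms Q)" "{x', y'} = {v i, v (par i)}"
      using at_props[OF i(1,2)] by blast
    have "(r, x, y) = (r', x', y')" by (rule atom_unique[OF xy at'(2)]) (simp only: at'(3) i(3))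
    then show ?thesis using a i(1,2) at'(1) by fastforce
  qed
  then show "\<forall>(r, x, y)\<in>set (atoms Q). \<Phi> r x y" by blast
qed

definition idx :: "'x => nat" where
  "idx = inv_into {1..m} v"

lemma idx: "x \<in> free Q ==> v (idx x) = x & idx x \<in> {1..m} & fr (idx x)"
proof -
  assume x: "x \<in> free Q"
  then have "x \<in> v ` {1..m}" using free_vars v_image by blast
  then have "v (idx x) = x" "idx x \<in> {1..m}" unfolding idx_def by (rule f_inv_into_f, rule inv_into_into)
  then show ?thesis using x by (simp add: fr_def)
qed

lemma idx_v: "fr i ==> idx (v i) = i"
  using v_inj by (simp add: fr_def idx_def inj_on_def)

end

section \<open>Correctness on a given input graph\<close>

locale query_input = query_run Q vs par m \<kappa> for Q :: "('x, 's) crpq" and vs par m \<kappa> +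
  fixes G :: "('v, 's) lgraph" and \<nu> :: "'v => nat" and es :: "('v \<times> 's \<times> 'v) list"
  assumes G: "wf_lgraph G" "represents_input G \<nu> es"
begin

definition n :: nat where
  "n = card (lverts G)"

definition esn :: "(nat \<times> nat \<times> nat) list" where
  "esn = map (\<lambda>(u, s, w). (\<nu> u, \<kappa> s, \<nu> w)) es"

lemma \<nu>: "bij_betw \<nu> (lverts G) {..<n}"
  using G by (simp add: represents_input_def n_def)

lemma \<nu>_inj: "a \<in> lverts G ==> b \<in> lverts G ==> \<nu> a = \<nu> b \<longleftrightarrow> a = b"
  using \<nu> by (auto simp: bij_betw_def inj_on_eq_iff)

lemma \<nu>_less: "a \<in> lverts G ==> \<nu> a < n"
  using \<nu> by (auto simp: bij_betw_def)

lemma es: "set es = ledges G" "length es = card (ledges G)"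
  using G distinct_card[of es] by (auto simp: represents_input_def)

lemma edge_verts: "(a, s, b) \<in> ledges G ==> a \<in> lverts G & b \<in> lverts G"
  using G by (auto simp: wf_lgraph_def)

sublocale R: tree_run m par off lev acl kst rules n esn
  by unfold_locales (use es edge_verts \<nu>_less in \<open>auto simp: esn_def\<close>)

lemma esn_iff: "u \<in> lverts G ==> (\<nu> u, \<kappa> s, b) \<in> set esn \<longleftrightarrow> (\<exists>w. b = \<nu> w & (u, s, w) \<in> ledges G)"
  "u \<in> lverts G ==> (b, \<kappa> s, \<nu> u) \<in> set esn \<longleftrightarrow> (\<exists>w. b = \<nu> w & (w, s, u) \<in> ledges G)"
proof -
  have i: "\<kappa> s = \<kappa> s' \<longleftrightarrow> s = s'" for s' using \<kappa> by (auto dest: injD)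
  have e: "(a, \<kappa> s, b) \<in> set esn \<longleftrightarrow> (\<exists>u w. a = \<nu> u & b = \<nu> w & (u, s, w) \<in> ledges G)" for a b
    unfolding esn_def set_map es(1) using i by force
  assume u: "u \<in> lverts G"
  have u': "\<nu> u = \<nu> u' \<longleftrightarrow> u = u'" if "u' \<in> lverts G" for u' using \<nu>_inj[OF u that] .
  show "(\<nu> u, \<kappa> s, b) \<in> set esn \<longleftrightarrow> (\<exists>w. b = \<nu> w & (u, s, w) \<in> ledges G)"
    unfolding e using u' edge_verts by metis
  show "(b, \<kappa> s, \<nu> u) \<in> set esn \<longleftrightarrow> (\<exists>w. b = \<nu> w & (w, s, u) \<in> ledges G)"
    unfolding e using u' edge_verts by metis
qed

definition Gd :: "nat => ('v, 's) lgraph" where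
  "Gd i = (if fwd i then G else rev_graph G)"

lemma aut_iff:
  assumes i: "i \<in> {1..m}" "par i ~= 0" and p: "p \<in> st i" and u: "u \<in> lverts G"
  shows "((cd i p, \<nu> u), (j, b)) \<in> P.aut (set esn) \<longleftrightarrow> (\<exists>p' w. j = cd i p' & b = \<nu> w & ((p, u), (p', w)) \<in> rpq_step (Gd i))"
proof -
  have r: "(cd i p, c, j, d) \<in> set rules \<longleftrightarrow> (\<exists>s p'. c = \<kappa> s & j = cd i p' & d = fwd i & p' \<in> pd s p)" for c d
  proof
    assume "(cd i p, c, j, d) \<in> set rules"
    then obtain i' q s p' where x: "cd i p = cd i' q" "c = \<kappa> s" "j = cd i' p'" "d = fwd i'" "i' \<in> {1..m}" "q \<in> st i'" "p' \<in> pd s q"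
      unfolding set_rules by blast
    have "i = i' & p = q" using cd_inj[OF i(1) x(5) p x(6)] x(1) by blast
    then show "\<exists>s p'. c = \<kappa> s & j = cd i p' & d = fwd i & p' \<in> pd s p" using x by blast
  qed (use i p set_rules in blast)
  have "((cd i p, \<nu> u), (j, b)) \<in> P.aut (set esn) \<longleftrightarrow> (\<exists>s p'. j = cd i p' & p' \<in> pd s p &
      (if fwd i then (\<nu> u, \<kappa> s, b) \<in> set esn else (b, \<kappa> s, \<nu> u) \<in> set esn))"
  proof -
    have "((cd i p, \<nu> u), (j, b)) \<in> P.aut (set esn) \<longleftrightarrow>
        (\<exists>c. (cd i p, c, j, True) \<in> set rules & (\<nu> u, c, b) \<in> set esn \<or> (cd i p, c, j, False) \<in> set rules & (b, c, \<nu> u) \<in> set esn)"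
      unfolding P.aut_def by blast
    then show ?thesis unfolding r by (cases "fwd i") (simp_all, blast+)
  qed
  also have "\<dots> \<longleftrightarrow> (\<exists>s p'. j = cd i p' & p' \<in> pd s p & (\<exists>w. b = \<nu> w & (u, s, w) \<in> ledges (Gd i)))"
    unfolding esn_iff[OF u] by (simp add: Gd_def rev_graph_def)
  also have "\<dots> \<longleftrightarrow> (\<exists>p' w. j = cd i p' & b = \<nu> w & ((p, u), (p', w)) \<in> rpq_step (Gd i))"
    unfolding rpq_step_def by blast
  finally show ?thesis .
qed

lemma wf_Gd: "wf_lgraph (Gd i)" "lverts (Gd i) = lverts G"
  using G(1) wf_rev_graph by (auto simp: Gd_def rev_graph_def)

lemma aut_reach:
  assumes i: "i \<in> {1..m}" "par i ~= 0" and a: "a \<in> lverts G" "b \<in> lverts G"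
  shows "(\<exists>q\<in>set (acl i). ((off i, \<nu> a), (q, \<nu> b)) \<in> (P.aut (set esn))\<^sup>*) \<longleftrightarrow> (\<exists>w\<in>lang (rx i). lpath (Gd i) a w b)"
proof -
  let ?S = "st i \<times> lverts G" and ?f = "\<lambda>(p, u). (cd i p, \<nu> u)"
  have cl: "y \<in> ?S" if xy: "x \<in> ?S" "(x, y) \<in> rpq_step (Gd i)" for x y
  proof -
    obtain p u p' w s where e: "x = (p, u)" "y = (p', w)" "p' \<in> pd s p" "(u, s, w) \<in> ledges (Gd i)"
      using xy(2) unfolding rpq_step_def by blast
    have "w \<in> lverts G" using wf_Gd[of i] e(4) by (auto simp: wf_lgraph_def)
    then show ?thesis using pd_st[of p i s] xy(1) e by auto
  qed
  have step: "(?f x, y') \<in> P.aut (set esn) \<longleftrightarrow> (\<exists>y\<in>?S. y' = ?f y & (x, y) \<in> rpq_step (Gd i))" if x: "x \<in> ?S" for x y'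
  proof -
    obtain p u j b where e: "x = (p, u)" "y' = (j, b)" by (cases x; cases y')
    have pu: "p \<in> st i" "u \<in> lverts G" using x e by auto
    show ?thesis unfolding e case_prod_conv aut_iff[OF i pu] using cl[OF x] e by force
  qed
  have rxS: "(rx i, a) \<in> ?S" using a by (simp add: st_def)
  have ri: "(?f (rx i, a), y') \<in> (P.aut (set esn))\<^sup>* \<longleftrightarrow> (\<exists>y\<in>?S. y' = ?f y & ((rx i, a), y) \<in> (rpq_step (Gd i))\<^sup>*)" for y'
    by (rule rtrancl_image, rule step, assumption, rule rxS, rule cl, assumption+)
  have cls: "(p, w) \<in> ?S" if "((rx i, a), (p, w)) \<in> (rpq_step (Gd i))\<^sup>*" for p w
    using that by (induction rule: rtrancl_induct) (rule rxS, rule cl)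
  have "(\<exists>q\<in>set (acl i). ((off i, \<nu> a), (q, \<nu> b)) \<in> (P.aut (set esn))\<^sup>*) \<longleftrightarrow> (\<exists>p. nullable p & ((rx i, a), (p, b)) \<in> (rpq_step (Gd i))\<^sup>*)"
  proof
    assume "\<exists>q\<in>set (acl i). ((off i, \<nu> a), (q, \<nu> b)) \<in> (P.aut (set esn))\<^sup>*"
    then obtain p where p: "p \<in> st i" "nullable p" "(?f (rx i, a), (cd i p, \<nu> b)) \<in> (P.aut (set esn))\<^sup>*"
      unfolding set_acl off_def by auto
    obtain y where y: "y \<in> ?S" "(cd i p, \<nu> b) = ?f y" "((rx i, a), y) \<in> (rpq_step (Gd i))\<^sup>*"
      using iffD1[OF ri p(3)] by (elim bexE conjE)
    obtain p2 b2 where "y = (p2, b2)" by (cases y)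
    then have "p2 = p" "b2 = b" using y(1,2) cd_inj[OF i(1) i(1) p(1), of p2] \<nu>_inj[OF a(2), of b2] by auto
    then show "\<exists>p. nullable p & ((rx i, a), (p, b)) \<in> (rpq_step (Gd i))\<^sup>*" using y(3) p(2) \<open>y = (p2, b2)\<close> by blast
  next
    assume "\<exists>p. nullable p & ((rx i, a), (p, b)) \<in> (rpq_step (Gd i))\<^sup>*"
    then obtain p where p: "nullable p" "((rx i, a), (p, b)) \<in> (rpq_step (Gd i))\<^sup>*" by blast
    have "(?f (rx i, a), ?f (p, b)) \<in> (P.aut (set esn))\<^sup>*"
      by (rule iffD2[OF ri]) (rule bexI[of _ "(p, b)"], rule conjI[OF refl p(2)], rule cls[OF p(2)])
    then have "((off i, \<nu> a), (cd i p, \<nu> b)) \<in> (P.aut (set esn))\<^sup>*" by (simp add: off_def)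
    moreover have "cd i p \<in> set (acl i)" using p(1) cls[OF p(2)] by (simp add: set_acl)
    ultimately show "\<exists>q\<in>set (acl i). ((off i, \<nu> a), (q, \<nu> b)) \<in> (P.aut (set esn))\<^sup>*" by blast
  qed
  also have "\<dots> \<longleftrightarrow> (\<exists>w\<in>lang (rx i). lpath (Gd i) a w b)" using rpq_reach[OF wf_Gd(1), of a i] a wf_Gd(2) by auto
  finally show ?thesis .
qed

lemma Rl_iff:
  assumes i: "i \<in> {1..m}" "par i ~= 0" and h: "\<And>x. x \<in> vars Q ==> h x \<in> lverts G"
  shows "R.Rl i (\<nu> (h (v (par i)))) (\<nu> (h (v i))) \<longleftrightarrow> (case atm i of (r, x, y) => \<exists>w\<in>lang r. lpath G (h x) w (h y))"
proof -
  have V: "h (v i) \<in> lverts G" "h (v (par i)) \<in> lverts G" using h v_vars i par_range[OF i] by blast+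
  obtain r x y where e: "atm i = (r, x, y)" "{x, y} = {v i, v (par i)}" using at_props[OF i] by blast
  have "R.Rl i (\<nu> (h (v (par i)))) (\<nu> (h (v i))) \<longleftrightarrow> (\<exists>w\<in>lang (rx i). lpath (Gd i) (h (v (par i))) w (h (v i)))"
    unfolding R.Rl_def using aut_reach[OF i V(2,1)] \<nu>_less[OF V(1)] i(2) by simp
  also have "\<dots> \<longleftrightarrow> (\<exists>w\<in>lang r. lpath G (h x) w (h y))"
  proof (cases "fwd i")
    case True
    then have "x = v (par i)" using e by (simp add: fwd_def)
    then have "y = v i" using e(2) by (auto simp: doubleton_eq_iff)
    then show ?thesis using True \<open>x = v (par i)\<close> e by (simp add: rx_def Gd_def)
  next
    case False
    then have "x ~= v (par i)" using e by (simp add: fwd_def)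
    then have "x = v i" "y = v (par i)" using e(2) by (auto simp: doubleton_eq_iff)
    then show ?thesis using False e rev_rpq[OF G(1)] by (simp add: rx_def Gd_def)
  qed
  finally show ?thesis by (simp add: e)
qed

definition homs :: "('x => 'v) set" where
  "homs = {h \<in> vars Q \<rightarrow>\<^sub>E lverts G. \<forall>(r, x, y)\<in>set (atoms Q). \<exists>w\<in>lang r. lpath G (h x) w (h y)}"

lemma answers_homs: "answers Q G = (\<lambda>h. restrict h (free Q)) ` homs"
proof
  show "answers Q G \<subseteq> (\<lambda>h. restrict h (free Q)) ` homs"
  proof
    fix \<alpha> assume "\<alpha> \<in> answers Q G"
    then obtain h where a: "\<alpha> \<in> free Q \<rightarrow>\<^sub>E lverts G" and h: "h \<in> homs" "\<forall>x\<in>free Q. h x = \<alpha> x"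
      by (auto simp: answers_def homs_def)
    have "\<alpha> = restrict h (free Q)" using a h(2) by (intro ext) (auto simp: restrict_def PiE_def extensional_def)
    then show "\<alpha> \<in> (\<lambda>h. restrict h (free Q)) ` homs" using h(1) by blast
  qed
  show "(\<lambda>h. restrict h (free Q)) ` homs \<subseteq> answers Q G"
  proof
    fix \<alpha> assume "\<alpha> \<in> (\<lambda>h. restrict h (free Q)) ` homs"
    then obtain h where h: "h \<in> homs" "\<alpha> = restrict h (free Q)" by blast
    then have "\<alpha> \<in> free Q \<rightarrow>\<^sub>E lverts G" using free_vars by (auto simp: homs_def)
    then show "\<alpha> \<in> answers Q G" using h unfolding answers_def homs_def by (intro CollectI conjI bexI[of _ h]) simp_all
  qed
qed

definition code :: "('x => 'v) => nat => nat" where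
  "code h i = (if i \<in> {1..m} then \<nu> (h (v i)) else 0)"

lemma code_H: "h \<in> homs ==> code h \<in> R.H"
proof -
  assume h: "h \<in> homs"
  then have hv: "\<And>x. x \<in> vars Q ==> h x \<in> lverts G" by (auto simp: homs_def)
  have "R.Rl i (code h (par i)) (code h i)" if i: "i \<in> {1..m}" for i
  proof (cases "par i = 0")
    case True
    then show ?thesis using i \<nu>_less[OF hv[OF v_vars[OF i]]] by (simp add: R.Rl_def code_def)
  next
    case False
    have "\<forall>(r, x, y)\<in>set (atoms Q). \<exists>w\<in>lang r. lpath G (h x) w (h y)" using h by (simp add: homs_def)
    then have "\<forall>i\<in>{1..m}. par i ~= 0 --> (case atm i of (r, x, y) => \<exists>w\<in>lang r. lpath G (h x) w (h y))"
      by (rule iffD1[OF atoms_all])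
    then have "case atm i of (r, x, y) => \<exists>w\<in>lang r. lpath G (h x) w (h y)" using i False by simp
    then show ?thesis using Rl_iff[OF i False, of h, OF hv] i par_range[OF i False] by (simp add: code_def)
  qed
  then show "code h \<in> R.H" by (simp add: R.H_def code_def)
qed

text \<open>The converse of \<open>code_H\<close>, by decoding through the inverse numberings.
  Agreement is limited to indices up to \<open>m\<close>, since solutions are arbitrary
  beyond.\<close>

lemma H_code: "\<mu> \<in> R.H ==> \<exists>h\<in>homs. \<forall>i\<le>m. code h i = \<mu> i"
proof -
  assume \<mu>: "\<mu> \<in> R.H"
  define vi where "vi = inv_into {1..m} v"
  define h where "h = restrict (\<lambda>x. inv_into (lverts G) \<nu> (\<mu> (vi x))) (vars Q)"
  have inj: "inj_on v {1..m}" using v_inj by (intro inj_onI) blast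
  have less: "\<mu> i \<in> \<nu> ` lverts G" if "i \<in> {1..m}" for i using \<nu> R.H_less[OF \<mu> that] by (simp add: bij_betw_def)
  have vi: "vi (v i) = i" if "i \<in> {1..m}" for i using inj that by (simp add: vi_def)
  have c: "code h i = \<mu> i" if "i <= m" for i
  proof (cases "i = 0")
    case True
    then show ?thesis using \<mu> by (simp add: code_def R.H_def)
  next
    case False
    then have i: "i \<in> {1..m}" using that by auto
    then show ?thesis using f_inv_into_f[OF less[OF i]] vi v_vars by (simp add: code_def h_def)
  qed
  have hv: "h x \<in> lverts G" if x: "x \<in> vars Q" for x
  proof -
    obtain i where "i \<in> {1..m}" "v i = x" using v_surj[OF x] by blast
    then show ?thesis using inv_into_into[OF less] vi x by (auto simp: h_def)
  qed
  have K: "case atm i of (r, x, y) => \<exists>w\<in>lang r. lpath G (h x) w (h y)" if i: "i \<in> {1..m}" "par i ~= 0" for i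
  proof -
    have "R.Rl i (code h (par i)) (code h i)" using \<mu> i c par_range[OF i] by (simp add: R.H_def)
    then show ?thesis using Rl_iff[OF i, of h, OF hv] i par_range[OF i] by (simp add: code_def)
  qed
  have "\<forall>(r, x, y)\<in>set (atoms Q). \<exists>w\<in>lang r. lpath G (h x) w (h y)"
  proof (rule iffD2[OF atoms_all[of "\<lambda>r x y. \<exists>w\<in>lang r. lpath G (h x) w (h y)"]], intro ballI impI)
    fix i assume "i \<in> {1..m}" "par i ~= 0"
    then show "case atm i of (r, x, y) => \<exists>w\<in>lang r. lpath G (h x) w (h y)" by (rule K)
  qed
  moreover have "h \<in> vars Q \<rightarrow>\<^sub>E lverts G" using hv by (auto simp: h_def)
  ultimately show "\<exists>h\<in>homs. \<forall>i\<le>m. code h i = \<mu> i" using c by (auto simp: homs_def)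
qed

lemma proj_homs: "W \<subseteq> {..m} ==> R.proj W = (\<lambda>h. restrict (code h) W) ` homs"
proof
  assume W: "W \<subseteq> {..m}"
  show "R.proj W \<subseteq> (\<lambda>h. restrict (code h) W) ` homs"
  proof
    fix \<rho> assume "\<rho> \<in> R.proj W"
    then obtain \<mu> where "\<mu> \<in> R.H" "\<rho> = restrict \<mu> W" by (auto simp: R.proj_def)
    then obtain h where h: "h \<in> homs" "\<forall>i\<le>m. code h i = \<mu> i" using H_code by blast
    have "\<rho> = restrict (code h) W" unfolding \<open>\<rho> = restrict \<mu> W\<close> using h(2) W by (intro ext) (auto simp: restrict_def)
    then show "\<rho> \<in> (\<lambda>h. restrict (code h) W) ` homs" using h(1) by blast
  qed
  show "(\<lambda>h. restrict (code h) W) ` homs \<subseteq> R.proj W" using code_H by (auto simp: R.proj_def)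
qed

lemma finite_answers: "finite (answers Q G)"
proof (rule finite_subset)
  show "answers Q G \<subseteq> free Q \<rightarrow>\<^sub>E lverts G" by (auto simp: answers_def)
  have "finite (vars Q)" using vs by (metis List.finite_set)
  then have "finite (free Q)" using free_vars finite_subset by blast
  then show "finite (free Q \<rightarrow>\<^sub>E lverts G)" using G(1) by (intro finite_PiE) (auto simp: wf_lgraph_def)
qed

lemma card_proj_free: "card (R.proj (Collect fr)) <= card (answers Q G)"
proof -
  let ?g = "\<lambda>\<alpha>. \<lambda>i\<in>Collect fr. \<nu> (\<alpha> (v i))"
  have e: "restrict (code h) (Collect fr) = ?g (restrict h (free Q))" for h
    by (intro ext) (auto simp: restrict_def code_def fr_def)
  have "Collect fr \<subseteq> {..m}" using fr_range by auto
  then have "R.proj (Collect fr) = ?g ` answers Q G"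
    unfolding answers_homs image_image e[symmetric] by (rule proj_homs)
  then show ?thesis using card_image_le[OF finite_answers] by simp
qed

text \<open>The summand 1 covers a graph without vertices, where a table can still have one constant
  row.\<close>

lemma card_state:
  assumes V: "V \<subseteq> {..m}" "V - insert 0 (Collect fr) \<subseteq> group c"
  shows "card (R.proj V) <= card (answers Q G) * n ^ cw Q + 1"
proof (cases "1 <= n")
  case True
  have "Collect fr \<subseteq> {1..m}" using fr_range by blast
  moreover have "card (V - insert 0 (Collect fr)) <= cw Q" by (rule card_group[OF V(2)]) auto
  ultimately have "card (R.proj V) <= card (R.proj (Collect fr)) * n ^ cw Q" by (intro R.card_proj V(1) True) auto
  also have "\<dots> <= card (answers Q G) * n ^ cw Q" using card_proj_free by simp
  finally show ?thesis by simp
next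
  case False
  have "R.proj V \<subseteq> {restrict (\<lambda>_. 0) V}"
  proof
    fix \<rho> assume "\<rho> \<in> R.proj V"
    then obtain \<mu> where \<mu>: "\<mu> \<in> R.H" "\<rho> = restrict \<mu> V" by (auto simp: R.proj_def)
    have "\<mu> i = 0" if "i \<in> V" for i using R.H_less[OF \<mu>(1), of i] False that V(1) \<mu>(1) by (cases "i = 0") (auto simp: R.H_def)
    then show "\<rho> \<in> {restrict (\<lambda>_. 0) V}" unfolding \<mu>(2) by (auto simp: restrict_def)
  qed
  then have "card (R.proj V) <= 1" using card_mono[of "{restrict (\<lambda>_. 0 :: nat) V}"] by fastforce
  then show ?thesis by simp
qed

lemma plan_ok_iff: "R.plan_ok W os \<longleftrightarrow> ok W os"
  by (induction W os rule: ok.induct) (auto simp: R.desc_def below_def R.separates_def sep_def)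

text \<open>Every vertex is an endpoint of some edge; this is why the time bound has no separate
  summand for the vertices.\<close>

lemma n_edges: "n <= 2 * length es"
proof -
  have "lverts G \<subseteq> fst ` set es \<union> (snd \<circ> snd) ` set es" unfolding es(1) using G(1) by (force simp: wf_lgraph_def)
  then have "n <= card (fst ` set es \<union> (snd \<circ> snd) ` set es)" unfolding n_def by (intro card_mono) auto
  also have "\<dots> <= card (fst ` set es) + card ((snd \<circ> snd) ` set es)" by (rule card_Un_le)
  also have "\<dots> <= length es + length es" by (intro add_mono order_trans[OF card_image_le card_length]) auto
  finally show ?thesis by simp
qed

text \<open>Column 0 is constant, so dropping it loses nothing and the output stays free of
  duplicates.\<close>

lemma output_table:
  assumes xs: "set xs = free Q"
  shows "(\<lambda>\<rho>. map \<rho> (map idx xs)) ` R.proj (insert 0 (Collect fr)) = (\<lambda>\<mu>. map (\<lambda>x. \<nu> (\<mu> x)) xs) ` answers Q G"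
    and "inj_on (\<lambda>\<rho>. map \<rho> (map idx xs)) (R.proj (insert 0 (Collect fr)))"
proof -
  let ?W = "insert 0 (Collect fr)"
  have W: "?W \<subseteq> {..m}" using fr_range by auto
  have e: "map (restrict (code h) ?W) (map idx xs) = map (\<lambda>x. \<nu> (restrict h (free Q) x)) xs" for h
    using idx xs by (auto simp: code_def)
  then show "(\<lambda>\<rho>. map \<rho> (map idx xs)) ` R.proj ?W = (\<lambda>\<mu>. map (\<lambda>x. \<nu> (\<mu> x)) xs) ` answers Q G"
    unfolding proj_homs[OF W] answers_homs image_image by (simp only: e)
  show "inj_on (\<lambda>\<rho>. map \<rho> (map idx xs)) (R.proj ?W)"
  proof (rule inj_onI)
    fix \<rho> \<rho>' assume a: "\<rho> \<in> R.proj ?W" "\<rho>' \<in> R.proj ?W" "map \<rho> (map idx xs) = map \<rho>' (map idx xs)"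
    obtain h h' where h: "\<rho> = restrict (code h) ?W" "\<rho>' = restrict (code h') ?W" using a(1,2) unfolding proj_homs[OF W] by blast
    have "\<rho> i = \<rho>' i" for i
    proof (cases "fr i")
      case True
      then have "v i \<in> set xs" using xs by (simp add: fr_def)
      then show ?thesis using a(3) idx_v[OF True] by (auto simp: map_eq_conv)
    next
      case False
      then show ?thesis by (simp add: h code_def)
    qed
    then show "\<rho> = \<rho>'" by blast
  qed
qed

lemma triples:
  "length (concat (map (\<lambda>(u, s, w). [\<nu> u, \<kappa> s, \<nu> w]) es')) = 3 * length es'"
  "i < length es' ==> concat (map (\<lambda>(u, s, w). [\<nu> u, \<kappa> s, \<nu> w]) es') ! (3 * i) = \<nu> (fst (es' ! i)) &
     concat (map (\<lambda>(u, s, w). [\<nu> u, \<kappa> s, \<nu> w]) es') ! (3 * i + 1) = \<kappa> (fst (snd (es' ! i))) &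
     concat (map (\<lambda>(u, s, w). [\<nu> u, \<kappa> s, \<nu> w]) es') ! (3 * i + 2) = \<nu> (snd (snd (es' ! i)))"
proof -
  show "length (concat (map (\<lambda>(u, s, w). [\<nu> u, \<kappa> s, \<nu> w]) es')) = 3 * length es'" by (induction es') auto
  show "i < length es' ==> concat (map (\<lambda>(u, s, w). [\<nu> u, \<kappa> s, \<nu> w]) es') ! (3 * i) = \<nu> (fst (es' ! i)) &
     concat (map (\<lambda>(u, s, w). [\<nu> u, \<kappa> s, \<nu> w]) es') ! (3 * i + 1) = \<kappa> (fst (snd (es' ! i))) &
     concat (map (\<lambda>(u, s, w). [\<nu> u, \<kappa> s, \<nu> w]) es') ! (3 * i + 2) = \<nu> (snd (snd (es' ! i)))"
  proof (induction es' arbitrary: i)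
    case (Cons e es')
    obtain u s w where e: "e = (u, s, w)" by (cases e)
    show ?case
    proof (cases i)
      case 0
      then show ?thesis by (simp add: e)
    next
      case (Suc j)
      then have "j < length es'" and *: "3 * i = Suc (Suc (Suc (3 * j)))" using Cons.prems by simp_all
      then show ?thesis using Cons.IH[of j] unfolding * by (simp add: e Suc)
    qed
  qed simp
qed

lemma wp_query:
  assumes h: "h = \<lparr>reg = (\<lambda>r. if r = 0 then n else if r = 1 then length es else 0),
      arr = (\<lambda>a i. if a = 0 & i < 3 * length es then mem (input_config \<nu> \<kappa> G es) i else 0), clk = 0\<rparr>"
    and ops: "ops = plan 1 (Suc m)" and cols: "cols = map idx xs" and xs: "set xs = free Q"
    and N: "N = card (answers Q G) * n ^ cw Q + 1"
  shows "wp (P.main ops cols) (\<lambda>u. \<exists>rows. distinct rows & set rows = R.proj (insert 0 (Collect fr)) & length rows <= N &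
      reg u 3 = length rows & reg u 9 = length cols * length rows &
      map (arr u (P.free_array ops (P.pb (Suc m) + Suc m))) [0..<length cols * length rows] = concat (map (\<lambda>\<rho>. map \<rho> cols) rows) &
      real (clk u) <= (100 + 4 * P.K + 13 * length rules + (m + 1) * P.SC + length ops * (P.OC * (1 + P.AC)) + 2 * length cols) *
        ((1 + n + length es) * (1 + sqrt N) + N)) h"
proof -
  note pl = plan_exists[folded ops]
  have ss: "R.start_state h"
    unfolding R.start_state_def h input_config_def Let_def using triples(1)[of es] triples(2)[of _ es]
    by (auto simp: esn_def case_prod_unfold)
  have c: "set cols \<subseteq> set (final [0] ops)" using pl idx xs cols by auto
  have N': "card (R.proj (set V)) <= N" if "V \<in> set (states [0] ops)" for V
  proof -
    from pl that have "set V \<subseteq> {..m} & (\<exists>c. set V - insert 0 (Collect fr) \<subseteq> group c)" by simp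
    then obtain c where "set V \<subseteq> {..m}" "set V - insert 0 (Collect fr) \<subseteq> group c" by (elim conjE exE)
    then show ?thesis unfolding N by (rule card_state)
  qed
  have n1: "1 <= n" if "ops ~= []" "R.H ~= {}"
  proof -
    have "ops = []" if "m = 0" using that unfolding ops plan_def by simp
    then have "1 <= m" using that(1) by (cases "m = 0") auto
    then show ?thesis using that(2) R.H_less[of _ 1] by fastforce
  qed
  have fin: "final W os \<in> set (states W os)" for W os by (induction W os rule: states.induct) auto
  have e: "length esn = length es" by (simp add: esn_def)
  have po: "R.plan_ok [0] ops" using pl plan_ok_iff by blast
  have Z: "set (final [0] ops) = insert 0 (Collect fr)" using pl by blast
  show ?thesis
  proof (rule wp_mono[OF R.wp_main[OF ss po c N' n1]], assumption, assumption, assumption)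
    fix u assume "\<exists>rows. distinct rows & set rows = R.proj (set (final [0] ops)) &
      reg u 3 = length rows & reg u 9 = length cols * length rows &
      map (arr u (P.free_array ops (P.pb (Suc m) + Suc m))) [0..<length cols * length rows] = concat (map (\<lambda>\<rho>. map \<rho> cols) rows) &
      real (clk u) <= (100 + 4 * P.K + 13 * length rules + (m + 1) * P.SC + length ops * (P.OC * (1 + P.AC)) + 2 * length cols) *
        ((1 + n + length esn) * (1 + sqrt N) + N)"
    then obtain rows where r: "distinct rows" "set rows = R.proj (set (final [0] ops))"
      "reg u 3 = length rows & reg u 9 = length cols * length rows &
      map (arr u (P.free_array ops (P.pb (Suc m) + Suc m))) [0..<length cols * length rows] = concat (map (\<lambda>\<rho>. map \<rho> cols) rows) &
      real (clk u) <= (100 + 4 * P.K + 13 * length rules + (m + 1) * P.SC + length ops * (P.OC * (1 + P.AC)) + 2 * length cols) *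
        ((1 + n + length esn) * (1 + sqrt N) + N)" by blast
    have "length rows <= N" using N'[OF fin] r(1,2) distinct_card[of rows] by simp
    then show "\<exists>rows. distinct rows & set rows = R.proj (insert 0 (Collect fr)) & length rows <= N &
      reg u 3 = length rows & reg u 9 = length cols * length rows &
      map (arr u (P.free_array ops (P.pb (Suc m) + Suc m))) [0..<length cols * length rows] = concat (map (\<lambda>\<rho>. map \<rho> cols) rows) &
      real (clk u) <= (100 + 4 * P.K + 13 * length rules + (m + 1) * P.SC + length ops * (P.OC * (1 + P.AC)) + 2 * length cols) *
        ((1 + n + length es) * (1 + sqrt N) + N)"
      using r unfolding Z e by blast
  qed
qed

end

text \<open>\<open>P\<close> stands for the output size times the power of the number of vertices.
  The number of vertices is dominated by \<open>E\<close>, and the stray \<open>sqrt P\<close> from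
  expanding the product is absorbed by \<open>1 + P\<close>.\<close>

lemma time_bound:
  fixes E n P A C k :: real
  assumes "0 <= E" "0 <= n" "n <= 2 * E" "0 <= P" "0 <= A" "0 <= C" "0 <= k"
  shows "C * (1 + E + A * ((1 + n + E) * (1 + sqrt (P + 1)) + (P + 1)) + k * (P + 1)) <= C * (1 + 6 * A + k) * (1 + E + E * sqrt P + P)"
proof -
  let ?S = "sqrt P" and ?F = "1 + E + E * sqrt P + P"
  have S: "0 <= ?S" "?S * ?S = P" using assms by simp_all
  have "0 <= (?S - 1) * (?S - 1)" by simp
  then have S1: "?S <= 1 + P" using S by (simp add: algebra_simps)
  have ES: "0 <= E * ?S" using assms S by simp
  have "sqrt (P + 1) <= ?S + sqrt 1" using assms by (intro sqrt_add_le_add_sqrt) auto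
  then have "(1 + n + E) * (1 + sqrt (P + 1)) <= (1 + 3 * E) * (2 + ?S)" using assms by (intro mult_mono) auto
  then have 1: "(1 + n + E) * (1 + sqrt (P + 1)) + (P + 1) <= 6 * ?F"
  proof -
    have "(1 + 3 * E) * (2 + ?S) = 2 + ?S + 6 * E + 3 * (E * ?S)" by (simp add: algebra_simps)
    moreover have "6 * ?F = 6 + 6 * E + 6 * (E * ?S) + 6 * P" by simp
    ultimately show ?thesis using \<open>(1 + n + E) * (1 + sqrt (P + 1)) <= (1 + 3 * E) * (2 + ?S)\<close> S1 ES assms(4) by linarith
  qed
  have 2: "k * (P + 1) <= k * ?F" using assms ES by (intro mult_left_mono) auto
  have 3: "A * ((1 + n + E) * (1 + sqrt (P + 1)) + (P + 1)) <= A * (6 * ?F)" using 1 assms by (intro mult_left_mono) auto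
  have "1 + E <= ?F" using ES assms by simp
  then have "1 + E + A * ((1 + n + E) * (1 + sqrt (P + 1)) + (P + 1)) + k * (P + 1) <= ?F + A * (6 * ?F) + k * ?F" using 2 3 by linarith
  also have "\<dots> = (1 + 6 * A + k) * ?F" by (simp add: algebra_simps)
  finally show ?thesis using assms by (simp only: mult.assoc mult_left_mono)
qed

text \<open>In HOL \<open>0 powr 0\<close> is 0 whereas \<open>0 ^ 0\<close> is 1, so a graph
  without vertices has to be excluded or have no edges.\<close>

lemma sqrt_powr:
  fixes V :: nat and a :: nat and k :: nat
  assumes "V = 0 ==> E = 0"
  shows "E * sqrt (real (a * V ^ k)) = E * real a powr (1/2) * real V powr (real k / 2)"
proof (cases "V = 0")
  case False
  then have "real V powr (real k / 2) = sqrt (real V ^ k)"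
    by (simp add: powr_half_sqrt[symmetric] powr_realpow[symmetric] powr_powr)
  then show ?thesis by (simp add: real_sqrt_mult powr_half_sqrt)
qed (use assms in simp)

context query_run
begin

text \<open>Program and constant are fixed before the graph is introduced. The summand 1 pays for
  the constant work that is done even on an empty graph.\<close>

theorem evaluates:
  assumes xs: "set xs = free Q"
  shows "\<exists>P. \<exists>c :: real. evaluates_within P Q xs \<kappa>
           (\<lambda>G :: ('v, 's) lgraph.
              let V = real (card (lverts G));
                  E = real (card (ledges G));
                  OUT = real (card (answers Q G))
              in c * (1 + E + E * OUT powr (1/2) * V powr (real (cw Q) / 2) + OUT * V ^ cw Q))"
proof -
  define ops where "ops = plan 1 (Suc m)"
  define cols where "cols = map idx xs"
  define a where "a = P.free_array ops (P.pb (Suc m) + Suc m)"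
  let ?P = "assemble (P.main ops cols) a"
  define A :: real where "A = 100 + 4 * P.K + 13 * length rules + (m + 1) * P.SC + length ops * (P.OC * (1 + P.AC)) + 2 * length cols"
  show ?thesis
  proof (rule assemble_correct[where c = "P.main ops cols" and a = a], goal_cases)
    case (1 C)
    note C = 1
  let ?c = "real C * (1 + 6 * A + real (length xs))"
  have "evaluates_within ?P Q xs \<kappa> (\<lambda>G :: ('v, 's) lgraph.
      let V = real (card (lverts G)); E = real (card (ledges G)); OUT = real (card (answers Q G))
      in ?c * (1 + E + E * OUT powr (1/2) * V powr (real (cw Q) / 2) + OUT * V ^ cw Q))"
    unfolding evaluates_within_def
  proof (intro allI impI)
    fix G :: "('v, 's) lgraph" and \<nu> es
    assume G: "wf_lgraph G & symbols Q \<subseteq> labels G & represents_input G \<nu> es"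
    interpret I: query_input Q vs par m \<kappa> G \<nu> es using G by unfold_locales auto
    let ?s = "input_config \<nu> \<kappa> G es" and ?N = "card (answers Q G) * I.n ^ cw Q + 1" and ?k = "length xs"
    have s: "pc ?s = 0" "regs ?s = (\<lambda>r. if r = 0 then I.n else if r = 1 then length es else 0)" "\<And>a. 3 * length es <= a ==> mem ?s a = 0"
      unfolding input_config_def Let_def I.n_def by (simp_all add: I.triples(1))
    have X: "\<exists>t (u :: config) (h' :: st). (Defs.step ?P ^^ t) ?s = u & (\<exists>rows. distinct rows & set rows = I.R.proj (insert 0 (Collect fr)) &
        length rows <= ?N & reg h' 3 = length rows & reg h' 9 = length cols * length rows &
        map (arr h' a) [0..<length cols * length rows] = concat (map (\<lambda>\<rho>. map \<rho> cols) rows) &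
        real (clk h') <= A * ((1 + I.n + length es) * (1 + sqrt ?N) + ?N)) &
        halted ?P u & regs u 0 = reg h' 3 & regs u 1 = 0 & (\<forall>j<reg h' 9. mem u j = arr h' a j) &
        t <= C * (1 + length es + clk h' + reg h' 9)"
      using C[OF s refl I.wp_query[OF refl ops_def cols_def xs refl]] unfolding a_def[symmetric] A_def[symmetric]
      by - (erule meta_mp, assumption)
    obtain t and u :: config and h' :: st and rows where t: "(Defs.step ?P ^^ t) ?s = u" "halted ?P u" "regs u 0 = reg h' 3" "regs u 1 = 0"
        "\<forall>j<reg h' 9. mem u j = arr h' a j" "t <= C * (1 + length es + clk h' + reg h' 9)"
      and r: "distinct rows" "set rows = I.R.proj (insert 0 (Collect fr))" "length rows <= ?N" "reg h' 3 = length rows"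
        "reg h' 9 = length cols * length rows"
        "map (arr h' a) [0..<length cols * length rows] = concat (map (\<lambda>\<rho>. map \<rho> cols) rows)"
        "real (clk h') <= A * ((1 + I.n + length es) * (1 + sqrt ?N) + ?N)"
      using X by blast
    let ?ts = "map (\<lambda>\<rho>. map \<rho> cols) rows"
    have k: "length cols = ?k" by (simp add: cols_def)
    have e: "map (mem u) [0..<?k * length rows] = map (arr h' a) [0..<?k * length rows]" using t(5) r(5) k by simp
    have "map (mem u) [0..<?k * length ?ts] = concat ?ts" unfolding length_map e using r(6) unfolding k .
    moreover have "distinct ?ts" using I.output_table(2)[OF xs] r(1,2) by (simp add: distinct_map cols_def)
    moreover have "set ?ts = (\<lambda>\<mu>. map (\<lambda>x. \<nu> (\<mu> x)) xs) ` answers Q G" using I.output_table(1)[OF xs] r(2) by (simp add: cols_def)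
    ultimately have ret: "returns ?k ((\<lambda>\<mu>. map (\<lambda>x. \<nu> (\<mu> x)) xs) ` answers Q G) u"
      unfolding returns_def using t(3,4) r(4) by (intro exI[of _ ?ts]) simp
    let ?E = "real (length es)" and ?p = "real (card (answers Q G) * I.n ^ cw Q)"
    have A0: "0 <= A" by (simp add: A_def)
    have N: "real ?N = ?p + 1" by simp
    have "reg h' 9 <= ?k * ?N" unfolding r(5) k by (rule mult_le_mono2[OF r(3)])
    then have "real (reg h' 9) <= real ?k * (?p + 1)" unfolding N[symmetric] of_nat_mult[symmetric] of_nat_le_iff .
    moreover have "real (clk h') <= A * ((1 + real I.n + ?E) * (1 + sqrt (?p + 1)) + (?p + 1))"
      using r(7) unfolding N by ((simp only: of_nat_add of_nat_1; fail) | (simp add: add.assoc; fail))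
    ultimately have "real (1 + length es + clk h' + reg h' 9) <= 1 + ?E + A * ((1 + real I.n + ?E) * (1 + sqrt (?p + 1)) + (?p + 1)) + real ?k * (?p + 1)"
      by simp
    then have "real C * real (1 + length es + clk h' + reg h' 9) <=
        real C * (1 + ?E + A * ((1 + real I.n + ?E) * (1 + sqrt (?p + 1)) + (?p + 1)) + real ?k * (?p + 1))"
      by (rule mult_left_mono) simp
    also have "\<dots> <= ?c * (1 + ?E + ?E * sqrt ?p + ?p)"
      using I.n_edges A0 by (intro time_bound) auto
    finally have "real C * real (1 + length es + clk h' + reg h' 9) <= ?c * (1 + ?E + ?E * sqrt ?p + ?p)" .
    moreover have "real t <= real C * real (1 + length es + clk h' + reg h' 9)" using t(6) unfolding of_nat_mult[symmetric] of_nat_le_iff .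
    ultimately have le: "real t <= ?c * (1 + ?E + ?E * sqrt ?p + ?p)" by (rule order_trans[rotated])
    have "I.n = 0 ==> ?E = 0"
    proof -
      assume "I.n = 0"
      then have "lverts G = {}" using G by (simp add: I.n_def wf_lgraph_def)
      then have "ledges G = {}" using I.edge_verts by auto
      then show "?E = 0" using I.es(2) by simp
    qed
    then have e: "?E * sqrt ?p = ?E * real (card (answers Q G)) powr (1/2) * real I.n powr (real (cw Q) / 2)" by (rule sqrt_powr)
    have p: "?p = real (card (answers Q G)) * real I.n ^ cw Q" by simp
    have "real t <= ?c * (1 + ?E + ?E * real (card (answers Q G)) powr (1/2) * real I.n powr (real (cw Q) / 2) + real (card (answers Q G)) * real I.n ^ cw Q)"
      using le unfolding e unfolding p .
    then show "\<exists>t s. real t <= (let V = real (card (lverts G)); E = real (card (ledges G)); OUT = real (card (answers Q G))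
        in ?c * (1 + E + E * OUT powr (1/2) * V powr (real (cw Q) / 2) + OUT * V ^ cw Q)) &
        (Defs.step ?P ^^ t) ?s = s & halted ?P s & returns ?k ((\<lambda>\<mu>. map (\<lambda>x. \<nu> (\<mu> x)) xs) ` answers Q G) s"
      using t(1,2) ret unfolding Let_def I.n_def I.es(2) by blast
  qed
  then show ?thesis by blast
  qed
qed

end

theorem theorem1:
  fixes Q :: "('x, 's) crpq" and xs :: "'x list" and \<kappa> :: "'s \<Rightarrow> nat"
  assumes "wf_crpq Q" and "acyclic_crpq Q"
    and "distinct xs" and "set xs = free Q"
    and "inj \<kappa>"
  shows "\<exists>P. \<exists>c::real. evaluates_within P Q xs \<kappa>
           (\<lambda>G :: ('v, 's) lgraph.
              let V = real (card (lverts G));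
                  E = real (card (ledges G));
                  OUT = real (card (answers Q G))
              in c * (1 + E + E * OUT powr (1/2) * V powr (real (cw Q) / 2)
                        + OUT * V ^ cw Q))"
proof -
  have g: "wf_ugraph (query_graph Q)" "cycle_free (query_graph Q)" "uverts (query_graph Q) = vars Q"
    using simple_query_graph[OF assms(2)] assms(2) by (simp_all add: simple_def acyclic_crpq_def query_graph_def)
  then obtain vs par where vs: "set vs = vars Q" "rooted_on (query_graph Q) (free Q) vs par"
    using rooted_order[OF g(1,2), of "free Q"] assms(1) by (auto simp: wf_crpq_def)
  interpret query_run Q vs par "length vs" \<kappa>
    using assms vs by unfold_locales auto
  show ?thesis by (rule evaluates[OF assms(4)])
qed

end
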